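(* The cell class $\mathcal{G}_\gamma$ is well quasi-ordered if and only if $\gamma<\xi$.
   Context: For a permutation class $\mathcal{C}$, $\operatorname{gr}(\mathcal{C})=\lim_{n\to\infty}\sqrt[n]{|\mathcal{C}_n|}$ is its growth rate (it exists for sum closed and for skew closed classes). For a permutation $\pi$, $\operatorname{Sub}(\pi)$ is the class of all permutations contained in $\pi$; $\bigoplus\operatorname{Sub}(\pi)$ denotes its sum closure (the smallest class containing $\operatorname{Sub}(\pi)$ closed under sums $\sigma\oplus\tau$), and the skew closure of $\operatorname{Sub}(\pi)$ is the smallest class containing $\operatorname{Sub}(\pi)$ closed under skew sums $\sigma\ominus\tau$. For a real number $\gamma$, the cell class is $\mathcal{G}_\gamma=\{\pi : \text{either } \operatorname{gr}(\bigoplus\operatorname{Sub}(\pi))<\gamma \text{ or } \operatorname{gr}(\text{skew closure of }\operatorname{Sub}(\pi))<\gamma\}$. The constant $\xi\approx 2.30522$ is the unique positive root of $x^5-2x^4-x^2-x-1$. A class is well quasi-ordered if it contains no infinite antichain under the containment order. *)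

theory Defs
  imports Complex_Main "HOL-Library.Sublist" "HOL-Combinatorics.Multiset_Permutations"
begin

text \<open>
  A permutation is a list of naturals in one-line notation, with values \<open>1, \<dots>, n\<close> where
  \<open>n\<close> is its length. The empty permutation is included.
\<close>

definition is_perm :: "nat list \<Rightarrow> bool" where
  "is_perm p \<longleftrightarrow> p \<in> permutations_of_set {1..length p}"

definition order_isomorphic :: "nat list \<Rightarrow> nat list \<Rightarrow> bool" where
  "order_isomorphic xs ys \<longleftrightarrow> length xs = length ys \<and>
     (\<forall>i<length xs. \<forall>j<length xs. xs ! i < xs ! j \<longleftrightarrow> ys ! i < ys ! j)"

text \<open>Containment \<open>\<sigma> \<le> \<pi>\<close>; \<^const>\<open>subseq\<close> does not require contiguity.\<close>

definition perm_contained :: "nat list \<Rightarrow> nat list \<Rightarrow> bool" where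
  "perm_contained \<sigma> \<pi> \<longleftrightarrow> (\<exists>xs. subseq xs \<pi> \<and> order_isomorphic \<sigma> xs)"

definition perm_class :: "nat list set \<Rightarrow> bool" where
  "perm_class C \<longleftrightarrow> (\<forall>\<pi>\<in>C. is_perm \<pi>) \<and>
     (\<forall>\<pi>\<in>C. \<forall>\<sigma>. is_perm \<sigma> \<longrightarrow> perm_contained \<sigma> \<pi> \<longrightarrow> \<sigma> \<in> C)"

definition Sub :: "nat list \<Rightarrow> nat list set" where
  "Sub \<pi> = {\<sigma>. is_perm \<sigma> \<and> perm_contained \<sigma> \<pi>}"

definition direct_sum :: "nat list \<Rightarrow> nat list \<Rightarrow> nat list" where
  "direct_sum \<sigma> \<tau> = \<sigma> @ map (\<lambda>x. x + length \<sigma>) \<tau>"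

definition skew_sum :: "nat list \<Rightarrow> nat list \<Rightarrow> nat list" where
  "skew_sum \<sigma> \<tau> = map (\<lambda>x. x + length \<tau>) \<sigma> @ \<tau>"

definition sum_closed :: "nat list set \<Rightarrow> bool" where
  "sum_closed C \<longleftrightarrow> (\<forall>\<sigma>\<in>C. \<forall>\<tau>\<in>C. direct_sum \<sigma> \<tau> \<in> C)"

definition skew_closed :: "nat list set \<Rightarrow> bool" where
  "skew_closed C \<longleftrightarrow> (\<forall>\<sigma>\<in>C. \<forall>\<tau>\<in>C. skew_sum \<sigma> \<tau> \<in> C)"

definition sum_closure :: "nat list set \<Rightarrow> nat list set" where
  "sum_closure X = \<Inter>{C. perm_class C \<and> sum_closed C \<and> X \<subseteq> C}"

definition skew_closure :: "nat list set \<Rightarrow> nat list set" where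
  "skew_closure X = \<Inter>{C. perm_class C \<and> skew_closed C \<and> X \<subseteq> C}"

text \<open>
  \<^const>\<open>lim\<close> is only meaningful when the limit exists, which is the case for sum closed and
  for skew closed classes (supermultiplicativity and the exponential growth of proper classes);
  the closures of \<open>Sub \<pi>\<close> used below are always proper classes. The index \<open>n = 0\<close>
  contributes \<open>root 0 _ = 0\<close>, which does not affect the limit.
\<close>

definition growth_rate :: "nat list set \<Rightarrow> real" where
  "growth_rate C = lim (\<lambda>n. root n (real (card {\<pi> \<in> C. length \<pi> = n})))"

definition cell_class :: "real \<Rightarrow> nat list set" where
  "cell_class \<gamma> = {\<pi>. is_perm \<pi> \<and>
     (growth_rate (sum_closure (Sub \<pi>)) < \<gamma> \<or> growth_rate (skew_closure (Sub \<pi>)) < \<gamma>)}"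

definition perm_antichain :: "nat list set \<Rightarrow> bool" where
  "perm_antichain A \<longleftrightarrow> (\<forall>\<sigma>\<in>A. \<forall>\<tau>\<in>A. \<sigma> \<noteq> \<tau> \<longrightarrow> \<not> perm_contained \<sigma> \<tau>)"

definition well_quasi_ordered :: "nat list set \<Rightarrow> bool" where
  "well_quasi_ordered C \<longleftrightarrow> \<not> (\<exists>A\<subseteq>C. infinite A \<and> perm_antichain A)"

definition \<xi> :: real where
  "\<xi> = (THE x. x > 0 \<and> x^5 - 2*x^4 - x^2 - x - 1 = 0)"

lemma xi_ex1: "\<exists>!x::real. x > 0 \<and> x^5 - 2*x^4 - x^2 - x - 1 = 0"
proof -
  let ?f = "\<lambda>x::real. x^5 - 2*x^4 - x^2 - x - 1"
  have "\<exists>x\<ge>2. x \<le> 3 \<and> ?f x = 0"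
    by (rule IVT') (auto intro!: continuous_intros)
  then obtain x where x: "x > 0" "?f x = 0"
    by (metis less_le_trans zero_less_numeral)
  have uniq: False if "0 < a" "a < b" "?f a = 0" "?f b = 0" for a b :: real
  proof -
    let ?g = "\<lambda>x::real. 2/x + 1/x^3 + 1/x^4 + 1/x^5"
    have g: "?g c = 1" if "0 < c" "?f c = 0" for c :: real
    proof -
      have "?g c = (2*c^4 + c^2 + c + 1) / c^5"
        using that(1) by (simp add: field_simps power_numeral_reduce)
      also have "2*c^4 + c^2 + c + 1 = c^5"
        using that(2) by simp
      finally show ?thesis
        using that(1) by simp
    qed
    have pw: "1/b^k < 1/a^k" if "k > 0" for k :: nat
      using that \<open>0 < a\<close> \<open>a < b\<close> by (intro divide_strict_left_mono power_strict_mono) auto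
    have "?g b < ?g a"
      using pw[of 1] pw[of 3] pw[of 4] pw[of 5] by simp
    then show False
      using g[of a] g[of b] that by simp
  qed
  show ?thesis
    using x uniq by (intro ex1I[of _ x]) (auto, metis linorder_neqE)
qed

end

theory Submission
  imports Defs "HOL-Library.Ramsey" "HOL-Library.Disjoint_Sets"
begin

text \<open>
  Sum indecomposable permutations are those with connected inversion graph, and the growth rate
  of \<open>\<Oplus>Sub(\<pi>)\<close> is the \<open>g\<close> with \<open>\<Sum> s\<^sub>n / g\<^sup>n = 1\<close>, where \<open>s\<^sub>n\<close> counts the sum indecomposable
  permutations of length \<open>n\<close> in \<open>\<pi>\<close>. The counts \<open>1, 1, 2, 3, 4, 4, 4, \<dots>\<close> yield exactly \<open>\<xi>\<close>, so a growth
  rate below \<open>\<gamma> < \<xi>\<close> forces some count of bounded index to fall below this sequence.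

  For \<open>\<gamma> < \<xi>\<close> take a minimal bad sequence and split each of its terms along a coarsest nontrivial
  partition into intervals. If infinitely many of the quotients have bounded size, two terms are
  comparable by the pigeonhole principle and Dickson's lemma on the blocks. Otherwise there are
  arbitrarily large simple quotients. A long monotone subsequence or star in a simple permutation
  is cut by a further point, which produces \<open>n - 1\<close> connected patterns for each length \<open>n\<close>; hence the
  inversion graph has bounded degree and contains a long induced path, an increasing oscillation.
  Any point outside a longest path, except for a twin of one of its ends, would again create too many
  patterns, and twins at both ends give the counts \<open>1, 1, 2, 3, 4, 4, 4, \<dots>\<close>. So the permutation is a path with at
  most one doubled end, and these form finitely many chains.

  For \<open>\<gamma> \<ge> \<xi>\<close> the increasing oscillations with both ends doubled are an infinite antichain. They are finite, so
  the counts are cut off eventually and the growth rates are strictly smaller than \<open>\<xi>\<close>.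
\<close>

section \<open>Inversion graphs of point sets\<close>

text \<open>Segments of an oscillation that start at an even and at an odd index are inverse to each
  other; this gives two patterns of each length from 3 on. A point joined to the second vertex of a
  segment adds a third one from length 4 on. The forks at the two ends of an oscillation with
  doubled ends coincide at length 4 and differ from length 5 on, which explains 1, 1, 2, 3, 4, 4, 4.
  A bounded part of the series already decides the comparison with a number below \<xi>, so only
  lengths up to some \<open>N\<close> matter, and the size of a monotone subset, the degree and the
  length of the path are bounded in terms of \<open>N\<close>. To show that a disturbance of the
  path is costly, patterns of all lengths up to \<open>N\<close> must fit into the path beside it. A
  long path has this room on at least one side, and negating both coordinates, which keeps the
  inversion graph, exchanges the sides. A triangle supplies only one pattern besides the two
  segments, but does so from length 3 on; therefore two count sequences are followed.\<close>

text \<open>Permutations are studied as finite point sets: a point \<open>u\<close> lies at position \<open>x u\<close> with value \<open>y u\<close>.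
  Inverse and reverse-complement then are exchanging \<open>x\<close> and \<open>y\<close> and negating both.\<close>

definition lt :: "('a \<Rightarrow> int) \<Rightarrow> ('a \<Rightarrow> int) \<Rightarrow> 'a \<Rightarrow> 'a \<Rightarrow> bool" where
  "lt x y u v \<longleftrightarrow> x u < x v \<and> y u < y v"

definition nw :: "('a \<Rightarrow> int) \<Rightarrow> ('a \<Rightarrow> int) \<Rightarrow> 'a \<Rightarrow> 'a \<Rightarrow> bool" where
  "nw x y u v \<longleftrightarrow> x u < x v \<and> y v < y u"

definition adj :: "('a \<Rightarrow> int) \<Rightarrow> ('a \<Rightarrow> int) \<Rightarrow> 'a \<Rightarrow> 'a \<Rightarrow> bool" where
  "adj x y u v \<longleftrightarrow> nw x y u v \<or> nw x y v u"

text \<open>Connectivity by cuts rather than by walks: a failing cut is then directly a candidate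
  for a sum decomposition.\<close>

definition conn :: "('a \<Rightarrow> int) \<Rightarrow> ('a \<Rightarrow> int) \<Rightarrow> 'a set \<Rightarrow> bool" where
  "conn x y A \<longleftrightarrow> A \<noteq> {} \<and> (\<forall>S. S \<subset> A \<longrightarrow> S \<noteq> {} \<longrightarrow> (\<exists>u\<in>S. \<exists>v\<in>A - S. adj x y u v))"

definition emb :: "('a \<Rightarrow> int) \<Rightarrow> ('a \<Rightarrow> int) \<Rightarrow> 'a set \<Rightarrow> ('b \<Rightarrow> int) \<Rightarrow> ('b \<Rightarrow> int) \<Rightarrow> 'b set \<Rightarrow> ('a \<Rightarrow> 'b) \<Rightarrow> bool" where
  "emb x y A x' y' B f \<longleftrightarrow> f ` A \<subseteq> B \<and>
     (\<forall>u\<in>A. \<forall>v\<in>A. (x u < x v \<longleftrightarrow> x' (f u) < x' (f v)) \<and> (y u < y v \<longleftrightarrow> y' (f u) < y' (f v)))"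

definition embeds :: "('a \<Rightarrow> int) \<Rightarrow> ('a \<Rightarrow> int) \<Rightarrow> 'a set \<Rightarrow> ('b \<Rightarrow> int) \<Rightarrow> ('b \<Rightarrow> int) \<Rightarrow> 'b set \<Rightarrow> bool" where
  "embeds x y A x' y' B \<longleftrightarrow> (\<exists>f. emb x y A x' y' B f)"

definition isom :: "('a \<Rightarrow> int) \<Rightarrow> ('a \<Rightarrow> int) \<Rightarrow> 'a set \<Rightarrow> 'a set \<Rightarrow> bool" where
  "isom x y A B \<longleftrightarrow> (\<exists>f. bij_betw f A B \<and> emb x y A x y B f)"

text \<open>Each isomorphism type of a connected \<open>n\<close>-set is one sum indecomposable
  pattern of length \<open>n\<close>, so this expresses that there are at least \<open>k\<close> of
  them; \<open>many_icnt\<close> makes the link to permutations.\<close>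

definition many :: "('a \<Rightarrow> int) \<Rightarrow> ('a \<Rightarrow> int) \<Rightarrow> 'a set \<Rightarrow> nat \<Rightarrow> nat \<Rightarrow> bool" where
  "many x y V n k \<longleftrightarrow> (\<exists>F. finite F \<and> card F = k \<and> (\<forall>A\<in>F. A \<subseteq> V \<and> card A = n \<and> conn x y A) \<and>
     (\<forall>A\<in>F. \<forall>B\<in>F. A \<noteq> B \<longrightarrow> \<not> isom x y A B))"


section \<open>Symmetries, embeddings and connectivity\<close>

lemma adj_sym: "adj x y u v \<longleftrightarrow> adj x y v u"
  by (auto simp: adj_def)

lemma adj_irrefl [simp]: "\<not> adj x y u u"
  by (auto simp: adj_def nw_def)

lemma lt_uminus: "lt (\<lambda>u. - x u) (\<lambda>u. - y u) u v \<longleftrightarrow> lt x y v u"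
  by (auto simp: lt_def)

lemma nw_uminus: "nw (\<lambda>u. - x u) (\<lambda>u. - y u) u v \<longleftrightarrow> nw x y v u"
  by (auto simp: nw_def)

lemma nw_swap: "nw y x u v \<longleftrightarrow> nw x y v u"
  by (auto simp: nw_def)

lemma adj_uminus: "adj (\<lambda>u. - x u) (\<lambda>u. - y u) = adj x y"
  by (auto simp: adj_def nw_uminus fun_eq_iff)

lemma adj_swap: "adj y x = adj x y"
  by (auto simp: adj_def nw_def fun_eq_iff)

lemma conn_uminus: "conn (\<lambda>u. - x u) (\<lambda>u. - y u) = conn x y"
  by (auto simp: conn_def adj_uminus fun_eq_iff)

lemma conn_swap: "conn y x = conn x y"
  by (auto simp: conn_def adj_swap fun_eq_iff)

lemma emb_uminus:
  "emb (\<lambda>u. - x u) (\<lambda>u. - y u) A (\<lambda>u. - x' u) (\<lambda>u. - y' u) B f \<longleftrightarrow> emb x y A x' y' B f"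
  by (auto simp: emb_def)

lemma embeds_uminus:
  "embeds (\<lambda>u. - x u) (\<lambda>u. - y u) A (\<lambda>u. - x' u) (\<lambda>u. - y' u) B \<longleftrightarrow> embeds x y A x' y' B"
  by (auto simp: embeds_def emb_uminus)

lemma isom_uminus: "isom (\<lambda>u. - x u) (\<lambda>u. - y u) = isom x y"
  by (auto simp: isom_def emb_uminus fun_eq_iff)

lemma isom_swap: "isom y x = isom x y"
  by (auto simp: isom_def emb_def fun_eq_iff)

lemma many_uminus: "many (\<lambda>u. - x u) (\<lambda>u. - y u) V n k \<longleftrightarrow> many x y V n k"
  by (simp add: many_def conn_uminus isom_uminus)

lemma many_swap: "many y x V n k \<longleftrightarrow> many x y V n k"
  by (simp add: many_def conn_swap isom_swap)

lemma many_mono: "many x y W n k \<Longrightarrow> W \<subseteq> V \<Longrightarrow> many x y V n k"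
proof -
  assume "many x y W n k" "W \<subseteq> V"
  then obtain F where "finite F" "card F = k" "\<forall>A\<in>F. A \<subseteq> W \<and> card A = n \<and> conn x y A"
    "\<forall>A\<in>F. \<forall>B\<in>F. A \<noteq> B \<longrightarrow> \<not> isom x y A B" unfolding many_def by blast
  then show ?thesis unfolding many_def using \<open>W \<subseteq> V\<close> by (intro exI[of _ F]) (simp, blast)
qed

lemma emb_trans: "emb x y A x' y' B f \<Longrightarrow> emb x' y' B x'' y'' C g \<Longrightarrow> emb x y A x'' y'' C (g \<circ> f)"
  unfolding emb_def by (auto simp: image_subset_iff)

lemma embeds_trans: "embeds x y A x' y' B \<Longrightarrow> embeds x' y' B x'' y'' C \<Longrightarrow> embeds x y A x'' y'' C"
  unfolding embeds_def by (blast intro: emb_trans)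

lemma embeds_refl: "A \<subseteq> B \<Longrightarrow> embeds x y A x y B"
  unfolding embeds_def emb_def by (intro exI[of _ id]) auto

lemma emb_inj: "emb x y A x' y' B f \<Longrightarrow> inj_on x A \<Longrightarrow> inj_on f A"
  unfolding emb_def inj_on_def by (metis less_irrefl linorder_neqE)

lemma isom_sym:
  assumes "isom x y A B"
  shows "isom x y B A"
proof -
  obtain f where f: "bij_betw f A B" "emb x y A x y B f"
    using assms by (auto simp: isom_def)
  let ?g = "the_inv_into A f"
  have g: "bij_betw ?g B A"
    using f(1) by (rule bij_betw_the_inv_into)
  have fg: "f (?g b) = b" "?g b \<in> A" if "b \<in> B" for b
    using f(1) that by (auto simp: f_the_inv_into_f_bij_betw bij_betw_apply[OF g])
  have "emb x y B x y A ?g"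
    unfolding emb_def
  proof (intro conjI ballI)
    show "?g ` B \<subseteq> A" using g by (simp add: bij_betw_def)
  next
    fix u v assume "u \<in> B" "v \<in> B"
    then show "x u < x v \<longleftrightarrow> x (?g u) < x (?g v)" "y u < y v \<longleftrightarrow> y (?g u) < y (?g v)"
      using f(2) fg unfolding emb_def by metis+
  qed
  with g show ?thesis by (auto simp: isom_def)
qed

lemma isom_refl: "isom x y A A"
  unfolding isom_def emb_def by (intro exI[of _ id]) auto

text \<open>Sets with different indices are not isomorphic and hence distinct, so indices can be
  counted instead of sets.\<close>

lemma manyI:
  assumes "finite J" "k \<le> card J"
    and "\<And>j. j \<in> J \<Longrightarrow> A j \<subseteq> V \<and> card (A j) = n \<and> conn x y (A j)"
    and "\<And>i j. i \<in> J \<Longrightarrow> j \<in> J \<Longrightarrow> i \<noteq> j \<Longrightarrow> \<not> isom x y (A i) (A j)"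
  shows "many x y V n k"
proof -
  obtain J' where J': "J' \<subseteq> J" "card J' = k" "finite J'"
    using obtain_subset_with_card_n[OF assms(2)] by auto
  have inj: "inj_on A J'"
    using assms(4) isom_refl J'(1) by (metis inj_onI subsetD)
  show ?thesis
    unfolding many_def
  proof (intro exI[of _ "A ` J'"] conjI ballI impI)
    show "card (A ` J') = k" using inj J'(2) by (simp add: card_image)
  next
    fix B C assume "B \<in> A ` J'" "C \<in> A ` J'" "B \<noteq> C"
    then show "\<not> isom x y B C" using J'(1) assms(4) by blast
  qed (use J' assms(3) in auto)
qed

lemma many_antimono: "many x y V n k \<Longrightarrow> j \<le> k \<Longrightarrow> many x y V n j"
proof -
  assume "many x y V n k" "j \<le> k"
  then obtain F where "finite F" "card F = k" "\<forall>A\<in>F. A \<subseteq> V \<and> card A = n \<and> conn x y A"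
    "\<forall>A\<in>F. \<forall>B\<in>F. A \<noteq> B \<longrightarrow> \<not> isom x y A B" unfolding many_def by blast
  then show ?thesis using \<open>j \<le> k\<close> by (intro manyI[of F _ "\<lambda>A. A"]) auto
qed

lemma conn_sing: "conn x y {u}"
  by (auto simp: conn_def)

lemma conn_insert:
  assumes "conn x y A" "u \<in> A" "adj x y v u"
  shows "conn x y (insert v A)"
  unfolding conn_def
proof (intro conjI allI impI)
  fix S assume S: "S \<subset> insert v A" "S \<noteq> {}"
  show "\<exists>a\<in>S. \<exists>b\<in>insert v A - S. adj x y a b"
  proof (cases "S - {v} = A \<or> S - {v} = {}")
    case True
    then show ?thesis
    proof
      assume A: "S - {v} = A"
      then have "v \<notin> S" using S by auto
      then have "S = A" using A by auto
      then show ?thesis using \<open>v \<notin> S\<close> assms(2,3) by (auto simp: adj_sym[of x y v u])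
    next
      assume A: "S - {v} = {}"
      then have "S = {v}" using S by auto
      moreover have "u \<noteq> v" using assms(3) by auto
      ultimately show ?thesis using assms(2,3) by auto
    qed
  next
    case False
    then have "S - {v} \<subset> A" using S by auto
    then obtain a b where "a \<in> S - {v}" "b \<in> A - (S - {v})" "adj x y a b"
      using assms(1) False unfolding conn_def by blast
    show ?thesis
    proof (cases "b = v")
      case True
      then have vA: "v \<in> A" using \<open>b \<in> A - (S - {v})\<close> by auto
      then have eq: "insert v A = A" by auto
      show ?thesis using assms(1) S unfolding conn_def eq by blast
    next
      case False
      then show ?thesis using \<open>a \<in> S - {v}\<close> \<open>b \<in> A - (S - {v})\<close> \<open>adj x y a b\<close> by blast
    qed
  qed
qed auto

lemma conn_Un:
  assumes "conn x y A" "finite B" "\<And>b. b \<in> B \<Longrightarrow> \<exists>u\<in>A. adj x y b u"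
  shows "conn x y (A \<union> B)"
  using assms(2,3)
proof (induction B)
  case empty
  then show ?case using assms(1) by simp
next
  case (insert b B)
  obtain u where "u \<in> A" "adj x y b u" using insert.prems by blast
  then show ?case using insert conn_insert[of x y "A \<union> B" u b] by auto
qed

lemma conn_edge:
  assumes "conn x y A" "u \<in> A" "A \<noteq> {u}"
  shows "\<exists>v\<in>A. adj x y u v"
proof -
  have "{u} \<subset> A" using assms by auto
  then have "\<exists>a\<in>{u}. \<exists>v\<in>A - {u}. adj x y a v" using assms(1) unfolding conn_def by blast
  then show ?thesis by auto
qed


section \<open>Isomorphism invariants\<close>

lemma isom_transfer:
  assumes "isom x y A B"
  obtains f where "bij_betw f A B"
    "\<And>u v. u \<in> A \<Longrightarrow> v \<in> A \<Longrightarrow> x (f u) < x (f v) \<longleftrightarrow> x u < x v"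
    "\<And>u v. u \<in> A \<Longrightarrow> v \<in> A \<Longrightarrow> y (f u) < y (f v) \<longleftrightarrow> y u < y v"
    "\<And>u v. u \<in> A \<Longrightarrow> v \<in> A \<Longrightarrow> adj x y (f u) (f v) \<longleftrightarrow> adj x y u v"
    "\<And>u v. u \<in> A \<Longrightarrow> v \<in> A \<Longrightarrow> nw x y (f u) (f v) \<longleftrightarrow> nw x y u v"
    "\<And>u v. u \<in> A \<Longrightarrow> v \<in> A \<Longrightarrow> lt x y (f u) (f v) \<longleftrightarrow> lt x y u v"
proof -
  obtain f where "bij_betw f A B" "emb x y A x y B f" using assms by (auto simp: isom_def)
  then show thesis
    by (intro that[of f]) (auto simp: emb_def adj_def nw_def lt_def)
qed

text \<open>Every edge of the inversion graph is listed once, from its upper left end, so the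
  cardinality is the number of inversions of the pattern.\<close>

definition edges :: "('a \<Rightarrow> int) \<Rightarrow> ('a \<Rightarrow> int) \<Rightarrow> 'a set \<Rightarrow> ('a \<times> 'a) set" where
  "edges x y A = {(u, v). u \<in> A \<and> v \<in> A \<and> nw x y u v}"

lemma isom_edges:
  assumes "isom x y A B"
  shows "card (edges x y A) = card (edges x y B)"
proof -
  obtain f where f: "bij_betw f A B" and n: "\<And>u v. u \<in> A \<Longrightarrow> v \<in> A \<Longrightarrow> nw x y (f u) (f v) \<longleftrightarrow> nw x y u v"
    using isom_transfer[OF assms] by metis
  have "bij_betw (map_prod f f) (edges x y A) (edges x y B)"
  proof (rule bij_betw_subset[of _ "A \<times> A" "B \<times> B"])
    show "bij_betw (map_prod f f) (A \<times> A) (B \<times> B)"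
      using f by (auto simp: bij_betw_def intro: map_prod_inj_on)
    show "edges x y A \<subseteq> A \<times> A" by (auto simp: edges_def)
    show "map_prod f f ` edges x y A = edges x y B"
    proof
      show "map_prod f f ` edges x y A \<subseteq> edges x y B"
        using n f by (auto simp: edges_def bij_betw_def)
      show "edges x y B \<subseteq> map_prod f f ` edges x y A"
      proof (clarsimp simp: edges_def)
        fix a b assume ab: "a \<in> B" "b \<in> B" "nw x y a b"
        then obtain u v where "a = f u" "b = f v" "u \<in> A" "v \<in> A" using f by (auto simp: bij_betw_def)
        then show "(a, b) \<in> map_prod f f ` {(u, v). u \<in> A \<and> v \<in> A \<and> nw x y u v}"
          using n ab by (auto intro!: rev_image_eqI[of "(u,v)"])
      qed
    qed
  qed
  then show ?thesis by (rule bij_betw_same_card)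
qed

lemma edges_finite: "finite A \<Longrightarrow> finite (edges x y A)"
  by (rule finite_subset[of _ "A \<times> A"]) (auto simp: edges_def)

lemma edges_insert:
  assumes "finite A" "v \<notin> A"
  shows "card (edges x y (insert v A)) = card (edges x y A) + card {u\<in>A. adj x y v u}"
proof -
  let ?h = "\<lambda>u. if nw x y u v then (u, v) else (v, u)"
  have "edges x y (insert v A) = edges x y A \<union> ?h ` {u\<in>A. adj x y v u}"
    by (auto simp: edges_def adj_def nw_def image_iff)
  moreover have "edges x y A \<inter> ?h ` {u\<in>A. adj x y v u} = {}"
    using assms by (auto simp: edges_def)
  moreover have inj: "inj_on ?h {u\<in>A. adj x y v u}"
    using assms by (auto simp: inj_on_def split: if_splits)
  ultimately have "card (edges x y (insert v A)) = card (edges x y A) + card (?h ` {u\<in>A. adj x y v u})"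
    using assms(1) edges_finite[of A x y] card_Un_disjoint[of "edges x y A" "?h ` {u\<in>A. adj x y v u}"] by simp
  also have "card (?h ` {u\<in>A. adj x y v u}) = card {u\<in>A. adj x y v u}"
    using inj by (rule card_image)
  finally show ?thesis .
qed

lemma edges_empty [simp]: "edges x y {} = {}"
  by (auto simp: edges_def)

lemma trichotomy:
  assumes "inj_on x V" "inj_on y V" "u \<in> V" "v \<in> V" "u \<noteq> v"
  obtains "lt x y u v" | "lt x y v u" | "adj x y u v"
proof -
  have "x u \<noteq> x v" "y u \<noteq> y v" using assms by (auto simp: inj_on_def)
  then show thesis using that unfolding lt_def adj_def nw_def by linarith
qed

lemma lt_not_adj: "lt x y u v \<Longrightarrow> \<not> adj x y u v"
  by (auto simp: lt_def adj_def nw_def)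

lemma lt_asym: "lt x y u v \<Longrightarrow> \<not> lt x y v u"
  by (auto simp: lt_def)

lemma lt_trans: "lt x y u v \<Longrightarrow> lt x y v w \<Longrightarrow> lt x y u w"
  by (auto simp: lt_def)

lemma nw_trans: "nw x y u v \<Longrightarrow> nw x y v w \<Longrightarrow> nw x y u w"
  by (auto simp: nw_def)

lemma nw_asym: "nw x y u v \<Longrightarrow> \<not> nw x y v u"
  by (auto simp: nw_def)

lemma edges_clique:
  assumes "finite A" "\<And>u v. u \<in> A \<Longrightarrow> v \<in> A \<Longrightarrow> u \<noteq> v \<Longrightarrow> adj x y u v"
  shows "card (edges x y A) = card A choose 2"
  using assms
proof (induction A)
  case (insert v A)
  have "{u\<in>A. adj x y v u} = A" using insert by auto
  moreover have "card (edges x y A) = card A choose 2" using insert by auto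
  ultimately show ?case using insert edges_insert[of A v x y] by (simp add: numeral_2_eq_2)
qed auto

lemma edges_indep:
  assumes "\<And>u v. u \<in> A \<Longrightarrow> v \<in> A \<Longrightarrow> \<not> adj x y u v"
  shows "card (edges x y A) = 0"
proof -
  have "edges x y A = {}" using assms by (auto simp: edges_def adj_def)
  then show ?thesis by simp
qed

text \<open>The points that play the 3 in an occurrence of 312. Their number separates patterns with
  equally many inversions. After reflecting \<open>y\<close>, they are the points that play the 1 in
  an occurrence of 132.\<close>

definition over_pair :: "('a \<Rightarrow> int) \<Rightarrow> ('a \<Rightarrow> int) \<Rightarrow> 'a set \<Rightarrow> 'a set" where
  "over_pair x y A = {z\<in>A. \<exists>u\<in>A. \<exists>v\<in>A. lt x y u v \<and> nw x y z u \<and> nw x y z v}"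

lemma image_filter:
  assumes "\<And>z. z \<in> A \<Longrightarrow> Q (f z) \<longleftrightarrow> P z"
  shows "f ` {z\<in>A. P z} = {z\<in>f ` A. Q z}"
  using assms by auto

lemma isom_over_pair:
  assumes "isom x y A B"
  shows "card (over_pair x y A) = card (over_pair x y B)"
proof -
  obtain f where f: "bij_betw f A B"
    and n: "\<And>u v. u \<in> A \<Longrightarrow> v \<in> A \<Longrightarrow> nw x y (f u) (f v) \<longleftrightarrow> nw x y u v"
    and l: "\<And>u v. u \<in> A \<Longrightarrow> v \<in> A \<Longrightarrow> lt x y (f u) (f v) \<longleftrightarrow> lt x y u v"
    using isom_transfer[OF assms] by metis
  have B: "B = f ` A" using f by (simp add: bij_betw_def)
  have "bij_betw f (over_pair x y A) (over_pair x y B)"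
  proof (rule bij_betw_subset[OF f])
    show "over_pair x y A \<subseteq> A" by (auto simp: over_pair_def)
    show "f ` over_pair x y A = over_pair x y B"
    proof -
      have "(\<exists>u\<in>B. \<exists>v\<in>B. lt x y u v \<and> nw x y (f z) u \<and> nw x y (f z) v) \<longleftrightarrow>
          (\<exists>u\<in>A. \<exists>v\<in>A. lt x y u v \<and> nw x y z u \<and> nw x y z v)" if "z \<in> A" for z
        unfolding B using n l that by simp
      then show ?thesis unfolding over_pair_def B by (rule image_filter)
    qed
  qed
  then show ?thesis by (rule bij_betw_same_card)
qed

lemma isom_reflect: "isom x (\<lambda>u. - y u) A B \<longleftrightarrow> isom x y A B"
  by (auto simp: isom_def emb_def)

lemma lt_reflect: "lt x (\<lambda>u. - y u) u v \<longleftrightarrow> nw x y u v"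
  by (auto simp: lt_def nw_def)

lemma nw_reflect: "nw x (\<lambda>u. - y u) u v \<longleftrightarrow> lt x y u v"
  by (auto simp: lt_def nw_def)

lemma subset_of_card: "n \<le> card S \<Longrightarrow> \<exists>A\<subseteq>S. card A = n"
  using obtain_subset_with_card_n by metis

section \<open>Four configurations with \<open>n - 1\<close> connected patterns of size
  \<open>n\<close>\<close>

text \<open>Take \<open>p\<close>, \<open>b\<close> points of \<open>S2\<close> and
  \<open>n - 1 - b\<close> points of \<open>S1\<close>. The inversions are those of a clique on
  \<open>n - 1\<close> points and one for each chosen point of \<open>S1\<close>, so their number
  determines \<open>b\<close>. The range \<open>b < n - 1\<close> keeps a point of
  \<open>S1\<close>, which joins \<open>p\<close> to the rest.\<close>

lemma many_near_clique:
  assumes fin: "finite V" and V: "S1 \<subseteq> V" "S2 \<subseteq> V" "p \<in> V" "S1 \<inter> S2 = {}" "p \<notin> S1 \<union> S2"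
    and cl: "\<And>u v. u \<in> S1 \<union> S2 \<Longrightarrow> v \<in> S1 \<union> S2 \<Longrightarrow> u \<noteq> v \<Longrightarrow> adj x y u v"
    and p1: "\<And>u. u \<in> S1 \<Longrightarrow> adj x y p u" and p2: "\<And>u. u \<in> S2 \<Longrightarrow> \<not> adj x y p u"
    and K: "n \<le> card S1" "n \<le> card S2" and n: "2 \<le> n"
  shows "many x y V n (n - 1)"
proof -
  have "\<exists>A1 A2. A1 \<subseteq> S1 \<and> card A1 = n - 1 - b \<and> A2 \<subseteq> S2 \<and> card A2 = b" if b: "b < n - 1" for b
  proof -
    obtain A1 where "A1 \<subseteq> S1" "card A1 = n - 1 - b"
      using subset_of_card[of "n - 1 - b" S1] K by (metis order_trans diff_le_self)
    moreover obtain A2 where "A2 \<subseteq> S2" "card A2 = b"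
      using subset_of_card[of b S2] K b by (metis less_imp_le order_trans diff_le_self)
    ultimately show ?thesis by blast
  qed
  then obtain A1 A2 where A: "\<And>b. b < n - 1 \<Longrightarrow> A1 b \<subseteq> S1 \<and> card (A1 b) = n - 1 - b \<and> A2 b \<subseteq> S2 \<and> card (A2 b) = b"
    by metis
  define A where "A b = insert p (A1 b \<union> A2 b)" for b
  have *: "A b \<subseteq> V \<and> card (A b) = n \<and> conn x y (A b) \<and> card (edges x y (A b)) = ((n - 1) choose 2) + (n - 1 - b)"
    if b: "b < n - 1" for b
  proof -
    have f: "finite (A1 b)" "finite (A2 b)" using A[OF b] V fin by (meson finite_subset)+
    have dis: "A1 b \<inter> A2 b = {}" "p \<notin> A1 b \<union> A2 b" using A[OF b] V by auto
    have c: "card (A1 b \<union> A2 b) = n - 1" using A[OF b] b dis f by (simp add: card_Un_disjoint)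
    have "A1 b \<noteq> {}" using A[OF b] b by auto
    then obtain a where a: "a \<in> A1 b" by blast
    have cn: "conn x y ({a} \<union> insert p (A1 b \<union> A2 b - {a}))"
    proof (rule conn_Un)
      fix q assume "q \<in> insert p (A1 b \<union> A2 b - {a})"
      then have "q = p \<or> q \<in> S1 \<union> S2 \<and> q \<noteq> a" "a \<in> S1" using a A[OF b] by auto
      then show "\<exists>u\<in>{a}. adj x y q u" using cl p1 by auto
    qed (use f in \<open>auto simp: conn_sing\<close>)
    have "{a} \<union> insert p (A1 b \<union> A2 b - {a}) = A b" using a by (auto simp: A_def)
    with cn have "conn x y (A b)" by simp
    moreover have "card (A b) = n" using c dis f n by (simp add: A_def)
    moreover have "card (edges x y (A b)) = ((n - 1) choose 2) + (n - 1 - b)"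
    proof -
      have "{u \<in> A1 b \<union> A2 b. adj x y p u} = A1 b" using A[OF b] p1 p2 by auto
      moreover have "card (edges x y (A1 b \<union> A2 b)) = (n - 1) choose 2"
        using edges_clique[of "A1 b \<union> A2 b" x y] f cl A[OF b] c by (metis (no_types, lifting) Un_mono finite_UnI subsetD)
      ultimately show ?thesis
        unfolding A_def using edges_insert[of "A1 b \<union> A2 b" p x y] f dis A[OF b] by auto
    qed
    moreover have "A b \<subseteq> V" using A[OF b] V by (auto simp: A_def)
    ultimately show ?thesis by simp
  qed
  show ?thesis
  proof (rule manyI[of "{..<n - 1}" _ A])
    fix i j assume ij: "i \<in> {..<n - 1}" "j \<in> {..<n - 1}" "i \<noteq> j"
    show "\<not> isom x y (A i) (A j)"
    proof
      assume "isom x y (A i) (A j)"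
      then have "card (edges x y (A i)) = card (edges x y (A j))" by (rule isom_edges)
      then show False using *[of i] *[of j] ij by auto
    qed
  qed (use * in auto)
qed

text \<open>A decreasing sequence in which one entry is replaced by the ascent formed by
  \<open>p\<close> and \<open>w\<close>. The number of inversions does not depend on where this
  happens, but the points in front of the ascent are exactly those in
  \<open>over_pair\<close>.\<close>

lemma many_split_clique:
  assumes fin: "finite V" and V: "S1 \<subseteq> V" "S2 \<subseteq> V" "p \<in> V" "w \<in> V" "S1 \<inter> S2 = {}"
    and cl: "\<And>u v. u \<in> S1 \<union> S2 \<Longrightarrow> v \<in> S1 \<union> S2 \<Longrightarrow> u \<noteq> v \<Longrightarrow> adj x y u v"
    and nw: "\<And>u. u \<in> S1 \<Longrightarrow> nw x y u p \<and> nw x y u w" "\<And>u. u \<in> S2 \<Longrightarrow> nw x y p u \<and> nw x y w u"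
    and pw: "lt x y p w \<or> lt x y w p"
    and K: "n \<le> card S1" "n \<le> card S2" and n: "3 \<le> n"
  shows "many x y V n (n - 1)"
proof -
  have "\<exists>A1 A2. A1 \<subseteq> S1 \<and> card A1 = a \<and> A2 \<subseteq> S2 \<and> card A2 = n - 2 - a" if a: "a < n - 1" for a
  proof -
    obtain A1 where "A1 \<subseteq> S1" "card A1 = a"
      using subset_of_card[of a S1] K a by (metis less_imp_le order_trans diff_le_self)
    moreover obtain A2 where "A2 \<subseteq> S2" "card A2 = n - 2 - a"
      using subset_of_card[of "n - 2 - a" S2] K a by (metis less_imp_le order_trans diff_le_self)
    ultimately show ?thesis by blast
  qed
  then obtain A1 A2 where A: "\<And>a. a < n - 1 \<Longrightarrow> A1 a \<subseteq> S1 \<and> card (A1 a) = a \<and> A2 a \<subseteq> S2 \<and> card (A2 a) = n - 2 - a"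
    by metis
  define A where "A a = {p, w} \<union> (A1 a \<union> A2 a)" for a
  have pw': "p \<notin> S1 \<union> S2" "w \<notin> S1 \<union> S2" "p \<noteq> w"
    using nw pw by (auto simp: nw_def lt_def)
  have *: "A a \<subseteq> V \<and> card (A a) = n \<and> conn x y (A a) \<and> over_pair x y (A a) = A1 a" if a: "a < n - 1" for a
  proof -
    have f: "finite (A1 a)" "finite (A2 a)" using A[OF a] V fin by (meson finite_subset)+
    have dis: "A1 a \<inter> A2 a = {}" "p \<notin> A1 a \<union> A2 a" "w \<notin> A1 a \<union> A2 a" using A[OF a] V pw' by auto
    have c: "card (A1 a \<union> A2 a) = n - 2" using A[OF a] a dis f by (simp add: card_Un_disjoint)
    have "A1 a \<union> A2 a \<noteq> {}" using c n by auto
    then obtain b where b: "b \<in> A1 a \<union> A2 a" by blast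
    have cn: "conn x y ({b} \<union> ({p, w} \<union> (A1 a \<union> A2 a - {b})))"
    proof (rule conn_Un)
      fix q assume q: "q \<in> {p, w} \<union> (A1 a \<union> A2 a - {b})"
      have "b \<in> S1 \<union> S2" using b A[OF a] by auto
      moreover have "q = p \<or> q = w \<or> (q \<in> S1 \<union> S2 \<and> q \<noteq> b)" using q A[OF a] by auto
      ultimately have "adj x y q b"
        using cl nw by (auto simp: adj_def)
      then show "\<exists>u\<in>{b}. adj x y q u" by simp
    qed (use f in \<open>auto simp: conn_sing\<close>)
    have "{b} \<union> ({p, w} \<union> (A1 a \<union> A2 a - {b})) = A a" using b by (auto simp: A_def)
    with cn have "conn x y (A a)" by simp
    moreover have "card (A a) = n" using c dis f n pw' by (simp add: A_def)
    moreover have "over_pair x y (A a) = A1 a"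
    proof -
      have lt2: "{u, v} = {p, w}" if "u \<in> A a" "v \<in> A a" "lt x y u v" for u v
      proof (rule ccontr)
        assume n: "{u, v} \<noteq> {p, w}"
        have "u \<noteq> v" using that(3) by (auto simp: lt_def)
        have "u = p \<or> u = w \<or> u \<in> S1 \<union> S2" "v = p \<or> v = w \<or> v \<in> S1 \<union> S2"
          using that A[OF a] by (auto simp: A_def)
        then have "adj x y u v"
          using n \<open>u \<noteq> v\<close> cl nw by (auto simp: adj_def)
        then show False using that(3) lt_not_adj by metis
      qed
      have "z \<in> A1 a" if z: "z \<in> over_pair x y (A a)" for z
      proof -
        obtain u v where uv: "u \<in> A a" "v \<in> A a" "lt x y u v" "nw x y z u" "nw x y z v" "z \<in> A a"
          using z by (auto simp: over_pair_def)
        then have "nw x y z p" "nw x y z w" using lt2[OF uv(1-3)] by (auto simp: doubleton_eq_iff)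
        then have "z \<noteq> p" "z \<noteq> w" "z \<notin> S2" using nw(2)[of z] by (auto simp: nw_def)
        then show ?thesis using uv(6) A[OF a] by (auto simp: A_def)
      qed
      moreover have "z \<in> over_pair x y (A a)" if "z \<in> A1 a" for z
      proof -
        have "nw x y z p \<and> nw x y z w" using that A[OF a] nw by auto
        then show ?thesis using pw that unfolding over_pair_def A_def by blast
      qed
      ultimately show ?thesis by blast
    qed
    moreover have "A a \<subseteq> V" using A[OF a] V by (auto simp: A_def)
    ultimately show ?thesis by simp
  qed
  show ?thesis
  proof (rule manyI[of "{..<n - 1}" _ A])
    fix i j assume ij: "i \<in> {..<n - 1}" "j \<in> {..<n - 1}" "i \<noteq> j"
    show "\<not> isom x y (A i) (A j)"
    proof
      assume "isom x y (A i) (A j)"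
      then have "card (over_pair x y (A i)) = card (over_pair x y (A j))" by (rule isom_over_pair)
      then show False using *[of i] *[of j] A[of i] A[of j] ij by auto
    qed
  qed (use * in auto)
qed

text \<open>Joining \<open>p\<close> to \<open>b\<close> leaves of a star with centre
  \<open>c\<close> makes the number of edges grow with \<open>b\<close>. For \<open>b = 0\<close>
  the point \<open>p\<close> may be isolated; a star without \<open>p\<close> is used
  instead.\<close>

lemma many_near_star:
  assumes fin: "finite V" and V: "S1 \<subseteq> V" "S2 \<subseteq> V" "p \<in> V" "c \<in> V" "S1 \<inter> S2 = {}" "p \<noteq> c"
    and ind: "\<And>u v. u \<in> S1 \<union> S2 \<Longrightarrow> v \<in> S1 \<union> S2 \<Longrightarrow> \<not> adj x y u v"
    and c: "\<And>u. u \<in> S1 \<union> S2 \<Longrightarrow> nw x y u c"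
    and p1: "p \<notin> S1" "\<And>u. u \<in> S1 \<Longrightarrow> \<not> adj x y p u" and p2: "\<And>u. u \<in> S2 \<Longrightarrow> adj x y p u"
    and K: "n \<le> card S1" "n \<le> card S2" and n: "3 \<le> n"
  shows "many x y V n (n - 1)"
proof -
  have "\<exists>A1 A2. A1 \<subseteq> S1 \<and> card A1 = n - 2 - b \<and> A2 \<subseteq> S2 \<and> card A2 = b" if b: "b < n - 1" for b
  proof -
    obtain A1 where "A1 \<subseteq> S1" "card A1 = n - 2 - b"
      using subset_of_card[of "n - 2 - b" S1] K by (metis order_trans diff_le_self)
    moreover obtain A2 where "A2 \<subseteq> S2" "card A2 = b"
      using subset_of_card[of b S2] K b by (metis less_imp_le order_trans diff_le_self)
    ultimately show ?thesis by blast
  qed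
  then obtain A1 A2 where A: "\<And>b. b < n - 1 \<Longrightarrow> A1 b \<subseteq> S1 \<and> card (A1 b) = n - 2 - b \<and> A2 b \<subseteq> S2 \<and> card (A2 b) = b"
    by metis
  obtain T where T: "T \<subseteq> S1" "card T = n - 1"
    using subset_of_card[of "n - 1" S1] K by (metis order_trans diff_le_self)
  define A where "A b = (if b = 0 then insert c T else insert p (insert c (A1 b \<union> A2 b)))" for b
  have cS: "c \<notin> S1 \<union> S2" using c by (auto simp: nw_def)
  have pS: "p \<notin> S1 \<union> S2" using p1 p2[of p] by auto
  have star: "conn x y (insert c B)" "card (edges x y (insert c B)) = card B" if B: "B \<subseteq> S1 \<union> S2" for B
  proof -
    have fB: "finite B" using B V fin by (meson finite_subset le_sup_iff)
    have "conn x y ({c} \<union> B)"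
      using fB B c by (intro conn_Un) (auto simp: conn_sing adj_def)
    then show "conn x y (insert c B)" by simp
    have "{u\<in>B. adj x y c u} = B" using B c by (auto simp: adj_def)
    moreover have "card (edges x y B) = 0" using B ind by (intro edges_indep) blast
    ultimately show "card (edges x y (insert c B)) = card B"
      using edges_insert[of B c x y] fB cS B by auto
  qed
  have fT: "finite T" using T V fin by (meson finite_subset)
  have T0: "card (insert c T) = n" using fT T cS n by (subst card_insert_disjoint) auto
  have *: "A b \<subseteq> V \<and> card (A b) = n \<and> conn x y (A b) \<and>
      card (edges x y (A b)) = (n - 2 + b) + (if adj x y p c then 1 else 0)"
    if b: "0 < b" "b < n - 1" for b
  proof -
    have f: "finite (A1 b)" "finite (A2 b)" using A[OF b(2)] V fin by (meson finite_subset)+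
    have dis: "A1 b \<inter> A2 b = {}" "p \<notin> insert c (A1 b \<union> A2 b)" "c \<notin> A1 b \<union> A2 b" using A[OF b(2)] V pS cS by auto
    have card: "card (A1 b \<union> A2 b) = n - 2" using A[OF b(2)] b dis f by (simp add: card_Un_disjoint)
    have sub: "A1 b \<union> A2 b \<subseteq> S1 \<union> S2" using A[OF b(2)] by auto
    have "A2 b \<noteq> {}" using A[OF b(2)] b by auto
    then obtain a where a: "a \<in> A2 b" by blast
    have "conn x y (A b)"
      using b a p2[of a] A[OF b(2)] conn_insert[OF star(1)[OF sub], of a p] by (auto simp: A_def)
    moreover have "card (A b) = n" using card dis f n b by (simp add: A_def)
    moreover have "card (edges x y (A b)) = (n - 2 + b) + (if adj x y p c then 1 else 0)"
    proof -
      have "{u \<in> insert c (A1 b \<union> A2 b). adj x y p u} = A2 b \<union> (if adj x y p c then {c} else {})"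
        using A[OF b(2)] p1 p2 by auto
      then have "card {u \<in> insert c (A1 b \<union> A2 b). adj x y p u} = b + (if adj x y p c then 1 else 0)"
        using A[OF b(2)] f dis by auto
      moreover have "card (edges x y (insert p (insert c (A1 b \<union> A2 b)))) =
          card (edges x y (insert c (A1 b \<union> A2 b))) + card {u \<in> insert c (A1 b \<union> A2 b). adj x y p u}"
        using f dis by (intro edges_insert) auto
      moreover have "A b = insert p (insert c (A1 b \<union> A2 b))" using b by (simp add: A_def)
      ultimately show ?thesis
        using star(2)[OF sub] card by (simp only: add.assoc)
    qed
    moreover have "A b \<subseteq> V" using A[OF b(2)] V b by (auto simp: A_def)
    ultimately show ?thesis by simp
  qed
  have **: "A 0 \<subseteq> V \<and> card (A 0) = n \<and> conn x y (A 0) \<and> card (edges x y (A 0)) = n - 1"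
    using T0 star[of T] T V by (auto simp: A_def)
  \<comment> \<open>Only the tree with \<open>b = 1\<close> and \<open>p\<close> not adjacent to
    \<open>c\<close> has as few edges as the star. It has no point to the lower right of all the
    others, as the centre of a star is.\<close>
  have no: "\<not> isom x y (A 0) (A b)" if b: "0 < b" "b < n - 1" for b
  proof
    assume i: "isom x y (A 0) (A b)"
    then have "card (edges x y (A 0)) = card (edges x y (A b))" by (rule isom_edges)
    then have e: "b = 1" "\<not> adj x y p c" using * ** b n by (auto split: if_splits)
    obtain f where f: "bij_betw f (A 0) (A b)"
      and nf: "\<And>u v. u \<in> A 0 \<Longrightarrow> v \<in> A 0 \<Longrightarrow> nw x y (f u) (f v) \<longleftrightarrow> nw x y u v"
      using isom_transfer[OF i] by metis
    have c0: "\<forall>v\<in>A 0 - {c}. nw x y v c" "c \<in> A 0" using T c by (auto simp: A_def)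
    have cb: "nw x y v (f c)" if v: "v \<in> A b" "v \<noteq> f c" for v
    proof -
      obtain u where "u \<in> A 0" "v = f u" using f v by (auto simp: bij_betw_def)
      then show ?thesis using nf c0 v by auto
    qed
    have "p \<in> A b" "c \<in> A b" using b by (auto simp: A_def)
    then have "f c \<noteq> p" "f c \<noteq> c" using cb[of c] cb[of p] e V unfolding adj_def by auto
    moreover have "f c \<in> A b" using f c0 by (auto simp: bij_betw_def)
    ultimately have "f c \<in> S1 \<union> S2" using A[OF b(2)] b by (auto simp: A_def)
    then have "nw x y (f c) c" using c by auto
    moreover have "nw x y c (f c)" using cb \<open>c \<in> A b\<close> \<open>f c \<noteq> c\<close> by auto
    ultimately show False by (auto simp: nw_def)
  qed
  show ?thesis
  proof (rule manyI[of "{..<n - 1}" _ A])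
    fix i j assume ij: "i \<in> {..<n - 1}" "j \<in> {..<n - 1}" "i \<noteq> j"
    show "\<not> isom x y (A i) (A j)"
    proof (cases "i = 0 \<or> j = 0")
      case True
      then show ?thesis using no[of i] no[of j] ij isom_sym by (metis gr0I lessThan_iff)
    next
      case False
      show ?thesis
      proof
        assume "isom x y (A i) (A j)"
        then have "card (edges x y (A i)) = card (edges x y (A j))" by (rule isom_edges)
        then show False using *[of i] *[of j] ij False by auto
      qed
    qed
  next
    fix j assume "j \<in> {..<n - 1}"
    then show "A j \<subseteq> V \<and> card (A j) = n \<and> conn x y (A j)" using *[of j] ** by (cases "j = 0") auto
  qed auto
qed

text \<open>An increasing sequence in which one entry is replaced by the descent formed by
  \<open>p\<close> and \<open>w\<close>, with a common neighbour \<open>c\<close> that keeps it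
  connected. The possible places of the descent give \<open>n - 2\<close> patterns, and the plain
  star is the remaining one.\<close>

lemma many_split_star:
  assumes fin: "finite V" and V: "S1 \<subseteq> V" "S2 \<subseteq> V" "p \<in> V" "w \<in> V" "c \<in> V" "S1 \<inter> S2 = {}"
    and ind: "\<And>u v. u \<in> S1 \<union> S2 \<Longrightarrow> v \<in> S1 \<union> S2 \<Longrightarrow> \<not> adj x y u v"
    and c: "\<And>u. u \<in> insert p (insert w (S1 \<union> S2)) \<Longrightarrow> nw x y u c"
    and lt: "\<And>u. u \<in> S1 \<Longrightarrow> lt x y u p \<and> lt x y u w" "\<And>u. u \<in> S2 \<Longrightarrow> lt x y p u \<and> lt x y w u"
    and pw: "adj x y p w"
    and K: "n \<le> card S1" "n \<le> card S2" and n: "3 \<le> n"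
  shows "many x y V n (n - 1)"
proof -
  have "\<exists>A1 A2. A1 \<subseteq> S1 \<and> card A1 = a \<and> A2 \<subseteq> S2 \<and> card A2 = n - 3 - a" if a: "a < n - 2" for a
  proof -
    obtain A1 where "A1 \<subseteq> S1" "card A1 = a"
      using subset_of_card[of a S1] K a by (metis less_imp_le order_trans diff_le_self)
    moreover obtain A2 where "A2 \<subseteq> S2" "card A2 = n - 3 - a"
      using subset_of_card[of "n - 3 - a" S2] K by (metis order_trans diff_le_self)
    ultimately show ?thesis by blast
  qed
  then obtain A1 A2 where A: "\<And>a. a < n - 2 \<Longrightarrow> A1 a \<subseteq> S1 \<and> card (A1 a) = a \<and> A2 a \<subseteq> S2 \<and> card (A2 a) = n - 3 - a"
    by metis
  obtain T where T: "T \<subseteq> S1" "card T = n - 1"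
    using subset_of_card[of "n - 1" S1] K by (metis order_trans diff_le_self)
  define A where "A a = (if a = n - 2 then insert c T else insert c ({p, w} \<union> (A1 a \<union> A2 a)))" for a
  have cS: "c \<notin> insert p (insert w (S1 \<union> S2))" using c by (auto simp: nw_def)
  have pS: "p \<notin> S1 \<union> S2" "w \<notin> S1 \<union> S2" "p \<noteq> w" using lt pw by (auto simp: lt_def)
  have npw: "\<not> adj x y p u" "\<not> adj x y w u" if "u \<in> S1 \<union> S2" for u
    using lt[of u] that by (auto simp: lt_def adj_def nw_def)
  have star: "conn x y (insert c B)" "card (edges x y (insert c B)) = card (edges x y B) + card B"
    if B: "B \<subseteq> insert p (insert w (S1 \<union> S2))" for B
  proof -
    have fB: "finite B" using B V fin by (meson finite_subset insert_subset le_sup_iff)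
    have "conn x y ({c} \<union> B)"
      using fB B c by (intro conn_Un) (auto simp: conn_sing adj_def)
    then show "conn x y (insert c B)" by simp
    have "{u\<in>B. adj x y c u} = B" using B c by (auto simp: adj_def)
    then show "card (edges x y (insert c B)) = card (edges x y B) + card B"
      using edges_insert[of B c x y] fB cS B by auto
  qed
  have fT: "finite T" using T V fin by (meson finite_subset)
  have T0: "card (insert c T) = n" using fT T cS n by (subst card_insert_disjoint) auto
  have *: "A a \<subseteq> V \<and> card (A a) = n \<and> conn x y (A a) \<and> card (edges x y (A a)) = n \<and>
      over_pair x (\<lambda>u. - y u) (A a) = A1 a"
    if a: "a < n - 2" for a
  proof -
    have f: "finite (A1 a)" "finite (A2 a)" using A[OF a] V fin by (meson finite_subset)+
    have dis: "A1 a \<inter> A2 a = {}" "{p, w} \<inter> (A1 a \<union> A2 a) = {}" "c \<notin> {p, w} \<union> (A1 a \<union> A2 a)"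
      using A[OF a] V pS cS by auto
    have card: "card (A1 a \<union> A2 a) = n - 3" using A[OF a] a dis f by (simp add: card_Un_disjoint)
    have sub: "{p, w} \<union> (A1 a \<union> A2 a) \<subseteq> insert p (insert w (S1 \<union> S2))" using A[OF a] by auto
    have card2: "card ({p, w} \<union> (A1 a \<union> A2 a)) = n - 1" using card dis f n pS by simp
    have "conn x y (A a)" using a star(1)[OF sub] by (simp add: A_def)
    moreover have "card (A a) = n" using card2 dis f n a by (simp add: A_def)
    moreover have "card (edges x y (A a)) = n"
    proof -
      let ?S = "A1 a \<union> A2 a"
      have "{u\<in>?S. adj x y w u} = {}" "{u\<in>insert w ?S. adj x y p u} = {w}"
        using npw A[OF a] pw by auto
      moreover have "card (edges x y ?S) = 0" using A[OF a] ind by (intro edges_indep) blast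
      ultimately have "card (edges x y (insert p (insert w ?S))) = 1"
        using edges_insert[of ?S w x y] edges_insert[of "insert w ?S" p x y] f dis pS by auto
      moreover have "A a = insert c ({p, w} \<union> ?S)" using a by (simp add: A_def)
      ultimately show ?thesis
        using star(2)[OF sub] card2 n by (simp del: star)
    qed
    moreover have "over_pair x (\<lambda>u. - y u) (A a) = A1 a"
    proof -
      have sub': "A a \<subseteq> insert c (insert p (insert w (S1 \<union> S2)))" using sub a by (auto simp: A_def)
      have "z \<in> A1 a" if z: "z \<in> over_pair x (\<lambda>u. - y u) (A a)" for z
      proof -
        obtain u v where uv: "u \<in> A a" "v \<in> A a" "nw x y u v" "lt x y z u" "lt x y z v" "z \<in> A a"
          using z by (auto simp: over_pair_def lt_reflect nw_reflect)
        have zc: "\<not> lt x y z c" using c[of z] subsetD[OF sub' uv(6)] by (auto simp: nw_def lt_def)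
        then have "u \<noteq> c" "v \<noteq> c" using uv(4,5) by blast+
        then have "u \<in> insert p (insert w (S1 \<union> S2))" "v \<in> insert p (insert w (S1 \<union> S2))"
          using subsetD[OF sub' uv(1)] subsetD[OF sub' uv(2)] by simp_all
        moreover have "adj x y u v" using uv by (auto simp: adj_def)
        ultimately have "{u, v} = {p, w}"
          using ind npw adj_sym[of x y u v] by (auto simp: doubleton_eq_iff)
        then have l: "lt x y z p" "lt x y z w" using uv by (auto simp: doubleton_eq_iff)
        have "z \<noteq> c" "z \<noteq> p" "z \<noteq> w" using l c[of p] by (auto simp: lt_def nw_def)
        moreover have "z \<notin> S2" using lt(2)[of z] l by (auto simp: lt_def)
        ultimately show ?thesis using uv(6) A[OF a] a by (auto simp: A_def)
      qed
      moreover have "z \<in> over_pair x (\<lambda>u. - y u) (A a)" if z: "z \<in> A1 a" for z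
      proof -
        have "lt x y z p \<and> lt x y z w" using z A[OF a] lt by auto
        moreover have "nw x y p w \<or> nw x y w p" using pw by (simp add: adj_def)
        ultimately show ?thesis using z a unfolding over_pair_def A_def lt_reflect nw_reflect by auto
      qed
      ultimately show ?thesis by blast
    qed
    moreover have "A a \<subseteq> V" using A[OF a] V a by (auto simp: A_def)
    ultimately show ?thesis by simp
  qed
  have **: "A (n - 2) \<subseteq> V \<and> card (A (n - 2)) = n \<and> conn x y (A (n - 2)) \<and> card (edges x y (A (n - 2))) = n - 1"
  proof -
    have "card (edges x y T) = 0" using T ind by (intro edges_indep) blast
    then show ?thesis using T0 star[of T] T V n by (auto simp: A_def)
  qed
  have no: "\<not> isom x y (A (n - 2)) (A a)" if a: "a < n - 2" for a
    using * ** isom_edges[of x y "A (n - 2)" "A a"] a n by fastforce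
  show ?thesis
  proof (rule manyI[of "{..<n - 1}" _ A])
    fix i j assume ij: "i \<in> {..<n - 1}" "j \<in> {..<n - 1}" "i \<noteq> j"
    show "\<not> isom x y (A i) (A j)"
    proof (cases "i = n - 2 \<or> j = n - 2")
      case True
      moreover have "i < n - 2 \<or> i = n - 2" "j < n - 2 \<or> j = n - 2" using ij by auto
      ultimately show ?thesis using no[of i] no[of j] ij isom_sym by metis
    next
      case False
      then have ij': "i < n - 2" "j < n - 2" using ij by auto
      show ?thesis
      proof
        assume "isom x y (A i) (A j)"
        \<comment> \<open>Complementing turns the descent into an ascent, so
          \<open>over_pair\<close> finds the leaves below it.\<close>
        then have "isom x (\<lambda>u. - y u) (A i) (A j)" by (simp add: isom_reflect)
        then have "card (over_pair x (\<lambda>u. - y u) (A i)) = card (over_pair x (\<lambda>u. - y u) (A j))"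
          by (rule isom_over_pair)
        then show False using *[OF ij'(1)] *[OF ij'(2)] A[OF ij'(1)] A[OF ij'(2)] ij by auto
      qed
    qed
  next
    fix j assume "j \<in> {..<n - 1}"
    then have "j = n - 2 \<or> j < n - 2" by auto
    then show "A j \<subseteq> V \<and> card (A j) = n \<and> conn x y (A j)" using *[of j] ** by auto
  qed (use n in auto)
qed

section \<open>Monotone subsets and stars in simple point sets\<close>

definition inc :: "('a \<Rightarrow> int) \<Rightarrow> ('a \<Rightarrow> int) \<Rightarrow> 'a set \<Rightarrow> bool" where
  "inc x y I \<longleftrightarrow> (\<forall>u\<in>I. \<forall>v\<in>I. x u < x v \<longleftrightarrow> y u < y v)"

text \<open>The point \<open>p\<close> cuts \<open>J\<close>, horizontally or vertically. A set that
  no outside point cuts is an interval in the sense of permutation patterns.\<close>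

definition between :: "('a \<Rightarrow> int) \<Rightarrow> ('a \<Rightarrow> int) \<Rightarrow> 'a set \<Rightarrow> 'a \<Rightarrow> bool" where
  "between x y J p \<longleftrightarrow> (\<exists>u\<in>J. \<exists>v\<in>J. x u < x p \<and> x p < x v \<or> y u < y p \<and> y p < y v)"

definition simple :: "('a \<Rightarrow> int) \<Rightarrow> ('a \<Rightarrow> int) \<Rightarrow> 'a set \<Rightarrow> bool" where
  "simple x y W \<longleftrightarrow> (\<forall>J\<subseteq>W. (\<forall>p\<in>W - J. \<not> between x y J p) \<longrightarrow> card J \<le> 1 \<or> J = W)"

text \<open>Trimming a chain at both ends ensures that a point cutting the remainder has at least
  \<open>K\<close> points of the chain on either side.\<close>

definition middle :: "('a \<Rightarrow> int) \<Rightarrow> nat \<Rightarrow> 'a set \<Rightarrow> 'a set" where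
  "middle x K I = {u\<in>I. K \<le> card {v\<in>I. x v < x u} \<and> K \<le> card {v\<in>I. x u < x v}}"

lemma between_reflect: "between x (\<lambda>u. - y u) J p \<longleftrightarrow> between x y J p"
  by (auto simp: between_def)

lemma between_swap: "between y x J p \<longleftrightarrow> between x y J p"
  by (auto simp: between_def)

lemma simple_reflect: "simple x (\<lambda>u. - y u) W \<longleftrightarrow> simple x y W"
  by (simp add: simple_def between_reflect)

lemma simple_swap: "simple y x W \<longleftrightarrow> simple x y W"
  by (simp add: simple_def between_swap)

lemma middle_inc:
  assumes "inc x y I"
  shows "middle y K I = middle x K I"
proof -
  have "{v\<in>I. y v < y u} = {v\<in>I. x v < x u} \<and> {v\<in>I. y u < y v} = {v\<in>I. x u < x v}" if "u \<in> I" for u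
    using assms that by (auto simp: inc_def)
  then show ?thesis by (auto simp: middle_def)
qed

text \<open>The number of points to the left is injective on \<open>I\<close>, so at most
  \<open>K\<close> points have fewer than \<open>K\<close> points to their left.\<close>

lemma card_few_below:
  fixes x :: "'a \<Rightarrow> int"
  assumes "finite I" "inj_on x I"
  shows "card {u\<in>I. card {v\<in>I. x v < x u} < K} \<le> (K :: nat)"
proof -
  let ?h = "\<lambda>u. card {v\<in>I. x v < x u}"
  have mono: "?h u < ?h w" if "u \<in> I" "w \<in> I" "x u < x w" for u w
  proof (rule psubset_card_mono)
    have "u \<in> {v\<in>I. x v < x w}" "u \<notin> {v\<in>I. x v < x u}" using that by auto
    moreover have "{v\<in>I. x v < x u} \<subseteq> {v\<in>I. x v < x w}" using that(3) by auto
    ultimately show "{v\<in>I. x v < x u} \<subset> {v\<in>I. x v < x w}" by blast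
  qed (use assms in auto)
  have "inj_on ?h {u\<in>I. ?h u < K}"
  proof (rule inj_onI)
    fix u w assume uw: "u \<in> {u\<in>I. ?h u < K}" "w \<in> {u\<in>I. ?h u < K}" "?h u = ?h w"
    then have "\<not> x u < x w" "\<not> x w < x u" using mono[of u w] mono[of w u] by auto
    then have "x u = x w" by linarith
    then show "u = w" using uw assms(2) by (auto simp: inj_on_def)
  qed
  then have "card {u\<in>I. ?h u < K} = card (?h ` {u\<in>I. ?h u < K})" by (simp add: card_image)
  also have "\<dots> \<le> card {..<K}" by (intro card_mono) auto
  finally show ?thesis by simp
qed

lemma card_middle:
  assumes "finite I" "inj_on x I"
  shows "card I \<le> card (middle x K I) + 2 * K"
proof -
  let ?a = "{u\<in>I. card {v\<in>I. x v < x u} < K}" and ?b = "{u\<in>I. card {v\<in>I. x u < x v} < K}"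
  have "inj_on (\<lambda>u. - x u) I" using assms by (auto simp: inj_on_def)
  then have b: "card ?b \<le> K" using card_few_below[of I "\<lambda>u. - x u" K] assms(1) by simp
  have a: "card ?a \<le> K" using card_few_below[of I x K] assms by simp
  have "I \<subseteq> middle x K I \<union> (?a \<union> ?b)" by (auto simp: middle_def)
  then have "card I \<le> card (middle x K I \<union> (?a \<union> ?b))"
    using assms by (intro card_mono) (auto simp: middle_def)
  also have "\<dots> \<le> card (middle x K I) + (card ?a + card ?b)"
    using card_Un_le[of "middle x K I" "?a \<union> ?b"] card_Un_le[of ?a ?b] by linarith
  finally show ?thesis using a b by linarith
qed

text \<open>The trimmed chain has at least two points and is not everything, so in a simple set some
  point cuts it. A point of the chain that cuts it would have enough chain points on either side to
  belong to the trimmed chain itself; hence the cutting point lies outside the chain.\<close>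

lemma separator_exists:
  assumes fin: "finite W" and inj: "inj_on x W" "inj_on y W" and simp: "simple x y W"
    and I: "I \<subseteq> W" "inc x y I" and K: "1 \<le> K" "2 * K + 2 \<le> card I"
  obtains p where "p \<in> W" "p \<notin> I" "between x y (middle x K I) p"
proof -
  let ?M = "middle x K I"
  have fI: "finite I" using I(1) fin by (rule finite_subset)
  have MI: "?M \<subseteq> I" by (auto simp: middle_def)
  have injI: "inj_on x I" using inj I by (meson inj_on_subset)
  have "card ?M \<ge> 2" using card_middle[OF fI injI, of K] K by linarith
  \<comment> \<open>The leftmost point of \<open>I\<close> is trimmed because \<open>K\<close> is at
    least 1.\<close>
  moreover have "?M \<noteq> W"
  proof
    assume "?M = W"
    then have IW: "I = W" "?M = I" using I MI by auto
    have ne: "finite (x ` I)" "x ` I \<noteq> {}" using fI K by auto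
    then obtain u where u: "u \<in> I" "x u = Min (x ` I)" using Min_in by (metis imageE)
    have "{v\<in>I. x v < x u} = {}" using u ne fI by (auto simp: not_less)
    then have "card {v\<in>I. x v < x u} = 0" by (metis card.empty)
    then have "u \<notin> ?M" using K by (simp add: middle_def)
    then show False using u IW by auto
  qed
  ultimately obtain p where p: "p \<in> W - ?M" "between x y ?M p"
    using simp MI I unfolding simple_def by (metis (no_types, lifting) Suc_1 not_less_eq_eq One_nat_def subset_trans)
  have "p \<notin> I"
  proof
    assume pI: "p \<in> I"
    obtain u v where uv: "u \<in> ?M" "v \<in> ?M" "x u < x p \<and> x p < x v \<or> y u < y p \<and> y p < y v"
      using p(2) by (auto simp: between_def)
    then have "x u < x p" "x p < x v" using pI MI I(2) by (auto simp: inc_def)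
    then have "card {w\<in>I. x w < x u} \<le> card {w\<in>I. x w < x p}" "card {w\<in>I. x v < x w} \<le> card {w\<in>I. x p < x w}"
      using fI by (auto intro!: card_mono)
    then have "p \<in> ?M" using uv pI by (auto simp: middle_def)
    then show False using p by auto
  qed
  then show thesis using p that by auto
qed

text \<open>The part of the chain to the left of \<open>p\<close> and the part below
  \<open>p\<close> are initial segments, hence nested. So one of \<open>low\<close> and
  \<open>up\<close> is a whole side of \<open>p\<close> and has \<open>2 * k\<close> points, and the
  \<open>2 * k\<close> points of the other side are shared by the opposite class and the points
  incomparable to \<open>p\<close>; one of these gets \<open>k\<close>. The factor 2 in
  \<open>middle\<close> pays for this halving.\<close>

lemma segments_aux:
  assumes fI: "finite I" and inc: "inc x y I" and inj: "inj_on x (insert p I)" "inj_on y (insert p I)" "p \<notin> I"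
    and uv: "u \<in> middle x (2 * k) I" "v \<in> middle x (2 * k) I" "x u < x p" "x p < x v"
  defines "low \<equiv> {w\<in>I. lt x y w p}" and "up \<equiv> {w\<in>I. lt x y p w}"
  shows "(k \<le> card low \<and> k \<le> card up) \<or> (k \<le> card (I - low - up) \<and> (k \<le> card low \<or> k \<le> card up))"
proof -
  define L where "L = {w\<in>I. x w < x p}"
  define R where "R = {w\<in>I. x p < x w}"
  define B where "B = {w\<in>I. y w < y p}"
  let ?mid = "I - low - up"
  have ne: "x w \<noteq> x p" "y w \<noteq> y p" if "w \<in> I" for w
    using inj that by (auto simp: inj_on_def)
  have "2 * k \<le> card {w\<in>I. x w < x u}" "2 * k \<le> card {w\<in>I. x v < x w}"
    using uv by (auto simp: middle_def)
  moreover have "card {w\<in>I. x w < x u} \<le> card L" "card {w\<in>I. x v < x w} \<le> card R"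
    using fI uv by (auto simp: L_def R_def intro!: card_mono)
  ultimately have LR: "2 * k \<le> card L" "2 * k \<le> card R" by linarith+
  have "L \<subseteq> B \<or> B \<subseteq> L"
  proof (rule ccontr)
    assume "\<not> ?thesis"
    then obtain a b where "a \<in> L" "a \<notin> B" "b \<in> B" "b \<notin> L" by blast
    then have "a \<in> I" "b \<in> I" "x a < x b" "y b < y a"
      using ne[of a] ne[of b] by (auto simp: L_def B_def)
    then show False using inc by (auto simp: inc_def)
  qed
  then show ?thesis
  proof
    assume LB: "L \<subseteq> B"
    have "low = L" using LB by (auto simp: low_def L_def B_def lt_def)
    moreover have "R \<subseteq> up \<union> ?mid" using calculation by (auto simp: R_def L_def)
    then have "card R \<le> card up + card ?mid"
      using card_mono[of "up \<union> ?mid" R] card_Un_le[of up ?mid] fI by (auto simp: up_def)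
    ultimately show ?thesis using LR by auto
  next
    assume BL: "B \<subseteq> L"
    have up: "up = R"
    proof
      show "R \<subseteq> up"
      proof
        fix w assume w: "w \<in> R"
        then have "w \<notin> B" using BL by (auto simp: R_def L_def)
        then show "w \<in> up" using w ne[of w] by (auto simp: up_def R_def B_def lt_def)
      qed
    qed (auto simp: up_def R_def lt_def)
    have "L \<subseteq> low \<union> ?mid" using up by (auto simp: R_def L_def)
    then have "card L \<le> card low + card ?mid"
      using card_mono[of "low \<union> ?mid" L] card_Un_le[of low ?mid] fI by (auto simp: low_def)
    then show ?thesis using LR up by auto
  qed
qed

lemma segments:
  assumes fI: "finite I" and inc: "inc x y I" and inj: "inj_on x (insert p I)" "inj_on y (insert p I)" "p \<notin> I"
    and bt: "between x y (middle x (2 * k) I) p"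
  defines "low \<equiv> {w\<in>I. lt x y w p}" and "up \<equiv> {w\<in>I. lt x y p w}"
  shows "(k \<le> card low \<and> k \<le> card up) \<or> (k \<le> card (I - low - up) \<and> (k \<le> card low \<or> k \<le> card up))"
proof -
  obtain u v where uv: "u \<in> middle x (2 * k) I" "v \<in> middle x (2 * k) I"
    "x u < x p \<and> x p < x v \<or> y u < y p \<and> y p < y v"
    using bt by (auto simp: between_def)
  from uv(3) show ?thesis
  proof
    assume "x u < x p \<and> x p < x v"
    then show ?thesis unfolding low_def up_def using segments_aux[OF assms(1-5) uv(1,2)] by auto
  next
    assume y: "y u < y p \<and> y p < y v"
    have inc': "inc y x I" using inc by (auto simp: inc_def)
    have "lt y x = lt x y" by (auto simp: lt_def fun_eq_iff)
    then show ?thesis unfolding low_def up_def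
      using segments_aux[OF fI inc' inj(2,1,3), of u k v] uv(1,2) y middle_inc[OF inc] by auto
  qed
qed

section \<open>Long monotone sets and large stars give too many patterns\<close>

text \<open>A largest decreasing set \<open>E\<close> is cut by some \<open>p\<close>. If
  \<open>p\<close> has many neighbours in \<open>E\<close> on both sides, then some \<open>w\<close>
  in \<open>E\<close> is not adjacent to \<open>p\<close>, since otherwise \<open>p\<close> could be
  added to \<open>E\<close>; \<open>p\<close> and \<open>w\<close> split the clique. Otherwise
  \<open>E\<close> has many neighbours and many non-neighbours of \<open>p\<close>.\<close>

lemma simple_long_clique:
  assumes fin: "finite W" and inj: "inj_on x W" "inj_on y W" and simp: "simple x y W"
    and D: "D \<subseteq> W" "inc x (\<lambda>u. - y u) D" and N: "4 * N + 2 \<le> card D" and n: "3 \<le> n" "n \<le> N"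
  shows "many x y W n (n - 1)"
proof -
  let ?y = "\<lambda>u. - y u"
  have "\<exists>E. (E \<subseteq> W \<and> inc x ?y E) \<and> (\<forall>E'. E' \<subseteq> W \<and> inc x ?y E' \<longrightarrow> card E' \<le> card E)"
    using D fin by (intro ex_has_greatest_nat[of _ D _ "Suc (card W)"]) (auto intro: card_mono simp: less_Suc_eq_le)
  then obtain E where E: "E \<subseteq> W" "inc x ?y E" "\<And>E'. E' \<subseteq> W \<Longrightarrow> inc x ?y E' \<Longrightarrow> card E' \<le> card E" by blast
  have cE: "4 * N + 2 \<le> card E" using E(3)[OF D] N by linarith
  have injy: "inj_on ?y W" using inj by (auto simp: inj_on_def)
  have fE: "finite E" using E fin finite_subset by metis
  \<comment> \<open>The bound \<open>4 * N + 2\<close> is the requirement of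
    \<open>separator_exists\<close> for \<open>K = 2 * N\<close>, and \<open>segments\<close> halves
    this to \<open>N\<close>.\<close>
  obtain p where p: "p \<in> W" "p \<notin> E" "between x ?y (middle x (2 * N) E) p"
    using separator_exists[OF fin inj(1) injy _ E(1,2), of "2 * N"] simp cE n by (auto simp: simple_reflect)
  have pE: "inj_on x (insert p E)" "inj_on ?y (insert p E)"
    using inj_on_subset[OF inj(1), of "insert p E"] inj_on_subset[OF injy, of "insert p E"] p E(1) by auto
  define low where "low = {w\<in>E. lt x ?y w p}"
  define up where "up = {w\<in>E. lt x ?y p w}"
  have seg: "(N \<le> card low \<and> N \<le> card up) \<or> (N \<le> card (E - low - up) \<and> (N \<le> card low \<or> N \<le> card up))"
    unfolding low_def up_def by (rule segments[OF fE E(2) pE p(2,3)])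
  have cl: "adj x y u v" if "u \<in> E" "v \<in> E" "u \<noteq> v" for u v
  proof -
    have "x u \<noteq> x v" using inj_on_contraD[OF pE(1), of u v] that by auto
    moreover have "x u < x v \<longleftrightarrow> - y u < - y v" "x v < x u \<longleftrightarrow> - y v < - y u"
      using E(2) that unfolding inc_def by auto
    ultimately show ?thesis unfolding adj_def nw_def by linarith
  qed
  have ladj: "adj x y p u" if "u \<in> low \<union> up" for u
    using that by (auto simp: low_def up_def lt_reflect adj_def)
  have mid: "u \<in> E \<and> \<not> adj x y p u" if "u \<in> E - low - up" for u
    using that by (auto simp: low_def up_def lt_reflect adj_def)
  from seg show ?thesis
  proof
    assume s: "N \<le> card low \<and> N \<le> card up"
    have "E - low - up \<noteq> {}"
    proof
      assume "E - low - up = {}"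
      then have E2: "\<And>w. w \<in> E \<Longrightarrow> lt x ?y w p \<or> lt x ?y p w" by (auto simp: low_def up_def)
      have "inc x ?y (insert p E)"
        using E(2) E2 unfolding inc_def lt_def by (auto 0 0) (metis less_asym)+
      then have "card (insert p E) \<le> card E" using p E by (intro E(3)) auto
      then show False using fE p by simp
    qed
    then obtain w where w: "w \<in> E - low - up" by blast
    have wp: "w \<noteq> p" using p w by auto
    then have ltw: "lt x y p w \<or> lt x y w p"
      using trichotomy[OF inj(1,2), of p w] p E w mid[OF w] by blast
    show ?thesis
    proof (rule many_split_clique[of W low up p w])
      fix u assume u: "u \<in> low"
      then have up: "nw x y u p" "u \<in> E" by (auto simp: low_def lt_reflect)
      have "u \<noteq> w" using u w by auto
      then have "nw x y u w \<or> nw x y w u" using cl[of u w] up w by (auto simp: adj_def)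
      moreover have "\<not> nw x y w u" using nw_trans[of x y w u p] up w by (auto simp: low_def lt_reflect)
      ultimately show "nw x y u p \<and> nw x y u w" using up by auto
    next
      fix u assume u: "u \<in> up"
      then have up: "nw x y p u" "u \<in> E" by (auto simp: up_def lt_reflect)
      have "u \<noteq> w" using u w by auto
      then have "nw x y u w \<or> nw x y w u" using cl[of u w] up w by (auto simp: adj_def)
      moreover have "\<not> nw x y u w" using nw_trans[of x y p u w] up w by (auto simp: up_def lt_reflect)
      ultimately show "nw x y p u \<and> nw x y w u" using up by auto
    next
      show "low \<inter> up = {}" by (auto simp: low_def up_def lt_def)
    qed (use fin E p w ltw s n cl in \<open>auto simp: low_def up_def\<close>)
  next
    assume s: "N \<le> card (E - low - up) \<and> (N \<le> card low \<or> N \<le> card up)"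
    then obtain S where S: "S = low \<or> S = up" "N \<le> card S" by blast
    then have SE: "S \<subseteq> E" "S \<subseteq> low \<union> up" by (auto simp: low_def up_def)
    show ?thesis
    proof (rule many_near_clique[of W S "E - low - up" p])
      show "S \<inter> (E - low - up) = {}" using SE by auto
      show "adj x y u v" if "u \<in> S \<union> (E - low - up)" "v \<in> S \<union> (E - low - up)" "u \<noteq> v" for u v
        using cl that SE by blast
      show "adj x y p u" if "u \<in> S" for u using ladj that SE by blast
      show "\<not> adj x y p u" if "u \<in> E - low - up" for u using mid that by blast
    qed (use fin SE E(1) p(1,2) S s n in auto)
  qed
qed

text \<open>The argument for cliques, applied to an increasing set with a common neighbour
  \<open>c\<close> to its lower right. Maximality is taken among the increasing sets with this
  neighbour.\<close>

lemma simple_long_star: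
  assumes fin: "finite W" and inj: "inj_on x W" "inj_on y W" and simp: "simple x y W"
    and c: "c \<in> W" and D: "D \<subseteq> W" "\<And>u. u \<in> D \<Longrightarrow> nw x y u c" "inc x y D"
    and N: "4 * N + 2 \<le> card D" and n: "3 \<le> n" "n \<le> N"
  shows "many x y W n (n - 1)"
proof -
  let ?P = "\<lambda>E. E \<subseteq> W \<and> (\<forall>u\<in>E. nw x y u c) \<and> inc x y E"
  have "\<exists>E. ?P E \<and> (\<forall>E'. ?P E' \<longrightarrow> card E' \<le> card E)"
    using D fin by (intro ex_has_greatest_nat[of ?P D _ "Suc (card W)"]) (auto intro: card_mono simp: less_Suc_eq_le)
  then obtain E where E: "E \<subseteq> W" "\<And>u. u \<in> E \<Longrightarrow> nw x y u c" "inc x y E" "\<And>E'. ?P E' \<Longrightarrow> card E' \<le> card E" by blast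
  have cE: "4 * N + 2 \<le> card E" using E(4)[of D] D N by force
  have fE: "finite E" using E fin finite_subset by metis
  obtain p where p: "p \<in> W" "p \<notin> E" "between x y (middle x (2 * N) E) p"
    using separator_exists[OF fin inj simp E(1,3), of "2 * N"] cE n by auto
  have pE: "inj_on x (insert p E)" "inj_on y (insert p E)"
    using inj_on_subset[OF inj(1), of "insert p E"] inj_on_subset[OF inj(2), of "insert p E"] p E(1) by auto
  \<comment> \<open>The centre \<open>c\<close> is to the right of and below all of
    \<open>E\<close>, so it cannot be the point that cuts \<open>E\<close>.\<close>
  have pc: "p \<noteq> c"
    using p(3) E(2) by (auto simp: between_def middle_def nw_def dest!: E(2))
  define low where "low = {w\<in>E. lt x y w p}"
  define up where "up = {w\<in>E. lt x y p w}"
  have seg: "(N \<le> card low \<and> N \<le> card up) \<or> (N \<le> card (E - low - up) \<and> (N \<le> card low \<or> N \<le> card up))"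
    unfolding low_def up_def by (rule segments[OF fE E(3) pE p(2,3)])
  have ind: "\<not> adj x y u v" if "u \<in> E" "v \<in> E" for u v
    using E(3) that unfolding inc_def adj_def nw_def by (metis less_asym)
  have ladj: "\<not> adj x y p u" if "u \<in> low \<union> up" for u
    using that by (auto simp: low_def up_def lt_def adj_def nw_def)
  have mid: "u \<in> E \<and> adj x y p u" if u: "u \<in> E - low - up" for u
  proof -
    have "u \<noteq> p" using u p by auto
    then show ?thesis using trichotomy[OF pE, of u p] u by (auto simp: low_def up_def adj_sym)
  qed
  from seg show ?thesis
  proof
    assume s: "N \<le> card low \<and> N \<le> card up"
    then have "low \<noteq> {}" "up \<noteq> {}" using n by auto
    then obtain l r where "l \<in> low" "r \<in> up" by blast
    \<comment> \<open>A point between two leaves is itself to the upper left of \<open>c\<close>,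
      hence a candidate for enlarging \<open>E\<close>.\<close>
    then have pnw: "nw x y p c" using E(2)[of l] E(2)[of r] by (auto simp: low_def up_def lt_def nw_def)
    have "E - low - up \<noteq> {}"
    proof
      assume "E - low - up = {}"
      then have E2: "\<And>w. w \<in> E \<Longrightarrow> lt x y w p \<or> lt x y p w" by (auto simp: low_def up_def)
      have "inc x y (insert p E)"
        using E(3) E2 unfolding inc_def lt_def by (auto 0 0) (metis less_asym)+
      then have "card (insert p E) \<le> card E" using p E pnw by (intro E(4)) auto
      then show False using fE p by simp
    qed
    then obtain w where w: "w \<in> E - low - up" by blast
    show ?thesis
    proof (rule many_split_star[of W low up p w c])
      fix u assume u: "u \<in> low"
      then have up: "lt x y u p" "u \<in> E" by (auto simp: low_def)
      have "u \<noteq> w" using u w by auto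
      then have "lt x y u w \<or> lt x y w u" using trichotomy[OF pE, of u w] ind[of u w] up w by auto
      moreover have "\<not> lt x y w u" using lt_trans[of x y w u p] up w by (auto simp: low_def)
      ultimately show "lt x y u p \<and> lt x y u w" using up by auto
    next
      fix u assume u: "u \<in> up"
      then have up: "lt x y p u" "u \<in> E" by (auto simp: up_def)
      have "u \<noteq> w" using u w by auto
      then have "lt x y u w \<or> lt x y w u" using trichotomy[OF pE, of u w] ind[of u w] up w by auto
      moreover have "\<not> lt x y u w" using lt_trans[of x y p u w] up w by (auto simp: up_def)
      ultimately show "lt x y p u \<and> lt x y w u" using up by auto
    next
      show "low \<inter> up = {}" by (auto simp: low_def up_def lt_def)
      show "nw x y u c" if "u \<in> insert p (insert w (low \<union> up))" for u
        using that E(2) pnw w by (auto simp: low_def up_def)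
      show "\<not> adj x y u v" if "u \<in> low \<union> up" "v \<in> low \<union> up" for u v
        using ind that by (auto simp: low_def up_def)
      show "low \<subseteq> W" "up \<subseteq> W" "w \<in> W" using E(1) w by (auto simp: low_def up_def)
    qed (use fin p(1) mid[OF w] c s n in auto)
  next
    assume s: "N \<le> card (E - low - up) \<and> (N \<le> card low \<or> N \<le> card up)"
    then obtain S where S: "S = low \<or> S = up" "N \<le> card S" by blast
    then have SE: "S \<subseteq> E" "S \<subseteq> low \<union> up" by (auto simp: low_def up_def)
    show ?thesis
    proof (rule many_near_star[of W S "E - low - up" p c])
      show "S \<inter> (E - low - up) = {}" using SE by auto
      show "\<not> adj x y u v" if "u \<in> S \<union> (E - low - up)" "v \<in> S \<union> (E - low - up)" for u v
        using ind that SE by blast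
      show "nw x y u c" if "u \<in> S \<union> (E - low - up)" for u using E(2) that SE by blast
      show "\<not> adj x y p u" if "u \<in> S" for u using ladj that SE by blast
      show "adj x y p u" if "u \<in> E - low - up" for u using mid that by blast
    qed (use fin SE E(1) p(1,2) S s n c pc in auto)
  qed
qed

section \<open>Point sets with few connected patterns\<close>

text \<open>The counts that correspond to \<open>\<xi>\<close>. The second sequence is what a long path with a triangle provides; its
  growth rate exceeds \<open>\<xi>\<close>.\<close>

definition t_seq :: "nat \<Rightarrow> nat" where
  "t_seq n = (if n \<le> 2 then 1 else min (n - 1) 4)"

definition u_seq :: "nat \<Rightarrow> nat" where
  "u_seq n = (if n \<le> 2 then 1 else 3)"

text \<open>Few patterns, tested at bounded lengths: neither count sequence is reached at all
  lengths up to \<open>N\<close>. Subsets inherit this, so it holds for quotients and for contained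
  permutations.\<close>

definition sparse :: "nat \<Rightarrow> ('a \<Rightarrow> int) \<Rightarrow> ('a \<Rightarrow> int) \<Rightarrow> 'a set \<Rightarrow> bool" where
  "sparse N x y V \<longleftrightarrow> \<not> (\<forall>n\<in>{1..N}. many x y V n (t_seq n)) \<and> \<not> (\<forall>n\<in>{1..N}. many x y V n (u_seq n))"

lemma sparse_mono: "sparse N x y V \<Longrightarrow> W \<subseteq> V \<Longrightarrow> sparse N x y W"
  unfolding sparse_def by (meson many_mono)

lemma sparse_uminus: "sparse N (\<lambda>u. - x u) (\<lambda>u. - y u) V \<longleftrightarrow> sparse N x y V"
  by (simp add: sparse_def many_uminus)

lemma sparse_swap: "sparse N y x V \<longleftrightarrow> sparse N x y V"
  by (simp add: sparse_def many_swap)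

lemma many_1_2:
  assumes "u \<in> V" "v \<in> V" "adj x y u v"
  shows "many x y V (Suc 0) (Suc 0)" "many x y V 2 (Suc 0)"
proof -
  show "many x y V (Suc 0) (Suc 0)"
    using assms by (intro manyI[of "{0::nat}" _ "\<lambda>_. {u}"]) (auto simp: conn_sing)
  have "u \<noteq> v" using assms by auto
  moreover have "conn x y {v, u}" using conn_insert[OF conn_sing, of u u x y v] assms by (auto simp: adj_sym)
  ultimately show "many x y V 2 (Suc 0)"
    using assms by (intro manyI[of "{0::nat}" _ "\<lambda>_. {v, u}"]) auto
qed

text \<open>One edge already supplies the patterns of lengths 1 and 2, so the shortage occurs at
  some length from 3 on.\<close>

lemma sparse_t:
  assumes "sparse N x y V" "u \<in> V" "v \<in> V" "adj x y u v"
  obtains n where "3 \<le> n" "n \<le> N" "\<not> many x y V n (t_seq n)"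
proof -
  obtain n where n: "n \<in> {1..N}" "\<not> many x y V n (t_seq n)" using assms(1) unfolding sparse_def by blast
  have "n \<noteq> 1" "n \<noteq> 2" using n many_1_2[OF assms(2-4)] by (auto simp: t_seq_def)
  then have "3 \<le> n" "n \<le> N" using n(1) by auto
  then show thesis using that n(2) by blast
qed

lemma sparse_u:
  assumes "sparse N x y V" "u \<in> V" "v \<in> V" "adj x y u v"
  obtains n where "3 \<le> n" "n \<le> N" "\<not> many x y V n (u_seq n)"
proof -
  obtain n where n: "n \<in> {1..N}" "\<not> many x y V n (u_seq n)" using assms(1) unfolding sparse_def by blast
  have "n \<noteq> 1" "n \<noteq> 2" using n many_1_2[OF assms(2-4)] by (auto simp: u_seq_def)
  then have "3 \<le> n" "n \<le> N" using n(1) by auto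
  then show thesis using that n(2) by blast
qed

section \<open>Sum indecomposability and coarsest partitions into intervals\<close>

definition sum_indec :: "('a \<Rightarrow> int) \<Rightarrow> ('a \<Rightarrow> int) \<Rightarrow> 'a set \<Rightarrow> bool" where
  "sum_indec x y V \<longleftrightarrow> V \<noteq> {} \<and> \<not> (\<exists>S. S \<subset> V \<and> S \<noteq> {} \<and> (\<forall>u\<in>S. \<forall>v\<in>V - S. lt x y u v))"

text \<open>Suppose the graph is disconnected and let \<open>C\<close> be a smallest proper union of
  components that contains the leftmost point \<open>p\<close>. A point \<open>v\<close> outside
  \<open>C\<close> is comparable to all of \<open>C\<close> and lies above \<open>p\<close>. No edge
  joins a point of \<open>C\<close> below \<open>v\<close> to one above \<open>v\<close>, so those
  below \<open>v\<close> again form such a union; by minimality this is \<open>C\<close>. Thus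
  \<open>C\<close> lies below everything else, which is a sum decomposition.\<close>

lemma sum_indec_imp_conn:
  assumes fin: "finite V" and inj: "inj_on x V" "inj_on y V" and ind: "sum_indec x y V"
  shows "conn x y V"
proof (rule ccontr)
  assume "\<not> conn x y V"
  define cl where "cl C \<longleftrightarrow> (\<forall>u\<in>C. \<forall>v\<in>V - C. \<not> adj x y u v)" for C
  have neV: "V \<noteq> {}" using ind by (simp add: sum_indec_def)
  obtain S where S: "S \<subset> V" "S \<noteq> {}" "cl S"
    using \<open>\<not> conn x y V\<close> neV unfolding conn_def cl_def by blast
  have clS': "cl (V - S)"
    unfolding cl_def
  proof (intro ballI)
    fix u v assume uv: "u \<in> V - S" "v \<in> V - (V - S)"
    then have "\<not> adj x y v u" using S unfolding cl_def by blast
    then show "\<not> adj x y u v" using adj_sym[of x y u v] by simp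
  qed
  have ne: "V \<noteq> {}" using S by auto
  then have "Min (x ` V) \<in> x ` V" using fin by (intro Min_in) auto
  then obtain p where p: "p \<in> V" "x p = Min (x ` V)" by fastforce
  let ?P = "\<lambda>C. C \<subset> V \<and> p \<in> C \<and> cl C"
  have "?P S \<or> ?P (V - S)" using S clS' p by auto
  then obtain C0 where "?P C0" by blast
  then have "\<exists>C. ?P C \<and> (\<forall>C'. ?P C' \<longrightarrow> card C \<le> card C')"
    by (rule ex_has_least_nat)
  then obtain C where C: "?P C" "\<And>C'. ?P C' \<Longrightarrow> card C \<le> card C'" by blast
  have "\<forall>w\<in>C. lt x y w v" if v: "v \<in> V - C" for v
  proof -
    let ?C1 = "{w\<in>C. lt x y w v}"
    have cmp: "lt x y w v \<or> lt x y v w" if w: "w \<in> C" for w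
    proof -
      have "\<not> adj x y w v" using C w v unfolding cl_def by blast
      moreover have "w \<in> V" "w \<noteq> v" using C w v by auto
      ultimately show ?thesis using trichotomy[OF inj, of w v] v by blast
    qed
    have "x p \<le> x v" using p fin v by auto
    then have "lt x y p v" using cmp[of p] C by (auto simp: lt_def)
    moreover have "cl ?C1"
      unfolding cl_def
    proof (intro ballI)
      fix u w assume u: "u \<in> ?C1" and w: "w \<in> V - ?C1"
      show "\<not> adj x y u w"
      proof (cases "w \<in> C")
        case True
        then have "lt x y v w" using w cmp by auto
        then show ?thesis using u lt_trans[of x y u v w] lt_not_adj[of x y u w] by auto
      next
        case False
        then show ?thesis using C u w unfolding cl_def by blast
      qed
    qed
    moreover have "?C1 \<subset> V" "?C1 \<subseteq> C" using C by auto
    ultimately have "card C \<le> card ?C1" using C by auto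
    moreover have "finite C" using C fin finite_subset[of C V] by auto
    ultimately have "?C1 = C" using card_seteq[of C ?C1] by auto
    then show ?thesis by blast
  qed
  then show False using ind C unfolding sum_indec_def by blast
qed

definition ivl :: "('a \<Rightarrow> int) \<Rightarrow> ('a \<Rightarrow> int) \<Rightarrow> 'a set \<Rightarrow> 'a set \<Rightarrow> bool" where
  "ivl x y V B \<longleftrightarrow> (\<forall>p\<in>V - B. \<not> between x y B p)"

lemma ivl_swap: "ivl y x V B \<longleftrightarrow> ivl x y V B"
  by (simp add: ivl_def between_swap)

text \<open>Both parts of a sum decomposition are intervals, so in a simple set they have at most
  one point each.\<close>

lemma simple_sum_indec:
  assumes "finite W" "simple x y W" "3 \<le> card W"
  shows "sum_indec x y W"
  unfolding sum_indec_def
proof (intro conjI notI)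
  show False if "W = {}" using that assms by auto
next
  assume "\<exists>S. S \<subset> W \<and> S \<noteq> {} \<and> (\<forall>u\<in>S. \<forall>v\<in>W - S. lt x y u v)"
  then obtain S where S: "S \<subset> W" "S \<noteq> {}" "\<And>u v. u \<in> S \<Longrightarrow> v \<in> W - S \<Longrightarrow> lt x y u v" by blast
  have b1: "\<forall>p\<in>W - S. \<not> between x y S p"
  proof (intro ballI notI)
    fix p assume p: "p \<in> W - S" "between x y S p"
    then obtain v where "v \<in> S" "x p < x v \<or> y p < y v" by (auto simp: between_def)
    then show False using S(3)[of v p] p by (auto simp: lt_def)
  qed
  have b2: "\<forall>p\<in>W - (W - S). \<not> between x y (W - S) p"
  proof (intro ballI notI)
    fix p assume p: "p \<in> W - (W - S)" "between x y (W - S) p"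
    then obtain v where "v \<in> W - S" "x v < x p \<or> y v < y p" by (auto simp: between_def)
    then show False using S(3)[of p v] p by (auto simp: lt_def)
  qed
  have "card S \<le> 1 \<or> S = W" "card (W - S) \<le> 1 \<or> W - S = W"
    using assms(2) b1 b2 S(1) unfolding simple_def by blast+
  then have "card S \<le> 1" "card (W - S) \<le> 1" using S by auto
  moreover have "card W = card S + card (W - S)"
    using assms(1) S(1) by (metis card_Diff_subset card_mono finite_subset le_add_diff_inverse psubset_imp_subset)
  ultimately show False using assms(3) by linarith
qed

text \<open>If the blocks interleaved, a point of one of them would cut the other. One comparison
  between two blocks therefore decides all.\<close>

lemma ivl_blocks_x:
  assumes "inj_on x V" "ivl x y V A" "ivl x y V B" "A \<subseteq> V" "B \<subseteq> V" "A \<inter> B = {}"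
    and "a \<in> A" "a' \<in> A" "b \<in> B" "b' \<in> B" "x a < x b"
  shows "x a' < x b'"
proof (rule ccontr)
  assume n: "\<not> x a' < x b'"
  have "a' \<noteq> b" "a' \<noteq> b'" using assms by auto
  then have "x a' \<noteq> x b" "x a' \<noteq> x b'" using assms(1,4,5,8-10) by (auto simp: inj_on_def)
  moreover have "\<not> between x y A b" "\<not> between x y B a'" using assms by (auto simp: ivl_def)
  ultimately show False using n assms(7-11) unfolding between_def by (meson linorder_neqE)
qed

text \<open>\<open>P\<close> has the fewest blocks among the partitions into at least two intervals.
  If it has three or more, then a sum decomposition would be a partition with two, and a nontrivial
  interval among the representatives would allow its blocks to be merged into one.\<close>

lemma minimal_quotient:
  assumes fin: "finite V" and inj: "inj_on x V" "inj_on y V" and V: "2 \<le> card V"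
  obtains P where "partition_on V P" "\<And>B. B \<in> P \<Longrightarrow> ivl x y V B" "2 \<le> card P"
    "3 \<le> card P \<Longrightarrow> sum_indec x y V"
    "\<And>r. 3 \<le> card P \<Longrightarrow> (\<And>B. B \<in> P \<Longrightarrow> r B \<in> B) \<Longrightarrow> simple x y (r ` P) \<and> card (r ` P) = card P"
proof -
  let ?Q = "\<lambda>P. partition_on V P \<and> (\<forall>B\<in>P. ivl x y V B) \<and> 2 \<le> card P"
  have "?Q ((\<lambda>v. {v}) ` V)"
  proof (intro conjI ballI)
    show "partition_on V ((\<lambda>v. {v}) ` V)" by (auto simp: partition_on_def disjoint_def)
    show "2 \<le> card ((\<lambda>v. {v}) ` V)" using V by (simp add: card_image)
    fix B assume "B \<in> (\<lambda>v. {v}) ` V"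
    then show "ivl x y V B" by (auto simp: ivl_def between_def)
  qed
  then have "\<exists>P. ?Q P \<and> (\<forall>P'. ?Q P' \<longrightarrow> card P \<le> card P')"
    by (rule ex_has_least_nat)
  then obtain P where P: "?Q P" and Pmin: "\<And>P'. ?Q P' \<Longrightarrow> card P \<le> card P'" by blast
  have part: "partition_on V P" and iv: "\<And>B. B \<in> P \<Longrightarrow> ivl x y V B" using P by auto
  have fP: "finite P" using finite_elements[OF fin part] .
  have PV: "\<And>B. B \<in> P \<Longrightarrow> B \<subseteq> V" "\<Union>P = V" "\<And>B C. B \<in> P \<Longrightarrow> C \<in> P \<Longrightarrow> B \<noteq> C \<Longrightarrow> B \<inter> C = {}" "{} \<notin> P"
    using part by (auto simp: partition_on_def disjoint_def)
  have bx: "x a' < x b'" if "A \<in> P" "B \<in> P" "A \<noteq> B" "a \<in> A" "a' \<in> A" "b \<in> B" "b' \<in> B" "x a < x b" for A B a a' b b'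
    using ivl_blocks_x[OF inj(1) iv[OF that(1)] iv[OF that(2)] PV(1)[OF that(1)] PV(1)[OF that(2)] PV(3)[OF that(1-3)] that(4-8)] .
  have by': "y a' < y b'" if "A \<in> P" "B \<in> P" "A \<noteq> B" "a \<in> A" "a' \<in> A" "b \<in> B" "b' \<in> B" "y a < y b" for A B a a' b b'
    using ivl_blocks_x[OF inj(2) _ _ PV(1)[OF that(1)] PV(1)[OF that(2)] PV(3)[OF that(1-3)] that(4-8), of x] iv that
    by (simp add: ivl_swap)
  show thesis
  proof (rule that[of P])
    show "partition_on V P" "\<And>B. B \<in> P \<Longrightarrow> ivl x y V B" "2 \<le> card P" using P by auto
  next
    assume c3: "3 \<le> card P"
    show "sum_indec x y V"
      unfolding sum_indec_def
    proof (intro conjI notI)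
      show False if "V = {}" using that V by auto
    next
      assume "\<exists>S. S \<subset> V \<and> S \<noteq> {} \<and> (\<forall>u\<in>S. \<forall>v\<in>V - S. lt x y u v)"
      then obtain S where S: "S \<subset> V" "S \<noteq> {}" "\<And>u v. u \<in> S \<Longrightarrow> v \<in> V - S \<Longrightarrow> lt x y u v" by blast
      have "ivl x y V S" unfolding ivl_def
      proof (intro ballI notI)
        fix p assume p: "p \<in> V - S" "between x y S p"
        then obtain v where "v \<in> S" "x p < x v \<or> y p < y v" by (auto simp: between_def)
        then show False using S(3)[of v p] p by (auto simp: lt_def)
      qed
      moreover have "ivl x y V (V - S)" unfolding ivl_def
      proof (intro ballI notI)
        fix p assume p: "p \<in> V - (V - S)" "between x y (V - S) p"
        then obtain v where "v \<in> V - S" "x v < x p \<or> y v < y p" by (auto simp: between_def)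
        then show False using S(3)[of p v] p by (auto simp: lt_def)
      qed
      moreover have "S \<noteq> V - S" using S by blast
      then have c2: "card {S, V - S} = 2" by simp
      moreover have "partition_on V {S, V - S}" using S by (auto simp: partition_on_def disjoint_def)
      ultimately have "?Q {S, V - S}" by auto
      then have "card P \<le> 2" using Pmin c2 by fastforce
      then show False using c3 by simp
    qed
  next
    fix r assume c3: "3 \<le> card P" and r: "\<And>B. B \<in> P \<Longrightarrow> r B \<in> B"
    have injr: "inj_on r P"
      using PV(3) r by (auto simp: inj_on_def) (metis IntI empty_iff)+
    have cr: "card (r ` P) = card P" using injr by (rule card_image)
    have "simple x y (r ` P)"
      unfolding simple_def
    proof (intro allI impI)
      fix J assume J: "J \<subseteq> r ` P" "\<forall>p\<in>r ` P - J. \<not> between x y J p"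
      show "card J \<le> 1 \<or> J = r ` P"
      proof (rule ccontr)
        assume neg: "\<not> ?thesis"
        define Q where "Q = {B\<in>P. r B \<in> J}"
        define U where "U = \<Union>Q"
        have QP: "Q \<subseteq> P" by (auto simp: Q_def)
        have rQ: "r ` Q = J" using J by (auto simp: Q_def)
        have cQ: "card Q = card J" using rQ injr QP by (metis card_image inj_on_subset)
        have c2: "2 \<le> card Q" using neg cQ by auto
        have "Q \<noteq> P" using neg rQ by auto
        then have Qlt: "Q \<subset> P" using QP by auto
        \<comment> \<open>Ensures that merging the blocks of \<open>Q\<close> leaves exactly
          \<open>card P - card Q + 1\<close> blocks.\<close>
        have "U \<notin> P - Q"
        proof
          assume U: "U \<in> P - Q"
          obtain B where B: "B \<in> Q" using c2 by fastforce
          then have "B \<subseteq> U" "B \<noteq> U" "B \<noteq> {}" using U PV(4) QP by (auto simp: U_def)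
          moreover have "B \<inter> U = {}" using PV(3)[of B U] B U QP \<open>B \<noteq> U\<close> by auto
          ultimately show False by auto
        qed
        then have cP: "card (insert U (P - Q)) = Suc (card P - card Q)"
          using fP QP finite_subset[OF QP fP] by (simp add: card_Diff_subset)
        have "card Q < card P" using Qlt fP by (simp add: psubset_card_mono)
        have "ivl x y V U"
          unfolding ivl_def
        proof (intro ballI notI)
          fix p assume p: "p \<in> V - U" "between x y U p"
          then obtain C where C: "C \<in> P" "p \<in> C" using PV(2) by blast
          have CQ: "C \<notin> Q" using p C by (auto simp: U_def)
          obtain u v where uv: "u \<in> U" "v \<in> U" "x u < x p \<and> x p < x v \<or> y u < y p \<and> y p < y v"
            using p(2) by (auto simp: between_def)
          obtain B1 B2 where B: "B1 \<in> Q" "u \<in> B1" "B2 \<in> Q" "v \<in> B2" using uv by (auto simp: U_def)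
          have BP: "B1 \<in> P" "B2 \<in> P" "B1 \<noteq> C" "C \<noteq> B2" using B QP CQ by auto
          have "x (r B1) < x (r C) \<and> x (r C) < x (r B2) \<or> y (r B1) < y (r C) \<and> y (r C) < y (r B2)"
            using uv(3) bx[OF BP(1) C(1) BP(3) B(2) r[OF BP(1)] C(2) r[OF C(1)]]
              bx[OF C(1) BP(2) BP(4) C(2) r[OF C(1)] B(4) r[OF BP(2)]]
              by'[OF BP(1) C(1) BP(3) B(2) r[OF BP(1)] C(2) r[OF C(1)]]
              by'[OF C(1) BP(2) BP(4) C(2) r[OF C(1)] B(4) r[OF BP(2)]] by blast
          then have "between x y J (r C)"
            unfolding between_def using rQ B by blast
          moreover have "r C \<in> r ` P - J" using C CQ by (auto simp: Q_def)
          ultimately show False using J by blast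
        qed
        moreover have "partition_on V (insert U (P - Q))"
          unfolding partition_on_def
        proof (intro conjI)
          show "\<Union> (insert U (P - Q)) = V" using PV(2) QP by (auto simp: U_def)
          show "disjoint (insert U (P - Q))"
            unfolding disjoint_def
          proof (intro ballI impI)
            have "U \<inter> C = {}" if "C \<in> P - Q" for C
            proof -
              have "B \<inter> C = {}" if "B \<in> Q" for B using PV(3)[of B C] that \<open>C \<in> P - Q\<close> QP by auto
              then show ?thesis by (auto simp: U_def)
            qed
            then show "B \<inter> C = {}" if "B \<in> insert U (P - Q)" "C \<in> insert U (P - Q)" "B \<noteq> C" for B C
              using that PV(3) by (metis Diff_iff inf_commute insertE)
          qed
          show "{} \<notin> insert U (P - Q)"
            using PV(4) c2 QP by (auto simp: U_def) (metis (no_types, lifting) card.empty subset_empty subsetI Union_upper subset_iff not_numeral_le_zero)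
        qed
        ultimately have "?Q (insert U (P - Q))"
          using iv cP \<open>card Q < card P\<close> by auto
        then have "card P \<le> card (insert U (P - Q))" by (rule Pmin)
        then show False using cP c2 \<open>card Q < card P\<close> by linarith
      qed
    qed
    then show "simple x y (r ` P) \<and> card (r ` P) = card P" using cr by simp
  qed
qed

section \<open>Long induced paths\<close>

definition ipath :: "('a \<Rightarrow> int) \<Rightarrow> ('a \<Rightarrow> int) \<Rightarrow> 'a set \<Rightarrow> (nat \<Rightarrow> 'a) \<Rightarrow> nat \<Rightarrow> bool" where
  "ipath x y V q m \<longleftrightarrow> q ` {..m} \<subseteq> V \<and> inj_on q {..m} \<and>
     (\<forall>i\<le>m. \<forall>j\<le>m. adj x y (q i) (q j) \<longleftrightarrow> j = Suc i \<or> i = Suc j)"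

fun ball :: "('a \<Rightarrow> int) \<Rightarrow> ('a \<Rightarrow> int) \<Rightarrow> 'a set \<Rightarrow> 'a \<Rightarrow> nat \<Rightarrow> 'a set" where
  "ball x y W p 0 = {p}"
| "ball x y W p (Suc k) = ball x y W p k \<union> {v\<in>W. \<exists>u\<in>ball x y W p k. adj x y u v}"

lemma ball_mono: "i \<le> j \<Longrightarrow> ball x y W p i \<subseteq> ball x y W p j"
  by (induction j) (auto simp: le_Suc_eq)

lemma ball_subset: "p \<in> W \<Longrightarrow> ball x y W p k \<subseteq> W"
  by (induction k) auto

lemma card_ball:
  assumes fin: "finite W" and p: "p \<in> W" and d: "\<And>c. c \<in> W \<Longrightarrow> card {u\<in>W. adj x y c u} \<le> d"
  shows "card (ball x y W p k) \<le> (d + 1) ^ k"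
proof (induction k)
  case (Suc k)
  let ?B = "ball x y W p k"
  have fB: "finite ?B" using ball_subset[OF p] fin by (rule finite_subset)
  have "{v\<in>W. \<exists>u\<in>?B. adj x y u v} = (\<Union>u\<in>?B. {v\<in>W. adj x y u v})" by auto
  then have "card {v\<in>W. \<exists>u\<in>?B. adj x y u v} \<le> (\<Sum>u\<in>?B. card {v\<in>W. adj x y u v})"
    using card_UN_le[OF fB, of "\<lambda>u. {v\<in>W. adj x y u v}"] by simp
  also have "\<dots> \<le> (\<Sum>u\<in>?B. d)" using d ball_subset[OF p] by (intro sum_mono) blast
  finally have "card {v\<in>W. \<exists>u\<in>?B. adj x y u v} \<le> card ?B * d" by simp
  then have "card (ball x y W p (Suc k)) \<le> card ?B + card ?B * d"
    using card_Un_le[of ?B "{v\<in>W. \<exists>u\<in>?B. adj x y u v}"] by auto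
  also have "\<dots> \<le> (d + 1) ^ Suc k" using Suc mult_le_mono1[of "card ?B" "(d+1)^k" "d + 1"] by (simp add: algebra_simps)
  finally show ?case .
qed auto

text \<open>That \<open>g j\<close> lies in no earlier ball makes \<open>g\<close> a shortest path
  from \<open>p\<close>, and shortest paths are induced.\<close>

lemma ball_path:
  assumes "p \<in> W" "v \<in> ball x y W p k" "\<And>i. i < k \<Longrightarrow> v \<notin> ball x y W p i"
  shows "\<exists>g. g k = v \<and> (\<forall>j\<le>k. g j \<in> ball x y W p j \<and> (\<forall>i<j. g j \<notin> ball x y W p i)) \<and>
     (\<forall>j<k. adj x y (g j) (g (Suc j)))"
  using assms(2,3)
proof (induction k arbitrary: v)
  case 0
  then show ?case by (intro exI[of _ "\<lambda>_. v"]) auto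
next
  case (Suc k)
  have "v \<notin> ball x y W p k" using Suc.prems(2)[of k] by simp
  then obtain u where u: "u \<in> ball x y W p k" "adj x y u v" "v \<in> W" using Suc.prems(1) by auto
  have "u \<notin> ball x y W p i" if "i < k" for i
  proof
    assume "u \<in> ball x y W p i"
    then have "v \<in> ball x y W p (Suc i)" using u by auto
    then show False using Suc.prems(2)[of "Suc i"] that by simp
  qed
  then obtain g where g: "g k = u" "\<forall>j\<le>k. g j \<in> ball x y W p j \<and> (\<forall>i<j. g j \<notin> ball x y W p i)"
    "\<forall>j<k. adj x y (g j) (g (Suc j))"
    using Suc.IH[OF u(1)] by blast
  show ?case
  proof (intro exI[of _ "g(Suc k := v)"] conjI allI impI)
    fix j assume "j \<le> Suc k"
    then show "(g(Suc k := v)) j \<in> ball x y W p j" using g Suc.prems(1) by (cases "j = Suc k") auto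
    fix i assume "i < j"
    then show "(g(Suc k := v)) j \<notin> ball x y W p i" using g Suc.prems(2) \<open>j \<le> Suc k\<close> by (cases "j = Suc k") auto
  next
    fix j assume "j < Suc k"
    then show "adj x y ((g(Suc k := v)) j) ((g(Suc k := v)) (Suc j))" using g u by (cases "j = k") auto
  qed auto
qed

text \<open>Bounded degree bounds the ball of radius \<open>R\<close>, so some vertex is farther
  than \<open>R\<close> from \<open>p\<close>; the first \<open>R\<close> edges of a shortest path
  to it are kept.\<close>

lemma long_path_exists:
  assumes fin: "finite W" and con: "conn x y W" and d: "\<And>c. c \<in> W \<Longrightarrow> card {u\<in>W. adj x y c u} \<le> d"
    and big: "(d + 1) ^ R < card W"
  shows "\<exists>q. ipath x y W q R"
proof -
  obtain p where p: "p \<in> W" using con by (auto simp: conn_def)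
  let ?B = "ball x y W p"
  have BW: "\<And>k. ?B k \<subseteq> W" using ball_subset[OF p] .
  have "(\<Union>k. ?B k) = W"
  proof (rule ccontr)
    assume "(\<Union>k. ?B k) \<noteq> W"
    then have "(\<Union>k. ?B k) \<subset> W" using BW by blast
    moreover have "p \<in> ?B 0" by simp
    then have "(\<Union>k. ?B k) \<noteq> {}" by blast
    ultimately obtain u v where uv: "u \<in> (\<Union>k. ?B k)" "v \<in> W - (\<Union>k. ?B k)" "adj x y u v"
      using con unfolding conn_def by meson
    then obtain k where "u \<in> ?B k" by blast
    then have "v \<in> ?B (Suc k)" using uv by auto
    then show False using uv by blast
  qed
  moreover have "?B R \<noteq> W" using card_ball[OF fin p d, of R] big by auto
  ultimately obtain v k0 where v: "v \<in> W" "v \<notin> ?B R" "v \<in> ?B k0" using BW by blast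
  define k where "k = (LEAST k. v \<in> ?B k)"
  have k: "v \<in> ?B k" "\<And>i. i < k \<Longrightarrow> v \<notin> ?B i"
    using v(3) unfolding k_def by (auto intro: LeastI dest: not_less_Least)
  have "R < k" using k(1) v(2) ball_mono[of k R x y W p] by (meson leI subsetD)
  obtain g where g: "\<And>j. j \<le> k \<Longrightarrow> g j \<in> ?B j" "\<And>i j. j \<le> k \<Longrightarrow> i < j \<Longrightarrow> g j \<notin> ?B i"
    "\<And>j. j < k \<Longrightarrow> adj x y (g j) (g (Suc j))"
    using ball_path[OF p k] by blast
  have sep: "g i \<noteq> g j \<and> (adj x y (g i) (g j) \<longrightarrow> j = Suc i)" if "i < j" "j \<le> k" for i j
  proof
    show "g i \<noteq> g j" using g(1)[of i] g(2)[of j i] that by auto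
    show "adj x y (g i) (g j) \<longrightarrow> j = Suc i"
    proof
      assume a: "adj x y (g i) (g j)"
      have "g j \<in> W" using g(1)[of j] that BW by blast
      then have "g j \<in> ?B (Suc i)" using a g(1)[of i] that by auto
      then show "j = Suc i" using g(2)[of j "Suc i"] that by (metis Suc_lessI)
    qed
  qed
  have "ipath x y W g R"
    unfolding ipath_def
  proof (intro conjI allI impI)
    show "g ` {..R} \<subseteq> W"
    proof (rule image_subsetI)
      fix j assume "j \<in> {..R}"
      then have "g j \<in> ?B j" using g(1)[of j] \<open>R < k\<close> by simp
      then show "g j \<in> W" using BW by blast
    qed
    show "inj_on g {..R}"
    proof (rule inj_onI)
      fix i j assume "i \<in> {..R}" "j \<in> {..R}" "g i = g j"
      then show "i = j" using sep[of i j] sep[of j i] \<open>R < k\<close> by (metis atMost_iff le_trans less_imp_le linorder_neqE_nat)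
    qed
    fix i j assume ij: "i \<le> R" "j \<le> R"
    show "adj x y (g i) (g j) \<longleftrightarrow> j = Suc i \<or> i = Suc j"
    proof
      assume a: "adj x y (g i) (g j)"
      then have "i \<noteq> j" by auto
      then show "j = Suc i \<or> i = Suc j"
        using sep[of i j] sep[of j i] a adj_sym[of x y "g i" "g j"] ij \<open>R < k\<close> by (cases "i < j") auto
    next
      assume "j = Suc i \<or> i = Suc j"
      then show "adj x y (g i) (g j)" using g(3)[of i] g(3)[of j] ij \<open>R < k\<close> adj_sym[of x y "g i" "g j"] by auto
    qed
  qed
  then show ?thesis by blast
qed

text \<open>The bound depends on \<open>N\<close> and not on the point set. Among many neighbours on
  one side of \<open>c\<close>, Ramsey's theorem finds a large clique or a large independent set,
  the latter being a star with centre \<open>c\<close>. Both give \<open>n - 1\<close> patterns of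
  each length from 3 to \<open>N\<close>, at least as many as \<open>t_seq\<close>.\<close>

lemma simple_bounded_degree:
  "\<exists>d. \<forall>(x :: 'a \<Rightarrow> int) y W. finite W \<longrightarrow> inj_on x W \<longrightarrow> inj_on y W \<longrightarrow> simple x y W \<longrightarrow> 3 \<le> card W \<longrightarrow>
     sparse N x y W \<longrightarrow> (\<forall>c\<in>W. card {u\<in>W. adj x y c u} \<le> d)"
proof -
  obtain r where r: "\<And>(V::'a set) E. finite V \<Longrightarrow> r \<le> card V \<Longrightarrow>
      \<exists>R\<subseteq>V. card R = 4 * N + 2 \<and> clique R E \<or> card R = 4 * N + 2 \<and> indep R E"
    using ramsey2[where m = "4 * N + 2" and n = "4 * N + 2" and ?'a = 'a] by blast
  have main: "card {u\<in>W. nw x y u c} < r"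
    if fin: "finite W" and inj: "inj_on x W" "inj_on y W" and simp: "simple x y W" and c3: "3 \<le> card W"
      and sp: "sparse N x y W" and c: "c \<in> W" for x y :: "'a \<Rightarrow> int" and W c
  proof (rule ccontr)
    assume "\<not> ?thesis"
    then have big: "r \<le> card {u\<in>W. nw x y u c}" by simp
    have con: "conn x y W" using sum_indec_imp_conn[OF fin inj simple_sum_indec[OF fin simp c3]] .
    have "W \<noteq> {c}" using c3 by auto
    then obtain v where v: "v \<in> W" "adj x y c v" using conn_edge[OF con c] by blast
    have tn: "t_seq n \<le> n - 1" if "3 \<le> n" for n using that by (simp add: t_seq_def)
    have no: False if "\<And>n. 3 \<le> n \<Longrightarrow> n \<le> N \<Longrightarrow> many x y W n (n - 1)"
      using sparse_t[OF sp c v] that many_antimono[OF _ tn] by metis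
    let ?E = "{{u, v} | u v. adj x y u v}"
    have "finite {u\<in>W. nw x y u c}" using fin by simp
    then obtain R where R: "R \<subseteq> {u\<in>W. nw x y u c}" "card R = 4 * N + 2" "clique R ?E \<or> indep R ?E"
      using r[OF _ big, of ?E] by blast
    have RW: "R \<subseteq> W" using R by auto
    from R(3) show False
    proof
      assume cl: "clique R ?E"
      have "inc x (\<lambda>u. - y u) R"
        unfolding inc_def
      proof (intro ballI)
        fix u v assume uv: "u \<in> R" "v \<in> R"
        show "x u < x v \<longleftrightarrow> - y u < - y v"
        proof (cases "u = v")
          case False
          then have "{u, v} \<in> ?E" using cl uv by (auto simp: clique_def)
          then have "adj x y u v" by (auto simp: doubleton_eq_iff adj_sym)
          then show ?thesis by (auto simp: adj_def nw_def)
        qed auto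
      qed
      then show False using no simple_long_clique[OF fin inj simp RW] R(2) by auto
    next
      assume ind: "indep R ?E"
      have "inc x y R"
        unfolding inc_def
      proof (intro ballI)
        fix u v assume uv: "u \<in> R" "v \<in> R"
        show "x u < x v \<longleftrightarrow> y u < y v"
        proof (cases "u = v")
          case False
          then have "{u, v} \<notin> ?E" using ind uv by (auto simp: indep_def)
          then have "\<not> adj x y u v" by auto
          then have "lt x y u v \<or> lt x y v u" using trichotomy[OF inj, of u v] uv RW False by blast
          then show ?thesis by (auto simp: lt_def)
        qed auto
      qed
      then show False using no simple_long_star[OF fin inj simp c RW _ _] R(1,2) by auto
    qed
  qed
  have "card {u\<in>W. adj x y c u} \<le> 2 * r"
    if fin: "finite W" and inj: "inj_on x W" "inj_on y W" and simp: "simple x y W" and c3: "3 \<le> card W"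
      and sp: "sparse N x y W" and c: "c \<in> W" for x y :: "'a \<Rightarrow> int" and W c
  proof -
    have "{u\<in>W. adj x y c u} = {u\<in>W. nw x y u c} \<union> {u\<in>W. nw y x u c}"
      by (auto simp: adj_def nw_swap)
    then have "card {u\<in>W. adj x y c u} \<le> card {u\<in>W. nw x y u c} + card {u\<in>W. nw y x u c}"
      using card_Un_le by metis
    moreover have "card {u\<in>W. nw x y u c} < r" using main[OF that] .
    \<comment> \<open>Exchanging \<open>x\<close> and \<open>y\<close> moves the neighbours to the
      lower right of \<open>c\<close> to its upper left.\<close>
    moreover have "card {u\<in>W. nw y x u c} < r"
      using main[of W y x c] that by (simp add: simple_swap sparse_swap)
    ultimately show ?thesis by linarith
  qed
  then show ?thesis by (intro exI[of _ "2 * r"]) blast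
qed

lemma simple_long_path:
  "\<exists>K\<ge>2. \<forall>(x :: 'a \<Rightarrow> int) y W. finite W \<longrightarrow> inj_on x W \<longrightarrow> inj_on y W \<longrightarrow> simple x y W \<longrightarrow>
     sparse N x y W \<longrightarrow> K < card W \<longrightarrow> (\<exists>q. ipath x y W q R)"
proof -
  obtain d where d: "\<forall>(x :: 'a \<Rightarrow> int) y W. finite W \<longrightarrow> inj_on x W \<longrightarrow> inj_on y W \<longrightarrow> simple x y W \<longrightarrow> 3 \<le> card W \<longrightarrow>
     sparse N x y W \<longrightarrow> (\<forall>c\<in>W. card {u\<in>W. adj x y c u} \<le> d)"
    using simple_bounded_degree[of N] by (rule exE)
  show ?thesis
  proof (intro exI[of _ "2 + (d + 1) ^ R"] conjI allI impI)
    fix x y :: "'a \<Rightarrow> int" and W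
    assume a: "finite W" "inj_on x W" "inj_on y W" "simple x y W" "sparse N x y W" "2 + (d + 1) ^ R < card W"
    have c3: "3 \<le> card W" using a(6) by simp
    have con: "conn x y W" using sum_indec_imp_conn[OF a(1-3) simple_sum_indec[OF a(1,4) c3]] .
    have big: "(d + 1) ^ R < card W" using a(6) by simp
    show "\<exists>q. ipath x y W q R"
      by (rule long_path_exists[OF a(1) con d[rule_format, OF a(1-4) c3 a(5)] big])
  qed simp
qed

lemma many3I:
  assumes "\<And>X. X \<in> {A, B, C} \<Longrightarrow> X \<subseteq> V \<and> card X = n \<and> conn x y X"
    and "\<not> isom x y A B" "\<not> isom x y A C" "\<not> isom x y B C"
  shows "many x y V n 3"
proof (rule manyI[of "{0::nat, 1, 2}" _ "\<lambda>j. [A, B, C] ! j"])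
  have "\<not> isom x y B A" "\<not> isom x y C A" "\<not> isom x y C B"
    using assms(2-) isom_sym by blast+
  then show "\<not> isom x y ([A, B, C] ! i) ([A, B, C] ! j)" if "i \<in> {0, 1, 2}" "j \<in> {0, 1, 2}" "i \<noteq> j" for i j
    using that assms(2-) by auto
  show "[A, B, C] ! j \<subseteq> V \<and> card ([A, B, C] ! j) = n \<and> conn x y ([A, B, C] ! j)" if "j \<in> {0, 1, 2}" for j
  proof -
    have "[A, B, C] ! j \<in> {A, B, C}" using that by auto
    then show ?thesis by (rule assms(1))
  qed
qed auto

lemma many4I:
  assumes "\<And>X. X \<in> {A, B, C, D} \<Longrightarrow> X \<subseteq> V \<and> card X = n \<and> conn x y X"
    and "\<not> isom x y A B" "\<not> isom x y A C" "\<not> isom x y A D" "\<not> isom x y B C" "\<not> isom x y B D" "\<not> isom x y C D"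
  shows "many x y V n 4"
proof (rule manyI[of "{0::nat, 1, 2, 3}" _ "\<lambda>j. [A, B, C, D] ! j"])
  have "\<not> isom x y B A" "\<not> isom x y C A" "\<not> isom x y D A" "\<not> isom x y C B" "\<not> isom x y D B" "\<not> isom x y D C"
    using assms(2-) isom_sym by blast+
  then show "\<not> isom x y ([A, B, C, D] ! i) ([A, B, C, D] ! j)" if "i \<in> {0, 1, 2, 3}" "j \<in> {0, 1, 2, 3}" "i \<noteq> j" for i j
    using that assms(2-) by auto
  show "[A, B, C, D] ! j \<subseteq> V \<and> card ([A, B, C, D] ! j) = n \<and> conn x y ([A, B, C, D] ! j)" if "j \<in> {0, 1, 2, 3}" for j
  proof -
    have "[A, B, C, D] ! j \<in> {A, B, C, D}" using that by auto
    then show ?thesis by (rule assms(1))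
  qed
qed auto

section \<open>Points outside a longest path\<close>

definition deg :: "('a \<Rightarrow> int) \<Rightarrow> ('a \<Rightarrow> int) \<Rightarrow> 'a set \<Rightarrow> 'a \<Rightarrow> nat" where
  "deg x y A c = card {v\<in>A. adj x y c v}"

definition has_deg :: "nat \<Rightarrow> ('a \<Rightarrow> int) \<Rightarrow> ('a \<Rightarrow> int) \<Rightarrow> 'a set \<Rightarrow> bool" where
  "has_deg k x y A \<longleftrightarrow> (\<exists>c\<in>A. k \<le> deg x y A c)"

text \<open>On an ascending path this distinguishes a fork near the lower end from one further
  up.\<close>

definition low_fork :: "('a \<Rightarrow> int) \<Rightarrow> ('a \<Rightarrow> int) \<Rightarrow> 'a set \<Rightarrow> bool" where
  "low_fork x y A \<longleftrightarrow> (\<exists>c\<in>A. \<exists>z\<in>A. 3 \<le> deg x y A c \<and> lt x y z c)"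

definition triangle :: "('a \<Rightarrow> int) \<Rightarrow> ('a \<Rightarrow> int) \<Rightarrow> 'a set \<Rightarrow> bool" where
  "triangle x y A \<longleftrightarrow> (\<exists>a\<in>A. \<exists>b\<in>A. \<exists>c\<in>A. adj x y a b \<and> adj x y b c \<and> adj x y a c)"

text \<open>In a segment of an ascending path with at least three vertices, the leftmost point is
  either the first vertex, of degree 1, or the second one, of degree 2. This separates the two
  inverse oscillations of the same length.\<close>

definition left_deg2 :: "('a \<Rightarrow> int) \<Rightarrow> ('a \<Rightarrow> int) \<Rightarrow> 'a set \<Rightarrow> bool" where
  "left_deg2 x y A \<longleftrightarrow> (\<exists>c\<in>A. (\<forall>z\<in>A. \<not> x z < x c) \<and> 2 \<le> deg x y A c)"

lemma isom_invariants:
  assumes "isom x y A B"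
  shows "has_deg k x y A \<Longrightarrow> has_deg k x y B" "low_fork x y A \<Longrightarrow> low_fork x y B"
    "triangle x y A \<Longrightarrow> triangle x y B" "left_deg2 x y A \<Longrightarrow> left_deg2 x y B"
proof -
  obtain f where f: "bij_betw f A B"
    and fx: "\<And>u v. u \<in> A \<Longrightarrow> v \<in> A \<Longrightarrow> x (f u) < x (f v) \<longleftrightarrow> x u < x v"
    and fa: "\<And>u v. u \<in> A \<Longrightarrow> v \<in> A \<Longrightarrow> adj x y (f u) (f v) \<longleftrightarrow> adj x y u v"
    and fl: "\<And>u v. u \<in> A \<Longrightarrow> v \<in> A \<Longrightarrow> lt x y (f u) (f v) \<longleftrightarrow> lt x y u v"
    by (rule isom_transfer[OF assms]) blast
  have B: "B = f ` A" using f by (simp add: bij_betw_def)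
  have d: "deg x y B (f c) = deg x y A c" if c: "c \<in> A" for c
  proof -
    have "f ` {v\<in>A. adj x y c v} = {v\<in>f ` A. adj x y (f c) v}"
      by (rule image_filter) (use fa c in auto)
    then have "bij_betw f {v\<in>A. adj x y c v} {v\<in>B. adj x y (f c) v}"
      using B f bij_betw_subset[of f A B "{v\<in>A. adj x y c v}"] by auto
    then show ?thesis unfolding deg_def using bij_betw_same_card by metis
  qed
  have fB: "f c \<in> B" if "c \<in> A" for c using that B by auto
  show "has_deg k x y B" if "has_deg k x y A"
    using that d fB unfolding has_deg_def by metis
  show "low_fork x y B" if "low_fork x y A"
  proof -
    obtain c z where "c \<in> A" "z \<in> A" "3 \<le> deg x y A c" "lt x y z c" using \<open>low_fork x y A\<close> unfolding low_fork_def by blast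
    then show ?thesis unfolding low_fork_def by (intro bexI[of _ "f c"] bexI[of _ "f z"]) (auto simp: d fl fB)
  qed
  show "triangle x y B" if "triangle x y A"
  proof -
    obtain a b c where "a \<in> A" "b \<in> A" "c \<in> A" "adj x y a b" "adj x y b c" "adj x y a c"
      using \<open>triangle x y A\<close> unfolding triangle_def by blast
    then show ?thesis unfolding triangle_def
      by (intro bexI[of _ "f a"] bexI[of _ "f b"] bexI[of _ "f c"]) (auto simp: fa fB)
  qed
  show "left_deg2 x y B" if "left_deg2 x y A"
  proof -
    obtain c where "c \<in> A" "\<forall>z\<in>A. \<not> x z < x c" "2 \<le> deg x y A c"
      using \<open>left_deg2 x y A\<close> unfolding left_deg2_def by blast
    then show ?thesis unfolding left_deg2_def B by (intro bexI[of _ "f c"]) (auto simp: fx d[unfolded B])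
  qed
qed

lemma ipath_extend:
  assumes ip: "ipath x y V q m" and z: "z \<in> V" "z \<notin> q ` {..m}" "\<And>i. i \<le> m \<Longrightarrow> adj x y z (q i) \<longleftrightarrow> i = 0"
  shows "ipath x y V (case_nat z q) (Suc m)"
  unfolding ipath_def
proof (intro conjI allI impI)
  have *: "{..Suc m} = insert 0 (Suc ` {..m})" by (rule atMost_Suc_eq_insert_0)
  show "case_nat z q ` {..Suc m} \<subseteq> V"
    using ip z(1) unfolding * ipath_def by auto
  show "inj_on (case_nat z q) {..Suc m}"
    using ip z(2) unfolding * ipath_def inj_on_def by auto
  fix i j assume "i \<le> Suc m" "j \<le> Suc m"
  then show "adj x y (case_nat z q i) (case_nat z q j) \<longleftrightarrow> j = Suc i \<or> i = Suc j"
    using ip z(3) adj_sym[of x y z] unfolding ipath_def by (cases i; cases j) auto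
qed

section \<open>Ascending induced paths and their segments\<close>

text \<open>Nonconsecutive vertices of an induced path are comparable. By \<open>ipath_opath\<close>
  all these comparisons point the same way along the path, so up to negating both coordinates the
  path ascends.\<close>

locale opath =
  fixes x y :: "'a \<Rightarrow> int" and V :: "'a set" and q :: "nat \<Rightarrow> 'a" and m :: nat
  assumes fin: "finite V" and injx: "inj_on x V" and injy: "inj_on y V"
    and ip: "ipath x y V q m" and asc: "\<And>i j. i + 2 \<le> j \<Longrightarrow> j \<le> m \<Longrightarrow> lt x y (q i) (q j)"
begin

lemma qV: "i \<le> m \<Longrightarrow> q i \<in> V"
  using ip by (auto simp: ipath_def)

lemma q_eq: "i \<le> m \<Longrightarrow> j \<le> m \<Longrightarrow> q i = q j \<longleftrightarrow> i = j"
  using ip by (auto simp: ipath_def inj_on_def)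

lemma adj_q: "i \<le> m \<Longrightarrow> j \<le> m \<Longrightarrow> adj x y (q i) (q j) \<longleftrightarrow> j = Suc i \<or> i = Suc j"
  using ip by (auto simp: ipath_def)

lemma lt_q: "i \<le> m \<Longrightarrow> j \<le> m \<Longrightarrow> lt x y (q i) (q j) \<longleftrightarrow> i + 2 \<le> j"
proof -
  assume ij: "i \<le> m" "j \<le> m"
  consider "i + 2 \<le> j" | "j + 2 \<le> i" | "j = Suc i \<or> i = Suc j" | "i = j" by linarith
  then show ?thesis
  proof cases
    case 2
    then show ?thesis using asc[of j i] ij lt_asym by fastforce
  next
    case 3
    then show ?thesis using adj_q[OF ij] lt_not_adj[of x y "q i" "q j"] by auto
  qed (use ij asc in \<open>auto simp: lt_def\<close>)
qed

lemma opath_rev: "opath (\<lambda>u. - x u) (\<lambda>u. - y u) V (\<lambda>j. q (m - j)) m"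
proof
  show "inj_on (\<lambda>u. - x u) V" "inj_on (\<lambda>u. - y u) V" using injx injy by (auto simp: inj_on_def)
  show "ipath (\<lambda>u. - x u) (\<lambda>u. - y u) V (\<lambda>j. q (m - j)) m"
    unfolding ipath_def adj_uminus
  proof (intro conjI allI impI)
    show "(\<lambda>j. q (m - j)) ` {..m} \<subseteq> V" using qV by auto
    show "inj_on (\<lambda>j. q (m - j)) {..m}"
    proof (rule inj_onI)
      fix i j assume "i \<in> {..m}" "j \<in> {..m}" "q (m - i) = q (m - j)"
      then show "i = j" using q_eq[of "m - i" "m - j"] by auto
    qed
    fix i j assume ij: "i \<le> m" "j \<le> m"
    have "adj x y (q (m - i)) (q (m - j)) \<longleftrightarrow> m - j = Suc (m - i) \<or> m - i = Suc (m - j)"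
      by (rule adj_q) auto
    also have "\<dots> \<longleftrightarrow> j = Suc i \<or> i = Suc j" using ij by presburger
    finally show "adj x y (q (m - i)) (q (m - j)) \<longleftrightarrow> j = Suc i \<or> i = Suc j" .
  qed
  fix i j assume "i + 2 \<le> j" "j \<le> m"
  then show "lt (\<lambda>u. - x u) (\<lambda>u. - y u) (q (m - i)) (q (m - j))"
    using asc[of "m - j" "m - i"] by (simp add: lt_uminus)
qed (rule fin)

text \<open>Two successive edges in the same direction would make \<open>q i\<close> and
  \<open>q (i + 2)\<close> adjacent by transitivity.\<close>

lemma nw_alternate: "i + 2 \<le> m \<Longrightarrow> nw x y (q i) (q (Suc i)) \<longleftrightarrow> \<not> nw x y (q (Suc i)) (q (Suc (Suc i)))"
proof -
  assume i: "i + 2 \<le> m"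
  have "adj x y (q i) (q (Suc i))" "adj x y (q (Suc i)) (q (Suc (Suc i)))" using i adj_q by auto
  moreover have "lt x y (q i) (q (Suc (Suc i)))" using asc[of i "Suc (Suc i)"] i by simp
  ultimately show ?thesis unfolding adj_def nw_def lt_def by linarith
qed

definition seg :: "nat \<Rightarrow> nat \<Rightarrow> 'a set" where
  "seg a n = q ` {a..<a + n}"

lemma in_seg: "i \<le> m \<Longrightarrow> a + n \<le> Suc m \<Longrightarrow> q i \<in> seg a n \<longleftrightarrow> a \<le> i \<and> i < a + n"
  unfolding seg_def using q_eq by (auto simp: image_iff)

lemma segE:
  assumes "v \<in> seg a n" "a + n \<le> Suc m"
  obtains i where "i \<le> m" "a \<le> i" "i < a + n" "v = q i"
proof -
  obtain i where i: "v = q i" "a \<le> i" "i < a + n" using assms(1) by (auto simp: seg_def)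
  then show thesis using that[of i] assms(2) by simp
qed

lemma seg_V: "a + n \<le> Suc m \<Longrightarrow> seg a n \<subseteq> V"
  unfolding seg_def using qV by auto

lemma finite_seg [simp]: "finite (seg a n)"
  by (simp add: seg_def)

lemma card_seg: "a + n \<le> Suc m \<Longrightarrow> card (seg a n) = n"
proof -
  assume a: "a + n \<le> Suc m"
  have "inj_on q {a..<a + n}" using a q_eq by (auto simp: inj_on_def)
  then show ?thesis by (simp add: seg_def card_image)
qed

lemma seg_Suc: "seg a (Suc n) = insert (q (a + n)) (seg a n)"
  by (auto simp: seg_def less_Suc_eq)

lemma nbrs_seg: "i \<le> m \<Longrightarrow> a + n \<le> Suc m \<Longrightarrow>
    {v\<in>seg a n. adj x y (q i) v} = q ` {j. a \<le> j \<and> j < a + n \<and> (j = Suc i \<or> i = Suc j)}"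
  unfolding seg_def using adj_q by auto

lemma conn_seg: "a + Suc n \<le> Suc m \<Longrightarrow> conn x y (seg a (Suc n))"
proof (induction n)
  case 0
  then show ?case by (simp add: seg_def conn_sing)
next
  case (Suc n)
  have "q (a + n) \<in> seg a (Suc n)" by (simp add: seg_def)
  moreover have "adj x y (q (a + Suc n)) (q (a + n))" using Suc.prems adj_q by auto
  ultimately show ?case using conn_insert[of x y "seg a (Suc n)"] Suc seg_Suc[of a "Suc n"] by simp
qed

lemma edges_seg: "a + Suc n \<le> Suc m \<Longrightarrow> card (edges x y (seg a (Suc n))) = n"
proof (induction n)
  case 0
  have "edges x y (seg a (Suc 0)) = {}" by (auto simp: seg_def edges_def nw_def)
  then show ?case by simp
next
  case (Suc n)
  have "{j. a \<le> j \<and> j < a + Suc n \<and> (j = Suc (a + Suc n) \<or> a + Suc n = Suc j)} = {a + n}" by auto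
  then have "{v\<in>seg a (Suc n). adj x y (q (a + Suc n)) v} = {q (a + n)}"
    using nbrs_seg[of "a + Suc n" a "Suc n"] Suc.prems by simp
  moreover have "q (a + Suc n) \<notin> seg a (Suc n)" using in_seg[of "a + Suc n" a "Suc n"] Suc.prems by simp
  ultimately show ?case
    using edges_insert[of "seg a (Suc n)" "q (a + Suc n)" x y] Suc seg_Suc[of a "Suc n"] by simp
qed

lemma deg_seg: "i \<le> m \<Longrightarrow> a + n \<le> Suc m \<Longrightarrow> deg x y (seg a n) (q i) \<le> 2"
proof -
  assume a: "i \<le> m" "a + n \<le> Suc m"
  have "{v\<in>seg a n. adj x y (q i) v} \<subseteq> {q (Suc i), q (i - 1)}"
    using nbrs_seg[OF a] by auto
  then have "deg x y (seg a n) (q i) \<le> card {q (Suc i), q (i - 1)}"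
    unfolding deg_def by (intro card_mono) auto
  also have "\<dots> \<le> 2" by (simp add: card_insert_if)
  finally show ?thesis .
qed

lemma seg_no_deg3: "a + n \<le> Suc m \<Longrightarrow> \<not> has_deg 3 x y (seg a n)"
proof
  assume a: "a + n \<le> Suc m" "has_deg 3 x y (seg a n)"
  then obtain c where c: "c \<in> seg a n" "3 \<le> deg x y (seg a n) c" by (auto simp: has_deg_def)
  then obtain i where "i \<le> m" "c = q i" using a(1) by (auto elim: segE)
  then show False using deg_seg[of i a n] a c by simp
qed

lemma seg_no_triangle: "a + n \<le> Suc m \<Longrightarrow> \<not> triangle x y (seg a n)"
proof
  assume a: "a + n \<le> Suc m" "triangle x y (seg a n)"
  then obtain u v w where "u \<in> seg a n" "v \<in> seg a n" "w \<in> seg a n" "adj x y u v" "adj x y v w" "adj x y u w"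
    unfolding triangle_def by blast
  moreover have "\<exists>i\<le>m. u = q i" if "u \<in> seg a n" for u using segE[OF that a(1)] by metis
  ultimately obtain i j k where "i \<le> m" "j \<le> m" "k \<le> m" "adj x y (q i) (q j)" "adj x y (q j) (q k)" "adj x y (q i) (q k)"
    by metis
  then show False using adj_q by auto
qed

lemma left_deg2_seg:
  assumes "a + n \<le> Suc m" "3 \<le> n"
  shows "left_deg2 x y (seg a n) \<longleftrightarrow> \<not> nw x y (q a) (q (Suc a))"
proof -
  have am: "a + 2 \<le> m" using assms by simp
  have ad: "adj x y (q a) (q (Suc a))" using adj_q[of a "Suc a"] am by simp
  have low: "x (q a) < x (q j) \<and> (j \<noteq> Suc (Suc a) \<longrightarrow> x (q (Suc a)) < x (q j))" if "a + 2 \<le> j" "j \<le> m" for j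
    using asc[of a j] asc[of "Suc a" j] that by (auto simp: lt_def)
  show ?thesis
  proof (cases "nw x y (q a) (q (Suc a))")
    case True
    have "c = q a" if c: "c \<in> seg a n" "\<forall>z\<in>seg a n. \<not> x z < x c" for c
    proof -
      obtain j where j: "c = q j" "a \<le> j" "j < a + n" using c(1) by (auto simp: seg_def)
      have "q a \<in> seg a n" using assms by (auto simp: seg_def)
      then have "\<not> x (q a) < x (q j)" using c(2) j by auto
      then have "j \<noteq> Suc a" "\<not> a + 2 \<le> j" using low[of j] True j assms by (auto simp: nw_def)
      then have "j = a" using j(2) by linarith
      then show ?thesis using j by simp
    qed
    moreover have "{j. a \<le> j \<and> j < a + n \<and> (j = Suc a \<or> a = Suc j)} = {Suc a}" using assms by auto
    then have "deg x y (seg a n) (q a) = 1"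
      using nbrs_seg[of a a n] assms am by (simp add: deg_def)
    ultimately show ?thesis using True unfolding left_deg2_def by force
  next
    case False
    then have n: "nw x y (q (Suc a)) (q a)" using ad by (auto simp: adj_def)
    have n2: "nw x y (q (Suc a)) (q (Suc (Suc a)))" using nw_alternate[of a] False am by simp
    have "\<not> x z < x (q (Suc a))" if "z \<in> seg a n" for z
    proof -
      obtain j where j: "z = q j" "a \<le> j" "j < a + n" using \<open>z \<in> seg a n\<close> by (auto simp: seg_def)
      then consider "j = a" | "j = Suc a" | "j = Suc (Suc a)" | "a + 3 \<le> j" by linarith
      then show ?thesis using j n n2 low[of j] assms by cases (auto simp: nw_def)
    qed
    moreover have "{j. a \<le> j \<and> j < a + n \<and> (j = Suc (Suc a) \<or> Suc a = Suc j)} = {a, Suc (Suc a)}" using assms by auto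
    then have "deg x y (seg a n) (q (Suc a)) = 2"
      using nbrs_seg[of "Suc a" a n] assms am q_eq[of a "Suc (Suc a)"] by (simp add: deg_def)
    moreover have "q (Suc a) \<in> seg a n" using assms by (auto simp: seg_def)
    ultimately show ?thesis using False unfolding left_deg2_def by (auto intro!: bexI[of _ "q (Suc a)"])
  qed
qed

text \<open>Starting one index later flips the direction of the first edge, so these are the two
  inverse oscillations.\<close>

lemma two_segs:
  assumes "3 \<le> n" "n \<le> m"
  shows "\<not> isom x y (seg 0 n) (seg 1 n)"
proof -
  have "left_deg2 x y (seg 0 n) \<longleftrightarrow> \<not> left_deg2 x y (seg 1 n)"
    using left_deg2_seg[of 0 n] left_deg2_seg[of 1 n] nw_alternate[of 0] assms by simp
  then show ?thesis using isom_invariants(4)[of x y] isom_sym by metis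
qed

lemma seg_props: "a + n \<le> Suc m \<Longrightarrow> 1 \<le> n \<Longrightarrow> seg a n \<subseteq> V \<and> card (seg a n) = n \<and> conn x y (seg a n)"
  using seg_V card_seg conn_seg[of a "n - 1"] by simp

lemma ext_props:
  assumes "p \<in> V" "p \<notin> q ` {..m}" "a + n \<le> Suc m" "1 \<le> n" "a \<le> i" "i < a + n" "adj x y p (q i)"
  shows "insert p (seg a n) \<subseteq> V \<and> card (insert p (seg a n)) = Suc n \<and> conn x y (insert p (seg a n))"
    "card (edges x y (insert p (seg a n))) = n - 1 + card {j. a \<le> j \<and> j < a + n \<and> adj x y p (q j)}"
proof -
  have pn: "p \<notin> seg a n" using assms by (auto simp: seg_def)
  have "q i \<in> seg a n" using assms by (auto simp: seg_def)
  then show "insert p (seg a n) \<subseteq> V \<and> card (insert p (seg a n)) = Suc n \<and> conn x y (insert p (seg a n))"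
    using seg_props[of a n] assms pn conn_insert[of x y "seg a n" "q i" p] by auto
  have "{u\<in>seg a n. adj x y p u} = q ` {j. a \<le> j \<and> j < a + n \<and> adj x y p (q j)}"
    by (auto simp: seg_def)
  moreover have "inj_on q {j. a \<le> j \<and> j < a + n \<and> adj x y p (q j)}"
    using q_eq assms by (auto simp: inj_on_def)
  ultimately have "card {u\<in>seg a n. adj x y p u} = card {j. a \<le> j \<and> j < a + n \<and> adj x y p (q j)}"
    by (simp add: card_image)
  then show "card (edges x y (insert p (seg a n))) = n - 1 + card {j. a \<le> j \<and> j < a + n \<and> adj x y p (q j)}"
    using edges_insert[OF _ pn, of x y] edges_seg[of a "n - 1"] assms by simp
qed

text \<open>Segments contain no triangle, so with the two segments there are three patterns of each
  length from 3 on, as \<open>u_seq\<close> demands.\<close>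

lemma triangle_not_sparse:
  assumes N: "N \<le> m" "3 \<le> N"
    and A: "\<And>n. 3 \<le> n \<Longrightarrow> n \<le> N \<Longrightarrow> \<exists>A\<subseteq>V. card A = n \<and> conn x y A \<and> triangle x y A"
  shows "\<not> sparse N x y V"
proof
  assume sp: "sparse N x y V"
  have "adj x y (q 0) (q 1)" "q 0 \<in> V" "q 1 \<in> V" using adj_q[of 0 1] qV N by auto
  then obtain n where n: "3 \<le> n" "n \<le> N" "\<not> many x y V n (u_seq n)" using sparse_u[OF sp] by metis
  obtain A where A: "A \<subseteq> V" "card A = n" "conn x y A" "triangle x y A" using A n by blast
  have "many x y V n 3"
  proof (rule many3I[of "seg 0 n" "seg 1 n" A])
    show "\<not> isom x y (seg 0 n) (seg 1 n)" using two_segs n N by simp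
    show "\<not> isom x y (seg 0 n) A" "\<not> isom x y (seg 1 n) A"
      using isom_invariants(3)[OF isom_sym, of x y _ A] A(4) seg_no_triangle[of 0 n] seg_no_triangle[of 1 n] n N by auto
    show "X \<subseteq> V \<and> card X = n \<and> conn x y X" if "X \<in> {seg 0 n, seg 1 n, A}" for X
      using that A seg_props[of 0 n] seg_props[of 1 n] n N by auto
  qed
  then show False using n by (simp add: u_seq_def)
qed

text \<open>The scheme for reaching \<open>t_seq\<close>: the two segments suffice at length 3,
  \<open>A\<close> is the third pattern from length 4 on, and \<open>B\<close> the fourth from
  length 5 on. Segments have degrees at most 2 and \<open>n - 1\<close> edges, so a point of degree
  3 or an additional edge tells \<open>A\<close> and \<open>B\<close> from them.\<close>

lemma four_not_sparse:
  assumes N: "N \<le> m" "3 \<le> N"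
    and A: "\<And>n. 4 \<le> n \<Longrightarrow> n \<le> N \<Longrightarrow> \<exists>A\<subseteq>V. card A = n \<and> conn x y A \<and> has_deg 3 x y A \<and>
      (5 \<le> n \<longrightarrow> (\<exists>B\<subseteq>V. card B = n \<and> conn x y B \<and> \<not> isom x y A B \<and> (has_deg 3 x y B \<or> card (edges x y B) = n)))"
  shows "\<not> sparse N x y V"
proof
  assume sp: "sparse N x y V"
  have "adj x y (q 0) (q 1)" "q 0 \<in> V" "q 1 \<in> V" using adj_q[of 0 1] qV N by auto
  then obtain n where n: "3 \<le> n" "n \<le> N" "\<not> many x y V n (t_seq n)" using sparse_t[OF sp] by metis
  have s01: "\<not> isom x y (seg 0 n) (seg 1 n)" using two_segs n N by simp
  have segs: "X \<subseteq> V \<and> card X = n \<and> conn x y X" if "X \<in> {seg 0 n, seg 1 n}" for X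
    using that seg_props[of 0 n] seg_props[of 1 n] n N by auto
  have deg: "\<not> isom x y X B" if "has_deg 3 x y B" "X \<in> {seg 0 n, seg 1 n}" for B X
    using isom_invariants(1)[OF isom_sym, of x y X B 3] that seg_no_deg3[of 0 n] seg_no_deg3[of 1 n] n N by auto
  have ed: "\<not> isom x y X B" if "card (edges x y B) = n" "X \<in> {seg 0 n, seg 1 n}" for B X
    using isom_edges[of x y X B] that edges_seg[of 0 "n - 1"] edges_seg[of 1 "n - 1"] n N by auto
  consider "n = 3" | "n = 4" | "5 \<le> n" using n by linarith
  then have "many x y V n (t_seq n)"
  proof cases
    case 1
    have "many x y V n 2"
    proof (rule manyI[of "{0::nat, 1}" _ "\<lambda>i. seg i n"])
      show "\<not> isom x y (seg i n) (seg j n)" if "i \<in> {0, 1}" "j \<in> {0, 1}" "i \<noteq> j" for i j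
        using that s01 isom_sym[of x y "seg 1 n" "seg 0 n"] by auto
    qed (use segs in auto)
    then show ?thesis using 1 by (simp add: t_seq_def)
  next
    case 2
    then obtain A where A: "A \<subseteq> V" "card A = n" "conn x y A" "has_deg 3 x y A" using A[of n] n by auto
    have "many x y V n 3"
    proof (rule many3I[of "seg 0 n" "seg 1 n" A])
      show "\<not> isom x y (seg 0 n) (seg 1 n)" by (rule s01)
      show "\<not> isom x y (seg 0 n) A" "\<not> isom x y (seg 1 n) A" using deg[OF A(4), of "seg 0 n"] deg[OF A(4), of "seg 1 n"] by blast+
      show "X \<subseteq> V \<and> card X = n \<and> conn x y X" if "X \<in> {seg 0 n, seg 1 n, A}" for X
        using that segs[of X] A(1-3) by blast
    qed
    then show ?thesis using 2 by (simp add: t_seq_def)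
  next
    case 3
    then obtain A B where A: "A \<subseteq> V" "card A = n" "conn x y A" "has_deg 3 x y A"
      and B: "B \<subseteq> V" "card B = n" "conn x y B" "\<not> isom x y A B" "has_deg 3 x y B \<or> card (edges x y B) = n"
      using A[of n] n by auto
    have "many x y V n 4"
    proof (rule many4I[of "seg 0 n" "seg 1 n" A B])
      show "\<not> isom x y (seg 0 n) (seg 1 n)" by (rule s01)
      show "\<not> isom x y (seg 0 n) A" "\<not> isom x y (seg 1 n) A" using deg[OF A(4), of "seg 0 n"] deg[OF A(4), of "seg 1 n"] by blast+
      show "\<not> isom x y (seg 0 n) B" "\<not> isom x y (seg 1 n) B"
        using B(5) deg[of B "seg 0 n"] deg[of B "seg 1 n"] ed[of B "seg 0 n"] ed[of B "seg 1 n"] by blast+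
      show "\<not> isom x y A B" by (rule B(4))
      show "X \<subseteq> V \<and> card X = n \<and> conn x y X" if "X \<in> {seg 0 n, seg 1 n, A, B}" for X
        using that segs[of X] A(1-3) B(1-3) by blast
    qed
    then show ?thesis using 3 by (simp add: t_seq_def)
  qed
  then show False using n by simp
qed

end

section \<open>Disturbances that exceed the pattern counts\<close>

context opath
begin

lemma triangle_bad:
  assumes N: "3 \<le> N" "N \<le> m" and p: "p \<in> V" "p \<notin> q ` {..m}" and i: "i + N \<le> m"
    and a: "adj x y p (q i)" "adj x y p (q (Suc i))"
  shows "\<not> sparse N x y V"
proof (rule triangle_not_sparse)
  fix n assume n: "3 \<le> n" "n \<le> N"
  let ?A = "insert p (seg i (n - 1))"
  have "?A \<subseteq> V \<and> card ?A = Suc (n - 1) \<and> conn x y ?A"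
    by (rule ext_props(1)[where i = i]) (use p i n a in auto)
  moreover have "triangle x y ?A"
    unfolding triangle_def
  proof (intro bexI conjI)
    show "adj x y p (q i)" "adj x y p (q (Suc i))" by fact+
    show "adj x y (q i) (q (Suc i))" using adj_q[of i "Suc i"] i N by simp
    show "q i \<in> ?A" "q (Suc i) \<in> ?A" using n i by (auto simp: in_seg)
  qed simp
  ultimately show "\<exists>A\<subseteq>V. card A = n \<and> conn x y A \<and> triangle x y A"
    using n by (intro exI[of _ ?A]) auto
qed (use N in auto)

lemma deg_ge3:
  assumes "finite A" "a \<in> A" "b \<in> A" "d \<in> A" "a \<noteq> b" "a \<noteq> d" "b \<noteq> d" "adj x y c a" "adj x y c b" "adj x y c d"
  shows "3 \<le> deg x y A c"
proof -
  have "card {a, b, d} \<le> card {v\<in>A. adj x y c v}" using assms by (intro card_mono) auto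
  then show ?thesis using assms by (simp add: deg_def)
qed

lemma fork_deg3:
  assumes p: "p \<notin> q ` {..m}" and i: "a < i" "Suc i < a + n" "a + n \<le> Suc m" and pi: "adj x y p (q i)"
  shows "3 \<le> deg x y (insert p (seg a n)) (q i)" "has_deg 3 x y (insert p (seg a n))"
proof -
  have qs: "q (i - 1) \<in> seg a n" "q (Suc i) \<in> seg a n" "q i \<in> seg a n" using i by (auto simp: in_seg)
  have ne: "p \<noteq> q (i - 1)" "p \<noteq> q (Suc i)" using p i by auto
  have ad: "adj x y (q i) (q (i - 1))" "adj x y (q i) (q (Suc i))" using adj_q i by auto
  have q2: "q (i - 1) \<noteq> q (Suc i)" using q_eq[of "i - 1" "Suc i"] i by simp
  show d: "3 \<le> deg x y (insert p (seg a n)) (q i)"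
    by (rule deg_ge3[of _ "q (i - 1)" "q (Suc i)" p]) (use qs ne ad q2 pi adj_sym[of x y p "q i"] in auto)
  show "has_deg 3 x y (insert p (seg a n))" unfolding has_deg_def using d qs by blast
qed

lemma deg3_only_fork:
  assumes p: "p \<in> V" "p \<notin> q ` {..m}" and i: "i \<le> m" "\<And>j. j \<le> m \<Longrightarrow> adj x y p (q j) \<longleftrightarrow> j = i" and an: "a + n \<le> Suc m"
    and c: "c \<in> insert p (seg a n)" "3 \<le> deg x y (insert p (seg a n)) c"
  shows "c = q i"
proof (rule ccontr)
  assume ci: "c \<noteq> q i"
  show False
  proof (cases "c = p")
    case True
    have "{v\<in>insert p (seg a n). adj x y p v} \<subseteq> {q i}"
    proof
      fix v assume v: "v \<in> {v\<in>insert p (seg a n). adj x y p v}"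
      then have "v \<in> seg a n" by auto
      then obtain j where "j \<le> m" "v = q j" using segE[OF _ an] by metis
      then show "v \<in> {q i}" using v i(2)[of j] by auto
    qed
    then have "deg x y (insert p (seg a n)) p \<le> card {q i}" unfolding deg_def by (intro card_mono) auto
    then show False using c True by simp
  next
    case False
    then obtain j where j: "j \<le> m" "c = q j" using c(1) segE[OF _ an] by (metis insertE)
    then have "j \<noteq> i" using ci by auto
    then have "\<not> adj x y c p" using i(2)[of j] j adj_sym[of x y c p] by auto
    then have "{v\<in>insert p (seg a n). adj x y c v} = {v\<in>seg a n. adj x y c v}" by auto
    then have "deg x y (insert p (seg a n)) c = deg x y (seg a n) c" by (simp add: deg_def)
    then show False using deg_seg[OF j(1) an] j c by simp
  qed
qed

text \<open>The segment that starts at \<open>q i\<close> closes a 4-cycle with \<open>p\<close>,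
  the one that starts at the next vertex does not, so they have \<open>n\<close> and
  \<open>n - 1\<close> edges. In the second one \<open>q (i + 2)\<close> has degree 3. That
  \<open>p\<close> has no later neighbours makes these counts exact.\<close>

lemma square_bad:
  assumes N: "3 \<le> N" "N \<le> m" and p: "p \<in> V" "p \<notin> q ` {..m}" and i: "i + 2 + N \<le> m"
    and a: "adj x y p (q i)" "adj x y p (q (i + 2))" "\<not> adj x y p (q (Suc i))"
    and b: "\<And>j. i + 2 < j \<Longrightarrow> j \<le> m \<Longrightarrow> \<not> adj x y p (q j)"
  shows "\<not> sparse N x y V"
proof (rule four_not_sparse)
  fix n assume n: "4 \<le> n" "n \<le> N"
  let ?A = "insert p (seg (Suc i) (n - 1))" and ?B = "insert p (seg i (n - 1))"
  have A: "?A \<subseteq> V \<and> card ?A = Suc (n - 1) \<and> conn x y ?A"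
    by (rule ext_props(1)[where i = "i + 2"]) (use p i n a in auto)
  have B: "?B \<subseteq> V \<and> card ?B = Suc (n - 1) \<and> conn x y ?B"
    by (rule ext_props(1)[where i = "i + 2"]) (use p i n a in auto)
  have A3: "has_deg 3 x y ?A"
    by (rule fork_deg3(2)[of p _ "i + 2"]) (use p i n a in auto)
  have "card (edges x y ?A) = n - 1 - 1 + card {j. Suc i \<le> j \<and> j < Suc i + (n - 1) \<and> adj x y p (q j)}"
    by (rule ext_props(2)[where i = "i + 2"]) (use p i n a in auto)
  moreover have "{j. Suc i \<le> j \<and> j < Suc i + (n - 1) \<and> adj x y p (q j)} = {i + 2}"
  proof -
    have "j = i + 2" if "Suc i \<le> j" "j < Suc i + (n - 1)" "adj x y p (q j)" for j
    proof -
      have "j \<le> m" using that(2) i n by linarith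
      then have "j \<noteq> Suc i" "\<not> i + 2 < j" using that(3) a(3) b[of j] by auto
      then show ?thesis using that by linarith
    qed
    then show ?thesis using a n by auto
  qed
  ultimately have eA: "card (edges x y ?A) = n - 1" using n by simp
  have "card (edges x y ?B) = n - 1 - 1 + card {j. i \<le> j \<and> j < i + (n - 1) \<and> adj x y p (q j)}"
    by (rule ext_props(2)[where i = "i + 2"]) (use p i n a in auto)
  moreover have "{j. i \<le> j \<and> j < i + (n - 1) \<and> adj x y p (q j)} = {i, i + 2}"
  proof -
    have "j = i \<or> j = i + 2" if "i \<le> j" "j < i + (n - 1)" "adj x y p (q j)" for j
    proof -
      have "j \<le> m" using that(2) i n by linarith
      then have "j \<noteq> Suc i" "\<not> i + 2 < j" using that(3) a(3) b[of j] by auto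
      then show ?thesis using that by linarith
    qed
    then show ?thesis using a n by auto
  qed
  ultimately have eB: "card (edges x y ?B) = n" using n by simp
  have "\<not> isom x y ?A ?B" using isom_edges[of x y ?A ?B] eA eB n by auto
  then show "\<exists>A\<subseteq>V. card A = n \<and> conn x y A \<and> has_deg 3 x y A \<and>
      (5 \<le> n \<longrightarrow> (\<exists>B\<subseteq>V. card B = n \<and> conn x y B \<and> \<not> isom x y A B \<and> (has_deg 3 x y B \<or> card (edges x y B) = n)))"
    using A B A3 eB n by (intro exI[of _ ?A] conjI impI exI[of _ ?B]) auto
qed (use N in auto)

text \<open>Only \<open>q i\<close> can have degree 3. It is at most the second vertex of the
  segment, whereas a path vertex below it would come at least two steps earlier.\<close>

lemma no_low_fork:
  assumes p: "p \<in> V" "p \<notin> q ` {..m}" and i: "i \<le> m" "\<And>j. j \<le> m \<Longrightarrow> adj x y p (q j) \<longleftrightarrow> j = i" and an: "a + n \<le> Suc m"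
    and ia: "i \<le> Suc a"
  shows "\<not> low_fork x y (insert p (seg a n))"
proof
  assume "low_fork x y (insert p (seg a n))"
  then obtain c z where c: "c \<in> insert p (seg a n)" "3 \<le> deg x y (insert p (seg a n)) c" "z \<in> insert p (seg a n)" "lt x y z c"
    by (auto simp: low_fork_def)
  have cq: "c = q i" using deg3_only_fork[OF p i an c(1,2)] .
  have "z \<noteq> p" using c(4) cq i lt_not_adj[of x y p "q i"] by auto
  then obtain j where "j \<le> m" "a \<le> j" "z = q j" using c(3) segE[OF _ an] by (metis insertE)
  then show False using c(4) cq lt_q[of j i] i(1) ia by simp
qed

text \<open>The same fork is placed at the second and at the third vertex of a segment. In the
  latter case the first vertex lies below the branching point, and from length 5 on the branching
  point still has degree 3.\<close>

lemma fork_bad: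
  assumes N: "3 \<le> N" "N \<le> m" and p: "p \<in> V" "p \<notin> q ` {..m}" and i: "2 \<le> i" "i + N \<le> m"
    and a: "\<And>j. j \<le> m \<Longrightarrow> adj x y p (q j) \<longleftrightarrow> j = i"
  shows "\<not> sparse N x y V"
proof (rule four_not_sparse)
  fix n assume n: "4 \<le> n" "n \<le> N"
  let ?A = "insert p (seg (i - 1) (n - 1))" and ?B = "insert p (seg (i - 2) (n - 1))"
  have im: "i \<le> m" using i by simp
  have ai: "adj x y p (q i)" using a[of i] im by simp
  have A: "?A \<subseteq> V \<and> card ?A = Suc (n - 1) \<and> conn x y ?A"
    by (rule ext_props(1)[where i = i]) (use p i n ai in auto)
  have B: "?B \<subseteq> V \<and> card ?B = Suc (n - 1) \<and> conn x y ?B"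
    by (rule ext_props(1)[where i = i]) (use p i n ai in auto)
  have A3: "has_deg 3 x y ?A"
    by (rule fork_deg3(2)[of p _ i]) (use p i n ai in auto)
  have B3: "has_deg 3 x y ?B \<and> \<not> isom x y ?A ?B" if n5: "5 \<le> n"
  proof
    have d: "3 \<le> deg x y ?B (q i)" "has_deg 3 x y ?B"
      using fork_deg3[of p "i - 2" i "n - 1"] p i n n5 ai by auto
    show "has_deg 3 x y ?B" by (rule d)
    have "q i \<in> seg (i - 2) (n - 1)" "q (i - 2) \<in> seg (i - 2) (n - 1)" using i n by (auto simp: in_seg)
    moreover have "lt x y (q (i - 2)) (q i)" using asc[of "i - 2" i] i by simp
    ultimately have "low_fork x y ?B" unfolding low_fork_def using d by blast
    moreover have "\<not> low_fork x y ?A"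
      by (rule no_low_fork[OF p im a]) (use i n in auto)
    ultimately show "\<not> isom x y ?A ?B" using isom_invariants(2)[OF isom_sym[of x y ?A ?B]] by blast
  qed
  show "\<exists>A\<subseteq>V. card A = n \<and> conn x y A \<and> has_deg 3 x y A \<and>
      (5 \<le> n \<longrightarrow> (\<exists>B\<subseteq>V. card B = n \<and> conn x y B \<and> \<not> isom x y A B \<and> (has_deg 3 x y B \<or> card (edges x y B) = n)))"
    using A B A3 B3 n by (intro exI[of _ ?A] conjI impI exI[of _ ?B]) auto
qed (use N in auto)

text \<open>Near the lower end no vertex lies below the branching point, near the upper end some
  vertex does. At length 4 the scheme asks for one fork only.\<close>

lemma both_ends_bad:
  assumes N: "3 \<le> N" "N + 4 \<le> m" and p: "p \<in> V" "p \<notin> q ` {..m}" and p': "p' \<in> V" "p' \<notin> q ` {..m}"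
    and a: "\<And>j. j \<le> m \<Longrightarrow> adj x y p (q j) \<longleftrightarrow> j = 1"
    and a': "\<And>j. j \<le> m \<Longrightarrow> adj x y p' (q j) \<longleftrightarrow> j = m - 1"
  shows "\<not> sparse N x y V"
proof (rule four_not_sparse)
  fix n assume n: "4 \<le> n" "n \<le> N"
  let ?A = "insert p (seg 0 (n - 1))" and ?B = "insert p' (seg (m + 2 - n) (n - 1))"
  have m1: "1 \<le> m" "m - 1 \<le> m" using N by auto
  have ai: "adj x y p (q 1)" "adj x y p' (q (m - 1))" using a[of 1] a'[of "m - 1"] m1 by auto
  have A: "?A \<subseteq> V \<and> card ?A = Suc (n - 1) \<and> conn x y ?A"
    by (rule ext_props(1)[where i = 1]) (use p N n ai in auto)
  have B: "?B \<subseteq> V \<and> card ?B = Suc (n - 1) \<and> conn x y ?B"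
    by (rule ext_props(1)[where i = "m - 1"]) (use p' N n ai in auto)
  have A3: "has_deg 3 x y ?A"
    by (rule fork_deg3(2)[of p _ 1]) (use p N n ai in auto)
  have B3: "has_deg 3 x y ?B \<and> \<not> isom x y ?A ?B" if n5: "5 \<le> n"
  proof
    have d: "3 \<le> deg x y ?B (q (m - 1))" "has_deg 3 x y ?B"
      using fork_deg3[of p' "m + 2 - n" "m - 1" "n - 1"] p' N n n5 ai by auto
    show "has_deg 3 x y ?B" by (rule d)
    have "q (m - 1) \<in> seg (m + 2 - n) (n - 1)" "q (m - 3) \<in> seg (m + 2 - n) (n - 1)" using N n n5 by (auto simp: in_seg)
    moreover have "lt x y (q (m - 3)) (q (m - 1))" using asc[of "m - 3" "m - 1"] N by simp
    ultimately have "low_fork x y ?B" unfolding low_fork_def using d by blast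
    moreover have "\<not> low_fork x y ?A"
      by (rule no_low_fork[OF p m1(1) a]) (use N n in auto)
    ultimately show "\<not> isom x y ?A ?B" using isom_invariants(2)[OF isom_sym[of x y ?A ?B]] by blast
  qed
  show "\<exists>A\<subseteq>V. card A = n \<and> conn x y A \<and> has_deg 3 x y A \<and>
      (5 \<le> n \<longrightarrow> (\<exists>B\<subseteq>V. card B = n \<and> conn x y B \<and> \<not> isom x y A B \<and> (has_deg 3 x y B \<or> card (edges x y B) = n)))"
    using A B A3 B3 n by (intro exI[of _ ?A] conjI impI exI[of _ ?B]) auto
qed (use N in auto)

text \<open>Two adjacent twins form a triangle with \<open>q 1\<close>; two nonadjacent ones give
  \<open>q 1\<close> degree 4, while a fork with one twin has degree 3 there.\<close>

lemma double_end_bad: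
  assumes N: "3 \<le> N" "N + 4 \<le> m" and p: "p \<in> V" "p \<notin> q ` {..m}" and p': "p' \<in> V" "p' \<notin> q ` {..m}" and ne: "p \<noteq> p'"
    and a: "\<And>j. j \<le> m \<Longrightarrow> adj x y p (q j) \<longleftrightarrow> j = 1"
    and a': "\<And>j. j \<le> m \<Longrightarrow> adj x y p' (q j) \<longleftrightarrow> j = 1"
  shows "\<not> sparse N x y V"
proof -
  have m1: "1 \<le> m" using N by auto
  have ai: "adj x y p (q 1)" "adj x y p' (q 1)" using a[of 1] a'[of 1] m1 by auto
  show ?thesis
  proof (cases "adj x y p p'")
    case True
    show ?thesis
    proof (rule triangle_not_sparse)
      fix n assume n: "3 \<le> n" "n \<le> N"
      let ?A = "insert p (seg 1 (n - 2))"
      have A: "?A \<subseteq> V \<and> card ?A = Suc (n - 2) \<and> conn x y ?A"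
        by (rule ext_props(1)[where i = 1]) (use p N n ai in auto)
      have "finite ?A" by simp
      have "p' \<notin> ?A" using p' ne n N by (auto simp: seg_def)
      moreover have "conn x y (insert p' ?A)"
        by (rule conn_insert[of x y ?A p]) (use A True adj_sym[of x y p p'] in auto)
      moreover have "q 1 \<in> ?A" using n N by (auto simp: in_seg)
      then have "triangle x y (insert p' ?A)" unfolding triangle_def using ai True by blast
      ultimately show "\<exists>A\<subseteq>V. card A = n \<and> conn x y A \<and> triangle x y A"
        using A p'(1) n by (intro exI[of _ "insert p' ?A"]) auto
    qed (use N in auto)
  next
    case False
    show ?thesis
    proof (rule four_not_sparse)
      fix n assume n: "4 \<le> n" "n \<le> N"
      let ?A = "insert p (seg 0 (n - 1))" and ?C = "insert p (seg 0 (n - 2))"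
      let ?B = "insert p' ?C"
      have A: "?A \<subseteq> V \<and> card ?A = Suc (n - 1) \<and> conn x y ?A"
        by (rule ext_props(1)[where i = 1]) (use p N n ai in auto)
      have C: "?C \<subseteq> V \<and> card ?C = Suc (n - 2) \<and> conn x y ?C"
        by (rule ext_props(1)[where i = 1]) (use p N n ai in auto)
      have A3: "has_deg 3 x y ?A"
        by (rule fork_deg3(2)[of p _ 1]) (use p N n ai in auto)
      have pC: "p' \<notin> ?C" using p' ne n N by (auto simp: seg_def)
      have q1C: "q 1 \<in> ?C" using n N by (auto simp: in_seg)
      have B: "conn x y ?B" "card ?B = n" "?B \<subseteq> V"
        using conn_insert[of x y ?C "q 1" p'] C q1C ai pC p'(1) n by auto
      have B3: "has_deg 3 x y ?B \<and> \<not> isom x y ?A ?B" if n5: "5 \<le> n"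
      proof
        have "3 \<le> deg x y ?C (q 1)"
          using fork_deg3(1)[of p 0 1 "n - 2"] p N n n5 ai by auto
        moreover have "{v\<in>?B. adj x y (q 1) v} = insert p' {v\<in>?C. adj x y (q 1) v}"
          using ai adj_sym[of x y p' "q 1"] by auto
        then have "deg x y ?B (q 1) = Suc (deg x y ?C (q 1))" using pC by (simp add: deg_def)
        ultimately have "4 \<le> deg x y ?B (q 1)" by simp
        then have h4: "has_deg 4 x y ?B" unfolding has_deg_def using q1C by blast
        have "3 \<le> deg x y ?B (q 1)" using \<open>4 \<le> deg x y ?B (q 1)\<close> by simp
        then show "has_deg 3 x y ?B" unfolding has_deg_def using q1C by blast
        have "\<not> has_deg 4 x y ?A"
        proof
          assume "has_deg 4 x y ?A"
          then obtain c where c: "c \<in> ?A" "4 \<le> deg x y ?A c" by (auto simp: has_deg_def)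
          have "c = q 1" by (rule deg3_only_fork[OF p m1 a]) (use c N n in auto)
          then have "{v\<in>?A. adj x y c v} \<subseteq> insert p {v\<in>seg 0 (n - 1). adj x y (q 1) v}" by auto
          then have "deg x y ?A c \<le> card (insert p {v\<in>seg 0 (n - 1). adj x y (q 1) v})"
            unfolding deg_def by (intro card_mono) auto
          also have "\<dots> \<le> Suc (deg x y (seg 0 (n - 1)) (q 1))"
            unfolding deg_def by (simp add: card_insert_if)
          also have "\<dots> \<le> 3" using deg_seg[of 1 0 "n - 1"] m1 n N by simp
          finally show False using c by simp
        qed
        then show "\<not> isom x y ?A ?B" using isom_invariants(1)[OF isom_sym[of x y ?A ?B] h4] by blast
      qed
      show "\<exists>A\<subseteq>V. card A = n \<and> conn x y A \<and> has_deg 3 x y A \<and>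
          (5 \<le> n \<longrightarrow> (\<exists>B\<subseteq>V. card B = n \<and> conn x y B \<and> \<not> isom x y A B \<and> (has_deg 3 x y B \<or> card (edges x y B) = n)))"
        using A B A3 B3 n by (intro exI[of _ ?A] conjI impI exI[of _ ?B]) auto
    qed (use N in auto)
  qed
qed

text \<open>A vertex at least two steps after the neighbour \<open>q i\<close> cannot lie below
  \<open>p\<close>, and one at least two steps before the neighbour \<open>q k\<close> cannot lie
  above \<open>p\<close>. So the vertices that satisfy both are adjacent to \<open>p\<close>, and as
  consecutive neighbours are excluded there is at most one of them. For \<open>k = i + 3\<close> the
  point \<open>p\<close> would lie between the adjacent vertices \<open>q (i + 1)\<close> and
  \<open>q (i + 2)\<close>.\<close>

lemma two_nbrs:
  assumes p: "p \<in> V" "p \<notin> q ` {..m}" and ik: "i < k" "k \<le> m" and a: "adj x y p (q i)" "adj x y p (q k)"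
    and nc: "\<And>j. Suc j \<le> m \<Longrightarrow> \<not> (adj x y p (q j) \<and> adj x y p (q (Suc j)))"
  shows "k = i + 2 \<or> k = i + 4 \<and> adj x y p (q (i + 2))"
proof -
  have tri: "lt x y (q j) p \<or> lt x y p (q j) \<or> adj x y p (q j)" if "j \<le> m" for j
  proof -
    have "q j \<noteq> p" "q j \<in> V" using p that qV by auto
    then show ?thesis using trichotomy[OF injx injy, of "q j" p] p(1) adj_sym[of x y p "q j"] by metis
  qed
  have nlow: "\<not> lt x y (q j) p" if "i + 2 \<le> j" "j \<le> m" for j
    using lt_trans[OF asc[OF that]] a(1) lt_not_adj[of x y "q i" p] adj_sym[of x y p "q i"] by blast
  have nup: "\<not> lt x y p (q j)" if "j + 2 \<le> k" for j
    using lt_trans[OF _ asc[OF that ik(2)], of p] a(2) lt_not_adj[of x y p "q k"] by blast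
  have mid: "adj x y p (q j)" if "i + 2 \<le> j" "j + 2 \<le> k" for j
    using nlow[of j] nup[of j] tri[of j] that ik by auto
  have "k \<noteq> Suc i" using nc[of i] a ik by auto
  moreover have "\<not> i + 5 \<le> k"
    using mid[of "i + 2"] mid[of "Suc (i + 2)"] nc[of "i + 2"] ik by auto
  moreover have "k \<noteq> i + 3"
  proof
    assume k: "k = i + 3"
    have "\<not> adj x y p (q (Suc i))" using nc[of i] a ik by auto
    then have l: "lt x y (q (Suc i)) p" using tri[of "Suc i"] nup[of "Suc i"] k ik by auto
    have "\<not> adj x y p (q (i + 2))" using nc[of "i + 2"] a k ik by (auto simp: numeral_eq_Suc)
    then have "lt x y p (q (i + 2))" using tri[of "i + 2"] nlow[of "i + 2"] k ik by auto
    then have "lt x y (q (Suc i)) (q (i + 2))" using l lt_trans by metis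
    then show False using lt_q[of "Suc i" "i + 2"] k ik by simp
  qed
  moreover have "adj x y p (q (i + 2))" if "k = i + 4" using mid[of "i + 2"] that by simp
  ultimately show ?thesis using ik by linarith
qed

end

section \<open>The complement of a longest path\<close>

text \<open>By \<open>two_nbrs\<close>, the neighbours of an outside point span at most four steps
  once consecutive ones are excluded. With \<open>m\<close> at least \<open>2 * N + 8\<close>,
  \<open>N\<close> vertices then remain on one of the two sides of them.\<close>

locale long_opath = opath +
  fixes N :: nat
  assumes N3: "3 \<le> N" and m_ge: "2 * N + 8 \<le> m" and sp: "sparse N x y V" and con: "conn x y V"
    and longest: "\<And>q'. \<not> ipath x y V q' (Suc m)"
begin

lemma long_rev: "long_opath (\<lambda>u. - x u) (\<lambda>u. - y u) V (\<lambda>j. q (m - j)) m N"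
  by (rule long_opath.intro[OF opath_rev]) (unfold_locales, use N3 m_ge sp con longest in \<open>auto simp: sparse_uminus conn_uminus ipath_def adj_uminus\<close>)

lemma rev_image: "(\<lambda>j. q (m - j)) ` {..m} = q ` {..m}"
proof -
  have "q i \<in> (\<lambda>j. q (m - j)) ` {..m}" if "i \<le> m" for i
    using that by (intro image_eqI[of _ _ "m - i"]) auto
  then show ?thesis by auto
qed

lemma no_consecutive:
  assumes p: "p \<in> V" "p \<notin> q ` {..m}" and i: "Suc i \<le> m"
  shows "\<not> (adj x y p (q i) \<and> adj x y p (q (Suc i)))"
proof
  assume a: "adj x y p (q i) \<and> adj x y p (q (Suc i))"
  interpret r: opath "\<lambda>u. - x u" "\<lambda>u. - y u" V "\<lambda>j. q (m - j)" m by (rule opath_rev)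
  have Nm: "N \<le> m" using m_ge by simp
  show False
  proof (cases "i + N \<le> m")
    case True
    then show False using triangle_bad[OF N3 Nm p True] a sp by simp
  next
    case False
    have 1: "m - Suc i + N \<le> m" "m - (m - Suc i) = Suc i" "m - Suc (m - Suc i) = i" using False m_ge i by auto
    show False
      using r.triangle_bad[OF N3 Nm p(1) _ 1(1)] p(2) a sp 1 by (simp add: rev_image adj_uminus sparse_uminus)
  qed
qed

text \<open>If \<open>q k\<close> is the last neighbour and there is an earlier one, then
  \<open>two_nbrs\<close> makes \<open>q (k - 2)\<close> a neighbour in either of its cases. This is
  the configuration of \<open>square_bad\<close>.\<close>

lemma one_nbr_aux:
  assumes p: "p \<in> V" "p \<notin> q ` {..m}" and k: "k + N \<le> m" "i < k" "adj x y p (q i)" "adj x y p (q k)"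
    "\<And>j. k < j \<Longrightarrow> j \<le> m \<Longrightarrow> \<not> adj x y p (q j)"
  shows False
proof -
  have km: "k \<le> m" using k by simp
  have "k = i + 2 \<or> k = i + 4 \<and> adj x y p (q (i + 2))"
    using two_nbrs[OF p k(2) km k(3,4) no_consecutive[OF p]] .
  then have k2: "2 \<le> k" "adj x y p (q (k - 2))" using k(3) by auto
  have "\<not> adj x y p (q (Suc (k - 2)))" using no_consecutive[OF p, of "k - 2"] k2 km by auto
  moreover have "k - 2 + 2 = k" using k2 by simp
  ultimately show False
    using square_bad[OF N3 _ p, of "k - 2"] k k2 sp by simp
qed

lemma one_nbr:
  assumes p: "p \<in> V" "p \<notin> q ` {..m}" and ij: "i \<le> m" "j \<le> m" "adj x y p (q i)" "adj x y p (q j)"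
  shows "i = j"
proof (rule ccontr)
  assume ne: "i \<noteq> j"
  interpret r: long_opath "\<lambda>u. - x u" "\<lambda>u. - y u" V "\<lambda>j. q (m - j)" m N by (rule long_rev)
  let ?A = "{i. i \<le> m \<and> adj x y p (q i)}"
  have fA: "finite ?A" by simp
  define a where "a = Min ?A"
  define b where "b = Max ?A"
  have "?A \<noteq> {}" using ij by auto
  then have "a \<in> ?A" "b \<in> ?A" unfolding a_def b_def using Min_in[OF fA] Max_in[OF fA] by blast+
  then have a: "a \<le> m" "adj x y p (q a)" and b: "b \<le> m" "adj x y p (q b)" by auto
  have le: "a \<le> l \<and> l \<le> b" if "l \<le> m" "adj x y p (q l)" for l
    using that fA by (auto simp: a_def b_def)
  have ab: "a < b" using le[of i] le[of j] ij ne by linarith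
  have "b \<le> a + 4" using two_nbrs[OF p ab b(1) a(2) b(2) no_consecutive[OF p]] by auto
  show False
  proof (cases "b + N \<le> m")
    case True
    then show False using one_nbr_aux[OF p True ab a(2) b(2)] le by fastforce
  next
    case False
    \<comment> \<open>In the reversed path the smallest neighbour \<open>a\<close> becomes the last
      one.\<close>
    have "m - a + N \<le> m" using False \<open>b \<le> a + 4\<close> m_ge a by linarith
    moreover have "m - b < m - a" using ab a b by linarith
    moreover have "\<not> adj x y p (q (m - l))" if "m - a < l" "l \<le> m" for l
      using le[of "m - l"] that a by force
    ultimately show False
      using r.one_nbr_aux[OF p(1), of "m - a" "m - b"] p(2) a b by (simp add: rev_image adj_uminus)
  qed
qed

text \<open>A point attached to an end vertex would extend the path, and one attached to an inner
  vertex gives a costly fork in one of the two directions. What remains is a point with the same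
  path neighbour as an end, a twin of it.\<close>

lemma nbr_end:
  assumes p: "p \<in> V" "p \<notin> q ` {..m}" and i: "i \<le> m" "adj x y p (q i)"
  shows "i = 1 \<or> i = m - 1"
proof (rule ccontr)
  assume ne: "\<not> ?thesis"
  interpret r: long_opath "\<lambda>u. - x u" "\<lambda>u. - y u" V "\<lambda>j. q (m - j)" m N by (rule long_rev)
  have a: "adj x y p (q j) \<longleftrightarrow> j = i" if "j \<le> m" for j using one_nbr[OF p] i that by auto
  have ra: "adj x y p (q (m - j)) \<longleftrightarrow> j = m - i" if "j \<le> m" for j using a[of "m - j"] i that by auto
  have Nm: "N \<le> m" using m_ge by simp
  have "i \<noteq> 0"
  proof
    assume "i = 0"
    then show False using ipath_extend[OF ip p] a longest by blast
  qed
  moreover have "i \<noteq> m"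
  proof
    assume im: "i = m"
    have "ipath (\<lambda>u. - x u) (\<lambda>u. - y u) V (case_nat p (\<lambda>j. q (m - j))) (Suc m)"
      by (rule ipath_extend[OF r.ip p(1)]) (use p ra im in \<open>auto simp: rev_image adj_uminus\<close>)
    then show False using r.longest by blast
  qed
  ultimately have i2: "2 \<le> i" "2 \<le> m - i" using ne i by linarith+
  show False
  proof (cases "i + N \<le> m")
    case True
    then show False using fork_bad[OF N3 Nm p i2(1) True a] sp by simp
  next
    case False
    then have 1: "m - i + N \<le> m" using m_ge i by linarith
    show False
      using r.fork_bad[OF N3 Nm p(1) _ i2(2) 1] p(2) ra sp by (simp add: rev_image adj_uminus sparse_uminus)
  qed
qed

lemma end_twin:
  assumes p: "p \<in> V" "p \<notin> q ` {..m}" and i: "i \<le> m" "adj x y p (q i)"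
  shows "(\<forall>j\<le>m. adj x y p (q j) \<longleftrightarrow> j = 1) \<or> (\<forall>j\<le>m. adj x y p (q j) \<longleftrightarrow> j = m - 1)"
proof -
  have "adj x y p (q j) \<longleftrightarrow> j = i" if "j \<le> m" for j using one_nbr[OF p] i that by auto
  then show ?thesis using nbr_end[OF p i] by auto
qed

text \<open>Replacing \<open>q 0\<close> by its twin \<open>p\<close> and putting \<open>z\<close>
  in front would give a longer path.\<close>

lemma twin_no_more:
  assumes p: "p \<in> V" "p \<notin> q ` {..m}" "\<And>j. j \<le> m \<Longrightarrow> adj x y p (q j) \<longleftrightarrow> j = 1"
    and z: "z \<in> V" "z \<notin> q ` {..m}" "z \<noteq> p" "\<And>j. j \<le> m \<Longrightarrow> \<not> adj x y z (q j)"
  shows "\<not> adj x y z p"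
proof
  assume zp: "adj x y z p"
  have m1: "1 \<le> m" using m_ge by simp
  have "ipath x y V (q(0 := p)) m"
    unfolding ipath_def
  proof (intro conjI allI impI)
    show "(q(0 := p)) ` {..m} \<subseteq> V" using p(1) qV by auto
    show "inj_on (q(0 := p)) {..m}"
    proof (rule inj_onI)
      fix i j assume ij: "i \<in> {..m}" "j \<in> {..m}" "(q(0 := p)) i = (q(0 := p)) j"
      have "q k \<noteq> p" if "k \<le> m" for k using p(2) that by auto
      then show "i = j" using ij q_eq[of i j] by (auto split: if_splits)
    qed
    fix i j assume "i \<le> m" "j \<le> m"
    then show "adj x y ((q(0 := p)) i) ((q(0 := p)) j) \<longleftrightarrow> j = Suc i \<or> i = Suc j"
      using adj_q[of i j] p(3)[of j] p(3)[of i] adj_sym[of x y p "q i"] by auto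
  qed
  moreover have "z \<notin> (q(0 := p)) ` {..m}" using z by auto
  moreover have "adj x y z ((q(0 := p)) i) \<longleftrightarrow> i = 0" if "i \<le> m" for i using zp z(4) that by auto
  ultimately show False using ipath_extend[of x y V "q(0 := p)" m z] z(1) longest by blast
qed

text \<open>At most one outside point has a neighbour on the path. By connectivity, any further
  point would lead to one that is attached to this twin alone, and \<open>twin_no_more\<close>
  excludes that.\<close>

lemma path_or_fork:
  obtains "V = q ` {..m}"
  | p where "V = insert p (q ` {..m})" "p \<notin> q ` {..m}" "\<And>j. j \<le> m \<Longrightarrow> adj x y p (q j) \<longleftrightarrow> j = 1"
  | p where "V = insert p (q ` {..m})" "p \<notin> q ` {..m}" "\<And>j. j \<le> m \<Longrightarrow> adj x y p (q j) \<longleftrightarrow> j = m - 1"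
proof -
  interpret r: long_opath "\<lambda>u. - x u" "\<lambda>u. - y u" V "\<lambda>j. q (m - j)" m N by (rule long_rev)
  let ?P = "q ` {..m}"
  have PV: "?P \<subseteq> V" using qV by auto
  have N4: "N + 4 \<le> m" using m_ge by simp
  have out: "(\<forall>j\<le>m. adj x y p (q j) \<longleftrightarrow> j = 1) \<or> (\<forall>j\<le>m. adj x y p (q j) \<longleftrightarrow> j = m - 1)"
    if "p \<in> V" "p \<notin> ?P" "u \<in> ?P" "adj x y p u" for p u
  proof -
    obtain i where "i \<le> m" "u = q i" using \<open>u \<in> ?P\<close> by auto
    then show ?thesis using end_twin[OF that(1,2)] that(4) by blast
  qed
  show thesis
  proof (cases "V = ?P")
    case True
    then show thesis by (rule that(1))
  next
    case False
    have "?P \<subset> V" "?P \<noteq> {}" using False PV by auto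
    then obtain u p where up: "u \<in> ?P" "p \<in> V - ?P" "adj x y u p" using con unfolding conn_def by meson
    have p: "p \<in> V" "p \<notin> ?P" "adj x y p u" using up adj_sym[of x y p u] by auto
    have uniq: "p' = p" if p': "p' \<in> V" "p' \<notin> ?P" "u' \<in> ?P" "adj x y p' u'" for p' u'
    proof (rule ccontr)
      assume ne: "p' \<noteq> p"
      have rev: "\<forall>j\<le>m. adj x y s (q (m - j)) \<longleftrightarrow> j = 1" if "\<forall>j\<le>m. adj x y s (q j) \<longleftrightarrow> j = m - 1" for s
      proof (intro allI impI)
        fix j assume "j \<le> m"
        then show "adj x y s (q (m - j)) \<longleftrightarrow> j = 1" using that[rule_format, of "m - j"] m_ge by auto
      qed
      from out[OF p(1,2) up(1) p(3)] out[OF p'] show False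
      proof (elim disjE)
        assume a: "\<forall>j\<le>m. adj x y p (q j) \<longleftrightarrow> j = 1" "\<forall>j\<le>m. adj x y p' (q j) \<longleftrightarrow> j = 1"
        show False using double_end_bad[OF N3 N4 p(1,2) p'(1,2) ne[symmetric]] a sp by blast
      next
        assume a: "\<forall>j\<le>m. adj x y p (q j) \<longleftrightarrow> j = 1" "\<forall>j\<le>m. adj x y p' (q j) \<longleftrightarrow> j = m - 1"
        show False using both_ends_bad[OF N3 N4 p(1,2) p'(1,2)] a sp by blast
      next
        assume a: "\<forall>j\<le>m. adj x y p (q j) \<longleftrightarrow> j = m - 1" "\<forall>j\<le>m. adj x y p' (q j) \<longleftrightarrow> j = 1"
        show False using both_ends_bad[OF N3 N4 p'(1,2) p(1,2)] a sp by blast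
      next
        assume a: "\<forall>j\<le>m. adj x y p (q j) \<longleftrightarrow> j = m - 1" "\<forall>j\<le>m. adj x y p' (q j) \<longleftrightarrow> j = m - 1"
        have "\<not> sparse N (\<lambda>u. - x u) (\<lambda>u. - y u) V"
          by (rule r.double_end_bad[OF N3 N4 p(1) _ p'(1) _ ne[symmetric]])
            (use p(2) p'(2) rev[OF a(1)] rev[OF a(2)] in \<open>auto simp: rev_image adj_uminus\<close>)
        then show False using sp by (simp add: sparse_uminus)
      qed
    qed
    have Veq: "V = insert p ?P"
    proof (rule ccontr)
      assume "V \<noteq> insert p ?P"
      then have "insert p ?P \<subset> V" "insert p ?P \<noteq> {}" using PV p by auto
      then obtain v z where vz: "v \<in> insert p ?P" "z \<in> V - insert p ?P" "adj x y v z" using con unfolding conn_def by meson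
      have z: "z \<in> V" "z \<notin> ?P" "z \<noteq> p" "adj x y z v" using vz adj_sym[of x y z v] by auto
      have zP: "\<not> adj x y z s" if "s \<in> ?P" for s using uniq[OF z(1,2) that] z(3) by blast
      then have "v = p" using vz z by auto
      then have zp: "adj x y z p" using z by simp
      from out[OF p(1,2) up(1) p(3)] show False
      proof
        assume a: "\<forall>j\<le>m. adj x y p (q j) \<longleftrightarrow> j = 1"
        then show False using twin_no_more[OF p(1,2) _ z(1-3)] zP zp by blast
      next
        assume a: "\<forall>j\<le>m. adj x y p (q j) \<longleftrightarrow> j = m - 1"
        have "adj x y p (q (m - j)) \<longleftrightarrow> j = 1" if "j \<le> m" for j using a[rule_format, of "m - j"] that m_ge by auto
        then have "\<not> adj (\<lambda>u. - x u) (\<lambda>u. - y u) z p"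
          by (intro r.twin_no_more[OF p(1) _ _ z(1)]) (use p(2) z(2,3) zP in \<open>auto simp: rev_image adj_uminus\<close>)
        then show False using zp by (simp add: adj_uminus)
      qed
    qed
    from out[OF p(1,2) up(1) p(3)] show thesis
    proof
      assume "\<forall>j\<le>m. adj x y p (q j) \<longleftrightarrow> j = 1"
      then show thesis using that(2)[OF Veq p(2)] by blast
    next
      assume "\<forall>j\<le>m. adj x y p (q j) \<longleftrightarrow> j = m - 1"
      then show thesis using that(3)[OF Veq p(2)] by blast
    qed
  qed
qed

end

section \<open>Normal forms of paths and forks\<close>

text \<open>The comparison of \<open>q 0\<close> and \<open>q 2\<close> propagates along the path: a
  later comparison in the other direction would, by transitivity, make two adjacent vertices
  comparable.\<close>

lemma ipath_opath:
  assumes fin: "finite V" and inj: "inj_on x V" "inj_on y V" and ip: "ipath x y V q m" and m: "2 \<le> m"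
  shows "opath x y V q m \<or> opath (\<lambda>u. - x u) (\<lambda>u. - y u) V q m"
proof -
  have main: "opath x y V q m"
    if inj: "inj_on x V" "inj_on y V" and ip: "ipath x y V q m" and l: "lt x y (q 0) (q 2)" for x y :: "'a \<Rightarrow> int"
  proof
    have qV: "q i \<in> V" if "i \<le> m" for i using ip that by (auto simp: ipath_def)
    have ad: "adj x y (q i) (q j) \<longleftrightarrow> j = Suc i \<or> i = Suc j" if "i \<le> m" "j \<le> m" for i j
      using ip that by (auto simp: ipath_def)
    have cmp: "lt x y (q i) (q j) \<or> lt x y (q j) (q i)" if "i + 2 \<le> j" "j \<le> m" for i j
    proof -
      have "inj_on q {..m}" using ip by (simp add: ipath_def)
      then have "q i \<noteq> q j" using inj_on_contraD[of q "{..m}" i j] that by auto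
      moreover have "\<not> adj x y (q i) (q j)" using ad that by auto
      ultimately show ?thesis using trichotomy[OF inj, of "q i" "q j"] qV that by (meson le_trans add_leD1)
    qed
    have nl: "\<not> lt x y (q i) (q (Suc i))" "\<not> lt x y (q (Suc i)) (q i)" if "Suc i \<le> m" for i
      using ad[of i "Suc i"] ad[of "Suc i" i] lt_not_adj[of x y] that by auto
    have step: "lt x y (q i) (q (i + 2))" if "i + 2 \<le> m" for i
      using that
    proof (induction i)
      case 0
      then show ?case using l by (simp add: numeral_2_eq_2)
    next
      case (Suc i)
      then have IH: "lt x y (q i) (q (i + 2))" by simp
      have a: "lt x y (q i) (q (i + 3))"
      proof (rule ccontr)
        assume "\<not> ?thesis"
        then have "lt x y (q (i + 3)) (q i)" using cmp[of i "i + 3"] Suc.prems by auto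
        then have "lt x y (q (Suc (i + 2))) (q (i + 2))" using IH lt_trans[of x y "q (i + 3)" "q i" "q (i + 2)"] by (simp add: numeral_eq_Suc)
        then show False using nl(2)[of "i + 2"] Suc.prems by simp
      qed
      show ?case
      proof (rule ccontr)
        assume "\<not> ?thesis"
        then have "lt x y (q (i + 3)) (q (Suc i))" using cmp[of "Suc i" "i + 3"] Suc.prems by (auto simp: numeral_eq_Suc)
        then have "lt x y (q i) (q (Suc i))" using a lt_trans by metis
        then show False using nl(1)[of i] Suc.prems by simp
      qed
    qed
    show "lt x y (q i) (q j)" if "i + 2 \<le> j" "j \<le> m" for i j
      using that
    proof (induction j rule: dec_induct)
      case base
      then show ?case using step by simp
    next
      case (step n)
      then have IH: "lt x y (q i) (q n)" by simp
      show ?case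
      proof (rule ccontr)
        assume "\<not> ?thesis"
        then have "lt x y (q (Suc n)) (q i)" using cmp[of i "Suc n"] step by auto
        then have "lt x y (q (Suc n)) (q n)" using IH lt_trans by metis
        then show False using nl(2)[of n] step by simp
      qed
    qed
  qed (use fin that in auto)
  have "inj_on q {..m}" using ip by (simp add: ipath_def)
  then have "q 0 \<noteq> q 2" using inj_on_contraD[of q "{..m}" 0 2] m by auto
  moreover have "q 0 \<in> V" "q 2 \<in> V" using ip m by (auto simp: ipath_def)
  moreover have "\<not> adj x y (q 0) (q 2)" using ip m by (auto simp: ipath_def)
  ultimately have "lt x y (q 0) (q 2) \<or> lt x y (q 2) (q 0)" using trichotomy[OF inj, of "q 0" "q 2"] by metis
  then show ?thesis
  proof
    assume "lt x y (q 0) (q 2)"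
    then show ?thesis using main[OF inj ip] by simp
  next
    assume "lt x y (q 2) (q 0)"
    then have "lt (\<lambda>u. - x u) (\<lambda>u. - y u) (q 0) (q 2)" by (simp add: lt_uminus)
    moreover have "inj_on (\<lambda>u. - x u) V" "inj_on (\<lambda>u. - y u) V" using inj by (auto simp: inj_on_def)
    moreover have "ipath (\<lambda>u. - x u) (\<lambda>u. - y u) V q m" using ip by (simp add: ipath_def adj_uminus)
    ultimately show ?thesis using main by simp
  qed
qed

context opath
begin

lemma nw_parity: "Suc i \<le> m \<Longrightarrow> nw x y (q i) (q (Suc i)) \<longleftrightarrow> (even i \<longleftrightarrow> nw x y (q 0) (q 1))"
proof (induction i)
  case (Suc i)
  then show ?case using nw_alternate[of i] by auto
qed auto

lemma nw_parity': "Suc i \<le> m \<Longrightarrow> nw x y (q (Suc i)) (q i) \<longleftrightarrow> \<not> (even i \<longleftrightarrow> nw x y (q 0) (q 1))"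
  using nw_parity[of i] adj_q[of i "Suc i"] nw_asym[of x y "q i" "q (Suc i)"] by (auto simp: adj_def)

text \<open>The order of the points depends on nothing but the indices and the direction of the
  first edge; hence paths that agree in this direction embed into each other index by index.\<close>

lemma xq_less:
  assumes "i \<le> m" "j \<le> m"
  shows "x (q i) < x (q j) \<longleftrightarrow> i + 2 \<le> j \<or> j = Suc i \<and> (even i \<longleftrightarrow> nw x y (q 0) (q 1)) \<or>
    i = Suc j \<and> \<not> (even j \<longleftrightarrow> nw x y (q 0) (q 1))"
proof -
  consider "i + 2 \<le> j" | "j + 2 \<le> i" | "j = Suc i" | "i = Suc j" | "i = j" by linarith
  then show ?thesis
  proof cases
    case 1 then show ?thesis using asc[of i j] assms by (auto simp: lt_def)
  next
    case 2 then show ?thesis using asc[of j i] assms by (auto simp: lt_def)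
  next
    case 3 then show ?thesis using nw_parity[of i] nw_parity'[of i] assms by (auto simp: nw_def)
  next
    case 4 then show ?thesis using nw_parity[of j] nw_parity'[of j] assms by (auto simp: nw_def)
  qed auto
qed

lemma yq_less:
  assumes "i \<le> m" "j \<le> m"
  shows "y (q i) < y (q j) \<longleftrightarrow> i + 2 \<le> j \<or> j = Suc i \<and> \<not> (even i \<longleftrightarrow> nw x y (q 0) (q 1)) \<or>
    i = Suc j \<and> (even j \<longleftrightarrow> nw x y (q 0) (q 1))"
proof -
  consider "i + 2 \<le> j" | "j + 2 \<le> i" | "j = Suc i" | "i = Suc j" | "i = j" by linarith
  then show ?thesis
  proof cases
    case 1 then show ?thesis using asc[of i j] assms by (auto simp: lt_def)
  next
    case 2 then show ?thesis using asc[of j i] assms by (auto simp: lt_def)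
  next
    case 3 then show ?thesis using nw_parity[of i] nw_parity'[of i] assms by (auto simp: nw_def)
  next
    case 4 then show ?thesis using nw_parity[of j] nw_parity'[of j] assms by (auto simp: nw_def)
  qed auto
qed

text \<open>For \<open>j\<close> at least 3, \<open>q 1\<close> lies below \<open>q j\<close>, so
  \<open>q j\<close> below \<open>p\<close> would put \<open>q 1\<close> below its neighbour
  \<open>p\<close>. If \<open>q 2\<close> were below \<open>p\<close>, it would also be below its
  neighbour \<open>q 3\<close>.\<close>

lemma twin_lt:
  assumes p: "p \<in> V" "p \<notin> q ` {..m}" "\<And>j. j \<le> m \<Longrightarrow> adj x y p (q j) \<longleftrightarrow> j = 1" and j: "2 \<le> j" "j \<le> m" and m: "3 \<le> m"
  shows "lt x y p (q j)"
proof -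
  have cmp: "lt x y p (q j) \<or> lt x y (q j) p" if "j \<le> m" "j \<noteq> 1" for j
  proof -
    have "p \<noteq> q j" "q j \<in> V" using p(2) that qV by auto
    then show ?thesis using trichotomy[OF injx injy p(1), of "q j"] p(3)[of j] that by metis
  qed
  have a1: "\<not> lt x y (q 1) p" "\<not> lt x y p (q 1)"
    using p(3)[of 1] m lt_not_adj[of x y p "q 1"] lt_not_adj[of x y "q 1" p] adj_sym[of x y p "q 1"] by auto
  have ge3: "lt x y p (q j)" if "3 \<le> j" "j \<le> m" for j
    using cmp[of j] lt_trans[OF asc[of 1 j], of p] a1 that by auto
  show ?thesis
  proof (cases "j = 2")
    case True
    show ?thesis
    proof (rule ccontr)
      assume "\<not> ?thesis"
      then have "lt x y (q 2) p" using cmp[of 2] True j by auto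
      then have "lt x y (q 2) (q 3)" using ge3[of 3] m lt_trans[of x y "q 2" p "q 3"] by simp
      then show False using lt_q[of 2 3] m by simp
    qed
  next
    case False
    then show ?thesis using ge3 j by simp
  qed
qed

text \<open>If the edges from \<open>q 0\<close> and from its twin to \<open>q 1\<close> had
  opposite directions, transitivity would make the twins adjacent.\<close>

lemma twin_nw:
  assumes p: "p \<in> V" "p \<notin> q ` {..m}" "\<And>j. j \<le> m \<Longrightarrow> adj x y p (q j) \<longleftrightarrow> j = 1" and m: "3 \<le> m"
  shows "nw x y p (q 1) \<longleftrightarrow> nw x y (q 0) (q 1)" "nw x y (q 1) p \<longleftrightarrow> \<not> nw x y (q 0) (q 1)"
proof -
  have "adj x y p (q 1)" "\<not> adj x y p (q 0)" "adj x y (q 0) (q 1)" using p(3)[of 1] p(3)[of 0] adj_q[of 0 1] m by auto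
  moreover have "\<not> (nw x y p (q 1) \<and> nw x y (q 1) (q 0))" "\<not> (nw x y (q 0) (q 1) \<and> nw x y (q 1) p)"
    using nw_trans[of x y p "q 1" "q 0"] nw_trans[of x y "q 0" "q 1" p] calculation by (auto simp: adj_def)
  ultimately show "nw x y p (q 1) \<longleftrightarrow> nw x y (q 0) (q 1)" "nw x y (q 1) p \<longleftrightarrow> \<not> nw x y (q 0) (q 1)"
    using nw_asym[of x y p "q 1"] by (auto simp: adj_def)
qed

end

text \<open>\<open>b\<close> is the orientation of the first edge of the path and \<open>e\<close> tells whether its end \<open>q 0\<close> has a twin \<open>p\<close>.\<close>

definition fork_form :: "('a \<Rightarrow> int) \<Rightarrow> ('a \<Rightarrow> int) \<Rightarrow> 'a set \<Rightarrow> nat \<Rightarrow> bool \<Rightarrow> bool \<Rightarrow> bool" where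
  "fork_form x y V m b e \<longleftrightarrow> (\<exists>q. opath x y V q m \<and> (nw x y (q 0) (q 1) \<longleftrightarrow> b) \<and>
     (if e then \<exists>p. V = insert p (q ` {..m}) \<and> p \<notin> q ` {..m} \<and> (\<forall>j\<le>m. adj x y p (q j) \<longleftrightarrow> j = 1) \<and> lt x y p (q 0)
      else V = q ` {..m}))"

text \<open>The end of the path and its twin have the same neighbour on the rest of the path, so
  they can be exchanged; the lower one is taken as the twin.\<close>

lemma fork_form_twin:
  assumes op: "opath x y V q m" and m: "3 \<le> m" and V: "V = insert p (q ` {..m})" and p: "p \<notin> q ` {..m}"
    "\<And>j. j \<le> m \<Longrightarrow> adj x y p (q j) \<longleftrightarrow> j = 1"
  shows "\<exists>b. fork_form x y V m b True"
proof -
  interpret opath x y V q m by (rule op)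
  have pV: "p \<in> V" using V by simp
  have p0: "p \<noteq> q 0" "\<not> adj x y p (q 0)" using p(1) p(2)[of 0] by auto
  have "lt x y p (q 0) \<or> lt x y (q 0) p"
    using trichotomy[OF injx injy pV qV[of 0]] p0 by auto
  then show ?thesis
  proof
    assume "lt x y p (q 0)"
    then show ?thesis unfolding fork_form_def using op V p by (intro exI[of _ "nw x y (q 0) (q 1)"] exI[of _ q]) auto
  next
    assume l: "lt x y (q 0) p"
    let ?q = "q(0 := p)"
    have s: "{..m} = insert 0 {1..m}" by auto
    have "?q ` {1..m} = q ` {1..m}" by auto
    then have im: "insert p (q ` {..m}) = insert (q 0) (?q ` {..m})" unfolding s image_insert by auto
    have op': "opath x y V ?q m"
    proof
      show "ipath x y V ?q m"
        unfolding ipath_def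
      proof (intro conjI allI impI)
        show "?q ` {..m} \<subseteq> V" using pV qV by auto
        show "inj_on ?q {..m}"
        proof (rule inj_onI)
          fix i j assume ij: "i \<in> {..m}" "j \<in> {..m}" "?q i = ?q j"
          have "q k \<noteq> p" if "k \<le> m" for k using p(1) that by auto
          then show "i = j" using ij q_eq[of i j] by (auto split: if_splits)
        qed
        fix i j assume "i \<le> m" "j \<le> m"
        then show "adj x y (?q i) (?q j) \<longleftrightarrow> j = Suc i \<or> i = Suc j"
          using adj_q[of i j] p(2)[of j] p(2)[of i] adj_sym[of x y p "q i"] by auto
      qed
      fix i j assume ij: "i + 2 \<le> j" "j \<le> m"
      then show "lt x y (?q i) (?q j)" using asc[OF ij] twin_lt[OF pV p _ ij(2) m] by auto
    qed (use fin injx injy in auto)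
    have "q 0 \<notin> ?q ` {..m}"
    proof
      assume "q 0 \<in> ?q ` {..m}"
      then obtain j where "q 0 = ?q j" "j \<in> {..m}" by (rule imageE)
      then show False using p0(1) q_eq[of 0 j] by (auto split: if_splits)
    qed
    moreover have "\<forall>j\<le>m. adj x y (q 0) (?q j) \<longleftrightarrow> j = 1"
      using adj_q[of 0] p0 adj_sym[of x y p "q 0"] by auto
    moreover have "V = insert (q 0) (?q ` {..m})" using V im by simp
    moreover have "lt x y (q 0) (?q 0)" using l by simp
    ultimately have "\<exists>p'. V = insert p' (?q ` {..m}) \<and> p' \<notin> ?q ` {..m} \<and>
        (\<forall>j\<le>m. adj x y p' (?q j) \<longleftrightarrow> j = 1) \<and> lt x y p' (?q 0)" by blast
    then show ?thesis unfolding fork_form_def if_True using op' by blast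
  qed
qed

text \<open>Negating both coordinates makes a descending path ascend, and together with reversing
  the path it moves a twin of the last vertex to \<open>q 0\<close>. This is the reason for the
  alternative in the conclusion.\<close>

lemma fork_form_exists:
  assumes fin: "finite V" and inj: "inj_on x V" "inj_on y V" and con: "conn x y V" and N: "3 \<le> N"
    and sp: "sparse N x y V" and ip: "ipath x y V q0 (2 * N + 8)"
  shows "\<exists>m b e. 3 \<le> m \<and> (fork_form x y V m b e \<or> fork_form (\<lambda>u. - x u) (\<lambda>u. - y u) V m b e)"
proof -
  have bound: "m < Suc (card V)" if "ipath x y V q m" for q m
  proof -
    have "card (q ` {..m}) \<le> card V" "inj_on q {..m}" using that fin by (auto simp: ipath_def intro: card_mono)
    then show ?thesis by (simp add: card_image)
  qed
  have "\<exists>m. (\<exists>q. ipath x y V q m) \<and> (\<forall>m'. (\<exists>q. ipath x y V q m') \<longrightarrow> m' \<le> m)"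
    by (rule ex_has_greatest_nat[of "\<lambda>m. \<exists>q. ipath x y V q m" _ "\<lambda>m. m" "Suc (card V)"]) (use ip bound in blast)+
  then obtain m q where q: "ipath x y V q m" and mx: "\<And>m' q'. ipath x y V q' m' \<Longrightarrow> m' \<le> m" by blast
  have m: "2 * N + 8 \<le> m" using mx[OF ip] .
  have longest: "\<not> ipath x y V q' (Suc m)" for q' using mx[of q' "Suc m"] by auto
  have main: "\<exists>b e. fork_form x' y' V m b e \<or> fork_form (\<lambda>u. - x' u) (\<lambda>u. - y' u) V m b e"
    if "opath x' y' V q m" "sparse N x' y' V" "conn x' y' V" "\<And>q'. \<not> ipath x' y' V q' (Suc m)" for x' y' :: "'a \<Rightarrow> int"
  proof -
    interpret long_opath x' y' V q m N
      by (rule long_opath.intro[OF that(1)]) (unfold_locales, use N m that in auto)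
    have m3: "3 \<le> m" using m by simp
    show ?thesis
    proof (rule path_or_fork)
      assume "V = q ` {..m}"
      then show ?thesis using opath_axioms unfolding fork_form_def by (intro exI[of _ "nw x' y' (q 0) (q 1)"] exI[of _ False]) auto
    next
      fix p assume "V = insert p (q ` {..m})" "p \<notin> q ` {..m}" "\<And>j. j \<le> m \<Longrightarrow> adj x' y' p (q j) \<longleftrightarrow> j = 1"
      then show ?thesis using fork_form_twin[OF opath_axioms m3] by blast
    next
      fix p assume p: "V = insert p (q ` {..m})" "p \<notin> q ` {..m}" "\<And>j. j \<le> m \<Longrightarrow> adj x' y' p (q j) \<longleftrightarrow> j = m - 1"
      have "\<exists>b. fork_form (\<lambda>u. - x' u) (\<lambda>u. - y' u) V m b True"
      proof (rule fork_form_twin[OF opath_rev m3])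
        show "adj (\<lambda>u. - x' u) (\<lambda>u. - y' u) p (q (m - j)) \<longleftrightarrow> j = 1" if "j \<le> m" for j
          using p(3)[of "m - j"] that m by (auto simp: adj_uminus)
      qed (use p in \<open>auto simp: rev_image\<close>)
      then show ?thesis by blast
    qed
  qed
  have "opath x y V q m \<or> opath (\<lambda>u. - x u) (\<lambda>u. - y u) V q m"
    by (rule ipath_opath[OF fin inj q]) (use m in simp)
  then have "\<exists>b e. fork_form x y V m b e \<or> fork_form (\<lambda>u. - x u) (\<lambda>u. - y u) V m b e"
  proof
    assume "opath x y V q m"
    then show ?thesis using main[OF _ sp con longest] by blast
  next
    assume "opath (\<lambda>u. - x u) (\<lambda>u. - y u) V q m"
    then show ?thesis using main[of "\<lambda>u. - x u" "\<lambda>u. - y u"] sp con longest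
      by (simp add: sparse_uminus conn_uminus ipath_def adj_uminus) blast
  qed
  moreover have "3 \<le> m" using m by simp
  ultimately show ?thesis by blast
qed

text \<open>Vertices with equal indices correspond, and so do the twins. The relations are fixed by
  the indices, \<open>b\<close> and the choice of the lower twin, so the shorter form sits at the
  beginning of the longer one.\<close>

lemma fork_form_embeds:
  assumes f: "fork_form x y V m b e" and f': "fork_form x' y' V' m' b e" and m: "3 \<le> m" "m \<le> m'"
  shows "embeds x y V x' y' V'"
proof -
  obtain q where q: "opath x y V q m" "nw x y (q 0) (q 1) \<longleftrightarrow> b"
    "if e then \<exists>p. V = insert p (q ` {..m}) \<and> p \<notin> q ` {..m} \<and> (\<forall>j\<le>m. adj x y p (q j) \<longleftrightarrow> j = 1) \<and> lt x y p (q 0) else V = q ` {..m}"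
    using f unfolding fork_form_def by blast
  obtain q' where q': "opath x' y' V' q' m'" "nw x' y' (q' 0) (q' 1) \<longleftrightarrow> b"
    "if e then \<exists>p. V' = insert p (q' ` {..m'}) \<and> p \<notin> q' ` {..m'} \<and> (\<forall>j\<le>m'. adj x' y' p (q' j) \<longleftrightarrow> j = 1) \<and> lt x' y' p (q' 0) else V' = q' ` {..m'}"
    using f' unfolding fork_form_def by blast
  interpret a: opath x y V q m by (rule q)
  interpret b: opath x' y' V' q' m' by (rule q')
  let ?r = "the_inv_into {..m} q"
  have injq: "inj_on q {..m}" using a.ip by (simp add: ipath_def)
  have r: "?r (q i) = i" if "i \<le> m" for i using the_inv_into_f_f[OF injq] that by simp
  have qq: "(x (q i) < x (q j) \<longleftrightarrow> x' (q' i) < x' (q' j)) \<and> (y (q i) < y (q j) \<longleftrightarrow> y' (q' i) < y' (q' j))"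
    if "i \<le> m" "j \<le> m" for i j
    using a.xq_less[OF that] a.yq_less[OF that] b.xq_less[of i j] b.yq_less[of i j] q(2) q'(2) that m by simp
  show ?thesis
  proof (cases e)
    case False
    then have V: "V = q ` {..m}" "V' = q' ` {..m'}" using q q' by auto
    have "emb x y V x' y' V' (\<lambda>v. q' (?r v))"
      unfolding emb_def V using qq r m by auto
    then show ?thesis unfolding embeds_def by blast
  next
    case True
    then obtain p p' where p: "V = insert p (q ` {..m})" "p \<notin> q ` {..m}" "\<And>j. j \<le> m \<Longrightarrow> adj x y p (q j) \<longleftrightarrow> j = 1" "lt x y p (q 0)"
      and p': "V' = insert p' (q' ` {..m'})" "p' \<notin> q' ` {..m'}" "\<And>j. j \<le> m' \<Longrightarrow> adj x' y' p' (q' j) \<longleftrightarrow> j = 1" "lt x' y' p' (q' 0)"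
      using q(3) q'(3) by auto
    have rel: "(x p < x (q j) \<longleftrightarrow> (j \<noteq> 1 \<or> b)) \<and> (y p < y (q j) \<longleftrightarrow> (j \<noteq> 1 \<or> \<not> b)) \<and>
        (x (q j) < x p \<longleftrightarrow> (j = 1 \<and> \<not> b)) \<and> (y (q j) < y p \<longleftrightarrow> (j = 1 \<and> b))"
      if op: "opath x y V q m" and m: "3 \<le> m" and b: "nw x y (q 0) (q 1) \<longleftrightarrow> b"
        and p: "V = insert p (q ` {..m})" "p \<notin> q ` {..m}" "\<And>j. j \<le> m \<Longrightarrow> adj x y p (q j) \<longleftrightarrow> j = 1" "lt x y p (q 0)"
        and j: "j \<le> m" for x y :: "'c \<Rightarrow> int" and V q m p j
    proof -
      interpret opath x y V q m by (rule op)
      have pV: "p \<in> V" using p(1) by simp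
      consider "j = 0" | "j = 1" | "2 \<le> j" by linarith
      then show ?thesis
      proof cases
        case 1
        then show ?thesis using p(4) by (auto simp: lt_def)
      next
        case 2
        then show ?thesis using twin_nw[OF pV p(2,3) m] b by (cases b) (auto simp: nw_def)
      next
        case 3
        then show ?thesis using twin_lt[OF pV p(2,3) 3 j m] by (auto simp: lt_def)
      qed
    qed
    have rp: "(x p < x (q j) \<longleftrightarrow> x' p' < x' (q' j)) \<and> (y p < y (q j) \<longleftrightarrow> y' p' < y' (q' j)) \<and>
        (x (q j) < x p \<longleftrightarrow> x' (q' j) < x' p') \<and> (y (q j) < y p \<longleftrightarrow> y' (q' j) < y' p')" if j: "j \<le> m" for j
    proof -
      have m': "3 \<le> m'" "j \<le> m'" using m j by auto
      show ?thesis using rel[OF q(1) m(1) q(2) p j] rel[OF q'(1) m'(1) q'(2) p' m'(2)] by simp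
    qed
    have ne: "q i \<noteq> p" if "i \<le> m" for i using p(2) that by auto
    have "emb x y V x' y' V' (\<lambda>v. if v = p then p' else q' (?r v))"
      unfolding emb_def
    proof (intro conjI ballI)
      show "(\<lambda>v. if v = p then p' else q' (?r v)) ` V \<subseteq> V'" unfolding p(1) p'(1) using r m by auto
      fix u v assume uv: "u \<in> V" "v \<in> V"
      consider "u = p" "v = p" | j where "u = p" "v = q j" "j \<le> m" | i where "u = q i" "i \<le> m" "v = p"
        | i j where "u = q i" "i \<le> m" "v = q j" "j \<le> m"
        using uv unfolding p(1) by auto
      then have "(x u < x v \<longleftrightarrow> x' (if u = p then p' else q' (?r u)) < x' (if v = p then p' else q' (?r v))) \<and>
        (y u < y v \<longleftrightarrow> y' (if u = p then p' else q' (?r u)) < y' (if v = p then p' else q' (?r v)))"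
        by cases (simp_all add: ne r rp qq)
      then show "x u < x v \<longleftrightarrow> x' (if u = p then p' else q' (?r u)) < x' (if v = p then p' else q' (?r v))"
        "y u < y v \<longleftrightarrow> y' (if u = p then p' else q' (?r u)) < y' (if v = p then p' else q' (?r v))" by blast+
    qed
    then show ?thesis unfolding embeds_def by blast
  qed
qed

section \<open>Sparse permutations are well quasi-ordered\<close>

definition py :: "nat list \<Rightarrow> nat \<Rightarrow> int" where
  "py \<pi> i = int (\<pi> ! i)"

definition vs :: "nat list \<Rightarrow> nat set" where
  "vs \<pi> = {..<length \<pi>}"

definition le :: "nat list \<Rightarrow> nat list \<Rightarrow> bool" where
  "le \<sigma> \<pi> \<longleftrightarrow> embeds int (py \<sigma>) (vs \<sigma>) int (py \<pi>) (vs \<pi>)"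

lemma is_perm_iff: "is_perm p \<longleftrightarrow> set p = {1..length p} \<and> distinct p"
  by (simp add: is_perm_def permutations_of_set_def)

lemma finite_vs [simp]: "finite (vs p)" and card_vs [simp]: "card (vs p) = length p"
  by (auto simp: vs_def)

lemma inj_int [simp]: "inj_on int A"
  by (simp add: inj_on_def)

lemma inj_py: "is_perm p \<Longrightarrow> inj_on (py p) (vs p)"
  by (auto simp: is_perm_iff inj_on_def py_def vs_def nth_eq_iff_index_eq)

text \<open>Standardisation: \<open>e\<close> lists \<open>A\<close> by increasing \<open>x\<close>,
  and \<open>rank\<close> replaces the \<open>y\<close>-values by 1, 2, and so on, as every point
  counts itself.\<close>

lemma pattern_exists:
  fixes x y :: "'a \<Rightarrow> int"
  assumes fin: "finite A" and inj: "inj_on x A" "inj_on y A"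
  shows "\<exists>\<sigma> e. is_perm \<sigma> \<and> length \<sigma> = card A \<and> bij_betw e (vs \<sigma>) A \<and> emb int (py \<sigma>) (vs \<sigma>) x y A e"
proof -
  let ?n = "card A"
  define xs where "xs = sorted_list_of_set (x ` A)"
  define e where "e i = the_inv_into A x (xs ! i)" for i
  define rank where "rank v = card {w\<in>A. y w \<le> y v}" for v
  define \<sigma> where "\<sigma> = map (\<lambda>i. rank (e i)) [0..<?n]"
  have len: "length xs = ?n" using inj(1) by (simp add: xs_def card_image)
  have sxs: "set xs = x ` A" "sorted_wrt (<) xs" using fin by (auto simp: xs_def)
  have eA: "e i \<in> A" "x (e i) = xs ! i" if "i < ?n" for i
  proof -
    have "xs ! i \<in> x ` A" using that len sxs(1) nth_mem[of i xs] by simp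
    then show "e i \<in> A" "x (e i) = xs ! i"
      unfolding e_def using inj(1) by (auto intro: the_inv_into_into f_the_inv_into_f)
  qed
  have xm: "x (e i) < x (e j) \<longleftrightarrow> i < j" if "i < ?n" "j < ?n" for i j
  proof -
    have mono: "xs ! i < xs ! j" if "i < j" "j < ?n" for i j
      using sorted_wrt_nth_less[OF sxs(2) that(1)] that len by simp
    show ?thesis using mono[of i j] mono[of j i] that eA by (cases i j rule: linorder_cases) auto
  qed
  have vs: "vs \<sigma> = {..<?n}" by (simp add: vs_def \<sigma>_def)
  have injE: "inj_on e {..<?n}"
  proof (rule inj_onI)
    fix i j assume ij: "i \<in> {..<?n}" "j \<in> {..<?n}" "e i = e j"
    then have "\<not> i < j" "\<not> j < i" using xm[of i j] xm[of j i] by auto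
    then show "i = j" by simp
  qed
  have imE: "e ` {..<?n} = A"
  proof (rule card_subset_eq[OF fin])
    show "e ` {..<?n} \<subseteq> A" using eA by auto
    show "card (e ` {..<?n}) = card A" using injE by (simp add: card_image)
  qed
  have rm: "rank u < rank v \<longleftrightarrow> y u < y v" if "u \<in> A" "v \<in> A" for u v
  proof -
    have mono: "rank u < rank v" if "u \<in> A" "v \<in> A" "y u < y v" for u v
      unfolding rank_def
    proof (rule psubset_card_mono)
      have "v \<in> {w\<in>A. y w \<le> y v}" "v \<notin> {w\<in>A. y w \<le> y u}" using that by auto
      moreover have "{w\<in>A. y w \<le> y u} \<subseteq> {w\<in>A. y w \<le> y v}" using that(3) by auto
      ultimately show "{w\<in>A. y w \<le> y u} \<subset> {w\<in>A. y w \<le> y v}" by blast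
    qed (use fin in auto)
    have "y u = y v \<Longrightarrow> rank u = rank v" by (simp add: rank_def)
    then show ?thesis using mono[of u v] mono[of v u] that by (cases "y u" "y v" rule: linorder_cases) auto
  qed
  have injr: "inj_on rank A"
  proof (rule inj_onI)
    fix u v assume uv: "u \<in> A" "v \<in> A" "rank u = rank v"
    then have "y u = y v" using rm[of u v] rm[of v u] by auto
    then show "u = v" using inj(2) uv by (auto simp: inj_on_def)
  qed
  have imr: "rank ` A = {1..?n}"
  proof (rule card_subset_eq)
    show "rank ` A \<subseteq> {1..?n}"
    proof
      fix r assume "r \<in> rank ` A"
      then obtain v where v: "v \<in> A" "r = rank v" by auto
      have "{w\<in>A. y w \<le> y v} \<noteq> {}" using v by auto
      then have "1 \<le> rank v" using fin unfolding rank_def by (simp add: Suc_le_eq card_gt_0_iff)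
      moreover have "rank v \<le> ?n" unfolding rank_def using fin by (intro card_mono) auto
      ultimately show "r \<in> {1..?n}" using v by simp
    qed
    show "card (rank ` A) = card {1..?n}" using injr by (simp add: card_image)
  qed simp
  have perm: "is_perm \<sigma>"
  proof -
    have "set \<sigma> = rank ` (e ` {..<?n})" by (auto simp: \<sigma>_def atLeast0LessThan)
    then have "set \<sigma> = {1..length \<sigma>}" using imE imr by (simp add: \<sigma>_def)
    moreover have "distinct \<sigma>"
    proof -
      have "inj_on (\<lambda>i. rank (e i)) {..<?n}"
        using comp_inj_on[OF injE, of rank] injr imE by (simp add: comp_def)
      then show ?thesis by (simp add: \<sigma>_def distinct_map atLeast0LessThan)
    qed
    ultimately show ?thesis by (simp add: is_perm_iff)
  qed
  have "emb int (py \<sigma>) (vs \<sigma>) x y A e"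
    unfolding emb_def
  proof (intro conjI ballI)
    show "e ` vs \<sigma> \<subseteq> A" using imE vs by simp
    fix i j assume "i \<in> vs \<sigma>" "j \<in> vs \<sigma>"
    then have ij: "i < ?n" "j < ?n" using vs by auto
    then show "int i < int j \<longleftrightarrow> x (e i) < x (e j)" using xm by simp
    show "py \<sigma> i < py \<sigma> j \<longleftrightarrow> y (e i) < y (e j)"
      using ij rm[of "e i" "e j"] eA by (simp add: py_def \<sigma>_def)
  qed
  moreover have "bij_betw e (vs \<sigma>) A" using injE imE vs by (simp add: bij_betw_def)
  ultimately show ?thesis using perm by (intro exI[of _ \<sigma>] exI[of _ e]) (auto simp: \<sigma>_def)
qed

lemma emb_adj: "emb x y A x' y' B f \<Longrightarrow> u \<in> A \<Longrightarrow> v \<in> A \<Longrightarrow> adj x' y' (f u) (f v) \<longleftrightarrow> adj x y u v"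
  by (auto simp: emb_def adj_def nw_def)

lemma conn_emb:
  assumes f: "emb x y A x' y' B f" and C: "C \<subseteq> A" "conn x y C"
  shows "conn x' y' (f ` C)"
  unfolding conn_def
proof (intro conjI allI impI)
  show "f ` C \<noteq> {}" using C by (auto simp: conn_def)
  fix S assume S: "S \<subset> f ` C" "S \<noteq> {}"
  let ?T = "{c\<in>C. f c \<in> S}"
  have "?T \<subset> C" "?T \<noteq> {}" using S by auto
  then obtain u v where uv: "u \<in> ?T" "v \<in> C - ?T" "adj x y u v" using C(2) unfolding conn_def by meson
  then have "f u \<in> S" "f v \<in> f ` C - S" "adj x' y' (f u) (f v)" using emb_adj[OF f] C(1) by auto
  then show "\<exists>u\<in>S. \<exists>v\<in>f ` C - S. adj x' y' u v" by blast
qed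

lemma isom_emb:
  assumes f: "emb x y A x' y' B f" and inj: "inj_on x A" and C: "C \<subseteq> A" "D \<subseteq> A"
    and i: "isom x' y' (f ` C) (f ` D)"
  shows "isom x y C D"
proof -
  obtain g where g: "bij_betw g (f ` C) (f ` D)" "emb x' y' (f ` C) x' y' (f ` D) g" using i by (auto simp: isom_def)
  have injf: "inj_on f A" using emb_inj[OF f inj] .
  let ?h = "\<lambda>c. the_inv_into D f (g (f c))"
  have bD: "bij_betw f D (f ` D)" "bij_betw f C (f ` C)"
    using injf C by (auto simp: bij_betw_def intro: inj_on_subset)
  have bij: "bij_betw ?h C D"
    using bij_betw_trans[OF bij_betw_trans[OF bD(2) g(1)] bij_betw_the_inv_into[OF bD(1)]] by (simp add: comp_def)
  have h: "?h c \<in> D" "f (?h c) = g (f c)" if "c \<in> C" for c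
  proof -
    have "g (f c) \<in> f ` D" using g(1) that by (auto simp: bij_betw_def)
    then show "f (?h c) = g (f c)" using bD(1) by (simp add: f_the_inv_into_f bij_betw_def)
    show "?h c \<in> D" using bij that by (auto simp: bij_betw_def)
  qed
  have "emb x y C x y D ?h"
    unfolding emb_def
  proof (intro conjI ballI)
    show "?h ` C \<subseteq> D" using h by auto
    fix u v assume uv: "u \<in> C" "v \<in> C"
    have A: "u \<in> A" "v \<in> A" "?h u \<in> A" "?h v \<in> A" using uv h C by auto
    have fC: "f u \<in> f ` C" "f v \<in> f ` C" using uv by auto
    show "x u < x v \<longleftrightarrow> x (?h u) < x (?h v)"
      using f g(2) A fC h(2)[OF uv(1)] h(2)[OF uv(2)] unfolding emb_def by metis
    show "y u < y v \<longleftrightarrow> y (?h u) < y (?h v)"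
      using f g(2) A fC h(2)[OF uv(1)] h(2)[OF uv(2)] unfolding emb_def by metis
  qed
  then show ?thesis using bij unfolding isom_def by blast
qed

lemma many_emb:
  assumes f: "emb x y A x' y' B f" and inj: "inj_on x A" and m: "many x y A n k"
  shows "many x' y' B n k"
proof -
  obtain F where F: "finite F" "card F = k" and F3: "\<forall>C\<in>F. C \<subseteq> A \<and> card C = n \<and> conn x y C"
    and F4: "\<forall>C\<in>F. \<forall>D\<in>F. C \<noteq> D \<longrightarrow> \<not> isom x y C D"
    using m unfolding many_def by (elim exE conjE)
  have injf: "inj_on f A" using emb_inj[OF f inj] .
  show ?thesis
  proof (rule manyI[of F _ "\<lambda>C. f ` C"])
    fix C assume C: "C \<in> F"
    have C3: "C \<subseteq> A" "card C = n" "conn x y C" using F3 C by auto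
    have "f ` C \<subseteq> B" using C3(1) f by (auto simp: emb_def)
    moreover have "card (f ` C) = n" using C3(2) inj_on_subset[OF injf C3(1)] by (simp add: card_image)
    ultimately show "f ` C \<subseteq> B \<and> card (f ` C) = n \<and> conn x' y' (f ` C)" using conn_emb[OF f C3(1,3)] by simp
  next
    fix C D assume CD: "C \<in> F" "D \<in> F" "C \<noteq> D"
    then have "C \<subseteq> A" "D \<subseteq> A" "\<not> isom x y C D" using F3 F4 by auto
    then show "\<not> isom x' y' (f ` C) (f ` D)" using isom_emb[OF f inj, of C D] by blast
  qed (use F in auto)
qed

lemma sparse_embeds: "embeds x y A x' y' B \<Longrightarrow> inj_on x A \<Longrightarrow> sparse N x' y' B \<Longrightarrow> sparse N x y A"
  unfolding embeds_def sparse_def using many_emb by metis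

definition sparse_perms :: "nat \<Rightarrow> nat list set" where
  "sparse_perms N = {\<pi>. is_perm \<pi> \<and> sparse N int (py \<pi>) (vs \<pi>)}"

lemma sparse_perms_le: "\<pi> \<in> sparse_perms N \<Longrightarrow> is_perm \<sigma> \<Longrightarrow> le \<sigma> \<pi> \<Longrightarrow> \<sigma> \<in> sparse_perms N"
  unfolding sparse_perms_def le_def by (auto intro: sparse_embeds)

lemma le_trans: "le \<rho> \<sigma> \<Longrightarrow> le \<sigma> \<tau> \<Longrightarrow> le \<rho> \<tau>"
  unfolding le_def by (rule embeds_trans)

section \<open>Minimal bad sequences and Dickson's lemma\<close>

definition bad :: "(nat \<Rightarrow> nat list) \<Rightarrow> bool" where
  "bad h \<longleftrightarrow> (\<forall>i j. i < j \<longrightarrow> \<not> le (h i) (h j))"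

text \<open>The construction of Nash-Williams: \<open>gp xs\<close> holds if the prefix
  \<open>xs\<close> extends to a bad sequence, and each next term is a shortest one that keeps this
  property.\<close>

lemma minimal_bad:
  assumes ex: "\<exists>g. range g \<subseteq> S \<and> bad g"
  obtains h where "range h \<subseteq> S" "bad h"
    "\<And>n g. range g \<subseteq> S \<Longrightarrow> bad g \<Longrightarrow> (\<And>i. i < n \<Longrightarrow> g i = h i) \<Longrightarrow> length (h n) \<le> length (g n)"
proof -
  define gp where "gp xs \<longleftrightarrow> (\<exists>g. range g \<subseteq> S \<and> bad g \<and> (\<forall>i<length xs. g i = xs ! i))" for xs
  define pre where "pre = rec_nat [] (\<lambda>n xs. xs @ [arg_min length (\<lambda>a. gp (xs @ [a]))])"
  define h where "h n = arg_min length (\<lambda>a. gp (pre n @ [a]))" for n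
  have pre0: "pre 0 = []" and preS: "pre (Suc n) = pre n @ [h n]" for n
    by (simp_all add: pre_def h_def)
  have pre: "pre n = map h [0..<n]" for n by (induction n) (auto simp: pre0 preS)
  have cont: "gp (xs @ [g (length xs)])"
    if "range g \<subseteq> S" "bad g" "\<forall>i<length xs. g i = xs ! i" for xs g
    unfolding gp_def using that by (intro exI[of _ g]) (auto simp: nth_append less_Suc_eq)
  have gpn: "gp (pre n)" for n
  proof (induction n)
    case 0
    then show ?case using ex by (simp add: gp_def pre0)
  next
    case (Suc n)
    then obtain g where g: "range g \<subseteq> S" "bad g" "\<forall>i<length (pre n). g i = pre n ! i" unfolding gp_def by blast
    have "gp (pre n @ [g (length (pre n))])" by (rule cont[OF g])
    then show ?case unfolding preS h_def by (rule arg_min_natI[where P = "\<lambda>a. gp (pre n @ [a])"])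
  qed
  have gph: "\<exists>g. range g \<subseteq> S \<and> bad g \<and> (\<forall>i<n. g i = h i)" for n
    using gpn[of n] unfolding gp_def pre by auto
  show thesis
  proof (rule that[of h])
    show "range h \<subseteq> S"
    proof
      fix a assume "a \<in> range h"
      then obtain n where n: "a = h n" by auto
      obtain g where "range g \<subseteq> S" "\<forall>i<Suc n. g i = h i" using gph[of "Suc n"] by blast
      then show "a \<in> S" using n by (metis lessI range_subsetD)
    qed
    show "bad h"
      unfolding bad_def
    proof (intro allI impI)
      fix i j :: nat assume ij: "i < j"
      obtain g where g: "bad g" "\<forall>i<Suc j. g i = h i" using gph[of "Suc j"] by blast
      then have "g i = h i" "g j = h j" using ij by auto
      then show "\<not> le (h i) (h j)" using g(1) ij unfolding bad_def by metis
    qed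
    fix n g assume g: "range g \<subseteq> S" "bad g" "\<And>i. i < n \<Longrightarrow> g i = h i"
    have "gp (pre n @ [g (length (pre n))])" by (rule cont[OF g(1,2)]) (auto simp: pre g(3))
    then have "gp (pre n @ [g n])" by (simp add: pre)
    then show "length (h n) \<le> length (g n)" unfolding h_def by (rule arg_min_nat_le[where P = "\<lambda>a. gp (pre n @ [a])"])
  qed
qed

text \<open>Let \<open>k i\<close> be properly contained in \<open>h (J i)\<close> and start with an
  index \<open>i0\<close> for which \<open>J i0\<close> is least. The terms of \<open>h\<close>
  before position \<open>J i0\<close>, followed by \<open>k\<close> from \<open>i0\<close> on, would
  form a bad sequence with a shorter term at that position.\<close>

lemma minimal_bad_smaller:
  assumes h: "range h \<subseteq> S" "bad h"
    and hmin: "\<And>n g. range g \<subseteq> S \<Longrightarrow> bad g \<Longrightarrow> (\<And>i. i < n \<Longrightarrow> g i = h i) \<Longrightarrow> length (h n) \<le> length (g n)"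
    and k: "range k \<subseteq> S" "\<And>i. \<exists>j. le (k i) (h j) \<and> length (k i) < length (h j)"
  shows "\<not> bad k"
proof
  assume bk: "bad k"
  obtain J where J: "\<And>i. le (k i) (h (J i)) \<and> length (k i) < length (h (J i))" using k(2) by metis
  have "\<exists>i0. \<forall>i. J i0 \<le> J i" using ex_has_least_nat[of "\<lambda>_. True" 0 J] by auto
  then obtain i0 where i0: "\<And>i. J i0 \<le> J i" by blast
  let ?g = "\<lambda>n. if n < J i0 then h n else k (i0 + (n - J i0))"
  have "range ?g \<subseteq> S" using h(1) k(1) by auto
  moreover have "bad ?g"
    unfolding bad_def
  proof (intro allI impI notI)
    fix i j :: nat assume ij: "i < j" and l: "le (?g i) (?g j)"
    consider "j < J i0" | "i < J i0" "J i0 \<le> j" | "J i0 \<le> i" by linarith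
    then show False
    proof cases
      case 1
      then show False using l ij h(2) unfolding bad_def by auto
    next
      case 2
      let ?t = "i0 + (j - J i0)"
      have "le (h i) (k ?t)" using l 2 by simp
      then have "le (h i) (h (J ?t))" using J le_trans by blast
      moreover have "i < J ?t" using 2 i0[of ?t] by simp
      ultimately show False using h(2) unfolding bad_def by blast
    next
      case 3
      then have "le (k (i0 + (i - J i0))) (k (i0 + (j - J i0)))" using l ij by simp
      moreover have "i0 + (i - J i0) < i0 + (j - J i0)" using 3 ij by simp
      ultimately show False using bk unfolding bad_def by blast
    qed
  qed
  ultimately have "length (h (J i0)) \<le> length (?g (J i0))" by (intro hmin) auto
  then show False using J[of i0] by simp
qed

text \<open>Induction on the number of coordinates. Ramsey's theorem makes the new coordinate
  comparable for all pairs or for none of them; the second case would be a bad sequence.\<close>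

lemma dickson:
  fixes g :: "nat \<Rightarrow> nat \<Rightarrow> nat list"
  assumes good: "\<And>k. range k \<subseteq> Q \<Longrightarrow> \<not> bad k" and J: "infinite J"
    and g: "\<And>a i. a < n \<Longrightarrow> i \<in> J \<Longrightarrow> g a i \<in> Q"
  shows "\<exists>J'. J' \<subseteq> J \<and> infinite J' \<and> (\<forall>i\<in>J'. \<forall>j\<in>J'. i < j \<longrightarrow> (\<forall>a<n. le (g a i) (g a j)))"
  using g
proof (induction n)
  case 0
  then show ?case using J by auto
next
  case (Suc n)
  then obtain J1 where J1: "J1 \<subseteq> J" "infinite J1" "\<And>i j a. i \<in> J1 \<Longrightarrow> j \<in> J1 \<Longrightarrow> i < j \<Longrightarrow> a < n \<Longrightarrow> le (g a i) (g a j)"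
    by (metis less_Suc_eq)
  \<comment> \<open>\<open>Ramsey2\<close> colours unordered pairs; \<open>Min\<close> and
    \<open>Max\<close> recover the order of the indices.\<close>
  define f where "f X = (if le (g n (Min X)) (g n (Max X)) then 1 else 0 :: nat)" for X :: "nat set"
  have fe: "f {i, j} = (if le (g n i) (g n j) then 1 else 0)" if "i < j" for i j
    using that by (simp add: f_def max_def min_def)
  have "\<forall>x\<in>J1. \<forall>y\<in>J1. x \<noteq> y \<longrightarrow> f {x, y} < 2" by (simp add: f_def)
  then obtain Y t where Y: "Y \<subseteq> J1" "infinite Y" "\<forall>x\<in>Y. \<forall>y\<in>Y. x \<noteq> y \<longrightarrow> f {x, y} = t"
    using Ramsey2[OF J1(2), of f 2] by blast
  have "\<exists>i\<in>Y. \<exists>j\<in>Y. i < j \<and> le (g n i) (g n j)"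
  proof (rule ccontr)
    assume no: "\<not> ?thesis"
    have "bad (\<lambda>i. g n (enumerate Y i))"
      unfolding bad_def
    proof (intro allI impI)
      fix i j :: nat assume "i < j"
      then have "enumerate Y i < enumerate Y j" using Y(2) by (rule enumerate_mono)
      then show "\<not> le (g n (enumerate Y i)) (g n (enumerate Y j))"
        using no enumerate_in_set[OF Y(2)] by blast
    qed
    moreover have "range (\<lambda>i. g n (enumerate Y i)) \<subseteq> Q"
      using enumerate_in_set[OF Y(2)] Y(1) J1(1) Suc.prems[of n] by blast
    ultimately show False using good by blast
  qed
  then obtain i j where "i \<in> Y" "j \<in> Y" "i < j" "f {i, j} = 1" using fe by auto
  then have t: "t = 1" using Y(3) by fastforce
  have "le (g n i) (g n j)" if "i \<in> Y" "j \<in> Y" "i < j" for i j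
    using Y(3) that t fe[OF that(3)] by (metis less_irrefl zero_neq_one)
  moreover have "le (g a i) (g a j)" if "i \<in> Y" "j \<in> Y" "i < j" "a < n" for i j a
    using J1(3)[of i j a] that Y(1) by blast
  ultimately have "\<forall>i\<in>Y. \<forall>j\<in>Y. i < j \<longrightarrow> (\<forall>a<Suc n. le (g a i) (g a j))"
    unfolding less_Suc_eq by blast
  moreover have "Y \<subseteq> J" using Y(1) J1(1) by simp
  ultimately show ?case using Y(2) by blast
qed

section \<open>Reassembling a point set from its blocks\<close>

text \<open>For different blocks of a partition into intervals, one such pair of points decides all
  (\<open>before_iff\<close>). A finite table of this relation therefore records the
  quotient.\<close>

definition before :: "('a \<Rightarrow> int) \<Rightarrow> 'a set \<Rightarrow> 'a set \<Rightarrow> bool" where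
  "before x A B \<longleftrightarrow> (\<exists>u\<in>A. \<exists>v\<in>B. x u < x v)"

lemma before_iff:
  assumes inj: "inj_on x V" "inj_on y V" and P: "partition_on V P" "\<And>B. B \<in> P \<Longrightarrow> ivl x y V B" and e: "bij_betw e {..<k} P"
    and ab: "a < k" "b < k" "a \<noteq> b" "u \<in> e a" "v \<in> e b"
  shows "x u < x v \<longleftrightarrow> before x (e a) (e b)" "y u < y v \<longleftrightarrow> before y (e a) (e b)"
proof -
  have eP: "e a \<in> P" "e b \<in> P" "e a \<noteq> e b" using e ab by (auto simp: bij_betw_def inj_on_def)
  have sub: "e a \<subseteq> V" "e b \<subseteq> V" "e a \<inter> e b = {}"
    using P(1) eP by (auto simp: partition_on_def disjoint_def)
  have i: "ivl x y V (e a)" "ivl x y V (e b)" using P(2) eP by auto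
  then have i': "ivl y x V (e a)" "ivl y x V (e b)" by (simp_all add: ivl_swap)
  show "x u < x v \<longleftrightarrow> before x (e a) (e b)" "y u < y v \<longleftrightarrow> before y (e a) (e b)"
    unfolding before_def
    using ivl_blocks_x[OF inj(1) i sub] ivl_blocks_x[OF inj(2) i' sub] ab by blast+
qed

lemma glue:
  assumes inj: "inj_on x V" "inj_on y V" and P: "partition_on V P" "\<And>B. B \<in> P \<Longrightarrow> ivl x y V B" and e: "bij_betw e {..<k} P"
    and inj': "inj_on x' V'" "inj_on y' V'" and P': "partition_on V' P'" "\<And>B. B \<in> P' \<Longrightarrow> ivl x' y' V' B" and e': "bij_betw e' {..<k} P'"
    and rel: "\<And>a b. a < k \<Longrightarrow> b < k \<Longrightarrow> a \<noteq> b \<Longrightarrow> before x (e a) (e b) \<longleftrightarrow> before x' (e' a) (e' b)"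
      "\<And>a b. a < k \<Longrightarrow> b < k \<Longrightarrow> a \<noteq> b \<Longrightarrow> before y (e a) (e b) \<longleftrightarrow> before y' (e' a) (e' b)"
    and em: "\<And>a. a < k \<Longrightarrow> embeds x y (e a) x' y' (e' a)"
  shows "embeds x y V x' y' V'"
proof -
  have eUn: "\<Union>(e ` {..<k}) = V" "\<Union>(e' ` {..<k}) = V'"
    using e e' P(1) P'(1) by (simp_all add: bij_betw_def partition_on_def)
  have "\<exists>\<phi>. \<forall>a<k. emb x y (e a) x' y' (e' a) (\<phi> a)" using em unfolding embeds_def by metis
  then obtain \<phi> where \<phi>: "\<And>a. a < k \<Longrightarrow> emb x y (e a) x' y' (e' a) (\<phi> a)" by blast
  have "\<forall>v\<in>V. \<exists>a. a < k \<and> v \<in> e a" using eUn(1) by blast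
  then obtain idx where idx: "\<And>v. v \<in> V \<Longrightarrow> idx v < k \<and> v \<in> e (idx v)" by metis
  let ?f = "\<lambda>v. \<phi> (idx v) v"
  have f: "?f v \<in> e' (idx v)" if "v \<in> V" for v
    using \<phi>[of "idx v"] idx[OF that] by (auto simp: emb_def)
  have "emb x y V x' y' V' ?f"
    unfolding emb_def
  proof (intro conjI ballI)
    show "?f ` V \<subseteq> V'"
    proof
      fix w assume "w \<in> ?f ` V"
      then obtain v where "v \<in> V" "w = ?f v" by blast
      then show "w \<in> V'" using f[of v] idx[of v] eUn(2) by blast
    qed
    fix u v assume uv: "u \<in> V" "v \<in> V"
    have "(x u < x v \<longleftrightarrow> x' (?f u) < x' (?f v)) \<and> (y u < y v \<longleftrightarrow> y' (?f u) < y' (?f v))"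
    proof (cases "idx u = idx v")
      case True
      have "emb x y (e (idx v)) x' y' (e' (idx v)) (\<phi> (idx v))" using \<phi> idx[OF uv(2)] by blast
      then show ?thesis using idx[OF uv(1)] idx[OF uv(2)] True unfolding emb_def by auto
    next
      case False
      have a: "idx u < k" "idx v < k" "u \<in> e (idx u)" "v \<in> e (idx v)" using idx uv by auto
      show ?thesis
        using before_iff[OF inj P e a(1,2) False a(3,4)] before_iff[OF inj' P' e' a(1,2) False f[OF uv(1)] f[OF uv(2)]]
          rel[OF a(1,2) False] by blast
    qed
    then show "x u < x v \<longleftrightarrow> x' (?f u) < x' (?f v)" "y u < y v \<longleftrightarrow> y' (?f u) < y' (?f v)" by blast+
  qed
  then show ?thesis unfolding embeds_def by blast
qed

lemma infinite_pigeonhole: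
  assumes "infinite J" "finite D" "\<And>i. i \<in> J \<Longrightarrow> f i \<in> D"
  shows "\<exists>d J'. J' \<subseteq> J \<and> infinite J' \<and> (\<forall>i\<in>J'. f i = d)"
proof -
  have "finite (f ` J)" using assms(2,3) by (meson finite_subset image_subsetI)
  then obtain i0 where "i0 \<in> J" "infinite {i\<in>J. f i = f i0}" using pigeonhole_infinite[OF assms(1)] by blast
  then show ?thesis by (intro exI[of _ "f i0"] exI[of _ "{i\<in>J. f i = f i0}"]) auto
qed

theorem sparse_perms_good:
  assumes N: "3 \<le> N" and k: "range k \<subseteq> sparse_perms N"
  shows "\<not> bad k"
proof
  assume "bad k"
  then have "\<exists>g. range g \<subseteq> sparse_perms N \<and> bad g" using k by blast
  then obtain h where h: "range h \<subseteq> sparse_perms N" "bad h"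
    and hmin: "\<And>n g. range g \<subseteq> sparse_perms N \<Longrightarrow> bad g \<Longrightarrow> (\<And>i. i < n \<Longrightarrow> g i = h i) \<Longrightarrow> length (h n) \<le> length (g n)"
    using minimal_bad by blast
  \<comment> \<open>The sparse permutations strictly below some term; by minimality they form no bad
    sequence.\<close>
  define Q where "Q = {\<alpha>\<in>sparse_perms N. \<exists>j. le \<alpha> (h j) \<and> length \<alpha> < length (h j)}"
  have Qgood: "\<not> bad g" if "range g \<subseteq> Q" for g
  proof (rule minimal_bad_smaller[where h = h and S = "sparse_perms N"])
    show "range h \<subseteq> sparse_perms N" "bad h" by (fact h)+
    show "length (h n) \<le> length (g n)" if "range g \<subseteq> sparse_perms N" "bad g" "\<And>i. i < n \<Longrightarrow> g i = h i" for n g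
      using hmin[OF that] .
    show "range g \<subseteq> sparse_perms N" using that by (auto simp: Q_def)
    show "\<exists>j. le (g i) (h j) \<and> length (g i) < length (h j)" for i
      using range_subsetD[OF that, of i] by (simp add: Q_def)
  qed
  have perm: "is_perm (h i)" and sp: "sparse N int (py (h i)) (vs (h i))" for i
    using range_subsetD[OF h(1), of i] by (auto simp: sparse_perms_def)
  \<comment> \<open>A term with at most one point would be contained in the next term, which is at
    least as long.\<close>
  have len: "2 \<le> length (h i)" for i
  proof (rule ccontr)
    assume n: "\<not> 2 \<le> length (h i)"
    have nil: "h j \<noteq> []" for j
    proof
      assume "h j = []"
      then have "le (h j) (h (Suc j))" by (auto simp: le_def embeds_def emb_def vs_def)
      then show False using h(2) unfolding bad_def by blast
    qed
    then have "length (h i) \<noteq> 0" by simp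
    then have "length (h i) = 1" using n by linarith
    moreover have "0 < length (h (Suc i))" using nil by simp
    ultimately have "emb int (py (h i)) (vs (h i)) int (py (h (Suc i))) (vs (h (Suc i))) (\<lambda>_. 0)"
      by (auto simp: emb_def vs_def Suc_le_eq)
    then have "le (h i) (h (Suc i))" unfolding le_def embeds_def by blast
    then show False using h(2) unfolding bad_def by blast
  qed
  obtain K where K: "2 \<le> K" "\<forall>(x :: nat \<Rightarrow> int) y W. finite W \<longrightarrow> inj_on x W \<longrightarrow> inj_on y W \<longrightarrow> simple x y W \<longrightarrow>
     sparse N x y W \<longrightarrow> K < card W \<longrightarrow> (\<exists>q. ipath x y W q (2 * N + 8))"
    using simple_long_path[where ?'a = nat and N = N and R = "2 * N + 8"] by blast
  define quot where "quot i P \<longleftrightarrow> partition_on (vs (h i)) P \<and> (\<forall>B\<in>P. ivl int (py (h i)) (vs (h i)) B) \<and> 2 \<le> card P \<and>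
     (3 \<le> card P \<longrightarrow> sum_indec int (py (h i)) (vs (h i))) \<and>
     (\<forall>r. 3 \<le> card P \<longrightarrow> (\<forall>B\<in>P. r B \<in> B) \<longrightarrow> simple int (py (h i)) (r ` P) \<and> card (r ` P) = card P)" for i P
  have "\<exists>P. quot i P" for i
  proof -
    have "2 \<le> card (vs (h i))" using len by simp
    then obtain P where "partition_on (vs (h i)) P" "\<And>B. B \<in> P \<Longrightarrow> ivl int (py (h i)) (vs (h i)) B" "2 \<le> card P"
      "3 \<le> card P \<Longrightarrow> sum_indec int (py (h i)) (vs (h i))"
      "\<And>r. 3 \<le> card P \<Longrightarrow> (\<And>B. B \<in> P \<Longrightarrow> r B \<in> B) \<Longrightarrow> simple int (py (h i)) (r ` P) \<and> card (r ` P) = card P"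
      by (rule minimal_quotient[OF finite_vs inj_int inj_py[OF perm]]) blast
    then show ?thesis unfolding quot_def by blast
  qed
  then obtain P where P: "\<And>i. quot i (P i)" by metis
  have Ppart: "partition_on (vs (h i)) (P i)" and Pivl: "\<And>B. B \<in> P i \<Longrightarrow> ivl int (py (h i)) (vs (h i)) B"
    and P2: "2 \<le> card (P i)" for i using P[of i] unfolding quot_def by auto
  have Pfin: "finite (P i)" for i using finite_elements[OF finite_vs Ppart] .
  show False
  proof (cases "infinite {i. card (P i) \<le> K}")
    case True
    have "\<exists>e. bij_betw e {..<card (P i)} (P i)" for i
      using ex_bij_betw_nat_finite[OF Pfin[of i]] by (simp add: atLeast0LessThan)
    then obtain e where e: "\<And>i. bij_betw (e i) {..<card (P i)} (P i)" by metis
    \<comment> \<open>The size of the quotient and its two order tables, cut off at \<open>K\<close>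
      so that finitely many values arise.\<close>
    define data where "data i = (card (P i), {(a, b). a < K \<and> b < K \<and> before int (e i a) (e i b)},
      {(a, b). a < K \<and> b < K \<and> before (py (h i)) (e i a) (e i b)})" for i
    have "data i \<in> {..K} \<times> (Pow ({..<K} \<times> {..<K}) \<times> Pow ({..<K} \<times> {..<K}))" if "i \<in> {i. card (P i) \<le> K}" for i
      using that by (auto simp: data_def)
    then obtain d J where J: "J \<subseteq> {i. card (P i) \<le> K}" "infinite J" "\<forall>i\<in>J. data i = d"
      using infinite_pigeonhole[OF True, of "{..K} \<times> (Pow ({..<K} \<times> {..<K}) \<times> Pow ({..<K} \<times> {..<K}))" data] by auto
    define n where "n = fst d"
    have cn: "card (P i) = n" if "i \<in> J" for i using J(3) that by (auto simp: data_def n_def)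
    have "J \<noteq> {}" using J(2) by auto
    then have nK: "n \<le> K" using J(1) cn by blast
    have eP: "e i a \<in> P i" if "i \<in> J" "a < n" for i a
      using e[of i] cn[OF that(1)] that(2) by (auto simp: bij_betw_def)
    have esub: "e i a \<subseteq> vs (h i)" "e i a \<noteq> vs (h i)" if ia: "i \<in> J" "a < n" for i a
    proof -
      show sub: "e i a \<subseteq> vs (h i)" using eP[OF ia] Ppart[of i] by (auto simp: partition_on_def)
      show "e i a \<noteq> vs (h i)"
      proof
        assume eq: "e i a = vs (h i)"
        have "B = e i a" if B: "B \<in> P i" for B
        proof (rule ccontr)
          assume "B \<noteq> e i a"
          then have "B \<inter> e i a = {}" "B \<noteq> {}" "B \<subseteq> vs (h i)"
            using Ppart[of i] B eP[OF ia] by (auto simp: partition_on_def disjoint_def)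
          then show False using eq by auto
        qed
        then have "P i \<subseteq> {e i a}" by auto
        then have "card (P i) \<le> card {e i a}" by (intro card_mono) auto
        then show False using P2[of i] by simp
      qed
    qed
    \<comment> \<open>Blocks are replaced by their standardisations, since \<open>Q\<close> and
      \<open>dickson\<close> speak of permutations.\<close>
    define pat where "pat i a = (SOME \<sigma>. is_perm \<sigma> \<and> length \<sigma> = card (e i a) \<and>
      embeds int (py \<sigma>) (vs \<sigma>) int (py (h i)) (e i a) \<and> embeds int (py (h i)) (e i a) int (py \<sigma>) (vs \<sigma>))" for i a
    have pat: "is_perm (pat i a) \<and> length (pat i a) = card (e i a) \<and>
      embeds int (py (pat i a)) (vs (pat i a)) int (py (h i)) (e i a) \<and> embeds int (py (h i)) (e i a) int (py (pat i a)) (vs (pat i a))"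
      if ia: "i \<in> J" "a < n" for i a
      unfolding pat_def
    proof (rule someI_ex)
      have "finite (e i a)" "inj_on (py (h i)) (e i a)"
        using esub[OF ia] finite_subset[OF _ finite_vs] inj_on_subset[OF inj_py[OF perm]] by auto
      then obtain \<sigma> f where \<sigma>: "is_perm \<sigma>" "length \<sigma> = card (e i a)" "bij_betw f (vs \<sigma>) (e i a)"
        "emb int (py \<sigma>) (vs \<sigma>) int (py (h i)) (e i a) f"
        using pattern_exists[of "e i a" int "py (h i)"] by auto
      have "emb int (py (h i)) (e i a) int (py \<sigma>) (vs \<sigma>) (the_inv_into (vs \<sigma>) f)"
        unfolding emb_def
      proof (intro conjI ballI)
        let ?g = "the_inv_into (vs \<sigma>) f"
        have bg: "bij_betw ?g (e i a) (vs \<sigma>)" using \<sigma>(3) by (rule bij_betw_the_inv_into)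
        then show "?g ` e i a \<subseteq> vs \<sigma>" by (simp add: bij_betw_def)
        fix u v assume uv: "u \<in> e i a" "v \<in> e i a"
        have g: "?g u \<in> vs \<sigma>" "?g v \<in> vs \<sigma>" "f (?g u) = u" "f (?g v) = v"
          using uv bij_betw_apply[OF bg] f_the_inv_into_f_bij_betw[OF \<sigma>(3)] by auto
        have m: "int s < int t \<longleftrightarrow> int (f s) < int (f t)" "py \<sigma> s < py \<sigma> t \<longleftrightarrow> py (h i) (f s) < py (h i) (f t)"
          if "s \<in> vs \<sigma>" "t \<in> vs \<sigma>" for s t using \<sigma>(4) that unfolding emb_def by blast+
        show "int u < int v \<longleftrightarrow> int (?g u) < int (?g v)" using m(1)[OF g(1,2)] g(3,4) by simp
        show "py (h i) u < py (h i) v \<longleftrightarrow> py \<sigma> (?g u) < py \<sigma> (?g v)" using m(2)[OF g(1,2)] g(3,4) by simp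
      qed
      then show "\<exists>\<sigma>. is_perm \<sigma> \<and> length \<sigma> = card (e i a) \<and>
        embeds int (py \<sigma>) (vs \<sigma>) int (py (h i)) (e i a) \<and> embeds int (py (h i)) (e i a) int (py \<sigma>) (vs \<sigma>)"
        using \<sigma> unfolding embeds_def by blast
    qed
    have patQ: "pat i a \<in> Q" if "a < n" "i \<in> J" for a i
    proof -
      note p = pat[OF that(2,1)]
      have sub: "e i a \<subset> vs (h i)" using esub[OF that(2,1)] by auto
      have l: "le (pat i a) (h i)"
        unfolding le_def using p embeds_trans embeds_refl[of "e i a" "vs (h i)" int "py (h i)"] sub by blast
      have "card (e i a) < card (vs (h i))" using sub by (intro psubset_card_mono) auto
      then have "length (pat i a) < length (h i)" using p by simp
      moreover have "pat i a \<in> sparse_perms N"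
        using sparse_perms_le[of "h i" N "pat i a"] range_subsetD[OF h(1), of i] p l by blast
      ultimately show ?thesis unfolding Q_def using l by blast
    qed
    obtain J' where J': "J' \<subseteq> J" "infinite J'" "\<forall>i\<in>J'. \<forall>j\<in>J'. i < j \<longrightarrow> (\<forall>a<n. le (pat i a) (pat j a))"
      using dickson[of Q J n "\<lambda>a i. pat i a"] Qgood J(2) patQ by blast
    obtain i where i: "i \<in> J'" using J'(2) by fastforce
    have "infinite (J' - {..i})" using J'(2) by simp
    then obtain j where j: "j \<in> J'" "i < j" by (metis Diff_iff atMost_iff ex_in_conv finite.emptyI not_le)
    have ij: "i \<in> J" "j \<in> J" using i j J' by auto
    have "le (h i) (h j)"
      unfolding le_def
    proof (rule glue[where k = n and P = "P i" and e = "e i" and P' = "P j" and e' = "e j"])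
      show "bij_betw (e i) {..<n} (P i)" "bij_betw (e j) {..<n} (P j)" using e[of i] e[of j] cn ij by auto
      show "ivl int (py (h i)) (vs (h i)) B" if "B \<in> P i" for B using Pivl[OF that] .
      show "ivl int (py (h j)) (vs (h j)) B" if "B \<in> P j" for B using Pivl[OF that] .
      have dd: "data i = data j" using J(3) ij by simp
      show "before int (e i a) (e i b) \<longleftrightarrow> before int (e j a) (e j b)"
        "before (py (h i)) (e i a) (e i b) \<longleftrightarrow> before (py (h j)) (e j a) (e j b)" if "a < n" "b < n" "a \<noteq> b" for a b
      proof -
        have "a < K" "b < K" using that nK by auto
        then have "(before int (e i a) (e i b) \<longleftrightarrow> (a, b) \<in> fst (snd (data i))) \<and> (before int (e j a) (e j b) \<longleftrightarrow> (a, b) \<in> fst (snd (data j))) \<and>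
          (before (py (h i)) (e i a) (e i b) \<longleftrightarrow> (a, b) \<in> snd (snd (data i))) \<and> (before (py (h j)) (e j a) (e j b) \<longleftrightarrow> (a, b) \<in> snd (snd (data j)))"
          by (simp add: data_def)
        then show "before int (e i a) (e i b) \<longleftrightarrow> before int (e j a) (e j b)"
          "before (py (h i)) (e i a) (e i b) \<longleftrightarrow> before (py (h j)) (e j a) (e j b)" unfolding dd by blast+
      qed
      show "embeds int (py (h i)) (e i a) int (py (h j)) (e j a)" if a: "a < n" for a
      proof -
        have "le (pat i a) (pat j a)" using J'(3) i j a by blast
        then show ?thesis
          using pat[OF ij(1) a] pat[OF ij(2) a] unfolding le_def by (meson embeds_trans)
      qed
    qed (use Ppart inj_py[OF perm] in auto)
    then show False using h(2) j(2) unfolding bad_def by blast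
  next
    case False
    then have inf: "infinite {i. K < card (P i)}"
    proof -
      have "{i. K < card (P i)} = UNIV - {i. card (P i) \<le> K}" by auto
      then show ?thesis using False by simp
    qed
    \<comment> \<open>The sign \<open>s\<close> writes both alternatives of
      \<open>fork_form_exists\<close> as one form, so that the type of a term is the triple of
      \<open>s\<close>, \<open>b\<close> and \<open>e\<close>.\<close>
    have "\<exists>s m b e. fork_form (\<lambda>u. s * int u) (\<lambda>u. s * py (h i) u) (vs (h i)) m b e \<and> s \<in> {1, -1 :: int} \<and> 3 \<le> m"
      if i: "i \<in> {i. K < card (P i)}" for i
    proof -
      have c3: "3 \<le> card (P i)" "K < card (P i)" using i K(1) by auto
      have con: "conn int (py (h i)) (vs (h i))"
        using P[of i] c3 sum_indec_imp_conn[OF finite_vs inj_int inj_py[OF perm]] unfolding quot_def by blast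
      have "{} \<notin> P i" using Ppart[of i] by (simp add: partition_on_def)
      then have "\<forall>B\<in>P i. \<exists>v. v \<in> B" by (metis all_not_in_conv)
      then obtain r where r: "\<And>B. B \<in> P i \<Longrightarrow> r B \<in> B" by metis
      let ?W = "r ` P i"
      have W: "simple int (py (h i)) ?W" "card ?W = card (P i)" using P[of i] c3(1) r unfolding quot_def by blast+
      have sub: "?W \<subseteq> vs (h i)" using r Ppart[of i] by (fastforce simp: partition_on_def)
      have "finite ?W" "inj_on (py (h i)) ?W" "sparse N int (py (h i)) ?W"
        using Pfin inj_on_subset[OF inj_py[OF perm] sub] sparse_mono[OF sp sub] by auto
      then obtain q where "ipath int (py (h i)) ?W q (2 * N + 8)" using K(2) W c3(2) inj_int by metis
      then have "ipath int (py (h i)) (vs (h i)) q (2 * N + 8)" using sub unfolding ipath_def by blast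
      then have "\<exists>m b e. 3 \<le> m \<and> (fork_form int (py (h i)) (vs (h i)) m b e \<or> fork_form (\<lambda>u. - int u) (\<lambda>u. - py (h i) u) (vs (h i)) m b e)"
        using fork_form_exists[OF finite_vs inj_int inj_py[OF perm] con N sp] by blast
      then obtain m b e where "3 \<le> m" "fork_form int (py (h i)) (vs (h i)) m b e \<or> fork_form (\<lambda>u. - int u) (\<lambda>u. - py (h i) u) (vs (h i)) m b e" by blast
      then show ?thesis
        using exI[of "\<lambda>s. fork_form (\<lambda>u. s * int u) (\<lambda>u. s * py (h i) u) (vs (h i)) m b e \<and> s \<in> {1, -1 :: int}" 1]
          exI[of "\<lambda>s. fork_form (\<lambda>u. s * int u) (\<lambda>u. s * py (h i) u) (vs (h i)) m b e \<and> s \<in> {1, -1 :: int}" "-1"]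
        by simp blast
    qed
    then obtain s m b e where ff: "\<And>i. i \<in> {i. K < card (P i)} \<Longrightarrow>
      fork_form (\<lambda>u. s i * int u) (\<lambda>u. s i * py (h i) u) (vs (h i)) (m i) (b i) (e i) \<and> s i \<in> {1, -1 :: int} \<and> 3 \<le> m i"
      by metis
    define data where "data i = (s i, b i, e i)" for i
    have "data i \<in> {1, -1} \<times> UNIV" if "i \<in> {i. K < card (P i)}" for i using ff[OF that] by (auto simp: data_def)
    then obtain d J0 where J0: "J0 \<subseteq> {i. K < card (P i)}" "infinite J0" "\<forall>i\<in>J0. data i = d"
      using infinite_pigeonhole[OF inf, of "{1, -1} \<times> UNIV" data] by auto
    have eq: "s i = fst d" "b i = fst (snd d)" "e i = snd (snd d)" if "i \<in> J0" for i
      using J0(3) that by (auto simp: data_def)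
    have ff': "fork_form (\<lambda>u. fst d * int u) (\<lambda>u. fst d * py (h i) u) (vs (h i)) (m i) (fst (snd d)) (snd (snd d))"
      and sd: "fst d \<in> {1, -1}" if "i \<in> J0" for i
      using ff[of i] J0(1) eq[OF that] that by auto
    have "J0 \<noteq> {}" using J0(2) by auto
    then obtain i0 where "i0 \<in> J0" by blast
    \<comment> \<open>A term with the smallest \<open>m\<close> among those of one type embeds into
      every later one of this type.\<close>
    then have "\<exists>i. i \<in> J0 \<and> (\<forall>j. j \<in> J0 \<longrightarrow> m i \<le> m j)" by (rule ex_has_least_nat)
    then obtain i where i: "i \<in> J0" "\<And>j. j \<in> J0 \<Longrightarrow> m i \<le> m j" by blast
    have "infinite (J0 - {..i})" using J0(2) by simp
    then obtain j where j: "j \<in> J0" "i < j" by (metis Diff_iff atMost_iff ex_in_conv finite.emptyI not_le)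
    have m3: "3 \<le> m i" using ff[of i] J0(1) i(1) by auto
    have "embeds (\<lambda>u. fst d * int u) (\<lambda>u. fst d * py (h i) u) (vs (h i)) (\<lambda>u. fst d * int u) (\<lambda>u. fst d * py (h j) u) (vs (h j))"
      by (rule fork_form_embeds[OF ff'[OF i(1)] ff'[OF j(1)] m3 i(2)[OF j(1)]])
    then have "le (h i) (h j)"
      using sd[OF i(1)] embeds_uminus[of int "py (h i)" "vs (h i)" int "py (h j)" "vs (h j)"] by (auto simp: le_def)
    then show False using h(2) j(2) unfolding bad_def by blast
  qed
qed

section \<open>Growth rates of sum closures\<close>

lemma subseq_embedding:
  "subseq xs ys \<Longrightarrow> \<exists>f. (\<forall>i<length xs. f i < length ys \<and> xs ! i = ys ! f i) \<and> (\<forall>i j. i < j \<longrightarrow> j < length xs \<longrightarrow> f i < f j)"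
proof (induction xs ys rule: list_emb.induct)
  case (list_emb_Cons xs ys y)
  then obtain f where f: "\<forall>i<length xs. f i < length ys \<and> xs ! i = ys ! f i" "\<forall>i j. i < j \<longrightarrow> j < length xs \<longrightarrow> f i < f j" by blast
  then show ?case by (intro exI[of _ "\<lambda>i. Suc (f i)"]) auto
next
  case (list_emb_Cons2 x y xs ys)
  then obtain f where f: "\<forall>i<length xs. f i < length ys \<and> xs ! i = ys ! f i" "\<forall>i j. i < j \<longrightarrow> j < length xs \<longrightarrow> f i < f j" by blast
  show ?case
  proof (intro exI[of _ "case_nat 0 (\<lambda>i. Suc (f i))"] conjI allI impI)
    fix i j :: nat assume "i < j" "j < length (x # xs)"
    then show "case_nat 0 (\<lambda>i. Suc (f i)) i < case_nat 0 (\<lambda>i. Suc (f i)) j"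
      using f(2) by (cases i; cases j) auto
  next
    fix i assume "i < length (x # xs)"
    then show "case_nat 0 (\<lambda>i. Suc (f i)) i < length (y # ys)" "(x # xs) ! i = (y # ys) ! case_nat 0 (\<lambda>i. Suc (f i)) i"
      using f(1) list_emb_Cons2(1) by (cases i; auto)+
  qed
qed auto

text \<open>Stated for prefixes of \<open>ys\<close> because of the induction: all chosen entries
  but the last lie in the prefix before position \<open>f n\<close>.\<close>

lemma subseq_map_nth:
  assumes "\<And>i j. i < j \<Longrightarrow> j < n \<Longrightarrow> f i < f j" "\<And>i. i < n \<Longrightarrow> f i < m" "m \<le> length ys"
  shows "subseq (map (\<lambda>i. ys ! f i) [0..<n]) (take m ys)"
  using assms
proof (induction n arbitrary: m)
  case (Suc n)
  have fn: "f n < m" "f n < length (take m ys)" using Suc.prems by auto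
  have "subseq (map (\<lambda>i. ys ! f i) [0..<n]) (take (f n) ys)"
  proof (rule Suc.IH)
    show "f n \<le> length ys" using fn by simp
  qed (use Suc.prems in auto)
  moreover have eq: "take m ys = take (f n) ys @ ys ! f n # drop (Suc (f n)) (take m ys)"
    using id_take_nth_drop[OF fn(2)] fn by (simp add: min_def)
  moreover have "subseq [ys ! f n] (ys ! f n # drop (Suc (f n)) (take m ys))" by simp
  ultimately have "subseq (map (\<lambda>i. ys ! f i) [0..<n] @ [ys ! f n]) (take (f n) ys @ ys ! f n # drop (Suc (f n)) (take m ys))"
    by (intro list_emb_append_mono)
  then have "subseq (map (\<lambda>i. ys ! f i) [0..<n] @ [ys ! f n]) (take m ys)" using eq by argo
  then show ?case by simp
qed auto

lemma perm_contained_iff_le: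
  "perm_contained \<sigma> \<pi> \<longleftrightarrow> le \<sigma> \<pi>"
proof
  assume "perm_contained \<sigma> \<pi>"
  then obtain xs where xs: "subseq xs \<pi>" "order_isomorphic \<sigma> xs" by (auto simp: perm_contained_def)
  obtain f where f: "\<And>i. i < length xs \<Longrightarrow> f i < length \<pi> \<and> xs ! i = \<pi> ! f i" "\<And>i j. i < j \<Longrightarrow> j < length xs \<Longrightarrow> f i < f j"
    using subseq_embedding[OF xs(1)] by blast
  have len: "length xs = length \<sigma>" and o: "\<And>i j. i < length \<sigma> \<Longrightarrow> j < length \<sigma> \<Longrightarrow> \<sigma> ! i < \<sigma> ! j \<longleftrightarrow> xs ! i < xs ! j"
    using xs(2) by (auto simp: order_isomorphic_def)
  have mono: "i < j \<longleftrightarrow> f i < f j" if "i < length \<sigma>" "j < length \<sigma>" for i j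
    using f(2)[of i j] f(2)[of j i] that len by (cases i j rule: linorder_cases) auto
  have "emb int (py \<sigma>) (vs \<sigma>) int (py \<pi>) (vs \<pi>) f"
    unfolding emb_def vs_def py_def using f(1) o mono len by auto
  then show "le \<sigma> \<pi>" by (auto simp: le_def embeds_def)
next
  assume "le \<sigma> \<pi>"
  then obtain f where "emb int (py \<sigma>) (vs \<sigma>) int (py \<pi>) (vs \<pi>) f" by (auto simp: le_def embeds_def)
  then have f: "f i < length \<pi>" "i < j \<longleftrightarrow> f i < f j" "\<sigma> ! i < \<sigma> ! j \<longleftrightarrow> \<pi> ! f i < \<pi> ! f j"
    if "i < length \<sigma>" "j < length \<sigma>" for i j
    using that unfolding emb_def vs_def py_def by auto
  have "subseq (map (\<lambda>i. \<pi> ! f i) [0..<length \<sigma>]) (take (length \<pi>) \<pi>)"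
  proof (rule subseq_map_nth)
    show "f i < f j" if "i < j" "j < length \<sigma>" for i j using f(2)[of i j] that by simp
    show "f i < length \<pi>" if "i < length \<sigma>" for i using f(1)[of i i] that by simp
  qed simp
  moreover have "order_isomorphic \<sigma> (map (\<lambda>i. \<pi> ! f i) [0..<length \<sigma>])"
    unfolding order_isomorphic_def using f(3) by auto
  ultimately show "perm_contained \<sigma> \<pi>" by (auto simp: perm_contained_def)
qed

lemma Sub_iff: "\<sigma> \<in> Sub \<pi> \<longleftrightarrow> is_perm \<sigma> \<and> le \<sigma> \<pi>"
  by (simp add: Sub_def perm_contained_iff_le)

lemma le_length: "le \<sigma> \<pi> \<Longrightarrow> length \<sigma> \<le> length \<pi>"
proof -
  assume "le \<sigma> \<pi>"
  then obtain f where f: "emb int (py \<sigma>) (vs \<sigma>) int (py \<pi>) (vs \<pi>) f" by (auto simp: le_def embeds_def)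
  then have "inj_on f (vs \<sigma>)" "f ` vs \<sigma> \<subseteq> vs \<pi>" using emb_inj[OF f] by (auto simp: emb_def)
  then show ?thesis using card_inj_on_le[of f "vs \<sigma>" "vs \<pi>"] by simp
qed

section \<open>Direct sums and their indecomposable summands\<close>

lemma length_direct_sum [simp]: "length (direct_sum \<sigma> \<tau>) = length \<sigma> + length \<tau>"
  by (simp add: direct_sum_def)

lemma nth_direct_sum:
  "i < length \<sigma> + length \<tau> \<Longrightarrow> direct_sum \<sigma> \<tau> ! i = (if i < length \<sigma> then \<sigma> ! i else \<tau> ! (i - length \<sigma>) + length \<sigma>)"
  by (auto simp: direct_sum_def nth_append)

lemma direct_sum_assoc: "direct_sum (direct_sum \<rho> \<sigma>) \<tau> = direct_sum \<rho> (direct_sum \<sigma> \<tau>)"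
  by (simp add: direct_sum_def comp_def add.assoc add.commute)

lemma direct_sum_Nil [simp]: "direct_sum [] \<tau> = \<tau>" "direct_sum \<sigma> [] = \<sigma>"
  by (simp_all add: direct_sum_def)

lemma direct_sum_inj: "length \<sigma> = length \<sigma>' \<Longrightarrow> direct_sum \<sigma> \<tau> = direct_sum \<sigma>' \<tau>' \<Longrightarrow> \<sigma> = \<sigma>' \<and> \<tau> = \<tau>'"
  by (auto simp: direct_sum_def inj_map_eq_map inj_def)

lemma is_perm_direct_sum:
  assumes "is_perm \<sigma>" "is_perm \<tau>"
  shows "is_perm (direct_sum \<sigma> \<tau>)"
proof -
  have "(\<lambda>x. x + length \<sigma>) ` {1..length \<tau>} = {length \<sigma> + 1..length \<sigma> + length \<tau>}"
    using image_add_atLeastAtMost[of "length \<sigma>" 1 "length \<tau>"] by (simp add: add.commute)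
  then have s: "set (direct_sum \<sigma> \<tau>) = {1..length \<sigma>} \<union> {length \<sigma> + 1..length \<sigma> + length \<tau>}"
    using assms by (simp add: direct_sum_def is_perm_iff add.commute)
  have "distinct (direct_sum \<sigma> \<tau>)"
    using assms \<open>(\<lambda>x. x + length \<sigma>) ` {1..length \<tau>} = {length \<sigma> + 1..length \<sigma> + length \<tau>}\<close>
    by (auto simp: direct_sum_def is_perm_iff distinct_map inj_on_def)
  moreover have "{1..length \<sigma>} \<union> {length \<sigma> + 1..length \<sigma> + length \<tau>} = {1..length \<sigma> + length \<tau>}"
    by auto
  ultimately show ?thesis using s by (simp add: is_perm_iff)
qed

text \<open>With each value the prefix also contains all smaller ones, as no later entry is smaller.
  Having \<open>p\<close> elements, it takes exactly the values \<open>{1..p}\<close>.\<close>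

lemma perm_split:
  assumes \<sigma>: "is_perm \<sigma>" and p: "p \<le> length \<sigma>" and l: "\<And>i j. i < p \<Longrightarrow> p \<le> j \<Longrightarrow> j < length \<sigma> \<Longrightarrow> \<sigma> ! i < \<sigma> ! j"
  obtains \<alpha> \<beta> where "is_perm \<alpha>" "is_perm \<beta>" "\<sigma> = direct_sum \<alpha> \<beta>" "length \<alpha> = p" "length \<beta> = length \<sigma> - p"
proof -
  let ?n = "length \<sigma>"
  let ?A = "set (take p \<sigma>)" and ?B = "set (drop p \<sigma>)"
  have set: "set \<sigma> = {1..?n}" "distinct \<sigma>" using \<sigma> by (auto simp: is_perm_iff)
  have AB: "?A \<union> ?B = {1..?n}" using set(1) set_append[of "take p \<sigma>" "drop p \<sigma>"] by simp
  have dis: "?A \<inter> ?B = {}" using set(2) by (metis append_take_drop_id distinct_append)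
  have cA: "card ?A = p" using distinct_card[of "take p \<sigma>"] set(2) p by simp
  have lt: "a < b" if "a \<in> ?A" "b \<in> ?B" for a b
  proof -
    have "\<exists>i. i < p \<and> a = \<sigma> ! i" using that(1) p by (auto simp: in_set_conv_nth)
    then obtain i where "i < p" "a = \<sigma> ! i" by blast
    moreover have "\<exists>j. j < ?n - p \<and> b = \<sigma> ! (p + j)" using that(2) p by (auto simp: in_set_conv_nth)
    then obtain j where "j < ?n - p" "b = \<sigma> ! (p + j)" by blast
    ultimately show ?thesis using l[of i "p + j"] by simp
  qed
  have "?A \<subseteq> {1..p}"
  proof
    fix a assume a: "a \<in> ?A"
    then have a1: "1 \<le> a" "a \<le> ?n" using AB by auto
    have "{1..a} \<subseteq> ?A"
    proof
      fix w assume w: "w \<in> {1..a}"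
      then have "w \<in> ?A \<union> ?B" using AB a1 by auto
      moreover have "w \<notin> ?B" using lt[OF a, of w] w by auto
      ultimately show "w \<in> ?A" by simp
    qed
    then have "card {1..a} \<le> card ?A" by (intro card_mono) auto
    then show "a \<in> {1..p}" using cA a1 by simp
  qed
  then have A: "?A = {1..p}" using cA by (intro card_subset_eq) auto
  moreover have "?B = {1..?n} - ?A" using AB dis by blast
  ultimately have B: "?B = {p + 1..?n}" by auto
  let ?b = "map (\<lambda>v. v - p) (drop p \<sigma>)"
  have injB: "inj_on (\<lambda>v. v - p) ?B" using B by (auto simp: inj_on_def)
  have "(\<lambda>v. v - p) ` {p + 1..?n} = {1..?n - p}"
  proof (intro set_eqI iffI)
    fix v assume "v \<in> {1..?n - p}"
    then show "v \<in> (\<lambda>v. v - p) ` {p + 1..?n}" by (intro image_eqI[of _ _ "v + p"]) auto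
  qed auto
  then have "is_perm ?b" using B injB set(2) by (auto simp: is_perm_iff distinct_map)
  moreover have "is_perm (take p \<sigma>)" using A set(2) p by (simp add: is_perm_iff)
  moreover have "map ((\<lambda>x. x + p) \<circ> (\<lambda>v. v - p)) (drop p \<sigma>) = drop p \<sigma>"
    by (rule map_idI) (use B in auto)
  then have "\<sigma> = direct_sum (take p \<sigma>) ?b" using p by (simp add: direct_sum_def min_def)
  ultimately show thesis using that[of "take p \<sigma>" ?b] p by simp
qed

lemma le_direct_sum_left: "le \<sigma> (direct_sum \<sigma> \<tau>)"
  unfolding le_def embeds_def emb_def vs_def py_def
  by (intro exI[of _ id]) (auto simp: nth_direct_sum)

lemma le_direct_sum_right: "le \<tau> (direct_sum \<sigma> \<tau>)"
  unfolding le_def embeds_def emb_def vs_def py_def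
  by (intro exI[of _ "\<lambda>i. length \<sigma> + i"]) (auto simp: nth_direct_sum)

text \<open>The positions sent into the first summand form an initial segment, and their entries are
  below all others; \<open>perm_split\<close> cuts there.\<close>

lemma le_direct_sumE:
  assumes \<rho>: "is_perm \<rho>" and l: "le \<rho> (direct_sum \<sigma> \<tau>)" and \<sigma>: "is_perm \<sigma>" and \<tau>: "is_perm \<tau>"
  obtains \<rho>1 \<rho>2 where "is_perm \<rho>1" "is_perm \<rho>2" "\<rho> = direct_sum \<rho>1 \<rho>2" "le \<rho>1 \<sigma>" "le \<rho>2 \<tau>"
proof -
  let ?n = "length \<rho>" and ?s = "length \<sigma>"
  obtain f where "emb int (py \<rho>) (vs \<rho>) int (py (direct_sum \<sigma> \<tau>)) (vs (direct_sum \<sigma> \<tau>)) f"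
    using l by (auto simp: le_def embeds_def)
  then have f: "f i < ?s + length \<tau>" "i < j \<longleftrightarrow> f i < f j" "\<rho> ! i < \<rho> ! j \<longleftrightarrow> direct_sum \<sigma> \<tau> ! f i < direct_sum \<sigma> \<tau> ! f j"
    if "i < ?n" "j < ?n" for i j
    using that unfolding emb_def vs_def py_def by auto
  define p where "p = card {i. i < ?n \<and> f i < ?s}"
  have "{i. i < ?n \<and> f i < ?s} = {..<p}"
  proof -
    let ?S = "{i. i < ?n \<and> f i < ?s}"
    have down: "i \<in> ?S" if "j \<in> ?S" "i \<le> j" for i j
      using that f(2)[of i j] by (cases "i = j") auto
    have fS: "finite ?S" by simp
    have "?S \<subseteq> {..<p}"
    proof
      fix j assume j: "j \<in> ?S"
      then have "{..j} \<subseteq> ?S" using down by blast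
      then have "card {..j} \<le> card ?S" using fS card_mono by blast
      then show "j \<in> {..<p}" by (simp add: p_def)
    qed
    then show ?thesis by (intro card_subset_eq) (auto simp: p_def)
  qed
  then have S: "i < ?n \<Longrightarrow> f i < ?s \<longleftrightarrow> i < p" for i by auto
  have "p \<le> card {..<?n}" unfolding p_def by (intro card_mono) auto
  then have pn: "p \<le> ?n" by simp
  have sv: "\<sigma> ! i \<le> ?s" if "i < ?s" for i using \<sigma> that nth_mem[OF that] by (auto simp: is_perm_iff)
  have tv: "1 \<le> \<tau> ! i" if "i < length \<tau>" for i using \<tau> that nth_mem[OF that] by (auto simp: is_perm_iff)
  have "\<rho> ! i < \<rho> ! j" if "i < p" "p \<le> j" "j < ?n" for i j
  proof -
    have ij: "i < ?n" "j < ?n" "f i < ?s" "\<not> f j < ?s" using that S[of i] S[of j] pn by auto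
    have "direct_sum \<sigma> \<tau> ! f i \<le> ?s" using ij f(1)[of i i] sv by (simp add: nth_direct_sum)
    moreover have "?s < direct_sum \<sigma> \<tau> ! f j" using ij f(1)[of j j] tv[of "f j - ?s"] by (simp add: nth_direct_sum Suc_le_eq)
    ultimately show ?thesis using f(3)[OF ij(1,2)] by simp
  qed
  then obtain \<alpha> \<beta> where ab: "is_perm \<alpha>" "is_perm \<beta>" "\<rho> = direct_sum \<alpha> \<beta>" "length \<alpha> = p" "length \<beta> = ?n - p"
    using perm_split[OF \<rho> pn] by blast
  have a: "\<alpha> ! i = \<rho> ! i" if "i < p" for i using ab that by (simp add: nth_direct_sum)
  have b: "\<rho> ! (p + i) = \<beta> ! i + p" if "i < ?n - p" for i using ab that by (simp add: nth_direct_sum)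
  have "emb int (py \<alpha>) (vs \<alpha>) int (py \<sigma>) (vs \<sigma>) f"
    unfolding emb_def
  proof (intro conjI ballI)
    show "f ` vs \<alpha> \<subseteq> vs \<sigma>" using S pn ab(4) by (auto simp: vs_def)
    fix i j assume "i \<in> vs \<alpha>" "j \<in> vs \<alpha>"
    then have ij: "i < p" "j < p" "i < ?n" "j < ?n" "f i < ?s" "f j < ?s" using ab(4) pn S by (auto simp: vs_def)
    show "int i < int j \<longleftrightarrow> int (f i) < int (f j)" using f(2)[OF ij(3,4)] by simp
    show "py \<alpha> i < py \<alpha> j \<longleftrightarrow> py \<sigma> (f i) < py \<sigma> (f j)"
      using f(3)[OF ij(3,4)] a ij by (simp add: py_def nth_direct_sum)
  qed
  moreover have "emb int (py \<beta>) (vs \<beta>) int (py \<tau>) (vs \<tau>) (\<lambda>i. f (p + i) - ?s)"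
    unfolding emb_def
  proof (intro conjI ballI)
    have F: "\<not> f (p + i) < ?s \<and> f (p + i) < ?s + length \<tau>" if "i < ?n - p" for i
      using S[of "p + i"] f(1)[of "p + i" "p + i"] that by simp
    show "(\<lambda>i. f (p + i) - ?s) ` vs \<beta> \<subseteq> vs \<tau>"
    proof
      fix v assume "v \<in> (\<lambda>i. f (p + i) - ?s) ` vs \<beta>"
      then obtain i where "i < ?n - p" "v = f (p + i) - ?s" using ab(5) by (auto simp: vs_def)
      then show "v \<in> vs \<tau>" using F[of i] by (simp add: vs_def) linarith
    qed
    fix i j assume "i \<in> vs \<beta>" "j \<in> vs \<beta>"
    then have ij: "i < ?n - p" "j < ?n - p" using ab(5) by (auto simp: vs_def)
    then have ij': "p + i < ?n" "p + j < ?n" by auto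
    show "int i < int j \<longleftrightarrow> int (f (p + i) - ?s) < int (f (p + j) - ?s)"
      using f(2)[OF ij'] F[OF ij(1)] F[OF ij(2)] by (simp add: less_diff_iff)
    show "py \<beta> i < py \<beta> j \<longleftrightarrow> py \<tau> (f (p + i) - ?s) < py \<tau> (f (p + j) - ?s)"
      using f(3)[OF ij'] b[OF ij(1)] b[OF ij(2)] F[OF ij(1)] F[OF ij(2)] by (simp add: py_def nth_direct_sum)
  qed
  ultimately show thesis using that ab(1-3) by (auto simp: le_def embeds_def)
qed

definition indec :: "nat list \<Rightarrow> bool" where
  "indec \<alpha> \<longleftrightarrow> is_perm \<alpha> \<and> sum_indec int (py \<alpha>) (vs \<alpha>)"

lemma not_indecE:
  assumes \<sigma>: "is_perm \<sigma>" "\<sigma> \<noteq> []" "\<not> indec \<sigma>"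
  obtains \<alpha> \<beta> where "is_perm \<alpha>" "is_perm \<beta>" "\<sigma> = direct_sum \<alpha> \<beta>" "\<alpha> \<noteq> []" "\<beta> \<noteq> []"
proof -
  let ?n = "length \<sigma>"
  have "0 \<in> vs \<sigma>" using \<sigma> by (simp add: vs_def)
  then have "vs \<sigma> \<noteq> {}" by blast
  then obtain S where S: "S \<subset> vs \<sigma>" "S \<noteq> {}" "\<And>u v. u \<in> S \<Longrightarrow> v \<in> vs \<sigma> - S \<Longrightarrow> lt int (py \<sigma>) u v"
    using \<sigma> unfolding indec_def sum_indec_def by blast
  have fS: "finite S" using S(1) finite_subset[of S "vs \<sigma>"] by auto
  define p where "p = card S"
  have "S \<subseteq> {..<p}"
  proof
    fix j assume j: "j \<in> S"
    have "{..j} \<subseteq> S"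
    proof
      fix i assume i: "i \<in> {..j}"
      have "i \<in> vs \<sigma>" using i j S(1) by (auto simp: vs_def)
      moreover have "\<not> lt int (py \<sigma>) j i" using i by (auto simp: lt_def)
      ultimately show "i \<in> S" using S(3)[OF j, of i] by blast
    qed
    then have "card {..j} \<le> card S" using fS card_mono by blast
    then show "j \<in> {..<p}" by (simp add: p_def)
  qed
  then have Sp: "S = {..<p}" by (intro card_subset_eq) (auto simp: p_def)
  have p: "0 < p" "p < ?n"
    using S(2) fS psubset_card_mono[OF finite_vs S(1)] by (auto simp: p_def card_gt_0_iff)
  obtain \<alpha> \<beta> where "is_perm \<alpha>" "is_perm \<beta>" "\<sigma> = direct_sum \<alpha> \<beta>" "length \<alpha> = p" "length \<beta> = ?n - p"
  proof (rule perm_split[OF \<sigma>(1), of p])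
    show "p \<le> ?n" using p by simp
    fix i j assume "i < p" "p \<le> j" "j < ?n"
    then show "\<sigma> ! i < \<sigma> ! j" using S(3)[of i j] Sp by (auto simp: vs_def lt_def py_def)
  qed
  then show thesis using that p by force
qed

text \<open>If the indecomposable \<alpha>' were longer than \<alpha>, then \<alpha> would be a
  proper lower summand of it. Applied in both directions, this makes the first indecomposable
  summand unique.\<close>

lemma indec_prefix_unique:
  assumes \<alpha>: "is_perm \<alpha>" "\<alpha> \<noteq> []" and \<alpha>': "indec \<alpha>'" and \<beta>: "is_perm \<beta>"
    and eq: "direct_sum \<alpha> \<beta> = direct_sum \<alpha>' \<beta>'"
  shows "length \<alpha>' \<le> length \<alpha>"
proof (rule ccontr)
  assume "\<not> ?thesis"
  then have p: "length \<alpha> < length \<alpha>'" by simp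
  have len: "length \<alpha> + length \<beta> = length \<alpha>' + length \<beta>'" using eq by (metis length_direct_sum)
  have a: "\<alpha>' ! i = direct_sum \<alpha> \<beta> ! i" if "i < length \<alpha>'" for i
    using that unfolding eq by (simp add: nth_direct_sum)
  have "lt int (py \<alpha>') i j" if i: "i \<in> {..<length \<alpha>}" and j: "j \<in> vs \<alpha>' - {..<length \<alpha>}" for i j
  proof -
    have ij: "i < length \<alpha>" "length \<alpha> \<le> j" "j < length \<alpha>'" using i j by (auto simp: vs_def)
    have "\<alpha>' ! i = \<alpha> ! i" using a[of i] ij p len by (simp add: nth_direct_sum)
    moreover have "\<alpha> ! i \<le> length \<alpha>" using \<alpha>(1) nth_mem[OF ij(1)] by (auto simp: is_perm_iff)
    moreover have jb: "j - length \<alpha> < length \<beta>" using ij len by linarith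
    have "\<alpha>' ! j = \<beta> ! (j - length \<alpha>) + length \<alpha>" using a[of j] ij len by (simp add: nth_direct_sum)
    moreover have "1 \<le> \<beta> ! (j - length \<alpha>)" using \<beta> nth_mem[OF jb] by (auto simp: is_perm_iff)
    ultimately show ?thesis using ij by (simp add: lt_def py_def)
  qed
  moreover have "{..<length \<alpha>} \<subset> vs \<alpha>'" "{..<length \<alpha>} \<noteq> {}" using p \<alpha>(2) by (auto simp: vs_def)
  ultimately show False using \<alpha>' unfolding indec_def sum_indec_def by blast
qed

inductive_set sum_span :: "nat list set \<Rightarrow> nat list set" for X where
  Nil: "[] \<in> sum_span X"
| Sum: "\<alpha> \<in> X \<Longrightarrow> indec \<alpha> \<Longrightarrow> \<beta> \<in> sum_span X \<Longrightarrow> direct_sum \<alpha> \<beta> \<in> sum_span X"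

lemma sums_perm: "\<rho> \<in> sum_span X \<Longrightarrow> is_perm \<rho>"
  by (induction rule: sum_span.induct) (auto simp: is_perm_direct_sum indec_def, simp add: is_perm_iff)

lemma sums_closed: "\<sigma> \<in> sum_span X \<Longrightarrow> \<tau> \<in> sum_span X \<Longrightarrow> direct_sum \<sigma> \<tau> \<in> sum_span X"
  by (induction rule: sum_span.induct) (auto simp: direct_sum_assoc intro: sum_span.Sum)

lemma Sub_sums: "\<sigma> \<in> Sub \<pi> \<Longrightarrow> \<sigma> \<in> sum_span (Sub \<pi>)"
proof (induction "length \<sigma>" arbitrary: \<sigma> rule: less_induct)
  case less
  have \<sigma>: "is_perm \<sigma>" "le \<sigma> \<pi>" using less.prems by (auto simp: Sub_iff)
  consider "\<sigma> = []" | "indec \<sigma>" | "\<sigma> \<noteq> []" "\<not> indec \<sigma>" by blast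
  then show ?case
  proof cases
    case 1
    then show ?thesis by (simp add: sum_span.Nil)
  next
    case 2
    then show ?thesis using sum_span.Sum[OF less.prems 2 sum_span.Nil] by simp
  next
    case 3
    then obtain \<alpha> \<beta> where ab: "is_perm \<alpha>" "is_perm \<beta>" "\<sigma> = direct_sum \<alpha> \<beta>" "\<alpha> \<noteq> []" "\<beta> \<noteq> []"
      using not_indecE[OF \<sigma>(1)] by blast
    have "le \<alpha> \<sigma>" "le \<beta> \<sigma>" unfolding ab(3) by (rule le_direct_sum_left le_direct_sum_right)+
    then have "\<alpha> \<in> Sub \<pi>" "\<beta> \<in> Sub \<pi>" using ab(1,2) le_trans[OF _ \<sigma>(2)] by (simp_all add: Sub_iff)
    then have "\<alpha> \<in> sum_span (Sub \<pi>)" "\<beta> \<in> sum_span (Sub \<pi>)" using less.hyps ab by auto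
    then show ?thesis using sums_closed ab(3) by blast
  qed
qed

lemma sums_le: "\<rho> \<in> sum_span (Sub \<pi>) \<Longrightarrow> is_perm \<sigma> \<Longrightarrow> le \<sigma> \<rho> \<Longrightarrow> \<sigma> \<in> sum_span (Sub \<pi>)"
proof (induction arbitrary: \<sigma> rule: sum_span.induct)
  case Nil
  then have "\<sigma> = []" using le_length[of \<sigma> "[]"] by simp
  then show ?case by (simp add: sum_span.Nil)
next
  case (Sum \<alpha> \<beta>)
  obtain \<sigma>1 \<sigma>2 where s: "is_perm \<sigma>1" "is_perm \<sigma>2" "\<sigma> = direct_sum \<sigma>1 \<sigma>2" "le \<sigma>1 \<alpha>" "le \<sigma>2 \<beta>"
    using le_direct_sumE[OF Sum.prems] Sum.hyps sums_perm by (metis indec_def)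
  have "\<sigma>1 \<in> Sub \<pi>" using s(1) le_trans[OF s(4)] Sum.hyps(1) by (simp add: Sub_iff)
  then have "\<sigma>1 \<in> sum_span (Sub \<pi>)" by (rule Sub_sums)
  moreover have "\<sigma>2 \<in> sum_span (Sub \<pi>)" using Sum.IH s by blast
  ultimately show ?case using sums_closed s(3) by blast
qed

lemma sum_closure_Sub: "sum_closure (Sub \<pi>) = sum_span (Sub \<pi>)"
proof
  have "perm_class (sum_span (Sub \<pi>))"
    unfolding perm_class_def perm_contained_iff_le using sums_perm sums_le by blast
  moreover have "sum_closed (sum_span (Sub \<pi>))" unfolding sum_closed_def using sums_closed by blast
  moreover have "Sub \<pi> \<subseteq> sum_span (Sub \<pi>)" using Sub_sums by blast
  ultimately show "sum_closure (Sub \<pi>) \<subseteq> sum_span (Sub \<pi>)" unfolding sum_closure_def by blast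
  show "sum_span (Sub \<pi>) \<subseteq> sum_closure (Sub \<pi>)"
  proof
    fix \<rho> assume "\<rho> \<in> sum_span (Sub \<pi>)"
    then show "\<rho> \<in> sum_closure (Sub \<pi>)"
    proof (induction rule: sum_span.induct)
      case Nil
      have "[] \<in> Sub \<pi>" by (simp add: Sub_iff is_perm_iff le_def embeds_def emb_def vs_def)
      then show ?case unfolding sum_closure_def by blast
    next
      case (Sum \<alpha> \<beta>)
      then show ?case unfolding sum_closure_def sum_closed_def by blast
    qed
  qed
qed

section \<open>Counting sums by their first summand\<close>

definition cnt :: "nat list set \<Rightarrow> nat \<Rightarrow> nat" where
  "cnt C n = card {\<rho>\<in>C. length \<rho> = n}"

definition icnt :: "nat list \<Rightarrow> nat \<Rightarrow> nat" where
  "icnt \<pi> k = card {\<alpha>\<in>Sub \<pi>. indec \<alpha> \<and> length \<alpha> = k}"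

lemma finite_perms: "(\<And>\<rho>. \<rho> \<in> C \<Longrightarrow> is_perm \<rho>) \<Longrightarrow> finite {\<rho>\<in>C. length \<rho> = n}"
  by (rule finite_subset[OF _ finite_lists_length_eq[of "{1..n}" n]]) (auto simp: is_perm_iff)

text \<open>The renewal equation: splitting off the first indecomposable summand is a bijection onto
  pairs of a summand and a remaining sum.\<close>

lemma cnt_recursion:
  assumes n: "1 \<le> n"
  shows "cnt (sum_span (Sub \<pi>)) n = (\<Sum>k=1..n. icnt \<pi> k * cnt (sum_span (Sub \<pi>)) (n - k))"
proof -
  let ?C = "sum_span (Sub \<pi>)"
  let ?I = "\<lambda>k. {\<alpha>\<in>Sub \<pi>. indec \<alpha> \<and> length \<alpha> = k}" and ?D = "\<lambda>n. {\<rho>\<in>?C. length \<rho> = n}"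
  let ?T = "SIGMA k:{1..n}. ?I k \<times> ?D (n - k)"
  let ?g = "\<lambda>(k :: nat, \<alpha>, \<beta>). direct_sum \<alpha> \<beta>"
  have finD: "finite (?D j)" for j by (rule finite_perms) (rule sums_perm)
  have finI: "finite (?I k)" for k
    by (rule finite_subset[OF _ finite_perms[of "Sub \<pi>" k]]) (auto simp: Sub_iff)
  have inj: "inj_on ?g ?T"
  proof (rule inj_onI)
    fix s t assume st: "s \<in> ?T" "t \<in> ?T" "?g s = ?g t"
    obtain k \<alpha> \<beta> where s: "s = (k, \<alpha>, \<beta>)" by (cases s) auto
    obtain k' \<alpha>' \<beta>' where t: "t = (k', \<alpha>', \<beta>')" by (cases t) auto
    have S: "indec \<alpha>" "length \<alpha> = k" "is_perm \<beta>" "\<alpha> \<noteq> []" using st(1) sums_perm unfolding s by auto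
    have T: "indec \<alpha>'" "length \<alpha>' = k'" "is_perm \<beta>'" "\<alpha>' \<noteq> []" using st(2) sums_perm unfolding t by auto
    have eq: "direct_sum \<alpha> \<beta> = direct_sum \<alpha>' \<beta>'" using st(3) s t by simp
    have "length \<alpha>' \<le> length \<alpha>" by (rule indec_prefix_unique[OF _ S(4) T(1) S(3) eq]) (use S(1) in \<open>simp add: indec_def\<close>)
    moreover have "length \<alpha> \<le> length \<alpha>'" by (rule indec_prefix_unique[OF _ T(4) S(1) T(3) eq[symmetric]]) (use T(1) in \<open>simp add: indec_def\<close>)
    ultimately have "\<alpha> = \<alpha>' \<and> \<beta> = \<beta>'" using direct_sum_inj[OF _ eq] by simp
    then show "s = t" using s t S T by simp
  qed
  have "?g ` ?T = ?D n"
  proof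
    show "?g ` ?T \<subseteq> ?D n" by (auto intro: sum_span.Sum)
    show "?D n \<subseteq> ?g ` ?T"
    proof
      fix \<rho> assume "\<rho> \<in> ?D n"
      then have \<rho>: "\<rho> \<in> ?C" "length \<rho> = n" by auto
      from \<rho>(1) show "\<rho> \<in> ?g ` ?T"
      proof cases
        case Nil
        then show ?thesis using \<rho> n by simp
      next
        case (Sum \<alpha> \<beta>)
        have "\<alpha> \<noteq> []" using Sum(3) by (auto simp: indec_def sum_indec_def vs_def)
        then have "(length \<alpha>, \<alpha>, \<beta>) \<in> ?T" using Sum \<rho>(2) by (auto simp: Suc_le_eq)
        then show ?thesis using Sum(1) by (intro image_eqI[of _ _ "(length \<alpha>, \<alpha>, \<beta>)"]) auto
      qed
    qed
  qed
  then have "cnt ?C n = card ?T" using card_image[OF inj] by (simp add: cnt_def)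
  also have "\<dots> = (\<Sum>k=1..n. card (?I k \<times> ?D (n - k)))" using finD finI by (intro card_SigmaI) auto
  finally show ?thesis by (simp add: cnt_def icnt_def card_cartesian_product)
qed

lemma cnt_0: "cnt (sum_span (Sub \<pi>)) 0 = 1"
proof -
  have "{\<rho>\<in>sum_span (Sub \<pi>). length \<rho> = 0} = {[]}" by (auto intro: sum_span.Nil)
  then show ?thesis by (simp add: cnt_def)
qed

lemma icnt_large: "length \<pi> < k \<Longrightarrow> icnt \<pi> k = 0"
proof -
  assume k: "length \<pi> < k"
  have "{\<alpha>\<in>Sub \<pi>. indec \<alpha> \<and> length \<alpha> = k} = {}"
  proof (rule ccontr)
    assume "\<not> ?thesis"
    then obtain \<alpha> where "le \<alpha> \<pi>" "length \<alpha> = k" by (auto simp: Sub_iff)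
    then show False using le_length[of \<alpha> \<pi>] k by simp
  qed
  then show ?thesis unfolding icnt_def by (metis card.empty)
qed

text \<open>The bound passes through the renewal equation because the weights
  \<open>icnt \<pi> k / g ^ k\<close> sum to at most 1. From \<open>L\<close> on there are no
  further weights.\<close>

lemma cnt_upper:
  assumes g: "0 < g" and s: "(\<Sum>k=1..L. real (icnt \<pi> k) / g ^ k) \<le> 1" and L: "length \<pi> \<le> L"
  shows "real (cnt (sum_span (Sub \<pi>)) n) \<le> g ^ n"
proof (induction n rule: less_induct)
  case (less n)
  show ?case
  proof (cases "n = 0")
    case True
    then show ?thesis by (simp add: cnt_0)
  next
    case False
    have "real (cnt (sum_span (Sub \<pi>)) n) = (\<Sum>k=1..n. real (icnt \<pi> k) * real (cnt (sum_span (Sub \<pi>)) (n - k)))"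
      using cnt_recursion[of n \<pi>] False by simp
    also have "\<dots> \<le> (\<Sum>k=1..n. real (icnt \<pi> k) * g ^ (n - k))"
      using less.IH by (intro sum_mono mult_left_mono) auto
    also have "\<dots> = (\<Sum>k=1..n. g ^ n * (real (icnt \<pi> k) / g ^ k))"
      using g by (intro sum.cong) (auto simp: power_diff)
    also have "\<dots> = g ^ n * (\<Sum>k=1..n. real (icnt \<pi> k) / g ^ k)" by (simp add: sum_distrib_left)
    also have "(\<Sum>k=1..n. real (icnt \<pi> k) / g ^ k) \<le> (\<Sum>k=1..max n L. real (icnt \<pi> k) / g ^ k)"
      using g by (intro sum_mono2) auto
    also have "(\<Sum>k=1..max n L. real (icnt \<pi> k) / g ^ k) = (\<Sum>k=1..L. real (icnt \<pi> k) / g ^ k)"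
      using L icnt_large[of \<pi>] by (intro sum.mono_neutral_right) auto
    finally have "real (cnt (sum_span (Sub \<pi>)) n) \<le> g ^ n * (\<Sum>k=1..L. real (icnt \<pi> k) / g ^ k)"
      using g by (simp add: mult_left_mono)
    also have "\<dots> \<le> g ^ n * 1" using s g by (intro mult_left_mono) auto
    finally show ?thesis by simp
  qed
qed

text \<open>The factor \<open>g ^ N\<close> absorbs the lengths up to \<open>N\<close>, for which it
  is enough that the count is positive. Beyond \<open>N\<close> the renewal equation with weights of
  total at least 1 preserves the bound.\<close>

lemma cnt_lower:
  assumes g: "1 \<le> g" and s: "1 \<le> (\<Sum>k=1..N. real (w k) / g ^ k)" and w: "\<And>k. 1 \<le> k \<Longrightarrow> k \<le> N \<Longrightarrow> w k \<le> icnt \<pi> k"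
    and pos: "\<And>n. 1 \<le> cnt (sum_span (Sub \<pi>)) n"
  shows "g ^ n \<le> real (cnt (sum_span (Sub \<pi>)) n) * g ^ N"
proof (induction n rule: less_induct)
  case (less n)
  show ?case
  proof (cases "n \<le> N")
    case True
    have "g ^ n \<le> 1 * g ^ N" using g True by (simp add: power_increasing)
    also have "\<dots> \<le> real (cnt (sum_span (Sub \<pi>)) n) * g ^ N" using g pos[of n] by (intro mult_right_mono) auto
    finally show ?thesis .
  next
    case False
    have "g ^ n \<le> g ^ n * (\<Sum>k=1..N. real (w k) / g ^ k)" using s g by simp
    also have "\<dots> = (\<Sum>k=1..N. real (w k) * g ^ (n - k))"
      using g False by (auto simp: sum_distrib_left power_diff intro!: sum.cong)
    also have "\<dots> \<le> (\<Sum>k=1..N. real (w k) * (real (cnt (sum_span (Sub \<pi>)) (n - k)) * g ^ N))"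
      using less.IH False by (intro sum_mono mult_left_mono) auto
    also have "\<dots> \<le> (\<Sum>k=1..N. real (icnt \<pi> k) * (real (cnt (sum_span (Sub \<pi>)) (n - k)) * g ^ N))"
      using w g by (intro sum_mono mult_right_mono) auto
    also have "\<dots> \<le> (\<Sum>k=1..n. real (icnt \<pi> k) * (real (cnt (sum_span (Sub \<pi>)) (n - k)) * g ^ N))"
      using False g by (intro sum_mono2) auto
    also have "\<dots> = real (cnt (sum_span (Sub \<pi>)) n) * g ^ N"
      using cnt_recursion[of n \<pi>] False by (simp add: sum_distrib_right mult.assoc)
    finally show ?thesis .
  qed
qed

section \<open>Existence of the growth rate and bounds for it\<close>

text \<open>Fekete's lemma for superadditive sequences; the limit is the supremum \<open>S\<close>
  of the quotients. For \<open>m\<close> with a quotient near \<open>S\<close>, division of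
  \<open>n\<close> by \<open>m\<close> bounds the quotient at \<open>n\<close> from below by that at
  \<open>m\<close>, up to an error of \<open>b m / n\<close>.\<close>

lemma fekete:
  fixes b :: "nat \<Rightarrow> real"
  assumes sup: "\<And>m n. b m + b n \<le> b (m + n)" and b0: "\<And>n. 0 \<le> b n" and up: "\<And>n. b n \<le> real n * c"
  shows "convergent (\<lambda>n. b n / real n)"
proof -
  let ?s = "\<lambda>n. b n / real n"
  define S where "S = (SUP n\<in>{1..}. ?s n)"
  have c: "?s n \<le> c" if "n \<in> {1..}" for n using up[of n] that by (simp add: field_simps)
  then have bdd: "bdd_above (?s ` {1..})" by (intro bdd_aboveI[of _ c]) blast
  have mult: "real k * b m \<le> b (k * m)" for k m
  proof (induction k)
    case (Suc k)
    have "real (Suc k) * b m = b m + real k * b m" by (simp add: algebra_simps)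
    also have "\<dots> \<le> b (m + k * m)" using Suc sup[of m "k * m"] by linarith
    finally show ?case by simp
  qed (use b0 in simp)
  have "?s \<longlonglongrightarrow> S"
  proof (rule LIMSEQ_I)
    fix r :: real assume r: "0 < r"
    have "S - r / 2 < S" using r by simp
    then obtain m where m: "1 \<le> m" "S - r / 2 < ?s m"
      using less_cSUP_iff[OF _ bdd, of "S - r / 2"] unfolding S_def[symmetric] by auto
    \<comment> \<open>From \<open>n0\<close> on the error \<open>b m / n\<close> is below
      \<open>r / 2\<close>.\<close>
    define n0 where "n0 = nat \<lceil>2 * b m / r\<rceil> + 1"
    show "\<exists>no. \<forall>n\<ge>no. norm (?s n - S) < r"
    proof (intro exI[of _ n0] allI impI)
      fix n assume n: "n0 \<le> n"
      then have n1: "1 \<le> n" by (simp add: n0_def)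
      have "2 * b m / r < real n" using n unfolding n0_def by linarith
      then have small: "b m / real n < r / 2" using r n1 by (simp add: field_simps)
      have "real (n div m) * b m \<le> b (n div m * m)" by (rule mult)
      also have "\<dots> \<le> b (n div m * m) + b (n mod m)" using b0 by simp
      also have "\<dots> \<le> b n" using sup[of "n div m * m" "n mod m"] by simp
      finally have q: "real (n div m) * b m \<le> b n" .
      have "n < (n div m + 1) * m" using m(1) by (metis Suc_eq_plus1 dividend_less_times_div mult.commute mult_Suc_right add.commute One_nat_def Suc_le_eq)
      then have "real n \<le> (real (n div m) + 1) * real m" by (metis less_imp_le of_nat_1 of_nat_add of_nat_le_iff of_nat_mult)
      then have "real n * ?s m \<le> (real (n div m) + 1) * real m * ?s m"
        using b0[of m] by (intro mult_right_mono) auto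
      also have "\<dots> = (real (n div m) + 1) * b m" using m(1) by simp
      also have "\<dots> \<le> b n + b m" using q by (simp add: algebra_simps)
      finally have "?s m \<le> ?s n + b m / real n" using n1 by (simp add: field_simps)
      then have "S - r < ?s n" using m(2) small by linarith
      moreover have "?s n \<le> S" unfolding S_def using n1 bdd by (intro cSUP_upper) auto
      ultimately show "norm (?s n - S) < r" using r by auto
    qed
  qed
  then show ?thesis by (rule convergentI)
qed

lemma cnt_pos:
  assumes "\<pi> \<noteq> []"
  shows "1 \<le> cnt (sum_span (Sub \<pi>)) n"
proof -
  have p: "is_perm [1]" by (simp add: is_perm_iff)
  have "emb int (py [1]) (vs [1]) int (py \<pi>) (vs \<pi>) (\<lambda>_. 0)" using assms by (auto simp: emb_def vs_def Suc_le_eq)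
  then have S: "[1] \<in> Sub \<pi>" using p by (auto simp: Sub_iff le_def embeds_def)
  have "\<exists>\<rho>\<in>sum_span (Sub \<pi>). length \<rho> = n" 
  proof (induction n)
    case 0
    then show ?case using sum_span.Nil by fastforce
  next
    case (Suc n)
    then obtain \<rho> where "\<rho> \<in> sum_span (Sub \<pi>)" "length \<rho> = n" by blast
    then show ?case using sums_closed[OF Sub_sums[OF S], of \<rho>] by (intro bexI[of _ "direct_sum [1] \<rho>"]) auto
  qed
  then have "{\<rho>\<in>sum_span (Sub \<pi>). length \<rho> = n} \<noteq> {}" by blast
  then show ?thesis
    using finite_perms[of "sum_span (Sub \<pi>)" n] sums_perm by (simp add: cnt_def Suc_le_eq card_gt_0_iff)
qed

lemma cnt_supermult: "cnt (sum_span (Sub \<pi>)) m * cnt (sum_span (Sub \<pi>)) n \<le> cnt (sum_span (Sub \<pi>)) (m + n)"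
proof -
  let ?D = "\<lambda>n. {\<rho>\<in>sum_span (Sub \<pi>). length \<rho> = n}"
  have "card (?D m \<times> ?D n) \<le> card (?D (m + n))"
  proof (rule card_inj_on_le[of "\<lambda>(\<alpha>, \<beta>). direct_sum \<alpha> \<beta>"])
    show "inj_on (\<lambda>(\<alpha>, \<beta>). direct_sum \<alpha> \<beta>) (?D m \<times> ?D n)"
      by (rule inj_onI) (auto dest!: direct_sum_inj[rotated])
    show "(\<lambda>(\<alpha>, \<beta>). direct_sum \<alpha> \<beta>) ` (?D m \<times> ?D n) \<subseteq> ?D (m + n)" by (auto intro: sums_closed)
    show "finite (?D (m + n))" by (rule finite_perms) (rule sums_perm)
  qed
  then show ?thesis by (simp add: cnt_def card_cartesian_product)
qed

lemma cnt_bounded: "\<exists>B\<ge>1. \<forall>n. real (cnt (sum_span (Sub \<pi>)) n) \<le> B ^ n"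
proof -
  let ?L = "length \<pi>"
  let ?B = "real (\<Sum>k=1..?L. icnt \<pi> k) + 1"
  have B: "1 \<le> ?B" by (simp add: sum_nonneg)
  have "(\<Sum>k=1..?L. real (icnt \<pi> k) / ?B ^ k) \<le> (\<Sum>k=1..?L. real (icnt \<pi> k) / ?B)"
  proof (intro sum_mono divide_left_mono)
    fix k assume "k \<in> {1..?L}"
    then show "?B \<le> ?B ^ k" using self_le_power[OF B, of k] by simp
  qed (use B in auto)
  also have "\<dots> = real (\<Sum>k=1..?L. icnt \<pi> k) / ?B" by (simp add: sum_divide_distrib)
  also have "\<dots> \<le> 1" by (simp del: of_nat_sum)
  finally have "real (cnt (sum_span (Sub \<pi>)) n) \<le> ?B ^ n" for n using cnt_upper[of ?B \<pi> ?L n] B by linarith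
  then show ?thesis using B by blast
qed

text \<open>Logarithms turn supermultiplicative counts into a superadditive sequence, so the
  \<open>lim\<close> in \<open>growth_rate\<close> is a genuine limit here.\<close>

lemma growth_LIMSEQ:
  assumes \<pi>: "\<pi> \<noteq> []"
  shows "(\<lambda>n. root n (real (cnt (sum_span (Sub \<pi>)) n))) \<longlonglongrightarrow> growth_rate (sum_closure (Sub \<pi>))"
proof -
  let ?a = "\<lambda>n. real (cnt (sum_span (Sub \<pi>)) n)"
  have a1: "1 \<le> ?a n" for n using cnt_pos[OF \<pi>, of n] by (metis of_nat_1 of_nat_le_iff)
  obtain B where B: "1 \<le> B" "\<And>n. ?a n \<le> B ^ n" using cnt_bounded by blast
  have "convergent (\<lambda>n. ln (?a n) / real n)"
  proof (rule fekete)
    show "ln (?a m) + ln (?a n) \<le> ln (?a (m + n))" for m n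
    proof -
      have "?a m * ?a n \<le> ?a (m + n)" using cnt_supermult[of \<pi> m n] by (metis of_nat_le_iff of_nat_mult)
      moreover have "0 < ?a m" "0 < ?a n" "0 < ?a (m + n)" using a1[of m] a1[of n] a1[of "m + n"] by linarith+
      ultimately show ?thesis by (metis ln_le_cancel_iff ln_mult_pos mult_pos_pos)
    qed
    show "0 \<le> ln (?a n)" for n using a1[of n] by simp
    show "ln (?a n) \<le> real n * ln B" for n
    proof -
      have "ln (?a n) \<le> ln (B ^ n)" using B a1[of n] by (metis ln_le_cancel_iff less_le_trans zero_less_one zero_less_power)
      then show ?thesis using B by (simp add: ln_realpow)
    qed
  qed
  then obtain l where l: "(\<lambda>n. ln (?a n) / real n) \<longlonglongrightarrow> l" by (auto simp: convergent_def)
  have "(\<lambda>n. exp (ln (?a n) / real n)) \<longlonglongrightarrow> exp l" using l by (rule tendsto_exp)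
  moreover have "\<forall>\<^sub>F n in sequentially. exp (ln (?a n) / real n) = root n (?a n)"
    using eventually_gt_at_top[of 0]
  proof eventually_elim
    case (elim n)
    have "0 < ?a n" using a1[of n] by linarith
    then show ?case using elim by (simp add: root_powr_inverse powr_def divide_inverse)
  qed
  ultimately have lim: "(\<lambda>n. root n (?a n)) \<longlonglongrightarrow> exp l" by (rule Lim_transform_eventually)
  then have "lim (\<lambda>n. root n (?a n)) = exp l" by (rule limI)
  then have "growth_rate (sum_closure (Sub \<pi>)) = exp l" by (simp add: growth_rate_def sum_closure_Sub cnt_def)
  then show ?thesis using lim by simp
qed

lemma growth_upper:
  assumes \<pi>: "\<pi> \<noteq> []" and g: "0 < g" and s: "(\<Sum>k=1..L. real (icnt \<pi> k) / g ^ k) \<le> 1" and L: "length \<pi> \<le> L"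
  shows "growth_rate (sum_closure (Sub \<pi>)) \<le> g"
proof (rule LIMSEQ_le_const2[OF growth_LIMSEQ[OF \<pi>]])
  show "\<exists>N. \<forall>n\<ge>N. root n (real (cnt (sum_span (Sub \<pi>)) n)) \<le> g"
  proof (intro exI[of _ 1] allI impI)
    fix n :: nat assume n: "1 \<le> n"
    have "root n (real (cnt (sum_span (Sub \<pi>)) n)) \<le> root n (g ^ n)"
      using cnt_upper[OF g s L] n by (intro real_root_le_mono) auto
    then show "root n (real (cnt (sum_span (Sub \<pi>)) n)) \<le> g" using n g by (simp add: real_root_power_cancel)
  qed
qed

lemma growth_lower:
  assumes \<pi>: "\<pi> \<noteq> []" and g: "1 \<le> g" and s: "1 \<le> (\<Sum>k=1..N. real (w k) / g ^ k)"
    and w: "\<And>k. 1 \<le> k \<Longrightarrow> k \<le> N \<Longrightarrow> w k \<le> icnt \<pi> k"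
  shows "g \<le> growth_rate (sum_closure (Sub \<pi>))"
proof -
  let ?a = "\<lambda>n. real (cnt (sum_span (Sub \<pi>)) n)"
  \<comment> \<open>The constant factor of \<open>cnt_lower\<close> vanishes under the
    \<open>n\<close>-th root.\<close>
  have "(\<lambda>n. root n (g ^ N)) \<longlonglongrightarrow> 1" using g by (intro LIMSEQ_root_const) simp
  then have "(\<lambda>n. g / root n (g ^ N)) \<longlonglongrightarrow> g / 1" by (intro tendsto_divide tendsto_const) auto
  then have "(\<lambda>n. g / root n (g ^ N)) \<longlonglongrightarrow> g" by simp
  moreover note growth_LIMSEQ[OF \<pi>]
  moreover have "\<exists>N'. \<forall>n\<ge>N'. g / root n (g ^ N) \<le> root n (?a n)"
  proof (intro exI[of _ 1] allI impI)
    fix n :: nat assume n: "1 \<le> n"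
    have "g ^ n \<le> ?a n * g ^ N" by (rule cnt_lower[OF g s w cnt_pos[OF \<pi>]])
    then have "root n (g ^ n) \<le> root n (?a n * g ^ N)" using n by (intro real_root_le_mono) auto
    then have "g \<le> root n (?a n) * root n (g ^ N)" using n g by (simp add: real_root_power_cancel real_root_mult)
    moreover have "0 < root n (g ^ N)" using n g by simp
    ultimately show "g / root n (g ^ N) \<le> root n (?a n)" by (simp add: field_simps)
  qed
  ultimately show ?thesis by (rule LIMSEQ_le)
qed

text \<open>Standardising the members of the family gives indecomposable permutations, and equal
  standardisations would yield an isomorphism between two members.\<close>

lemma many_icnt:
  assumes \<pi>: "is_perm \<pi>" and m: "many int (py \<pi>) (vs \<pi>) n k"
  shows "k \<le> icnt \<pi> n"
proof -
  obtain F where F: "finite F" "card F = k" and F3: "\<forall>A\<in>F. A \<subseteq> vs \<pi> \<and> card A = n \<and> conn int (py \<pi>) A"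
    and F4: "\<forall>A\<in>F. \<forall>B\<in>F. A \<noteq> B \<longrightarrow> \<not> isom int (py \<pi>) A B"
    using m unfolding many_def by (elim exE conjE)
  have "\<forall>A\<in>F. \<exists>\<sigma>. is_perm \<sigma> \<and> length \<sigma> = n \<and> (\<exists>e. bij_betw e (vs \<sigma>) A \<and> emb int (py \<sigma>) (vs \<sigma>) int (py \<pi>) A e)"
  proof
    fix A assume A: "A \<in> F"
    then have "finite A" "inj_on (py \<pi>) A" "card A = n"
      using F3 finite_subset[OF _ finite_vs, of A \<pi>] inj_on_subset[OF inj_py[OF \<pi>]] by auto
    then show "\<exists>\<sigma>. is_perm \<sigma> \<and> length \<sigma> = n \<and> (\<exists>e. bij_betw e (vs \<sigma>) A \<and> emb int (py \<sigma>) (vs \<sigma>) int (py \<pi>) A e)"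
      using pattern_exists[of A int "py \<pi>"] by auto
  qed
  then obtain S where S: "\<And>A. A \<in> F \<Longrightarrow> is_perm (S A) \<and> length (S A) = n \<and>
      (\<exists>e. bij_betw e (vs (S A)) A \<and> emb int (py (S A)) (vs (S A)) int (py \<pi>) A e)" by metis
  have inj: "inj_on S F"
  proof (rule inj_onI, rule ccontr)
    fix A B assume AB: "A \<in> F" "B \<in> F" "S A = S B" "A \<noteq> B"
    obtain e where e: "bij_betw e (vs (S A)) A" "emb int (py (S A)) (vs (S A)) int (py \<pi>) A e" using S[OF AB(1)] by blast
    obtain e' where e': "bij_betw e' (vs (S A)) B" "emb int (py (S A)) (vs (S A)) int (py \<pi>) B e'" using S[OF AB(2)] AB(3) by auto
    let ?g = "the_inv_into (vs (S A)) e"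
    have bg: "bij_betw ?g A (vs (S A))" using e(1) by (rule bij_betw_the_inv_into)
    have g: "?g u \<in> vs (S A)" "e (?g u) = u" if "u \<in> A" for u
      using that bij_betw_apply[OF bg] f_the_inv_into_f_bij_betw[OF e(1)] by auto
    have "emb int (py \<pi>) A int (py \<pi>) B (e' \<circ> ?g)"
      unfolding emb_def
    proof (intro conjI ballI)
      show "(e' \<circ> ?g) ` A \<subseteq> B" using g e'(1) by (auto simp: bij_betw_def)
      fix u v assume uv: "u \<in> A" "v \<in> A"
      show "int u < int v \<longleftrightarrow> int ((e' \<circ> ?g) u) < int ((e' \<circ> ?g) v)"
        using e(2) e'(2) g(1)[OF uv(1)] g(1)[OF uv(2)] g(2)[OF uv(1)] g(2)[OF uv(2)] unfolding emb_def comp_def by metis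
      show "py \<pi> u < py \<pi> v \<longleftrightarrow> py \<pi> ((e' \<circ> ?g) u) < py \<pi> ((e' \<circ> ?g) v)"
        using e(2) e'(2) g(1)[OF uv(1)] g(1)[OF uv(2)] g(2)[OF uv(1)] g(2)[OF uv(2)] unfolding emb_def comp_def by metis
    qed
    moreover have "bij_betw (e' \<circ> ?g) A B" using bij_betw_trans[OF bg e'(1)] .
    ultimately have "isom int (py \<pi>) A B" unfolding isom_def by blast
    then show False using F4 AB by blast
  qed
  have "S ` F \<subseteq> {\<alpha>\<in>Sub \<pi>. indec \<alpha> \<and> length \<alpha> = n}"
  proof
    fix \<sigma> assume "\<sigma> \<in> S ` F"
    then obtain A where A: "A \<in> F" "\<sigma> = S A" by blast
    obtain e where e: "bij_betw e (vs \<sigma>) A" "emb int (py \<sigma>) (vs \<sigma>) int (py \<pi>) A e" using S[OF A(1)] A(2) by auto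
    have A3: "A \<subseteq> vs \<pi>" "conn int (py \<pi>) A" using F3 A(1) by auto
    have "emb int (py \<sigma>) (vs \<sigma>) int (py \<pi>) (vs \<pi>) e" using e(2) A3(1) unfolding emb_def by blast
    then have "le \<sigma> \<pi>" by (auto simp: le_def embeds_def)
    moreover have "sum_indec int (py \<sigma>) (vs \<sigma>)"
      unfolding sum_indec_def
    proof (intro conjI notI)
      show False if "vs \<sigma> = {}" using that e(1) A3(2) by (auto simp: conn_def bij_betw_def)
      assume "\<exists>T. T \<subset> vs \<sigma> \<and> T \<noteq> {} \<and> (\<forall>u\<in>T. \<forall>v\<in>vs \<sigma> - T. lt int (py \<sigma>) u v)"
      then obtain T where T: "T \<subset> vs \<sigma>" "T \<noteq> {}" "\<And>u v. u \<in> T \<Longrightarrow> v \<in> vs \<sigma> - T \<Longrightarrow> lt int (py \<sigma>) u v" by blast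
      have eA: "e ` vs \<sigma> = A" "inj_on e (vs \<sigma>)" using e(1) by (auto simp: bij_betw_def)
      have "e ` T \<subset> A" using eA T(1) by (metis image_strict_mono)
      moreover have "e ` T \<noteq> {}" using T by simp
      ultimately obtain a b where ab: "a \<in> e ` T" "b \<in> A - e ` T" "adj int (py \<pi>) a b"
        using A3(2) unfolding conn_def by meson
      then obtain u v where uv: "u \<in> T" "a = e u" "v \<in> vs \<sigma> - T" "b = e v" using eA by auto
      have "adj int (py \<sigma>) u v" using emb_adj[OF e(2), of u v] ab(3) uv T(1) by auto
      then show False using T(3)[OF uv(1,3)] lt_not_adj by metis
    qed
    ultimately show "\<sigma> \<in> {\<alpha>\<in>Sub \<pi>. indec \<alpha> \<and> length \<alpha> = n}"
      using S[OF A(1)] A(2) by (simp add: Sub_iff indec_def)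
  qed
  moreover have "finite {\<alpha>\<in>Sub \<pi>. indec \<alpha> \<and> length \<alpha> = n}"
    by (rule finite_subset[OF _ finite_perms[of "Sub \<pi>" n]]) (auto simp: Sub_iff)
  ultimately have "card (S ` F) \<le> icnt \<pi> n" unfolding icnt_def by (intro card_mono)
  then show ?thesis using F(2) inj by (simp add: card_image)
qed

section \<open>Classes below \<open>\<xi>\<close>\<close>

definition xi_poly :: "real \<Rightarrow> real" where
  "xi_poly x = x^5 - 2*x^4 - x^2 - x - 1"

lemma xi: "0 < \<xi>" "xi_poly \<xi> = 0"
  using theI'[OF xi_ex1] unfolding \<xi>_def[symmetric] by (auto simp: xi_poly_def)

text \<open>Divided by \<open>x ^ 5\<close>, the polynomial is 1 minus a sum of strictly decreasing
  functions.\<close>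

lemma xi_poly_neg:
  assumes "0 < x" "x < \<xi>"
  shows "xi_poly x < 0"
proof -
  have h: "xi_poly x = x^5 * (1 - (2/x + 1/x^3 + 1/x^4 + 1/x^5))" if "0 < x" for x :: real
    using that by (simp add: xi_poly_def field_simps power_numeral_reduce)
  have pw: "1/\<xi>^k < 1/x^k" if "0 < k" for k :: nat
    using that assms xi(1) by (intro divide_strict_left_mono power_strict_mono) auto
  have "1 - (2/\<xi> + 1/\<xi>^3 + 1/\<xi>^4 + 1/\<xi>^5) = 0" using h[OF xi(1)] xi by simp
  then have "1 - (2/x + 1/x^3 + 1/x^4 + 1/x^5) < 0"
    using pw[of 1] pw[of 3] pw[of 4] pw[of 5] by simp
  then show ?thesis using h[OF assms(1)] assms(1) by (simp add: mult_pos_neg)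
qed

text \<open>The value 231/100 lies above \<xi>, yet at this point the first five terms of the series
  of \<open>u_seq\<close> still sum to at least 1, see \<open>u_sum\<close>.\<close>

lemma xi_bounds: "2 < \<xi>" "\<xi> < 231/100"
proof -
  show "2 < \<xi>"
  proof (rule ccontr)
    assume "\<not> ?thesis"
    then have "\<xi> = 2 \<or> \<xi> < 2" by linarith
    then show False
    proof
      assume "\<xi> = 2"
      then have "xi_poly 2 = 0" using xi(2) by simp
      then show False by (simp add: xi_poly_def)
    next
      assume l: "\<xi> < 2"
      have "2/\<xi> > 1" using l xi(1) by simp
      then have "2 * \<xi>^4 > \<xi>^5" using xi(1) l by (simp add: power_numeral_reduce)
      moreover have "0 < \<xi>^2" using xi(1) by simp
      ultimately show False using xi unfolding xi_poly_def by linarith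
    qed
  qed
  show "\<xi> < 231/100"
  proof (rule ccontr)
    assume "\<not> ?thesis"
    then have "\<xi> = 231/100 \<or> 231/100 < \<xi>" by linarith
    then have "xi_poly (231/100) \<le> 0"
    proof
      assume "\<xi> = 231/100"
      then have "xi_poly (231/100) = xi_poly \<xi>" by (simp only:)
      then show ?thesis using xi(2) by linarith
    next
      assume "231/100 < \<xi>"
      then show ?thesis using xi_poly_neg[of "231/100"] by simp
    qed
    then show False by (simp add: xi_poly_def power_numeral_reduce)
  qed
qed

text \<open>The last term is the tail of the series, a geometric series with coefficient 4. The
  infinite series is thus 1 minus a positive multiple of \<open>xi_poly x\<close> and equals 1
  exactly at the root \<xi>.\<close>

lemma t_sum:
  fixes x :: real
  assumes x: "1 < x" and N: "4 \<le> N"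
  shows "(\<Sum>k=1..N. real (t_seq k) / x ^ k) = 1 - xi_poly x / (x^4 * (x - 1)) - 4 / (x ^ N * (x - 1))"
  using N
proof (induction N rule: dec_induct)
  case base
  have "{1..4} = {1, 2, 3, 4::nat}" by auto
  then have "(\<Sum>k=1..4. real (t_seq k) / x ^ k) = 1/x + 1/x^2 + 2/x^3 + 3/x^4" by (simp add: t_seq_def)
  also have "\<dots> = 1 - xi_poly x / (x^4 * (x - 1)) - 4 / (x ^ 4 * (x - 1))"
    using x unfolding xi_poly_def by (simp add: divide_simps; simp add: algebra_simps power_numeral_reduce)
  finally show ?case .
next
  case (step N)
  have "(\<Sum>k=1..Suc N. real (t_seq k) / x ^ k) = 1 - xi_poly x / (x^4 * (x - 1)) - 4 / (x ^ N * (x - 1)) + 4 / x ^ Suc N"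
    using step by (simp add: t_seq_def)
  moreover have "4 / x ^ Suc N = 4 / (x ^ N * (x - 1)) - 4 / (x ^ Suc N * (x - 1))"
    using x by (simp add: divide_simps; simp add: algebra_simps)
  ultimately show ?case by simp
qed

text \<open>All terms decrease in \<open>x\<close>, so the right end of the range and five terms
  suffice.\<close>

lemma u_sum:
  fixes x :: real
  assumes x: "2 \<le> x" "x \<le> 231/100" and N: "5 \<le> N"
  shows "1 \<le> (\<Sum>k=1..N. real (u_seq k) / x ^ k)"
proof -
  let ?c = "231/100 :: real"
  have "1 \<le> (\<Sum>k=1..5. real (u_seq k) / ?c ^ k)"
  proof -
    have "{1..5} = {1, 2, 3, 4, 5::nat}" by auto
    then show ?thesis by (simp add: u_seq_def power_numeral_reduce)
  qed
  also have "\<dots> \<le> (\<Sum>k=1..5. real (u_seq k) / x ^ k)"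
    using x by (intro sum_mono divide_left_mono power_mono) auto
  also have "\<dots> \<le> (\<Sum>k=1..N. real (u_seq k) / x ^ k)"
    using x N by (intro sum_mono2) auto
  finally show ?thesis .
qed

text \<open>Below \<xi> the infinite series exceeds 1 by some \<open>d > 0\<close>, and the tail
  eventually drops below \<open>d\<close>.\<close>

lemma t_sum_ge_1:
  assumes g: "2 \<le> g" "g < \<xi>"
  shows "\<exists>N\<ge>5. 1 \<le> (\<Sum>k=1..N. real (t_seq k) / g ^ k)"
proof -
  define d where "d = - xi_poly g / (g^4 * (g - 1))"
  have "0 < d" unfolding d_def using g xi_poly_neg[of g] by (intro divide_pos_pos) auto
  have "(\<lambda>N. 4 / (g - 1) * (1 / g) ^ N) \<longlonglongrightarrow> 4 / (g - 1) * 0"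
    using g by (intro tendsto_mult tendsto_const LIMSEQ_power_zero) auto
  then have "\<forall>\<^sub>F N in sequentially. 4 / (g - 1) * (1 / g) ^ N < d"
    using \<open>0 < d\<close> by (intro order_tendstoD(2)) auto
  then obtain N0 where N0: "\<And>N. N0 \<le> N \<Longrightarrow> 4 / (g - 1) * (1 / g) ^ N < d" by (auto simp: eventually_sequentially)
  let ?N = "max N0 5"
  have "4 / (g ^ ?N * (g - 1)) = 4 / (g - 1) * (1 / g) ^ ?N" by (simp add: power_one_over field_simps)
  also have "\<dots> < d" by (rule N0) simp
  finally have "4 / (g ^ ?N * (g - 1)) < d" .
  moreover have "(\<Sum>k=1..?N. real (t_seq k) / g ^ k) = 1 + d - 4 / (g ^ ?N * (g - 1))"
    using t_sum[of g ?N] g by (simp add: d_def)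
  ultimately have "1 \<le> (\<Sum>k=1..?N. real (t_seq k) / g ^ k)" by linarith
  then show ?thesis by (intro exI[of _ ?N]) auto
qed

lemma sparse_of_growth:
  assumes g: "2 \<le> g" "g < \<xi>"
  shows "\<exists>N\<ge>3. \<forall>\<pi>. is_perm \<pi> \<longrightarrow> growth_rate (sum_closure (Sub \<pi>)) < g \<longrightarrow> \<pi> \<in> sparse_perms N"
proof -
  obtain N where N: "5 \<le> N" "1 \<le> (\<Sum>k=1..N. real (t_seq k) / g ^ k)" using t_sum_ge_1[OF g] by blast
  have u: "1 \<le> (\<Sum>k=1..N. real (u_seq k) / g ^ k)" using u_sum[of g N] g xi_bounds N by simp
  have "sparse N int (py \<pi>) (vs \<pi>)" if \<pi>: "is_perm \<pi>" and gr: "growth_rate (sum_closure (Sub \<pi>)) < g" for \<pi>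
  proof (cases "\<pi> = []")
    \<comment> \<open>The growth bounds concern nonempty permutations; the empty one already lacks a
      pattern of length 1.\<close>
    case True
    have "\<not> many int (py \<pi>) (vs \<pi>) 1 1"
    proof
      assume "many int (py \<pi>) (vs \<pi>) 1 1"
      then obtain F where F: "card F = 1" "\<forall>A\<in>F. A \<subseteq> vs \<pi> \<and> card A = 1" unfolding many_def by blast
      then obtain A where "A \<in> F" by fastforce
      then show False using F(2) True by (auto simp: vs_def)
    qed
    moreover have "t_seq 1 = 1" "u_seq 1 = 1" "1 \<in> {1..N}" using N by (auto simp: t_seq_def u_seq_def)
    ultimately show ?thesis unfolding sparse_def by metis
  next
    case False
    have no: False if "\<And>n. 1 \<le> n \<Longrightarrow> n \<le> N \<Longrightarrow> many int (py \<pi>) (vs \<pi>) n (w n)" "1 \<le> (\<Sum>k=1..N. real (w k) / g ^ k)" for w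
    proof -
      have "g \<le> growth_rate (sum_closure (Sub \<pi>))"
        by (rule growth_lower[OF False _ that(2)]) (use g many_icnt[OF \<pi> that(1)] in auto)
      then show False using gr by simp
    qed
    show ?thesis
      unfolding sparse_def
    proof (intro conjI notI)
      assume "\<forall>n\<in>{1..N}. many int (py \<pi>) (vs \<pi>) n (t_seq n)"
      then show False by (intro no[OF _ N(2)]) simp
    next
      assume "\<forall>n\<in>{1..N}. many int (py \<pi>) (vs \<pi>) n (u_seq n)"
      then show False by (intro no[OF _ u]) simp
    qed
  qed
  then show ?thesis using N(1) unfolding sparse_perms_def by (intro exI[of _ N]) auto
qed

lemma no_infinite_antichain_sum:
  assumes g: "g < \<xi>" and A: "perm_antichain A" "infinite A" "\<And>\<pi>. \<pi> \<in> A \<Longrightarrow> is_perm \<pi> \<and> growth_rate (sum_closure (Sub \<pi>)) < g"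
  shows False
proof -
  \<comment> \<open>Replacing \<open>g\<close> by 2 when it is smaller meets the lower bound in
    \<open>sparse_of_growth\<close> and stays below \<xi>.\<close>
  have g2: "2 \<le> max g 2" "max g 2 < \<xi>" using g xi_bounds by auto
  obtain N where N: "3 \<le> N" "\<And>\<pi>. is_perm \<pi> \<Longrightarrow> growth_rate (sum_closure (Sub \<pi>)) < max g 2 \<Longrightarrow> \<pi> \<in> sparse_perms N"
    using sparse_of_growth[OF g2] by blast
  obtain h :: "nat \<Rightarrow> nat list" where h: "inj h" "range h \<subseteq> A" using infinite_countable_subset[OF A(2)] by blast
  have "range h \<subseteq> sparse_perms N"
  proof
    fix \<pi> assume "\<pi> \<in> range h"
    then have "\<pi> \<in> A" using h by blast
    then show "\<pi> \<in> sparse_perms N" using A(3)[of \<pi>] by (intro N(2)) auto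
  qed
  then have "\<not> bad h" by (rule sparse_perms_good[OF N(1)])
  then obtain i j where ij: "i < j" "le (h i) (h j)" unfolding bad_def by blast
  have "h i \<noteq> h j" using h(1) ij(1) by (metis injD less_irrefl)
  moreover have "h i \<in> A" "h j \<in> A" using h(2) by auto
  ultimately show False using A(1) ij(2) unfolding perm_antichain_def perm_contained_iff_le by blast
qed

section \<open>Reversal exchanges sums and skew sums\<close>

lemma is_perm_rev: "is_perm (rev p) \<longleftrightarrow> is_perm p"
  by (simp add: is_perm_iff)

lemma order_isomorphic_rev: "order_isomorphic xs ys \<Longrightarrow> order_isomorphic (rev xs) (rev ys)"
  unfolding order_isomorphic_def by (auto simp: rev_nth)

lemma subseq_rev: "subseq xs ys \<Longrightarrow> subseq (rev xs) (rev ys)"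
proof (induction xs ys rule: list_emb.induct)
  case (list_emb_Cons xs ys y)
  then show ?case by (simp add: subseq_rev_drop_many)
next
  case (list_emb_Cons2 x y xs ys)
  then show ?case by (simp add: list_emb_append_mono)
qed simp

lemma perm_contained_rev: "perm_contained (rev \<sigma>) (rev \<pi>) \<longleftrightarrow> perm_contained \<sigma> \<pi>"
proof -
  have imp: "perm_contained (rev \<sigma>) (rev \<pi>)" if c: "perm_contained \<sigma> \<pi>" for \<sigma> \<pi>
  proof -
    obtain xs where "subseq xs \<pi>" "order_isomorphic \<sigma> xs" using c by (auto simp: perm_contained_def)
    then show ?thesis unfolding perm_contained_def
      by (intro exI[of _ "rev xs"]) (auto simp: order_isomorphic_rev subseq_rev)
  qed
  show ?thesis using imp[of \<sigma> \<pi>] imp[of "rev \<sigma>" "rev \<pi>"] by auto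
qed

lemma perm_class_rev: "perm_class C \<Longrightarrow> perm_class (rev ` C)"
  unfolding perm_class_def
proof (intro conjI ballI allI impI)
  assume C: "(\<forall>\<pi>\<in>C. is_perm \<pi>) \<and> (\<forall>\<pi>\<in>C. \<forall>\<sigma>. is_perm \<sigma> \<longrightarrow> perm_contained \<sigma> \<pi> \<longrightarrow> \<sigma> \<in> C)"
  fix \<pi> assume "\<pi> \<in> rev ` C"
  then obtain \<rho> where \<rho>: "\<rho> \<in> C" "\<pi> = rev \<rho>" by blast
  show "is_perm \<pi>" using C \<rho> by (simp add: is_perm_rev)
  fix \<sigma> assume "is_perm \<sigma>" "perm_contained \<sigma> \<pi>"
  then have "is_perm (rev \<sigma>)" "perm_contained (rev \<sigma>) \<rho>"
    using perm_contained_rev[of "rev \<sigma>" \<rho>] \<rho>(2) by (auto simp: is_perm_rev)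
  then have "rev \<sigma> \<in> C" using C \<rho>(1) by blast
  then show "\<sigma> \<in> rev ` C" by (metis image_eqI rev_rev_ident)
qed

lemma rev_skew_sum: "rev (skew_sum \<sigma> \<tau>) = direct_sum (rev \<tau>) (rev \<sigma>)"
  by (simp add: skew_sum_def direct_sum_def rev_map)

lemma rev_direct_sum: "rev (direct_sum \<sigma> \<tau>) = skew_sum (rev \<tau>) (rev \<sigma>)"
  by (simp add: skew_sum_def direct_sum_def rev_map)

lemma rev_image_rev: "rev ` rev ` C = C"
  by (simp add: image_image)

lemma sum_closed_rev: "sum_closed C \<Longrightarrow> skew_closed (rev ` C)"
  unfolding sum_closed_def skew_closed_def by (auto simp: rev_direct_sum[symmetric])

lemma skew_closed_rev: "skew_closed C \<Longrightarrow> sum_closed (rev ` C)"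
  unfolding sum_closed_def skew_closed_def by (auto simp: rev_skew_sum[symmetric])

text \<open>Reversal is an involution that carries skew closed classes to sum closed ones and back,
  so it carries one intersection to the other.\<close>

lemma skew_closure_rev: "skew_closure X = rev ` sum_closure (rev ` X)"
proof
  show "rev ` sum_closure (rev ` X) \<subseteq> skew_closure X"
    unfolding skew_closure_def
  proof (rule Inter_greatest)
    fix C assume "C \<in> {C. perm_class C \<and> skew_closed C \<and> X \<subseteq> C}"
    then have "perm_class (rev ` C)" "sum_closed (rev ` C)" "rev ` X \<subseteq> rev ` C"
      by (auto simp: perm_class_rev skew_closed_rev)
    then have "sum_closure (rev ` X) \<subseteq> rev ` C" unfolding sum_closure_def by blast
    then have "rev ` sum_closure (rev ` X) \<subseteq> rev ` rev ` C" by (rule image_mono)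
    then show "rev ` sum_closure (rev ` X) \<subseteq> C" by (simp only: rev_image_rev)
  qed
  have "rev ` skew_closure X \<subseteq> sum_closure (rev ` X)"
    unfolding sum_closure_def
  proof (rule Inter_greatest)
    fix C assume "C \<in> {C. perm_class C \<and> sum_closed C \<and> rev ` X \<subseteq> C}"
    then have C: "perm_class (rev ` C)" "skew_closed (rev ` C)" "rev ` X \<subseteq> C"
      by (auto simp: perm_class_rev sum_closed_rev)
    have "X \<subseteq> rev ` C" using image_mono[OF C(3), of rev] by (simp only: rev_image_rev)
    then have "skew_closure X \<subseteq> rev ` C" using C unfolding skew_closure_def by blast
    then have "rev ` skew_closure X \<subseteq> rev ` rev ` C" by (rule image_mono)
    then show "rev ` skew_closure X \<subseteq> C" by (simp only: rev_image_rev)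
  qed
  then have "rev ` rev ` skew_closure X \<subseteq> rev ` sum_closure (rev ` X)" by (rule image_mono)
  then show "skew_closure X \<subseteq> rev ` sum_closure (rev ` X)" by (simp only: rev_image_rev)
qed

lemma Sub_rev: "rev ` Sub \<pi> = Sub (rev \<pi>)"
proof
  show "rev ` Sub \<pi> \<subseteq> Sub (rev \<pi>)" by (auto simp: Sub_def is_perm_rev perm_contained_rev)
  show "Sub (rev \<pi>) \<subseteq> rev ` Sub \<pi>"
  proof
    fix \<sigma> assume "\<sigma> \<in> Sub (rev \<pi>)"
    then have "rev \<sigma> \<in> Sub \<pi>" using perm_contained_rev[of "rev \<sigma>" \<pi>] by (auto simp: Sub_def is_perm_rev)
    then show "\<sigma> \<in> rev ` Sub \<pi>" by (metis image_eqI rev_rev_ident)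
  qed
qed

lemma growth_rate_rev: "growth_rate (rev ` C) = growth_rate C"
proof -
  have "card {\<pi>\<in>rev ` C. length \<pi> = n} = card {\<pi>\<in>C. length \<pi> = n}" for n
  proof -
    have "{\<pi>\<in>rev ` C. length \<pi> = n} = rev ` {\<pi>\<in>C. length \<pi> = n}" by auto
    then show ?thesis by (simp add: card_image)
  qed
  then show ?thesis by (simp add: growth_rate_def)
qed

lemma growth_skew_closure: "growth_rate (skew_closure (Sub \<pi>)) = growth_rate (sum_closure (Sub (rev \<pi>)))"
  by (simp add: skew_closure_rev growth_rate_rev Sub_rev)

lemma perm_antichain_subset: "perm_antichain A \<Longrightarrow> B \<subseteq> A \<Longrightarrow> perm_antichain B"
  unfolding perm_antichain_def by blast

lemma perm_antichain_rev: "perm_antichain A \<Longrightarrow> perm_antichain (rev ` A)"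
  unfolding perm_antichain_def by (auto simp: perm_contained_rev)

lemma cell_class_wqo:
  assumes g: "\<gamma> < \<xi>"
  shows "well_quasi_ordered (cell_class \<gamma>)"
  unfolding well_quasi_ordered_def
proof
  assume "\<exists>A\<subseteq>cell_class \<gamma>. infinite A \<and> perm_antichain A"
  then obtain A where A: "A \<subseteq> cell_class \<gamma>" "infinite A" "perm_antichain A" by blast
  define A1 where "A1 = {\<pi>\<in>A. growth_rate (sum_closure (Sub \<pi>)) < \<gamma>}"
  define A2 where "A2 = {\<pi>\<in>A. growth_rate (skew_closure (Sub \<pi>)) < \<gamma>}"
  have "A = A1 \<union> A2" using A(1) by (auto simp: A1_def A2_def cell_class_def)
  then have "infinite A1 \<or> infinite A2" using A(2) by auto
  then show False
  proof
    assume i: "infinite A1"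
    have "perm_antichain A1" by (rule perm_antichain_subset[OF A(3)]) (simp add: A1_def)
    moreover have "is_perm \<pi> \<and> growth_rate (sum_closure (Sub \<pi>)) < \<gamma>" if "\<pi> \<in> A1" for \<pi>
      using that A(1) by (auto simp: A1_def cell_class_def)
    ultimately show False using no_infinite_antichain_sum[OF g _ i] by blast
  next
    assume i: "infinite A2"
    have "perm_antichain (rev ` A2)" by (rule perm_antichain_rev[OF perm_antichain_subset[OF A(3)]]) (simp add: A2_def)
    moreover have "infinite (rev ` A2)" using i by (simp add: finite_image_iff)
    moreover have "is_perm \<pi> \<and> growth_rate (sum_closure (Sub \<pi>)) < \<gamma>" if "\<pi> \<in> rev ` A2" for \<pi>
      using that A(1) by (auto simp: A2_def cell_class_def is_perm_rev growth_skew_closure)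
    ultimately show False using no_infinite_antichain_sum[OF g] by blast
  qed
qed

section \<open>The antichain of oscillations with doubled ends\<close>

text \<open>A strictly increasing map of the positions to themselves is the identity, and each value
  of a permutation is its rank among the entries.\<close>

lemma le_same_length:
  assumes \<alpha>: "is_perm \<alpha>" and \<beta>: "is_perm \<beta>" and len: "length \<alpha> = length \<beta>" and l: "le \<alpha> \<beta>"
  shows "\<alpha> = \<beta>"
proof -
  let ?n = "length \<alpha>"
  obtain f where "emb int (py \<alpha>) (vs \<alpha>) int (py \<beta>) (vs \<beta>) f" using l by (auto simp: le_def embeds_def)
  then have f: "f i < ?n" "i < j \<longleftrightarrow> f i < f j" "\<alpha> ! i < \<alpha> ! j \<longleftrightarrow> \<beta> ! f i < \<beta> ! f j" if "i < ?n" "j < ?n" for i j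
    using that len unfolding emb_def vs_def py_def by auto
  have ge: "i \<le> f i" if "i < ?n" for i
    using that
  proof (induction i)
    case (Suc i)
    then have "f i < f (Suc i)" using f(2)[of i "Suc i"] by simp
    then show ?case using Suc by simp
  qed simp
  have le': "f (?n - Suc i) \<le> ?n - Suc i" if "i < ?n" for i
    using that
  proof (induction i)
    case 0
    then show ?case using f(1)[of "?n - 1" "?n - 1"] by simp
  next
    case (Suc i)
    have "?n - Suc (Suc i) < ?n - Suc i" "?n - Suc (Suc i) < ?n" "?n - Suc i < ?n" using Suc.prems by linarith+
    then have "f (?n - Suc (Suc i)) < f (?n - Suc i)" using f(2) by blast
    moreover have "f (?n - Suc i) \<le> ?n - Suc i" using Suc by simp
    ultimately show ?case by linarith
  qed
  have id: "f i = i" if "i < ?n" for i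
    using ge[OF that] le'[of "?n - Suc i"] that by simp
  have o: "\<alpha> ! i < \<alpha> ! j \<longleftrightarrow> \<beta> ! i < \<beta> ! j" if "i < ?n" "j < ?n" for i j
    using f(3)[OF that] id that by simp
  have val: "\<gamma> ! i = card {j. j < length \<gamma> \<and> \<gamma> ! j \<le> \<gamma> ! i}" if \<gamma>: "is_perm \<gamma>" and i: "i < length \<gamma>" for \<gamma> i
  proof -
    have g: "set \<gamma> = {1..length \<gamma>}" "distinct \<gamma>" using \<gamma> by (auto simp: is_perm_iff)
    have gi: "\<gamma> ! i \<in> {1..length \<gamma>}" using g(1) nth_mem[OF i] by simp
    have "bij_betw ((!) \<gamma>) {j. j < length \<gamma> \<and> \<gamma> ! j \<le> \<gamma> ! i} {1..\<gamma> ! i}"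
      unfolding bij_betw_def
    proof
      show "inj_on ((!) \<gamma>) {j. j < length \<gamma> \<and> \<gamma> ! j \<le> \<gamma> ! i}" using g(2) by (auto simp: inj_on_def nth_eq_iff_index_eq)
      show "(!) \<gamma> ` {j. j < length \<gamma> \<and> \<gamma> ! j \<le> \<gamma> ! i} = {1..\<gamma> ! i}"
      proof
        show "(!) \<gamma> ` {j. j < length \<gamma> \<and> \<gamma> ! j \<le> \<gamma> ! i} \<subseteq> {1..\<gamma> ! i}"
        proof
          fix v assume "v \<in> (!) \<gamma> ` {j. j < length \<gamma> \<and> \<gamma> ! j \<le> \<gamma> ! i}"
          then obtain j where j: "j < length \<gamma>" "\<gamma> ! j \<le> \<gamma> ! i" "v = \<gamma> ! j" by auto
          then have "v \<in> {1..length \<gamma>}" using g(1) nth_mem[OF j(1)] by simp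
          then show "v \<in> {1..\<gamma> ! i}" using j by simp
        qed
        show "{1..\<gamma> ! i} \<subseteq> (!) \<gamma> ` {j. j < length \<gamma> \<and> \<gamma> ! j \<le> \<gamma> ! i}"
        proof
          fix v assume v: "v \<in> {1..\<gamma> ! i}"
          then have "v \<in> set \<gamma>" using g(1) gi by auto
          then obtain j where "j < length \<gamma>" "\<gamma> ! j = v" by (auto simp: in_set_conv_nth)
          then show "v \<in> (!) \<gamma> ` {j. j < length \<gamma> \<and> \<gamma> ! j \<le> \<gamma> ! i}" using v by auto
        qed
      qed
    qed
    then have "card {j. j < length \<gamma> \<and> \<gamma> ! j \<le> \<gamma> ! i} = card {1..\<gamma> ! i}" by (rule bij_betw_same_card)
    then show ?thesis by simp
  qed
  show ?thesis
  proof (rule nth_equalityI[OF len])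
    fix i assume i: "i < ?n"
    have "{j. j < ?n \<and> \<alpha> ! j \<le> \<alpha> ! i} = {j. j < length \<beta> \<and> \<beta> ! j \<le> \<beta> ! i}"
    proof -
      have "\<alpha> ! j \<le> \<alpha> ! i \<longleftrightarrow> \<beta> ! j \<le> \<beta> ! i" if "j < ?n" for j using o[OF i that] by (simp add: not_less[symmetric])
      then show ?thesis using len by auto
    qed
    then show "\<alpha> ! i = \<beta> ! i" using val[OF \<alpha> i] val[OF \<beta>, of i] i len by simp
  qed
qed

lemma embeds_inverse:
  assumes f: "emb x y A x' y' B f" and bij: "bij_betw f A B"
  shows "embeds x' y' B x y A"
proof -
  let ?g = "the_inv_into A f"
  have bg: "bij_betw ?g B A" using bij by (rule bij_betw_the_inv_into)
  have g: "?g u \<in> A" "f (?g u) = u" if "u \<in> B" for u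
    using that bij_betw_apply[OF bg] f_the_inv_into_f_bij_betw[OF bij] by auto
  have "emb x' y' B x y A ?g"
    unfolding emb_def
  proof (intro conjI ballI)
    show "?g ` B \<subseteq> A" using g by auto
    fix u v assume uv: "u \<in> B" "v \<in> B"
    show "x' u < x' v \<longleftrightarrow> x (?g u) < x (?g v)" "y' u < y' v \<longleftrightarrow> y (?g u) < y (?g v)"
      using f g(1)[OF uv(1)] g(1)[OF uv(2)] g(2)[OF uv(1)] g(2)[OF uv(2)] unfolding emb_def by metis+
  qed
  then show ?thesis unfolding embeds_def by blast
qed

text \<open>The increasing oscillation \<open>0, \<dots>, m\<close>; the points \<open>m + 1\<close> and \<open>m + 2\<close> are the twins of \<open>0\<close> and \<open>m\<close>, and the
  factor \<open>4\<close> leaves room for them.\<close>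

definition xo :: "nat \<Rightarrow> int" where
  "xo i = 4 * (2 * int i - (if even i then 3 else 0))"

definition yo :: "nat \<Rightarrow> int" where
  "yo i = 4 * (2 * int i + (if even i then 3 else 0))"

definition proj :: "nat \<Rightarrow> nat \<Rightarrow> nat" where
  "proj m v = (if v = Suc m then 0 else if v = m + 2 then m else v)"

definition X :: "nat \<Rightarrow> nat \<Rightarrow> int" where
  "X m v = xo (proj m v) + (if v > m then 1 else 0)"

definition Y :: "nat \<Rightarrow> nat \<Rightarrow> int" where
  "Y m v = yo (proj m v) + (if v > m then 1 else 0)"

section \<open>Order and adjacency in the doubled oscillation\<close>

text \<open>Up to the factor 4, consecutive points are 2 apart on the diagonal and the even ones are
  moved left and up by 3. This exceeds 2, so every even point is to the upper left of both its
  neighbours; it is less than 6, so points at distance three remain comparable.\<close>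

lemma xo_less: "xo i < xo j \<longleftrightarrow> i + 2 \<le> j \<or> j = Suc i \<and> even i \<or> i = Suc j \<and> even i"
proof -
  consider "i + 2 \<le> j" | "j + 2 \<le> i" | "j = Suc i" | "i = Suc j" | "i = j" by linarith
  then show ?thesis by cases (auto simp: xo_def)
qed

lemma yo_less: "yo i < yo j \<longleftrightarrow> i + 2 \<le> j \<or> j = Suc i \<and> odd i \<or> i = Suc j \<and> odd i"
proof -
  consider "i + 2 \<le> j" | "j + 2 \<le> i" | "j = Suc i" | "i = Suc j" | "i = j" by linarith
  then show ?thesis by cases (auto simp: yo_def)
qed

lemma xo_cases: "i \<noteq> j \<Longrightarrow> xo i < xo j \<or> xo j < xo i"
proof -
  assume "i \<noteq> j"
  then consider "i + 2 \<le> j" | "j + 2 \<le> i" | "j = Suc i" | "i = Suc j" by linarith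
  then show ?thesis by cases (auto simp: xo_less)
qed

lemma yo_cases: "i \<noteq> j \<Longrightarrow> yo i < yo j \<or> yo j < yo i"
proof -
  assume "i \<noteq> j"
  then consider "i + 2 \<le> j" | "j + 2 \<le> i" | "j = Suc i" | "i = Suc j" by linarith
  then show ?thesis by cases (auto simp: yo_less)
qed

text \<open>The values of \<open>xo\<close> are multiples of 4, so adding 1 to a twin changes no
  comparison with other points and merely places it above and to the right of its original.\<close>

lemma X_less: "X m u < X m v \<longleftrightarrow> xo (proj m u) < xo (proj m v) \<or> proj m u = proj m v \<and> u \<le> m \<and> m < v"
proof (cases "proj m u = proj m v")
  case True
  then show ?thesis by (auto simp: X_def)
next
  case False
  have "\<exists>c. xo i = 4 * c" for i unfolding xo_def by blast
  then obtain c d where cd: "xo (proj m u) = 4 * c" "xo (proj m v) = 4 * d" by meson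
  then have "c < d \<or> d < c" using xo_cases[OF False] by simp
  then show ?thesis using False unfolding X_def cd by (elim disjE) simp_all
qed

lemma Y_less: "Y m u < Y m v \<longleftrightarrow> yo (proj m u) < yo (proj m v) \<or> proj m u = proj m v \<and> u \<le> m \<and> m < v"
proof (cases "proj m u = proj m v")
  case True
  then show ?thesis by (auto simp: Y_def)
next
  case False
  have "\<exists>c. yo i = 4 * c" for i unfolding yo_def by blast
  then obtain c d where cd: "yo (proj m u) = 4 * c" "yo (proj m v) = 4 * d" by meson
  then have "c < d \<or> d < c" using yo_cases[OF False] by simp
  then show ?thesis using False unfolding Y_def cd by (elim disjE) simp_all
qed

lemma proj_eq:
  assumes "u \<le> m + 2" "v \<le> m + 2" "proj m u = proj m v" "1 \<le> m" "u \<noteq> v"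
  shows "(u \<le> m \<and> m < v) \<or> (v \<le> m \<and> m < u)"
  using assms unfolding proj_def by (auto split: if_splits)

lemma inj_X: "1 \<le> m \<Longrightarrow> inj_on (X m) {..m + 2}"
proof (rule inj_onI, rule ccontr)
  fix u v assume m: "1 \<le> m" and uv: "u \<in> {..m + 2}" "v \<in> {..m + 2}" "X m u = X m v" "u \<noteq> v"
  have "\<not> X m u < X m v" "\<not> X m v < X m u" using uv by auto
  then show False
    using X_less[of m u v] X_less[of m v u] proj_eq[of u m v] xo_cases[of "proj m u" "proj m v"] uv m
    by (cases "proj m u = proj m v") auto
qed

lemma inj_Y: "1 \<le> m \<Longrightarrow> inj_on (Y m) {..m + 2}"
proof (rule inj_onI, rule ccontr)
  fix u v assume m: "1 \<le> m" and uv: "u \<in> {..m + 2}" "v \<in> {..m + 2}" "Y m u = Y m v" "u \<noteq> v"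
  have "\<not> Y m u < Y m v" "\<not> Y m v < Y m u" using uv by auto
  then show False
    using Y_less[of m u v] Y_less[of m v u] proj_eq[of u m v] yo_cases[of "proj m u" "proj m v"] uv m
    by (cases "proj m u = proj m v") auto
qed

lemma adj_XY: "adj (X m) (Y m) u v \<longleftrightarrow> proj m u = Suc (proj m v) \<or> proj m v = Suc (proj m u)"
proof -
  consider "proj m u + 2 \<le> proj m v" | "proj m v + 2 \<le> proj m u" | "proj m v = Suc (proj m u)"
    | "proj m u = Suc (proj m v)" | "proj m u = proj m v" by linarith
  then show ?thesis
    unfolding adj_def nw_def X_less Y_less xo_less yo_less by cases auto
qed

text \<open>Parity determines the direction of the edges, so even translations preserve the order.
  The two summands \<open>d\<close> and \<open>e\<close> allow both directions of translation
  without subtracting naturals.\<close>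

lemma shift_less:
  assumes "i' + e = i + d" "j' + e = j + d" "even d" "even (e :: nat)"
  shows "xo i' < xo j' \<longleftrightarrow> xo i < xo j" "yo i' < yo j' \<longleftrightarrow> yo i < yo j"
proof -
  have "i' + 2 \<le> j' \<longleftrightarrow> i + 2 \<le> j" "j' = Suc i' \<longleftrightarrow> j = Suc i" "i' = Suc j' \<longleftrightarrow> i = Suc j"
    using assms by linarith+
  moreover have "even i' \<longleftrightarrow> even i" using assms by (metis even_add)
  ultimately show "xo i' < xo j' \<longleftrightarrow> xo i < xo j" "yo i' < yo j' \<longleftrightarrow> yo i < yo j"
    unfolding xo_less yo_less by blast+
qed

lemma shift_emb:
  assumes f: "f ` C \<subseteq> A" and d: "even d" "even e" and pr: "\<And>u. u \<in> C \<Longrightarrow> proj m (f u) + e = proj m u + d"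
    and tw: "\<And>u v. u \<in> C \<Longrightarrow> v \<in> C \<Longrightarrow> proj m u = proj m v \<Longrightarrow> u \<le> m \<Longrightarrow> m < v \<Longrightarrow> f u \<le> m \<and> m < f v"
    and C: "C \<subseteq> {..m + 2}" "1 \<le> m"
  shows "embeds (X m) (Y m) C (X m) (Y m) A"
proof -
  have "(X m u < X m v \<longleftrightarrow> X m (f u) < X m (f v)) \<and> (Y m u < Y m v \<longleftrightarrow> Y m (f u) < Y m (f v))"
    if uv: "u \<in> C" "v \<in> C" for u v
  proof (cases "u = v")
    case False
    have p: "proj m (f u) = proj m (f v) \<longleftrightarrow> proj m u = proj m v" using pr[OF uv(1)] pr[OF uv(2)] by linarith
    have s: "xo (proj m (f u)) < xo (proj m (f v)) \<longleftrightarrow> xo (proj m u) < xo (proj m v)"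
      "yo (proj m (f u)) < yo (proj m (f v)) \<longleftrightarrow> yo (proj m u) < yo (proj m v)"
      using shift_less[OF pr[OF uv(1)] pr[OF uv(2)] d] by auto
    have "f u \<le> m \<and> m < f v \<longleftrightarrow> u \<le> m \<and> m < v" if eq: "proj m u = proj m v"
    proof -
      have "(u \<le> m \<and> m < v) \<or> (v \<le> m \<and> m < u)"
        using proj_eq[of u m v] uv C eq False by auto
      then show ?thesis using tw[OF uv eq] tw[OF uv(2,1) eq[symmetric]] by linarith
    qed
    then show ?thesis unfolding X_less Y_less s p by blast
  qed simp
  then show ?thesis using f unfolding embeds_def emb_def by blast
qed

text \<open>Along an edge the projection changes by exactly 1, so a connected set skips no
  value.\<close>

lemma conn_proj_interval:
  assumes A: "conn (X m) (Y m) A" and u: "u \<in> A" "v \<in> A" and j: "proj m u \<le> j" "j \<le> proj m v"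
  shows "\<exists>w\<in>A. proj m w = j"
proof (rule ccontr)
  assume no: "\<not> ?thesis"
  let ?S = "{w\<in>A. proj m w < j}"
  have "proj m u \<noteq> j" "proj m v \<noteq> j" using no u by auto
  then have "u \<in> ?S" "v \<notin> ?S" using u j by auto
  then have "?S \<subset> A" "?S \<noteq> {}" using u by auto
  then obtain a b where ab: "a \<in> ?S" "b \<in> A - ?S" "adj (X m) (Y m) a b" using A unfolding conn_def by meson
  have "proj m b \<noteq> j" using no ab(2) by auto
  then show False using ab unfolding adj_XY by auto
qed

text \<open>Representatives of all connected patterns of size \<open>n\<close>; in general these are a path, its inverse and paths with
  either end doubled.\<close>

definition canon :: "nat \<Rightarrow> nat \<Rightarrow> nat set list" where
  "canon m n = (if n = m + 3 then [{..m + 2}] else if n = 1 then [{0}] else if n = 2 then [{0, 1}]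
     else if n = 3 then [{0, 1, 2}, {1, 2, 3}] else if n = 4 then [{..<n}, {1..n}, insert (Suc m) {..n - 2}]
     else [{..<n}, {1..n}, insert (Suc m) {..n - 2}, insert (m + 2) {m + 2 - n..m}])"

lemma canon_length: "1 \<le> n \<Longrightarrow> 4 \<le> m \<Longrightarrow> length (canon m n) \<le> t_seq n"
  by (auto simp: canon_def t_seq_def)

text \<open>A connected set projects onto an interval \<open>{a..b}\<close> and contains one point
  over each value, except that both members of a twin pair may occur at an end. Without such a pair
  it is a path, given by its length and the parity of \<open>a\<close>. As \<open>m\<close> is even,
  both ends have the same orientation.\<close>

lemma canon_embeds:
  assumes m: "even m" "4 \<le> m" and A: "A \<subseteq> {..m + 2}" "conn (X m) (Y m) A"
  shows "\<exists>C\<in>set (canon m (card A)). C \<subseteq> {..m + 2} \<and> card C = card A \<and> embeds (X m) (Y m) C (X m) (Y m) A"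
proof -
  have m1: "1 \<le> m" using m by simp
  have fA: "finite A" using A(1) finite_subset by blast
  have neA: "A \<noteq> {}" using A(2) by (auto simp: conn_def)
  let ?pA = "proj m ` A"
  define a where "a = Min ?pA"
  define b where "b = Max ?pA"
  have ab: "a \<in> ?pA" "b \<in> ?pA" "\<And>w. w \<in> A \<Longrightarrow> a \<le> proj m w \<and> proj m w \<le> b"
    unfolding a_def b_def using fA neA by auto
  obtain w0 where w0: "w0 \<in> A" using neA by blast
  have "proj m w \<le> m" if "w \<in> A" for w using A(1) that by (auto simp: proj_def)
  then have ab': "a \<le> b" "b \<le> m" using ab(3)[OF w0] ab(2) by auto
  \<comment> \<open>Chooses the point of \<open>A\<close> over \<open>j\<close>: the original if it
    is in \<open>A\<close>, its twin otherwise.\<close>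
  define rep where "rep j = (if j \<in> A then j else if j = 0 then Suc m else m + 2)" for j
  have rep: "rep j \<in> A \<and> proj m (rep j) = j" if j: "a \<le> j" "j \<le> b" for j
  proof -
    obtain u v where "u \<in> A" "v \<in> A" "proj m u = a" "proj m v = b" using ab by auto
    then obtain w where w: "w \<in> A" "proj m w = j" using conn_proj_interval[OF A(2), of u v j] j by auto
    then show ?thesis using A(1) ab' j m1 unfolding rep_def proj_def by (auto split: if_splits)
  qed
  have rep_in: "rep j = j" if "j \<in> A" for j using that by (simp add: rep_def)
  have repA: "A = rep ` {a..b} \<union> (if 0 \<in> A \<and> Suc m \<in> A then {Suc m} else {}) \<union> (if m \<in> A \<and> m + 2 \<in> A then {m + 2} else {})"
  proof
    show "A \<subseteq> rep ` {a..b} \<union> (if 0 \<in> A \<and> Suc m \<in> A then {Suc m} else {}) \<union> (if m \<in> A \<and> m + 2 \<in> A then {m + 2} else {})"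
    proof
      fix w assume w: "w \<in> A"
      have p: "proj m w \<in> {a..b}" using ab(3)[OF w] by simp
      have "w = rep (proj m w) \<or> w = Suc m \<and> 0 \<in> A \<or> w = m + 2 \<and> m \<in> A"
        using w A(1) m1 unfolding rep_def proj_def by auto
      then show "w \<in> rep ` {a..b} \<union> (if 0 \<in> A \<and> Suc m \<in> A then {Suc m} else {}) \<union> (if m \<in> A \<and> m + 2 \<in> A then {m + 2} else {})"
        using p w by auto
    qed
    show "rep ` {a..b} \<union> (if 0 \<in> A \<and> Suc m \<in> A then {Suc m} else {}) \<union> (if m \<in> A \<and> m + 2 \<in> A then {m + 2} else {}) \<subseteq> A"
      using rep by auto
  qed
  have crep: "card (rep ` {a..b}) = b - a + 1"
  proof -
    have "inj_on rep {a..b}" by (rule inj_onI) (metis atLeastAtMost_iff rep)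
    then show ?thesis using ab' by (simp add: card_image)
  qed
  have nSm: "Suc m \<notin> rep ` {a..b}" if "0 \<in> A"
  proof
    assume "Suc m \<in> rep ` {a..b}"
    then obtain j where j: "j \<in> {a..b}" "Suc m = rep j" by blast
    then have "proj m (Suc m) = j" using rep[of j] by auto
    then show False using j rep_in[of 0] that by (simp add: proj_def)
  qed
  have nm2: "m + 2 \<notin> rep ` {a..b}" if "m \<in> A"
  proof
    assume "m + 2 \<in> rep ` {a..b}"
    then obtain j where j: "j \<in> {a..b}" "m + 2 = rep j" by blast
    then have "proj m (m + 2) = j" using rep[of j] by auto
    then show False using j rep_in[of m] that by (simp add: proj_def)
  qed
  have nbr: "\<exists>v\<in>A. proj m u = Suc (proj m v) \<or> proj m v = Suc (proj m u)" if "u \<in> A" "A \<noteq> {u}" for u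
    using conn_edge[OF A(2) that] by (simp add: adj_XY)
  have inA: "j \<in> A" if "a \<le> j" "j \<le> b" "j \<noteq> 0" "j \<noteq> m" for j
    using rep[OF that(1,2)] that(3,4) by (auto simp: rep_def proj_def split: if_splits)
  let ?goal = "\<lambda>C. C \<in> set (canon m (card A)) \<and> C \<subseteq> {..m + 2} \<and> card C = card A \<and> embeds (X m) (Y m) C (X m) (Y m) A"
  have "\<exists>C. ?goal C"
  proof (cases "0 \<in> A \<and> Suc m \<in> A")
    case T0: True
    have a0: "a = 0" using ab(3)[of 0] T0 by (simp add: proj_def)
    have b1: "1 \<le> b"
    proof -
      have "A \<noteq> {0}" using T0 by auto
      then obtain v where "v \<in> A" "proj m v = 1" using nbr[of 0] T0 by (auto simp: proj_def)
      then show ?thesis using ab(3)[of v] by simp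
    qed
    show ?thesis
    proof (cases "m \<in> A \<and> m + 2 \<in> A")
      case Tm: True
      have bm: "b = m" using ab(3)[of m] Tm ab'(2) m1 by (simp add: proj_def)
      have "{..m + 2} \<subseteq> A"
      proof
        fix j assume "j \<in> {..m + 2}"
        then have "j = 0 \<or> j = m \<or> j = Suc m \<or> j = m + 2 \<or> (j \<noteq> 0 \<and> j \<noteq> m \<and> j \<le> m)" by auto
        then show "j \<in> A" using T0 Tm inA[of j] a0 bm by auto
      qed
      then have "A = {..m + 2}" using A(1) by auto
      then have "?goal A" by (auto simp: canon_def intro: embeds_refl)
      then show ?thesis by blast
    next
      case Tm: False
      have n: "card A = b + 2"
      proof -
        have "A = insert (Suc m) (rep ` {a..b})" using repA T0 Tm by auto
        then have "card A = Suc (card (rep ` {a..b}))" using nSm T0 by (metis card_insert_disjoint finite_atLeastAtMost finite_imageI)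
        then show ?thesis using crep a0 by simp
      qed
      show ?thesis
      proof (cases "b = 1")
        case True
        \<comment> \<open>A twin pair and its common neighbour form a path with three vertices,
          where the twin takes the place of 2.\<close>
        have 1: "1 \<in> A" using inA[of 1] a0 True m by simp
        have "emb (X m) (Y m) {0, 1, 2} (X m) (Y m) A (\<lambda>v. if v = 2 then Suc m else v)"
          using T0 1 m unfolding emb_def X_less Y_less xo_less yo_less proj_def by auto
        then have "?goal {0, 1, 2}" using n True m by (auto simp: canon_def embeds_def)
        then show ?thesis by blast
      next
        case False
        let ?C = "insert (Suc m) {..card A - 2}"
        have C: "?C \<subseteq> {..m + 2}" "card ?C = card A" using n ab'(2) by auto
        have "embeds (X m) (Y m) ?C (X m) (Y m) A"
        proof (rule shift_emb[where d = 0 and e = 0 and f = "\<lambda>v. if v \<le> m then rep v else v"])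
          show "(\<lambda>v. if v \<le> m then rep v else v) ` ?C \<subseteq> A" using rep a0 n ab'(2) T0 by auto
          show "proj m (if u \<le> m then rep u else u) + 0 = proj m u + 0" if "u \<in> ?C" for u
            using that rep[of u] a0 n ab'(2) by (auto simp: proj_def)
          fix u v assume uv: "u \<in> ?C" "v \<in> ?C" "proj m u = proj m v" "u \<le> m" "m < v"
          then have "v = Suc m" using n ab'(2) by auto
          then have "u = 0" using uv by (auto simp: proj_def split: if_splits)
          then show "(if u \<le> m then rep u else u) \<le> m \<and> m < (if v \<le> m then rep v else v)"
            using rep_in[of 0] T0 uv by simp
        qed (use C m1 in auto)
        moreover have "?C \<in> set (canon m (card A))" using n False b1 ab'(2) by (auto simp: canon_def)
        ultimately show ?thesis using C by blast
      qed
    qed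
  next
    case T0: False
    show ?thesis
    proof (cases "m \<in> A \<and> m + 2 \<in> A")
      case Tm: True
      have bm: "b = m" using ab(3)[of m] Tm ab'(2) m1 by (simp add: proj_def)
      have am: "a \<le> m - 1"
      proof -
        have "A \<noteq> {m}" using Tm by auto
        then obtain v where "v \<in> A" "m = Suc (proj m v) \<or> proj m v = Suc m" using nbr[of m] Tm m1 by (auto simp: proj_def)
        then show ?thesis using ab(3)[of v] bm by auto
      qed
      have n: "card A = m - a + 2"
      proof -
        have "A = insert (m + 2) (rep ` {a..b})" using repA T0 Tm by auto
        then have "card A = Suc (card (rep ` {a..b}))" using nm2 Tm by (metis card_insert_disjoint finite_atLeastAtMost finite_imageI)
        then show ?thesis using crep bm by simp
      qed
      obtain k where k: "m = Suc (Suc (Suc (Suc k)))" "even k"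
      proof -
        have "m = Suc (Suc (Suc (Suc (m - 4))))" "even (m - 4)" using m by auto
        then show thesis using that by blast
      qed
      consider "a = m - 1" | "a = m - 2" | "a + 3 \<le> m" using am by linarith
      then show ?thesis
      proof cases
        case 1
        have i: "m - 1 \<in> A" using inA[of "m - 1"] 1 bm m by auto
        have "emb (X m) (Y m) {0, 1, 2} (X m) (Y m) A (\<lambda>v. if v = 0 then m else if v = 1 then m - 1 else m + 2)"
          using Tm i k unfolding emb_def X_less Y_less xo_less yo_less proj_def by auto
        then have "?goal {0, 1, 2}" using n 1 m by (auto simp: canon_def embeds_def)
        then show ?thesis by blast
      next
        case 2
        \<comment> \<open>With four points the forks at the two ends coincide: three ascending
          points, all joined to the fourth. Hence \<open>canon\<close> has three sets at this
          size.\<close>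
        have i: "m - 1 \<in> A" "m - 2 \<in> A" using inA[of "m - 1"] inA[of "m - 2"] 2 bm m by auto
        have n4: "card A = 4" using n 2 m by simp
        have C: "insert (Suc m) {..2} = {0, 1, 2, Suc m}" by auto
        have "emb (X m) (Y m) {0, 1, 2, Suc m} (X m) (Y m) A (\<lambda>v. if v = 0 then m - 2 else if v = 1 then m - 1 else if v = 2 then m + 2 else m)"
          using Tm i k unfolding emb_def X_less Y_less xo_less yo_less proj_def by auto
        then have "?goal {0, 1, 2, Suc m}" using n4 m C by (auto simp: canon_def embeds_def)
        then show ?thesis by blast
      next
        case 3
        let ?C = "insert (m + 2) {m + 2 - card A..m}"
        have ma: "m + 2 - card A = a" using n 3 by simp
        have C: "?C \<subseteq> {..m + 2}" "card ?C = card A" using n 3 by auto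
        have "embeds (X m) (Y m) ?C (X m) (Y m) A"
        proof (rule shift_emb[where d = 0 and e = 0 and f = "\<lambda>v. if v \<le> m then rep v else v"])
          show "(\<lambda>v. if v \<le> m then rep v else v) ` ?C \<subseteq> A" using rep ma bm Tm by auto
          show "proj m (if u \<le> m then rep u else u) + 0 = proj m u + 0" if "u \<in> ?C" for u
            using that rep[of u] ma bm by (auto simp: proj_def)
          fix u v assume uv: "u \<in> ?C" "v \<in> ?C" "proj m u = proj m v" "u \<le> m" "m < v"
          then have "v = m + 2" by auto
          then have "u = m" using uv m1 by (auto simp: proj_def split: if_splits)
          then show "(if u \<le> m then rep u else u) \<le> m \<and> m < (if v \<le> m then rep v else v)"
            using rep_in[of m] Tm uv by simp
        qed (use C m1 in auto)
        moreover have "?C \<in> set (canon m (card A))" using n 3 by (auto simp: canon_def)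
        ultimately show ?thesis using C by blast
      qed
    next
      case Tm: False
      have n: "card A = b - a + 1" using repA crep T0 Tm by auto
      \<comment> \<open>A translation by the even number \<open>c - a\<close>, which may be
        negative; \<open>a + c\<close> and \<open>2 * c\<close> are the even summands that
        \<open>shift_emb\<close> asks for.\<close>
      have sh: "embeds (X m) (Y m) {c..c + (b - a)} (X m) (Y m) A" if c: "even c \<longleftrightarrow> even a" "c + (b - a) \<le> m" for c
      proof (rule shift_emb[where d = "a + c" and e = "2 * c" and f = "\<lambda>v. rep (v + a - c)"])
        have r: "rep (v + a - c) \<in> A \<and> proj m (rep (v + a - c)) = v + a - c" if "v \<in> {c..c + (b - a)}" for v
          by (rule rep) (use that ab'(1) in auto)
        show "(\<lambda>v. rep (v + a - c)) ` {c..c + (b - a)} \<subseteq> A" using r by auto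
        show "proj m (rep (u + a - c)) + 2 * c = proj m u + (a + c)" if u: "u \<in> {c..c + (b - a)}" for u
        proof -
          have "proj m u = u" using u c(2) by (auto simp: proj_def)
          then show ?thesis using r[OF u] u by auto
        qed
      qed (use c m1 in auto)
      consider "b = a" | "b = Suc a" "even a" | "b = Suc a" "odd a" | "a + 2 \<le> b" "even a" | "a + 2 \<le> b" "odd a" using ab'(1) by linarith
      then show ?thesis
      proof cases
        case 1
        have "emb (X m) (Y m) {0} (X m) (Y m) A (\<lambda>v. rep a)" using rep[of a] 1 by (auto simp: emb_def)
        then have "?goal {0}" using n 1 m by (auto simp: canon_def embeds_def)
        then show ?thesis by blast
      next
        case 2
        have "{0..0 + (b - a)} = {0, 1}" using 2 by auto
        then have "?goal {0, 1}" using sh[of 0] n 2 m by (auto simp: canon_def)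
        then show ?thesis by blast
      next
        case 3
        have r: "rep a \<in> A" "proj m (rep a) = a" "rep b \<in> A" "proj m (rep b) = Suc a" using rep[of a] rep[of b] 3 by auto
        have p: "proj m 0 = 0" "proj m (Suc 0) = Suc 0" using m by (auto simp: proj_def)
        have "emb (X m) (Y m) {0, 1} (X m) (Y m) A (\<lambda>v. if v = 0 then rep b else rep a)"
          using r 3 m unfolding emb_def X_less Y_less by (auto simp: r p xo_less yo_less)
        then have "?goal {0, 1}" using n 3 m by (auto simp: canon_def embeds_def)
        then show ?thesis by blast
      next
        case 4
        have C: "{0..0 + (b - a)} = {..<card A}" using n by auto
        have "?goal {..<card A}"
        proof (intro conjI)
          show "embeds (X m) (Y m) {..<card A} (X m) (Y m) A" using sh[of 0] 4 ab' C by simp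
          show "{..<card A} \<in> set (canon m (card A))"
            using n 4 ab' by (auto simp: canon_def numeral_eq_Suc lessThan_Suc)
        qed (use n ab' in auto)
        then show ?thesis by blast
      next
        case 5
        have C: "{1..1 + (b - a)} = {1..card A}" using n by auto
        \<comment> \<open>An odd \<open>a\<close> is at least 1, so the interval moved to start at 1
          still ends within the path.\<close>
        have "0 < a" using 5 by (intro odd_pos)
        then have cm: "1 + (b - a) \<le> m" using ab' by linarith
        have "?goal {1..card A}"
        proof (intro conjI)
          show "embeds (X m) (Y m) {1..card A} (X m) (Y m) A" using sh[of 1] 5 C cm by simp
          show "{1..card A} \<in> set (canon m (card A))"
            using n 5 ab' by (auto simp: canon_def)
        qed (use n ab' 5 in auto)
        then show ?thesis by blast
      qed
    qed
  qed
  then show ?thesis by blast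
qed

definition osc :: "nat \<Rightarrow> nat list" where
  "osc m = (SOME \<sigma>. is_perm \<sigma> \<and> length \<sigma> = m + 3 \<and> embeds int (py \<sigma>) (vs \<sigma>) (X m) (Y m) {..m + 2} \<and>
     embeds (X m) (Y m) {..m + 2} int (py \<sigma>) (vs \<sigma>))"

lemma osc:
  assumes m: "1 \<le> m"
  shows "is_perm (osc m)" "length (osc m) = m + 3"
    "embeds int (py (osc m)) (vs (osc m)) (X m) (Y m) {..m + 2}"
    "embeds (X m) (Y m) {..m + 2} int (py (osc m)) (vs (osc m))"
proof -
  obtain \<sigma> e where \<sigma>: "is_perm \<sigma>" "length \<sigma> = card {..m + 2}" "bij_betw e (vs \<sigma>) {..m + 2}" "emb int (py \<sigma>) (vs \<sigma>) (X m) (Y m) {..m + 2} e"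
    using pattern_exists[OF finite_atMost inj_X[OF m] inj_Y[OF m]] by blast
  have "\<exists>\<sigma>. is_perm \<sigma> \<and> length \<sigma> = m + 3 \<and> embeds int (py \<sigma>) (vs \<sigma>) (X m) (Y m) {..m + 2} \<and>
     embeds (X m) (Y m) {..m + 2} int (py \<sigma>) (vs \<sigma>)"
    using \<sigma> embeds_inverse[OF \<sigma>(4,3)] by (intro exI[of _ \<sigma>]) (auto simp: embeds_def)
  then have "is_perm (osc m) \<and> length (osc m) = m + 3 \<and> embeds int (py (osc m)) (vs (osc m)) (X m) (Y m) {..m + 2} \<and>
     embeds (X m) (Y m) {..m + 2} int (py (osc m)) (vs (osc m))"
    unfolding osc_def by (rule someI_ex)
  then show "is_perm (osc m)" "length (osc m) = m + 3"
    "embeds int (py (osc m)) (vs (osc m)) (X m) (Y m) {..m + 2}"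
    "embeds (X m) (Y m) {..m + 2} int (py (osc m)) (vs (osc m))" by blast+
qed

text \<open>A pattern is determined by its representative in \<open>canon\<close>: embeddings
  between sets of equal size are bijective, so two patterns with the same representative embed into
  each other and are equal by \<open>le_same_length\<close>.\<close>

lemma icnt_osc:
  assumes m: "even m" "4 \<le> m" and n: "1 \<le> n"
  shows "icnt (osc m) n \<le> t_seq n"
proof -
  have m1: "1 \<le> m" using m by simp
  let ?I = "{\<alpha>\<in>Sub (osc m). indec \<alpha> \<and> length \<alpha> = n}"
  have "\<exists>C. C \<in> set (canon m n) \<and> card C = n \<and> C \<subseteq> {..m + 2} \<and> embeds (X m) (Y m) C int (py \<alpha>) (vs \<alpha>)" if \<alpha>: "\<alpha> \<in> ?I" for \<alpha>
  proof -
    have a: "is_perm \<alpha>" "le \<alpha> (osc m)" "indec \<alpha>" "length \<alpha> = n" using \<alpha> by (auto simp: Sub_iff)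
    have "embeds int (py \<alpha>) (vs \<alpha>) (X m) (Y m) {..m + 2}"
      using a(2) osc(3)[OF m1] unfolding le_def by (rule embeds_trans)
    then obtain f where f: "emb int (py \<alpha>) (vs \<alpha>) (X m) (Y m) {..m + 2} f" by (auto simp: embeds_def)
    let ?A = "f ` vs \<alpha>"
    have injf: "inj_on f (vs \<alpha>)" by (rule emb_inj[OF f inj_int])
    have A: "?A \<subseteq> {..m + 2}" "card ?A = n" using f a(4) injf by (auto simp: emb_def card_image)
    have "conn int (py \<alpha>) (vs \<alpha>)"
      by (rule sum_indec_imp_conn[OF finite_vs inj_int inj_py[OF a(1)]]) (use a(3) in \<open>simp add: indec_def\<close>)
    then have cA: "conn (X m) (Y m) ?A" by (rule conn_emb[OF f order_refl])
    have "emb int (py \<alpha>) (vs \<alpha>) (X m) (Y m) ?A f" using f unfolding emb_def by blast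
    then have inv: "embeds (X m) (Y m) ?A int (py \<alpha>) (vs \<alpha>)"
      by (rule embeds_inverse) (simp add: bij_betw_def injf)
    obtain C where "C \<in> set (canon m n)" "C \<subseteq> {..m + 2}" "card C = n" "embeds (X m) (Y m) C (X m) (Y m) ?A"
      using canon_embeds[OF m A(1) cA] A(2) by auto
    then show ?thesis using embeds_trans[OF _ inv] by blast
  qed
  then obtain c where c: "\<And>\<alpha>. \<alpha> \<in> ?I \<Longrightarrow> c \<alpha> \<in> set (canon m n) \<and> card (c \<alpha>) = n \<and> c \<alpha> \<subseteq> {..m + 2} \<and>
      embeds (X m) (Y m) (c \<alpha>) int (py \<alpha>) (vs \<alpha>)"
    by metis
  have inj: "inj_on c ?I"
  proof (rule inj_onI)
    fix \<alpha> \<beta> assume ab: "\<alpha> \<in> ?I" "\<beta> \<in> ?I" "c \<alpha> = c \<beta>"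
    obtain f where f: "emb (X m) (Y m) (c \<alpha>) int (py \<alpha>) (vs \<alpha>) f" using c[OF ab(1)] by (auto simp: embeds_def)
    have injf: "inj_on f (c \<alpha>)" using emb_inj[OF f] inj_on_subset[OF inj_X[OF m1]] c[OF ab(1)] by blast
    have "f ` c \<alpha> = vs \<alpha>"
    proof (rule card_subset_eq[OF finite_vs])
      show "f ` c \<alpha> \<subseteq> vs \<alpha>" using f by (auto simp: emb_def)
      show "card (f ` c \<alpha>) = card (vs \<alpha>)" using injf c[OF ab(1)] ab(1) by (simp add: card_image)
    qed
    then have "bij_betw f (c \<alpha>) (vs \<alpha>)" using injf by (simp add: bij_betw_def)
    then have "embeds int (py \<alpha>) (vs \<alpha>) (X m) (Y m) (c \<alpha>)" by (rule embeds_inverse[OF f])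
    then have "le \<alpha> \<beta>" unfolding le_def using c[OF ab(2)] ab(3) embeds_trans by metis
    then show "\<alpha> = \<beta>" using ab by (intro le_same_length) (auto simp: Sub_iff)
  qed
  have "icnt (osc m) n = card (c ` ?I)" using inj by (simp add: icnt_def card_image)
  also have "\<dots> \<le> card (set (canon m n))" using c by (intro card_mono) auto
  also have "\<dots> \<le> length (canon m n)" by (rule card_length)
  also have "\<dots> \<le> t_seq n" by (rule canon_length[OF n m(2)])
  finally show ?thesis .
qed

text \<open>The permutation has \<open>m + 3\<close> points, so its series stops there and at \<xi>
  misses 1 by the tail in \<open>t_sum\<close>. By continuity the sum is still below 1 slightly to
  the left of \<xi>, which makes the inequality strict.\<close>

lemma growth_osc:
  assumes m: "even m" "4 \<le> m"
  shows "growth_rate (sum_closure (Sub (osc m))) < \<xi>"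
proof -
  let ?f = "\<lambda>x. \<Sum>k=1..m + 3. real (t_seq k) / x ^ k"
  have m1: "1 \<le> m" using m by simp
  have "?f \<xi> = 1 - 4 / (\<xi> ^ (m + 3) * (\<xi> - 1))"
    using t_sum[of \<xi> "m + 3"] xi_bounds xi(2) m by simp
  moreover have "0 < 4 / (\<xi> ^ (m + 3) * (\<xi> - 1))" using xi_bounds by (intro divide_pos_pos mult_pos_pos) auto
  ultimately have less: "?f \<xi> < 1" by linarith
  have "isCont ?f \<xi>" using xi(1) by (intro continuous_intros) auto
  then have "(?f \<longlongrightarrow> ?f \<xi>) (at_left \<xi>)" unfolding isCont_def by (rule filterlim_at_split[THEN iffD1, THEN conjunct1])
  then have "\<forall>\<^sub>F x in at_left \<xi>. ?f x < 1" using less by (rule order_tendstoD)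
  moreover have "\<forall>\<^sub>F x in at_left \<xi>. x \<in> {2<..<\<xi>}" using xi_bounds by (intro eventually_at_left_real)
  ultimately have "\<forall>\<^sub>F x in at_left \<xi>. ?f x < 1 \<and> x \<in> {2<..<\<xi>}" by (rule eventually_conj)
  then obtain g where g: "?f g < 1" "2 < g" "g < \<xi>"
    using eventually_happens[of _ "at_left \<xi>"] trivial_limit_at_left_real by fastforce
  have "(\<Sum>k=1..m + 3. real (icnt (osc m) k) / g ^ k) \<le> ?f g"
    using g icnt_osc[OF m] by (intro sum_mono divide_right_mono) auto
  then have s: "(\<Sum>k=1..m + 3. real (icnt (osc m) k) / g ^ k) \<le> 1" using g by linarith
  have ne: "osc m \<noteq> []" using osc(2)[OF m1] by auto
  have "growth_rate (sum_closure (Sub (osc m))) \<le> g"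
    by (rule growth_upper[OF ne _ s]) (use g osc(2)[OF m1] in auto)
  then show ?thesis using g by simp
qed

section \<open>Incomparability of the doubled oscillations\<close>

text \<open>The branching points 1 and \<open>m - 1\<close> must go to the branching points 1 and
  \<open>m' - 1\<close>, and all neighbours of these are used, in particular both twin pairs. The
  image is connected, so it also covers everything in between; it is the whole larger oscillation,
  against the number of points.\<close>

lemma osc_antichain:
  assumes m: "even m" "4 \<le> m" and m': "even m'" "4 \<le> m'" and l: "le (osc m) (osc m')"
  shows "m = m'"
proof (rule ccontr)
  assume ne: "m \<noteq> m'"
  have m1: "1 \<le> m" "1 \<le> m'" using m m' by auto
  have lt: "m < m'" using le_length[OF l] osc(2) m1 ne by simp
  have "embeds (X m) (Y m) {..m + 2} (X m') (Y m') {..m' + 2}"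
    using embeds_trans[OF embeds_trans[OF osc(4)[OF m1(1)] l[unfolded le_def]] osc(3)[OF m1(2)]] .
  then obtain f where f: "emb (X m) (Y m) {..m + 2} (X m') (Y m') {..m' + 2} f" by (auto simp: embeds_def)
  let ?V = "{..m + 2}"
  let ?A = "f ` ?V"
  have injf: "inj_on f ?V" by (rule emb_inj[OF f inj_X[OF m1(1)]])
  have AV: "?A \<subseteq> {..m' + 2}" using f by (auto simp: emb_def)
  have ad: "adj (X m') (Y m') (f u) (f v) \<longleftrightarrow> adj (X m) (Y m) u v" if "u \<in> ?V" "v \<in> ?V" for u v
    using emb_adj[OF f that] .
  have con: "conn (X m) (Y m) ?V"
    unfolding conn_def
  proof (intro conjI allI impI)
    fix S assume S: "S \<subset> ?V" "S \<noteq> {}"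
    show "\<exists>u\<in>S. \<exists>v\<in>?V - S. adj (X m) (Y m) u v"
    proof (rule ccontr)
      assume "\<not> ?thesis"
      then have no: "\<And>u v. u \<in> S \<Longrightarrow> v \<in> ?V \<Longrightarrow> adj (X m) (Y m) u v \<Longrightarrow> v \<in> S" by blast
      obtain w where w: "w \<in> S" using S by blast
      have up: "j \<in> S" if "i \<in> S" "i \<le> j" "j \<le> m" for i j
        using that(2,1,3)
      proof (induction j rule: dec_induct)
        case (step n)
        then show ?case by (intro no[of n "Suc n"]) (auto simp: adj_XY proj_def)
      qed simp
      have down: "j \<in> S" if "i \<in> S" "j \<le> i" "i \<le> m" for i j
        using that(2,1,3)
      proof (induction rule: inc_induct)
        case (step n)
        then show ?case by (intro no[of "Suc n" n]) (auto simp: adj_XY proj_def)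
      qed simp
      have "1 \<in> S"
      proof (cases "w \<le> m")
        case True
        then show ?thesis using up[OF w, of 1] down[OF w, of 1] m by (cases "w \<le> 1") auto
      next
        case False
        then have "w = Suc m \<or> w = m + 2" using w S by fastforce
        then show ?thesis
        proof
          assume "w = Suc m"
          then show ?thesis using w m by (intro no[of w 1]) (auto simp: adj_XY proj_def)
        next
          assume "w = m + 2"
          then have "m - 1 \<in> S" using w m by (intro no[of w "m - 1"]) (auto simp: adj_XY proj_def)
          then show ?thesis using down[of "m - 1" 1] m by simp
        qed
      qed
      then have all: "j \<in> S" if "j \<le> m" for j using up[of 1 j] down[of 1 j] that m by (cases "1 \<le> j") auto
      have "Suc m \<in> S" using all[of 1] m by (intro no[of 1 "Suc m"]) (auto simp: adj_XY proj_def)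
      moreover have "m + 2 \<in> S" using all[of "m - 1"] m by (intro no[of "m - 1" "m + 2"]) (auto simp: adj_XY proj_def)
      ultimately have "?V \<subseteq> S" using all by (auto simp: le_Suc_eq)
      then show False using S by blast
    qed
  qed auto
  have conA: "conn (X m') (Y m') ?A" by (rule conn_emb[OF f order_refl con])
  \<comment> \<open>In the larger oscillation only 1 and \<open>m' - 1\<close> have three
    neighbours; any other point has at most one on either side.\<close>
  have three: "w \<in> {1, m' - 1}" if w: "w \<in> {..m' + 2}" "w = f u" "u \<in> ?V" "{p, q, r} \<subseteq> ?V" "distinct [p, q, r]"
      "adj (X m) (Y m) u p" "adj (X m) (Y m) u q" "adj (X m) (Y m) u r" for u p q r w
  proof (rule ccontr)
    assume nw: "w \<notin> {1, m' - 1}"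
    have a: "adj (X m') (Y m') w (f p)" "adj (X m') (Y m') w (f q)" "adj (X m') (Y m') w (f r)"
      using w ad by auto
    have d: "f p \<noteq> f q" "f p \<noteq> f r" "f q \<noteq> f r" using injf w by (auto simp: inj_on_def)
    have in': "f p \<le> m' + 2" "f q \<le> m' + 2" "f r \<le> m' + 2" using AV w(4) by auto
    let ?j = "proj m' w"
    have j: "?j \<le> m'" "?j \<noteq> 1" "?j \<noteq> m' - 1" using w(1) nw m' by (auto simp: proj_def split: if_splits)
    have "v = Suc ?j \<or> v = ?j - 1" if v: "adj (X m') (Y m') w v" "v \<le> m' + 2" for v
    proof -
      have pv: "proj m' v = Suc ?j \<or> ?j = Suc (proj m' v)" using v(1) unfolding adj_XY by auto
      have "v \<noteq> Suc m'" using pv j by (auto simp: proj_def)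
      moreover have "v \<noteq> m' + 2" using pv j by (auto simp: proj_def)
      ultimately have "proj m' v = v" using v(2) by (simp add: proj_def)
      then show ?thesis using pv by auto
    qed
    then show False using a d in' by metis
  qed
  \<comment> \<open>A branching point has exactly three neighbours there, so the three images
    exhaust them and include the twin pair.\<close>
  have full: "(w = 1 \<and> {0, Suc m'} \<subseteq> ?A) \<or> (w = m' - 1 \<and> {m', m' + 2} \<subseteq> ?A)"
    if w: "w \<in> {..m' + 2}" "w = f u" "u \<in> ?V" "{p, q, r} \<subseteq> ?V" "distinct [p, q, r]"
      "adj (X m) (Y m) u p" "adj (X m) (Y m) u q" "adj (X m) (Y m) u r" for u p q r w
  proof -
    have a: "adj (X m') (Y m') w (f p)" "adj (X m') (Y m') w (f q)" "adj (X m') (Y m') w (f r)"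
      using w ad by auto
    have d: "f p \<noteq> f q" "f p \<noteq> f r" "f q \<noteq> f r" using injf w by (auto simp: inj_on_def)
    have in': "f p \<le> m' + 2" "f q \<le> m' + 2" "f r \<le> m' + 2" using AV w(4) by auto
    have sub: "{f p, f q, f r} \<subseteq> ?A" using w(4) by blast
    have c: "w = 1 \<or> w = m' - 1" using three[OF w] by simp
    have n1: "v = 0 \<or> v = Suc m' \<or> v = 2" if "adj (X m') (Y m') 1 v" "v \<le> m' + 2" for v
      using that m' unfolding adj_XY by (auto simp: proj_def split: if_splits)
    have n2: "v = m' \<or> v = m' + 2 \<or> v = m' - 2" if "adj (X m') (Y m') (m' - 1) v" "v \<le> m' + 2" for v
      using that m' unfolding adj_XY by (auto simp: proj_def split: if_splits)
    from c show ?thesis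
    proof
      assume w1: "w = 1"
      have "0 \<in> {f p, f q, f r}" "Suc m' \<in> {f p, f q, f r}"
        using n1[OF a(1)[unfolded w1] in'(1)] n1[OF a(2)[unfolded w1] in'(2)] n1[OF a(3)[unfolded w1] in'(3)] d by auto
      from this[THEN subsetD[OF sub]] show ?thesis using w1 by blast
    next
      assume w1: "w = m' - 1"
      have "m' \<in> {f p, f q, f r}" "m' + 2 \<in> {f p, f q, f r}"
        using n2[OF a(1)[unfolded w1] in'(1)] n2[OF a(2)[unfolded w1] in'(2)] n2[OF a(3)[unfolded w1] in'(3)] d by auto
      from this[THEN subsetD[OF sub]] show ?thesis using w1 by blast
    qed
  qed
  have f1: "(f 1 = 1 \<and> {0, Suc m'} \<subseteq> ?A) \<or> (f 1 = m' - 1 \<and> {m', m' + 2} \<subseteq> ?A)"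
  proof (rule full[where u = 1 and p = 0 and q = "Suc m" and r = 2])
    show "f 1 \<in> {..m' + 2}" by (rule subsetD[OF AV], rule imageI) simp
  qed (use m in \<open>simp_all add: adj_XY proj_def\<close>)
  have f2: "(f (m - 1) = 1 \<and> {0, Suc m'} \<subseteq> ?A) \<or> (f (m - 1) = m' - 1 \<and> {m', m' + 2} \<subseteq> ?A)"
  proof (rule full[where u = "m - 1" and p = m and q = "m + 2" and r = "m - 2"])
    show "f (m - 1) \<in> {..m' + 2}" by (rule subsetD[OF AV], rule imageI) simp
    have "m - 2 < m" using m by simp
    then show "distinct [m, m + 2, m - 2]" by auto
    have P: "proj m v = v" if "v \<le> m" for v using that by (simp add: proj_def)
    have P': "proj m (m + 2) = m" by (simp add: proj_def)
    have le: "m - 1 \<le> m" "m - 2 \<le> m" by simp_all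
    show "adj (X m) (Y m) (m - 1) m" unfolding adj_XY P[OF order_refl] P[OF le(1)] using m(2) by linarith
    show "adj (X m) (Y m) (m - 1) (m + 2)" unfolding adj_XY P' P[OF le(1)] using m(2) by linarith
    show "adj (X m) (Y m) (m - 1) (m - 2)" unfolding adj_XY P[OF le(1)] P[OF le(2)] using m(2) by linarith
    show "m - 1 \<in> ?V" "{m, m + 2, m - 2} \<subseteq> ?V" by auto
  qed simp
  have "f 1 \<noteq> f (m - 1)" using inj_on_contraD[OF injf, of 1 "m - 1"] m by auto
  then have ex: "{0, Suc m', m', m' + 2} \<subseteq> ?A" and e: "{f 1, f (m - 1)} = {1, m' - 1}"
    using f1 f2 by auto
  have "f 1 \<in> ?A" "f (m - 1) \<in> ?A" by (rule imageI, use m in simp)+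
  then have "{f 1, f (m - 1)} \<subseteq> ?A" by simp
  then have ends: "1 \<in> ?A" "m' - 1 \<in> ?A" unfolding e by auto
  have "{1..m' - 1} \<subseteq> ?A"
  proof
    fix j assume j: "j \<in> {1..m' - 1}"
    have "proj m' 1 = 1" "proj m' (m' - 1) = m' - 1" using m' by (auto simp: proj_def)
    then obtain w where w: "w \<in> ?A" "proj m' w = j" using conn_proj_interval[OF conA ends, of j] j by auto
    then have "w = j" using j m' by (auto simp: proj_def split: if_splits)
    then show "j \<in> ?A" using w by simp
  qed
  have "{..m' + 2} \<subseteq> ?A"
  proof
    fix j assume "j \<in> {..m' + 2}"
    then have "j \<in> {0, Suc m', m', m' + 2} \<or> j \<in> {1..m' - 1}" by auto
    then show "j \<in> ?A" using ex \<open>{1..m' - 1} \<subseteq> ?A\<close> by blast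
  qed
  then have "card {..m' + 2} \<le> card ?A" by (intro card_mono) auto
  then show False using injf lt by (simp add: card_image)
qed

lemma cell_class_not_wqo:
  assumes g: "\<xi> \<le> \<gamma>"
  shows "\<not> well_quasi_ordered (cell_class \<gamma>)"
proof -
  let ?M = "{m :: nat. even m \<and> 4 \<le> m}"
  have m1: "1 \<le> m" if "m \<in> ?M" for m using that by auto
  have "osc m \<in> cell_class \<gamma>" if "m \<in> ?M" for m
    using growth_osc[of m] osc(1)[of m] that g by (auto simp: cell_class_def)
  then have "osc ` ?M \<subseteq> cell_class \<gamma>" by blast
  moreover have "infinite (osc ` ?M)"
  proof -
    have "inj_on osc ?M"
    proof (rule inj_onI)
      fix m m' assume mm: "m \<in> ?M" "m' \<in> ?M" "osc m = osc m'"
      have "length (osc m) = m + 3" "length (osc m') = m' + 3" by (rule osc(2), rule m1, fact mm)+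
      then show "m = m'" using arg_cong[OF mm(3), of length] by linarith
    qed
    moreover have "infinite ?M"
    proof
      assume "finite ?M"
      moreover have "(\<lambda>k. 2 * k + 4) ` (UNIV :: nat set) \<subseteq> ?M" by auto
      ultimately have "finite ((\<lambda>k. 2 * k + 4) ` (UNIV :: nat set))" by (rule rev_finite_subset)
      moreover have "inj (\<lambda>k :: nat. 2 * k + 4)" by (simp add: inj_def)
      ultimately show False using finite_imageD by blast
    qed
    ultimately show ?thesis using finite_imageD by blast
  qed
  moreover have "perm_antichain (osc ` ?M)"
    unfolding perm_antichain_def perm_contained_iff_le using osc_antichain by blast
  ultimately show ?thesis unfolding well_quasi_ordered_def by blast
qed

theorem theorem8p8:
  fixes \<gamma> :: real
  shows "well_quasi_ordered (cell_class \<gamma>) \<longleftrightarrow> \<gamma> < \<xi>"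
  using cell_class_wqo cell_class_not_wqo not_le by metis

end
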